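(* Let $N\ge 2$ be an integer and $T>0$. Assume $R\in\mathbb S^m_{++}$, $Q-S^\top R^{-1}S\in\mathbb S^n_{++}$ and $Q+\bar Q-S^\top R^{-1}S\in\mathbb S^n_{++}$. Let $P_T^N,\Pi_T^N,p_T^N,\kappa_T^N$ be the rescaled functions defined in the context. Then: (i) For every collection of initial states $\boldsymbol\xi=(\xi^1,\dots,\xi^N)$ with $\xi^i\in L^4_{\tilde{\mathcal F}_0}$ independent of $(W^0,\dots,W^N)$, the social optimization problem (minimize $J_T^{\rm soc}(\boldsymbol\xi;\mathbf u(\cdot))$ over $\mathbf u(\cdot)\in(\mathscr U_c[0,T])^N$) admits a unique open-loop optimal control $\mathbf u_T(\cdot)=(u_T^{1,N}(\cdot),\dots,u_T^{N,N}(\cdot))$, with the closed-loop representation $$u_T^{i,N}(t)=\Big(\Theta_T^N(t)+\tfrac1N\bar\theta_T^N(t)\Big)X_T^{i,N}(t)+\big(\bar\Theta_T^N(t)-\Theta_T^N(t)\big)X_T^{(N)}(t)+\theta_T^N(t),\quad t\in[0,T],$$ where $X_T^{i,N}$, $i=1,\dots,N$, solve the closed-loop system obtained by inserting these controls in the state equations, and $X_T^{(N)}=\frac1N\sum_{i=1}^N X_T^{i,N}$. (ii) For every deterministic collection of initial states $\mathbf x=(x^1,\dots,x^N)\in\mathbb R^{Nn}$, with $\bar x=\frac1N\sum_{j=1}^N x^j$, the value function $V_T^{\rm soc}(\mathbf x)=\inf_{\mathbf u}J_T^{\rm soc}(\mathbf x;\mathbf u(\cdot))$ is $$V_T^{\rm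 soc}(\mathbf x)=\mathbf x^\top\mathbf P_T(0)\mathbf x+2\mathbf x^\top\mathbf p_T(0)+\mathbf k_T(0)=\frac1N\sum_{j=1}^N(x^j)^\top P_T^N(0)x^j+\frac1{N^2}\sum_{k=1}^N\sum_{j\ne k}(x^j)^\top\Pi_T^N(0)x^k+2\bar x^\top p_T^N(0)+\kappa_T^N(0).$$
   Context: Notation. $\mathbb S^k,\mathbb S^k_+,\mathbb S^k_{++}$ denote the real symmetric, positive semidefinite, positive definite $k\times k$ matrices. Fix $n,m\in\mathbb N^+$, $A,\bar A,C,\bar C,\Gamma,\bar\Gamma\in\mathbb R^{n\times n}$, $B,D\in\mathbb R^{n\times m}$, $Q,\bar Q\in\mathbb S^n$, $S\in\mathbb R^{m\times n}$, $R\in\mathbb S^m$, $b,\sigma,\gamma,q\in\mathbb R^n$, $r\in\mathbb R^m$. $N$-agent problem. $(\tilde\Omega,\tilde{\mathcal F},\tilde{\mathbb P})$ is a complete probability space carrying independent one-dimensional standard Brownian motions $W^0,W^1,\dots,W^N$ and an initial $\sigma$-algebra $\tilde{\mathcal F}_0$, independent of them, on which $\tilde{\mathbb P}$ is atomless; $\tilde{\mathbb F}$ is the complete right-continuous augmentation of the filtration generated by $W^0,\dots,W^N$ and $\tilde{\mathcal F}_0$; $\tilde{\mathbb E}$ is expectation. $L^4_{\tilde{\mathcal F}_0}$ is the set of $\tilde{\mathcal F}_0$-measurable $\mathbb R^n$-valued $\xi$ with $\tilde{\mathbb E}|\xi|^4<\infty$. $\mathscr U_c[0,T]$ is the set of $\tilde{\mathbb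 F}$-progressively measurable $u:[0,T]\times\tilde\Omega\to\mathbb R^m$ with $\tilde{\mathbb E}\int_0^T|u|^2dt<\infty$. State equations, $i=1,\dots,N$: $X^{i,N}(0)=\xi^i$, $$dX^{i,N}=\{AX^{i,N}+\bar AX^{(N)}+Bu^{i,N}+b\}dt+\{CX^{i,N}+\bar CX^{(N)}+Du^{i,N}+\sigma\}dW^i+\{\Gamma X^{i,N}+\bar\Gamma X^{(N)}+\gamma\}dW^0,$$ with $X^{(N)}=\frac1N\sum_iX^{i,N}$. Running cost: $f(x,\bar x,u)=\langle Qx,x\rangle+2\langle Sx,u\rangle+\langle Ru,u\rangle+2\langle q,x\rangle+2\langle r,u\rangle+\langle\bar Q\bar x,\bar x\rangle$. Costs: $J_T^i(\boldsymbol\xi;\mathbf u)=\tilde{\mathbb E}\int_0^Tf(X^{i,N},X^{(N)},u^{i,N})dt$, $J_T^{\rm soc}=\frac1N\sum_{i=1}^NJ_T^i$. Stacked matrices. $e_i^N$ is the $i$-th canonical basis vector of $\mathbb R^N$, $\mathbf 1_{k\times\ell}$ the all-ones matrix, $\otimes$ the Kronecker product. $\mathbf A=I_N\otimes A$, $\bar{\mathbf A}=\mathbf 1_{N\times N}\otimes\frac{\bar A}N$, $\mathbf B^i=e_i^N\otimes B$, $\mathbf B=(\mathbf B^1,\dots,\mathbf B^N)$, $\mathbf b=\mathbf 1_{N\times1}\otimes b$, $\mathbf C^i=e_i^N\otimes(e_i^N)^\top\otimes C$, $\bar{\mathbf C}^i=e_i^N\otimes\frac{\mathbf 1_{N\times1}^\top}N\otimes\bar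 C$, $\mathbf D^i=e_i^N\otimes D$, $\boldsymbol\sigma^i=e_i^N\otimes\sigma$, $\boldsymbol\gamma=\mathbf 1_{N\times1}\otimes\gamma$, $\boldsymbol\Gamma=I_N\otimes\Gamma$, $\bar{\boldsymbol\Gamma}=\mathbf 1_{N\times N}\otimes\frac{\bar\Gamma}N$, $\mathbf Q=\frac1NI_N\otimes Q$, $\bar{\mathbf Q}=\mathbf 1_{N\times N}\otimes\frac{\bar Q}{N^2}$, $\mathbf S=\frac1NI_N\otimes S$, $\mathbf R=\frac1NI_N\otimes R$, $\mathbf q=\frac{\mathbf 1_{N\times1}}N\otimes q$, $\mathbf r=\frac{\mathbf 1_{N\times1}}N\otimes r$, $\mathbf e^i=(e_i^N\otimes I_m)^\top$. For $\mathbf Z\in\mathbb R^{Nn\times Nn}$: $\mathcal M_1(\mathbf Z)=\frac12\sum_i(\mathbf e^i)^\top(\mathbf D^i)^\top\mathbf Z\mathbf D^i\mathbf e^i$, $\mathcal M_2(\mathbf Z)=\sum_i(\mathbf C^i+\bar{\mathbf C}^i)^\top\mathbf Z\mathbf D^i\mathbf e^i$, $\mathcal M_3(\mathbf Z)=\sum_i(\boldsymbol\sigma^i)^\top\mathbf Z\mathbf D^i\mathbf e^i$, $\mathcal M_4(\mathbf Z)=\frac12\sum_i(\mathbf C^i+\bar{\mathbf C}^i)^\top\mathbf Z(\mathbf C^i+\bar{\mathbf C}^i)+\frac12(\boldsymbol\Gamma+\bar{\boldsymbol\Gamma})^\top\mathbf Z(\boldsymbol\Gamma+\bar{\boldsymbol\Gamma})$,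 $\mathcal M_5(\mathbf Z)=\sum_i(\boldsymbol\sigma^i)^\top\mathbf Z(\mathbf C^i+\bar{\mathbf C}^i)+\boldsymbol\gamma^\top\mathbf Z(\boldsymbol\Gamma+\bar{\boldsymbol\Gamma})$, $\mathcal M_6(\mathbf Z)=\frac12\sum_i(\boldsymbol\sigma^i)^\top\mathbf Z\boldsymbol\sigma^i+\frac12\boldsymbol\gamma^\top\mathbf Z\boldsymbol\gamma$. Riccati system. $(\mathbf P_T,\mathbf p_T,\mathbf k_T)$ is the solution on $[0,T]$, with values in $\mathbb S^{Nn}_+\times\mathbb R^{Nn}\times\mathbb R$ and zero terminal values at $T$ (it exists and is unique under the hypotheses), of, writing $\mathbf M=\mathbf P_T\mathbf B+\mathcal M_2(\mathbf P_T)+\mathbf S^\top$, $\mathbf N=\mathbf R+2\mathcal M_1(\mathbf P_T)$, $\mathbf v=\mathbf p_T^\top\mathbf B+\mathcal M_3(\mathbf P_T)+\mathbf r^\top$: $\dot{\mathbf P}_T-\mathbf M\mathbf N^{-1}\mathbf M^\top+\mathbf P_T(\mathbf A+\bar{\mathbf A})+(\mathbf A+\bar{\mathbf A})^\top\mathbf P_T+2\mathcal M_4(\mathbf P_T)+\mathbf Q+\bar{\mathbf Q}=0$, $\dot{\mathbf p}_T-\mathbf M\mathbf N^{-1}\mathbf v^\top+\mathbf P_T\mathbf b+(\mathbf A+\bar{\mathbf A})^\top\mathbf p_T+\mathcal M_5(\mathbf P_T)^\top+\mathbf q=0$, $\dot{\mathbf k}_T-\mathbf v\mathbf N^{-1}\mathbf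 v^\top+2\mathbf p_T^\top\mathbf b+2\mathcal M_6(\mathbf P_T)=0$. Rescaled functions. Under the hypotheses, $\mathbf P_T(t)$ has all diagonal $n\times n$ blocks equal to some symmetric $P_T^{1,N}(t)$ and all off-diagonal blocks equal to some symmetric $P_T^{2,N}(t)$, and $\mathbf p_T(t)$ has all $n$-blocks equal to some $p_T^{1,N}(t)$. Set $P_T^N=NP_T^{1,N}$, $\Pi_T^N=N^2P_T^{2,N}$, $p_T^N=Np_T^{1,N}$, $\kappa_T^N=\mathbf k_T$. Put $\mathcal R(P)=R+D^\top PD$, and $\Theta_T^N=-\mathcal R(P_T^N)^{-1}(B^\top P_T^N+D^\top P_T^NC+S)$, $\bar\Theta_T^N=-\mathcal R(P_T^N)^{-1}(B^\top(P_T^N+\Pi_T^N)+D^\top P_T^N(C+\bar C)+S)$, $\theta_T^N=-\mathcal R(P_T^N)^{-1}(B^\top p_T^N+D^\top P_T^N\sigma+r)$, $\bar\theta_T^N=\mathcal R(P_T^N)^{-1}B^\top\Pi_T^N$. *)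

theory Defs
  imports "HOL-Probability.Probability"
begin

text \<open>Dimensions are types: state index \<open>'n\<close>, control index \<open>'m\<close>, agent index \<open>'N\<close>, so that
  \<open>N = CARD('N)\<close>.  Stacked vectors in \<open>R^{Nn}\<close> are indexed by \<open>'N \<times> 'n\<close>.\<close>

section \<open>Matrices\<close>

definition symmetric_mat :: "real^'k^'k \<Rightarrow> bool" where
  "symmetric_mat A \<longleftrightarrow> transpose A = A"

definition psd_mat :: "real^'k^'k \<Rightarrow> bool" where
  "psd_mat A \<longleftrightarrow> symmetric_mat A \<and> (\<forall>x. 0 \<le> x \<bullet> (A *v x))"

definition pd_mat :: "real^'k^'k \<Rightarrow> bool" where
  "pd_mat A \<longleftrightarrow> symmetric_mat A \<and> (\<forall>x. x \<noteq> 0 \<longrightarrow> 0 < x \<bullet> (A *v x))"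

text \<open>Kronecker products matrix/matrix, column/matrix and column/column, and the product
  \<open>v w\<^sup>T\<close> of a column and a row.\<close>

definition kron :: "real^'b^'a \<Rightarrow> real^'d^'c \<Rightarrow> real^('b \<times> 'd)^('a \<times> 'c)" where
  "kron A B = (\<chi> p q. A $ fst p $ fst q * B $ snd p $ snd q)"

definition kron_col :: "real^'a \<Rightarrow> real^'d^'c \<Rightarrow> real^'d^('a \<times> 'c)" where
  "kron_col v B = (\<chi> p q. v $ fst p * B $ snd p $ q)"

definition kron_vec :: "real^'a \<Rightarrow> real^'c \<Rightarrow> real^('a \<times> 'c)" where
  "kron_vec v w = (\<chi> p. v $ fst p * w $ snd p)"

definition col_row :: "real^'a \<Rightarrow> real^'b \<Rightarrow> real^'b^'a" where
  "col_row v w = (\<chi> i j. v $ i * w $ j)"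

definition ones_vec :: "real^'k" where
  "ones_vec = (\<chi> i. 1)"

definition ones_mat :: "real^'l^'k" where
  "ones_mat = (\<chi> i j. 1)"

definition stack :: "('N::finite \<Rightarrow> real^'n) \<Rightarrow> real^('N \<times> 'n)" where
  "stack x = (\<chi> p. x (fst p) $ snd p)"

section \<open>Coefficients\<close>

record ('n::finite, 'm::finite) lq =
  cA :: "real^'n^'n"   cAbar :: "real^'n^'n"   cB :: "real^'m^'n"   cb :: "real^'n"
  cC :: "real^'n^'n"   cCbar :: "real^'n^'n"   cD :: "real^'m^'n"   csigma :: "real^'n"
  cGamma :: "real^'n^'n"   cGammabar :: "real^'n^'n"   cgamma :: "real^'n"
  cQ :: "real^'n^'n"   cQbar :: "real^'n^'n"   cS :: "real^'n^'m"   cR :: "real^'m^'m"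
  cq :: "real^'n"   cr :: "real^'m"

definition running_cost ::
  "('n::finite, 'm::finite) lq \<Rightarrow> real^'n \<Rightarrow> real^'n \<Rightarrow> real^'m \<Rightarrow> real" where
  "running_cost L x xbar u =
     (cQ L *v x) \<bullet> x + 2 * ((cS L *v x) \<bullet> u) + (cR L *v u) \<bullet> u
     + 2 * (cq L \<bullet> x) + 2 * (cr L \<bullet> u) + (cQbar L *v xbar) \<bullet> xbar"

section \<open>Brownian motions and filtration\<close>

definition standard_brownian_motion :: "'w measure \<Rightarrow> (real \<Rightarrow> 'w \<Rightarrow> real) \<Rightarrow> bool" where
  "standard_brownian_motion M W \<longleftrightarrow>
     (\<forall>t\<ge>0. W t \<in> borel_measurable M) \<and>
     (AE \<omega> in M. W 0 \<omega> = 0) \<and>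
     (AE \<omega> in M. continuous_on {0..} (\<lambda>t. W t \<omega>)) \<and>
     (\<forall>s t. 0 \<le> s \<and> s < t \<longrightarrow>
        distributed M lborel (\<lambda>\<omega>. W t \<omega> - W s \<omega>) (normal_density 0 (sqrt (t - s)))) \<and>
     (\<forall>(k::nat) \<tau>. 0 \<le> \<tau> 0 \<and> (\<forall>i<k. \<tau> i < \<tau> (Suc i)) \<longrightarrow>
        prob_space.indep_vars M (\<lambda>_. borel) (\<lambda>i \<omega>. W (\<tau> (Suc i)) \<omega> - W (\<tau> i) \<omega>) {..<k})"

definition process_events :: "'w measure \<Rightarrow> (real \<Rightarrow> 'w \<Rightarrow> real) \<Rightarrow> 'w set set" where
  "process_events M W =
     sigma_sets (space M) {W t -` B \<inter> space M |t B. 0 \<le> t \<and> B \<in> sets borel}"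

definition atomless_on :: "'w measure \<Rightarrow> 'w measure \<Rightarrow> bool" where
  "atomless_on M G \<longleftrightarrow>
     (\<forall>E\<in>sets G. 0 < measure M E \<longrightarrow>
        (\<exists>E'\<in>sets G. E' \<subseteq> E \<and> 0 < measure M E' \<and> measure M E' < measure M E))"

text \<open>\<open>W None\<close> is the common noise, \<open>W (Some i)\<close> the noise of agent \<open>i\<close>.  The \<open>indep_sets\<close>
  clause makes the initial sigma-algebra and all Brownian motions jointly independent.\<close>

definition stochastic_basis ::
  "'w measure \<Rightarrow> 'w measure \<Rightarrow> ('N::finite option \<Rightarrow> real \<Rightarrow> 'w \<Rightarrow> real) \<Rightarrow> bool" where
  "stochastic_basis M F0 W \<longleftrightarrow>
     prob_space M \<and> complete_measure M \<and> subalgebra M F0 \<and> atomless_on M F0 \<and>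
     (\<forall>j. standard_brownian_motion M (W j)) \<and>
     prob_space.indep_sets M (case_option (sets F0) (\<lambda>j. process_events M (W j))) UNIV"

definition generated_filtration ::
  "'w measure \<Rightarrow> 'w measure \<Rightarrow> ('N option \<Rightarrow> real \<Rightarrow> 'w \<Rightarrow> real) \<Rightarrow> real \<Rightarrow> 'w measure" where
  "generated_filtration M F0 W t =
     sigma (space M)
       (sets F0 \<union> {W j s -` B \<inter> space M |j s B. 0 \<le> s \<and> s \<le> t \<and> B \<in> sets borel}
        \<union> null_sets M)"

definition augmented_filtration ::
  "'w measure \<Rightarrow> 'w measure \<Rightarrow> ('N option \<Rightarrow> real \<Rightarrow> 'w \<Rightarrow> real) \<Rightarrow> real \<Rightarrow> 'w measure" where
  "augmented_filtration M F0 W t =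
     sigma (space M) (\<Inter>s\<in>{t<..}. sets (generated_filtration M F0 W s))"

definition progressive ::
  "(real \<Rightarrow> 'w measure) \<Rightarrow> real \<Rightarrow> (real \<Rightarrow> 'w \<Rightarrow> 'a::topological_space) \<Rightarrow> bool" where
  "progressive F T H \<longleftrightarrow>
     (\<forall>t\<in>{0..T}. (\<lambda>(s, \<omega>). H s \<omega>) \<in> borel_measurable (restrict_space borel {0..t} \<Otimes>\<^sub>M F t))"

definition square_integrable_process ::
  "'w measure \<Rightarrow> real \<Rightarrow> (real \<Rightarrow> 'w \<Rightarrow> 'a::real_normed_vector) \<Rightarrow> bool" where
  "square_integrable_process M T H \<longleftrightarrow>
     (\<integral>\<^sup>+\<omega>. (\<integral>\<^sup>+t\<in>{0..T}. ennreal ((norm (H t \<omega>))\<^sup>2) \<partial>lborel) \<partial>M) < \<infinity>"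

section \<open>Ito integral\<close>

text \<open>A simple integrand on \<open>[0,t]\<close> is \<open>\<Sum>k<K. \<eta> k\<close> on \<open>(\<tau> k, \<tau> (k+1)]\<close>, with \<open>\<eta> k\<close> bounded and
  \<open>F (\<tau> k)\<close>-measurable.\<close>

definition simple_integrand ::
  "(real \<Rightarrow> 'w measure) \<Rightarrow> real \<Rightarrow> nat \<Rightarrow> (nat \<Rightarrow> real) \<Rightarrow> (nat \<Rightarrow> 'w \<Rightarrow> 'a::euclidean_space) \<Rightarrow> bool" where
  "simple_integrand F t K \<tau> \<eta> \<longleftrightarrow>
     \<tau> 0 = 0 \<and> \<tau> K = t \<and> (\<forall>k<K. \<tau> k \<le> \<tau> (Suc k)) \<and>
     (\<forall>k<K. \<eta> k \<in> borel_measurable (F (\<tau> k)) \<and> bounded (\<eta> k ` space (F (\<tau> k))))"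

definition simple_process ::
  "nat \<Rightarrow> (nat \<Rightarrow> real) \<Rightarrow> (nat \<Rightarrow> 'w \<Rightarrow> 'a::euclidean_space) \<Rightarrow> real \<Rightarrow> 'w \<Rightarrow> 'a" where
  "simple_process K \<tau> \<eta> s \<omega> =
     (\<Sum>k<K. indicator {\<tau> k<..\<tau> (Suc k)} s *\<^sub>R \<eta> k \<omega>)"

definition simple_integral ::
  "(real \<Rightarrow> 'w \<Rightarrow> real) \<Rightarrow> nat \<Rightarrow> (nat \<Rightarrow> real) \<Rightarrow> (nat \<Rightarrow> 'w \<Rightarrow> 'a::euclidean_space) \<Rightarrow> 'w \<Rightarrow> 'a" where
  "simple_integral W K \<tau> \<eta> \<omega> =
     (\<Sum>k<K. (W (\<tau> (Suc k)) \<omega> - W (\<tau> k) \<omega>) *\<^sub>R \<eta> k \<omega>)"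

text \<open>\<open>J\<close> is a version of the integral of \<open>H\<close> against \<open>W\<close> over \<open>[0,t]\<close>: the \<open>L\<^sup>2\<close>-limit of the
  integrals of simple integrands converging to \<open>H\<close> in \<open>L\<^sup>2(dt \<otimes> dP)\<close>.\<close>

definition has_ito_integral ::
  "'w measure \<Rightarrow> (real \<Rightarrow> 'w measure) \<Rightarrow> (real \<Rightarrow> 'w \<Rightarrow> real) \<Rightarrow> real \<Rightarrow>
   (real \<Rightarrow> 'w \<Rightarrow> 'a::euclidean_space) \<Rightarrow> ('w \<Rightarrow> 'a) \<Rightarrow> bool" where
  "has_ito_integral M F W t H J \<longleftrightarrow>
     progressive F t H \<and> square_integrable_process M t H \<and> J \<in> borel_measurable M \<and>
     (\<exists>K \<tau> \<eta>.
        (\<forall>l::nat. simple_integrand F t (K l) (\<tau> l) (\<eta> l)) \<and>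
        ((\<lambda>l. \<integral>\<^sup>+\<omega>. (\<integral>\<^sup>+s\<in>{0..t}.
            ennreal ((norm (H s \<omega> - simple_process (K l) (\<tau> l) (\<eta> l) s \<omega>))\<^sup>2) \<partial>lborel) \<partial>M)
          \<longlonglongrightarrow> 0) \<and>
        ((\<lambda>l. \<integral>\<^sup>+\<omega>. ennreal ((norm (J \<omega> - simple_integral W (K l) (\<tau> l) (\<eta> l) \<omega>))\<^sup>2) \<partial>M)
          \<longlonglongrightarrow> 0))"

section \<open>The social optimization problem\<close>

definition average :: "('N::finite \<Rightarrow> real \<Rightarrow> 'w \<Rightarrow> real^'n) \<Rightarrow> real \<Rightarrow> 'w \<Rightarrow> real^'n" where
  "average X t \<omega> = (1 / real CARD('N)) *\<^sub>R (\<Sum>i\<in>UNIV. X i t \<omega>)"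

definition social_controls ::
  "'w measure \<Rightarrow> 'w measure \<Rightarrow> ('N::finite option \<Rightarrow> real \<Rightarrow> 'w \<Rightarrow> real) \<Rightarrow> real \<Rightarrow>
   ('N \<Rightarrow> real \<Rightarrow> 'w \<Rightarrow> real^'m) set" where
  "social_controls M F0 W T =
     {u. \<forall>i. progressive (augmented_filtration M F0 W) T (u i) \<and>
             square_integrable_process M T (u i)}"

definition initial_states ::
  "'w measure \<Rightarrow> 'w measure \<Rightarrow> ('N::finite option \<Rightarrow> real \<Rightarrow> 'w \<Rightarrow> real) \<Rightarrow> ('N \<Rightarrow> 'w \<Rightarrow> real^'n) set" where
  "initial_states M F0 W =
     {\<xi>. (\<forall>i. \<xi> i \<in> borel_measurable F0 \<and>
              (\<integral>\<^sup>+\<omega>. ennreal ((norm (\<xi> i \<omega>)) ^ 4) \<partial>M) < \<infinity>) \<and>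
         prob_space.indep_set M
           (sigma_sets (space M) {\<xi> i -` B \<inter> space M |i B. B \<in> sets borel})
           (sigma_sets (space M) (\<Union>j. process_events M (W j)))}"

text \<open>Strong solutions in the usual sense: progressive, almost surely continuous and square
  integrable.  At \<open>t = 0\<close> the integral equation is the initial condition.\<close>

definition state_solution ::
  "('n::finite, 'm::finite) lq \<Rightarrow> 'w measure \<Rightarrow> 'w measure \<Rightarrow>
   ('N::finite option \<Rightarrow> real \<Rightarrow> 'w \<Rightarrow> real) \<Rightarrow> real \<Rightarrow> ('N \<Rightarrow> 'w \<Rightarrow> real^'n) \<Rightarrow>
   ('N \<Rightarrow> real \<Rightarrow> 'w \<Rightarrow> real^'m) \<Rightarrow> ('N \<Rightarrow> real \<Rightarrow> 'w \<Rightarrow> real^'n) \<Rightarrow> bool" where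
  "state_solution L M F0 W T \<xi> u X \<longleftrightarrow>
     (\<forall>i. progressive (augmented_filtration M F0 W) T (X i) \<and>
          (AE \<omega> in M. continuous_on {0..T} (\<lambda>t. X i t \<omega>)) \<and>
          square_integrable_process M T (X i)) \<and>
     (\<forall>i. \<forall>t\<in>{0..T}. \<exists>J J0.
        has_ito_integral M (augmented_filtration M F0 W) (W (Some i)) t
          (\<lambda>s \<omega>. cC L *v X i s \<omega> + cCbar L *v average X s \<omega> + cD L *v u i s \<omega> + csigma L) J \<and>
        has_ito_integral M (augmented_filtration M F0 W) (W None) t
          (\<lambda>s \<omega>. cGamma L *v X i s \<omega> + cGammabar L *v average X s \<omega> + cgamma L) J0 \<and>
        (AE \<omega> in M. X i t \<omega> =
           \<xi> i \<omega>
           + (\<integral>s\<in>{0..t}. (cA L *v X i s \<omega> + cAbar L *v average X s \<omega> + cB L *v u i s \<omega> + cb L) \<partial>lborel)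
           + J \<omega> + J0 \<omega>))"

text \<open>The state is determined by the control up to indistinguishability; any version may be chosen.\<close>

definition state_of ::
  "('n::finite, 'm::finite) lq \<Rightarrow> 'w measure \<Rightarrow> 'w measure \<Rightarrow>
   ('N::finite option \<Rightarrow> real \<Rightarrow> 'w \<Rightarrow> real) \<Rightarrow> real \<Rightarrow> ('N \<Rightarrow> 'w \<Rightarrow> real^'n) \<Rightarrow>
   ('N \<Rightarrow> real \<Rightarrow> 'w \<Rightarrow> real^'m) \<Rightarrow> 'N \<Rightarrow> real \<Rightarrow> 'w \<Rightarrow> real^'n" where
  "state_of L M F0 W T \<xi> u = (SOME X. state_solution L M F0 W T \<xi> u X)"

definition agent_cost ::
  "('n::finite, 'm::finite) lq \<Rightarrow> 'w measure \<Rightarrow> 'w measure \<Rightarrow>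
   ('N::finite option \<Rightarrow> real \<Rightarrow> 'w \<Rightarrow> real) \<Rightarrow> real \<Rightarrow> ('N \<Rightarrow> 'w \<Rightarrow> real^'n) \<Rightarrow>
   ('N \<Rightarrow> real \<Rightarrow> 'w \<Rightarrow> real^'m) \<Rightarrow> 'N \<Rightarrow> real" where
  "agent_cost L M F0 W T \<xi> u i =
     (let X = state_of L M F0 W T \<xi> u in
      \<integral>\<omega>. (\<integral>t\<in>{0..T}. running_cost L (X i t \<omega>) (average X t \<omega>) (u i t \<omega>) \<partial>lborel) \<partial>M)"

definition social_cost ::
  "('n::finite, 'm::finite) lq \<Rightarrow> 'w measure \<Rightarrow> 'w measure \<Rightarrow>
   ('N::finite option \<Rightarrow> real \<Rightarrow> 'w \<Rightarrow> real) \<Rightarrow> real \<Rightarrow> ('N \<Rightarrow> 'w \<Rightarrow> real^'n) \<Rightarrow>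
   ('N \<Rightarrow> real \<Rightarrow> 'w \<Rightarrow> real^'m) \<Rightarrow> real" where
  "social_cost L M F0 W T \<xi> u = (1 / real CARD('N)) * (\<Sum>i\<in>UNIV. agent_cost L M F0 W T \<xi> u i)"

definition social_optimal ::
  "('n::finite, 'm::finite) lq \<Rightarrow> 'w measure \<Rightarrow> 'w measure \<Rightarrow>
   ('N::finite option \<Rightarrow> real \<Rightarrow> 'w \<Rightarrow> real) \<Rightarrow> real \<Rightarrow> ('N \<Rightarrow> 'w \<Rightarrow> real^'n) \<Rightarrow>
   ('N \<Rightarrow> real \<Rightarrow> 'w \<Rightarrow> real^'m) \<Rightarrow> bool" where
  "social_optimal L M F0 W T \<xi> u \<longleftrightarrow>
     u \<in> social_controls M F0 W T \<and>
     (\<forall>v\<in>social_controls M F0 W T. social_cost L M F0 W T \<xi> u \<le> social_cost L M F0 W T \<xi> v)"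

text \<open>Equality of controls as elements of \<open>L\<^sup>2([0,T] \<times> \<Omega>)\<close>.\<close>

definition same_control ::
  "'w measure \<Rightarrow> real \<Rightarrow> ('N \<Rightarrow> real \<Rightarrow> 'w \<Rightarrow> real^'m) \<Rightarrow> ('N \<Rightarrow> real \<Rightarrow> 'w \<Rightarrow> real^'m) \<Rightarrow> bool" where
  "same_control M T u v \<longleftrightarrow>
     (\<forall>i. AE (t, \<omega>) in restrict_space lborel {0..T} \<Otimes>\<^sub>M M. u i t \<omega> = v i t \<omega>)"

text \<open>The infimum is taken in the extended reals, since \<open>Inf\<close> on \<open>real\<close> is unspecified for sets
  that are unbounded below.\<close>

definition social_value ::
  "('n::finite, 'm::finite) lq \<Rightarrow> 'w measure \<Rightarrow> 'w measure \<Rightarrow>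
   ('N::finite option \<Rightarrow> real \<Rightarrow> 'w \<Rightarrow> real) \<Rightarrow> real \<Rightarrow> ('N \<Rightarrow> real^'n) \<Rightarrow> ereal" where
  "social_value L M F0 W T x =
     (INF u\<in>social_controls M F0 W T. ereal (social_cost L M F0 W T (\<lambda>i _. x i) u))"

section \<open>Stacked coefficients\<close>

definition bA :: "('n::finite, 'm::finite) lq \<Rightarrow> real^('N::finite \<times> 'n)^('N \<times> 'n)" where
  "bA L = kron (mat 1) (cA L)"

definition bAbar :: "('n::finite, 'm::finite) lq \<Rightarrow> real^('N::finite \<times> 'n)^('N \<times> 'n)" where
  "bAbar L = kron ones_mat ((1 / real CARD('N)) *\<^sub>R cAbar L)"

definition bBi :: "('n::finite, 'm::finite) lq \<Rightarrow> 'N::finite \<Rightarrow> real^'m^('N \<times> 'n)" where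
  "bBi L i = kron_col (axis i 1) (cB L)"

definition bB :: "('n::finite, 'm::finite) lq \<Rightarrow> real^('N::finite \<times> 'm)^('N \<times> 'n)" where
  "bB L = (\<chi> p q. bBi L (fst q) $ p $ snd q)"

definition bb :: "('n::finite, 'm::finite) lq \<Rightarrow> real^('N::finite \<times> 'n)" where
  "bb L = kron_vec ones_vec (cb L)"

definition bC :: "('n::finite, 'm::finite) lq \<Rightarrow> 'N::finite \<Rightarrow> real^('N \<times> 'n)^('N \<times> 'n)" where
  "bC L i = kron (col_row (axis i 1) (axis i 1)) (cC L)"

definition bCbar :: "('n::finite, 'm::finite) lq \<Rightarrow> 'N::finite \<Rightarrow> real^('N \<times> 'n)^('N \<times> 'n)" where
  "bCbar L i = kron (col_row (axis i 1) ((1 / real CARD('N)) *\<^sub>R ones_vec)) (cCbar L)"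

definition bD :: "('n::finite, 'm::finite) lq \<Rightarrow> 'N::finite \<Rightarrow> real^'m^('N \<times> 'n)" where
  "bD L i = kron_col (axis i 1) (cD L)"

definition bsigma :: "('n::finite, 'm::finite) lq \<Rightarrow> 'N::finite \<Rightarrow> real^('N \<times> 'n)" where
  "bsigma L i = kron_vec (axis i 1) (csigma L)"

definition bgamma :: "('n::finite, 'm::finite) lq \<Rightarrow> real^('N::finite \<times> 'n)" where
  "bgamma L = kron_vec ones_vec (cgamma L)"

definition bGamma :: "('n::finite, 'm::finite) lq \<Rightarrow> real^('N::finite \<times> 'n)^('N \<times> 'n)" where
  "bGamma L = kron (mat 1) (cGamma L)"

definition bGammabar :: "('n::finite, 'm::finite) lq \<Rightarrow> real^('N::finite \<times> 'n)^('N \<times> 'n)" where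
  "bGammabar L = kron ones_mat ((1 / real CARD('N)) *\<^sub>R cGammabar L)"

definition bQ :: "('n::finite, 'm::finite) lq \<Rightarrow> real^('N::finite \<times> 'n)^('N \<times> 'n)" where
  "bQ L = (1 / real CARD('N)) *\<^sub>R kron (mat 1) (cQ L)"

definition bQbar :: "('n::finite, 'm::finite) lq \<Rightarrow> real^('N::finite \<times> 'n)^('N \<times> 'n)" where
  "bQbar L = kron ones_mat ((1 / (real CARD('N))\<^sup>2) *\<^sub>R cQbar L)"

definition bS :: "('n::finite, 'm::finite) lq \<Rightarrow> real^('N::finite \<times> 'n)^('N \<times> 'm)" where
  "bS L = (1 / real CARD('N)) *\<^sub>R kron (mat 1) (cS L)"

definition bR :: "('n::finite, 'm::finite) lq \<Rightarrow> real^('N::finite \<times> 'm)^('N \<times> 'm)" where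
  "bR L = (1 / real CARD('N)) *\<^sub>R kron (mat 1) (cR L)"

definition bq :: "('n::finite, 'm::finite) lq \<Rightarrow> real^('N::finite \<times> 'n)" where
  "bq L = kron_vec ((1 / real CARD('N)) *\<^sub>R ones_vec) (cq L)"

definition br :: "('n::finite, 'm::finite) lq \<Rightarrow> real^('N::finite \<times> 'm)" where
  "br L = kron_vec ((1 / real CARD('N)) *\<^sub>R ones_vec) (cr L)"

definition be :: "'N::finite \<Rightarrow> real^('N \<times> 'm)^'m" where
  "be i = transpose (kron_col (axis i 1) (mat 1))"

section \<open>Riccati system\<close>

text \<open>Row vectors are represented as vectors: \<open>x v* M\<close> is \<open>x\<^sup>T M\<close>.\<close>

definition M1 :: "('n::finite, 'm::finite) lq \<Rightarrow> real^('N::finite \<times> 'n)^('N \<times> 'n) \<Rightarrow>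
    real^('N \<times> 'm)^('N \<times> 'm)" where
  "M1 L Z = (1/2) *\<^sub>R (\<Sum>i\<in>UNIV. transpose (be i) ** transpose (bD L i) ** Z ** bD L i ** be i)"

definition M2 :: "('n::finite, 'm::finite) lq \<Rightarrow> real^('N::finite \<times> 'n)^('N \<times> 'n) \<Rightarrow>
    real^('N \<times> 'm)^('N \<times> 'n)" where
  "M2 L Z = (\<Sum>i\<in>UNIV. transpose (bC L i + bCbar L i) ** Z ** bD L i ** be i)"

definition M3 :: "('n::finite, 'm::finite) lq \<Rightarrow> real^('N::finite \<times> 'n)^('N \<times> 'n) \<Rightarrow>
    real^('N \<times> 'm)" where
  "M3 L Z = (\<Sum>i\<in>UNIV. bsigma L i v* (Z ** bD L i ** be i))"

definition M4 :: "('n::finite, 'm::finite) lq \<Rightarrow> real^('N::finite \<times> 'n)^('N \<times> 'n) \<Rightarrow>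
    real^('N \<times> 'n)^('N \<times> 'n)" where
  "M4 L Z =
     (1/2) *\<^sub>R (\<Sum>i\<in>UNIV. transpose (bC L i + bCbar L i) ** Z ** (bC L i + bCbar L i))
     + (1/2) *\<^sub>R (transpose (bGamma L + bGammabar L) ** Z ** (bGamma L + bGammabar L))"

definition M5 :: "('n::finite, 'm::finite) lq \<Rightarrow> real^('N::finite \<times> 'n)^('N \<times> 'n) \<Rightarrow>
    real^('N \<times> 'n)" where
  "M5 L Z =
     (\<Sum>i\<in>UNIV. bsigma L i v* (Z ** (bC L i + bCbar L i)))
     + bgamma L v* (Z ** (bGamma L + bGammabar L))"

definition M6 :: "('n::finite, 'm::finite) lq \<Rightarrow> real^('N::finite \<times> 'n)^('N \<times> 'n) \<Rightarrow> real" where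
  "M6 L Z =
     (1/2) * (\<Sum>i\<in>UNIV. bsigma L i \<bullet> (Z *v bsigma L i)) + (1/2) * (bgamma L \<bullet> (Z *v bgamma L))"

definition riccati_solution ::
  "('n::finite, 'm::finite) lq \<Rightarrow> real \<Rightarrow> (real \<Rightarrow> real^('N::finite \<times> 'n)^('N \<times> 'n)) \<Rightarrow>
   (real \<Rightarrow> real^('N \<times> 'n)) \<Rightarrow> (real \<Rightarrow> real) \<Rightarrow> bool" where
  "riccati_solution L T P p k \<longleftrightarrow>
     P T = 0 \<and> p T = 0 \<and> k T = 0 \<and>
     (\<forall>t\<in>{0..T}.
        psd_mat (P t) \<and>
        (let MM = P t ** bB L + M2 L (P t) + transpose (bS L);
             NI = matrix_inv (bR L + 2 *\<^sub>R M1 L (P t));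
             vv = p t v* bB L + M3 L (P t) + br L
         in
          \<exists>P' p' k'.
            (P has_vector_derivative P') (at t within {0..T}) \<and>
            (p has_vector_derivative p') (at t within {0..T}) \<and>
            (k has_real_derivative k') (at t within {0..T}) \<and>
            P' - MM ** NI ** transpose MM + P t ** (bA L + bAbar L)
               + transpose (bA L + bAbar L) ** P t + 2 *\<^sub>R M4 L (P t) + bQ L + bQbar L = 0 \<and>
            p' - (MM ** NI) *v vv + P t *v bb L
               + transpose (bA L + bAbar L) *v p t + M5 L (P t) + bq L = 0 \<and>
            k' - vv \<bullet> (NI *v vv) + 2 * (p t \<bullet> bb L) + 2 * M6 L (P t) = 0))"

section \<open>Blocks and feedback coefficients\<close>

definition block :: "'N::finite \<Rightarrow> 'N \<Rightarrow> real^('N \<times> 'n)^('N \<times> 'n) \<Rightarrow> real^'n^'n" where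
  "block i j Z = (\<chi> a b. Z $ (i, a) $ (j, b))"

definition diagonal_block :: "real^('N::finite \<times> 'n)^('N \<times> 'n) \<Rightarrow> real^'n^'n" where
  "diagonal_block Z = (THE Y. \<forall>i. block i i Z = Y)"

text \<open>Determined only if \<open>CARD('N) \<ge> 2\<close>.\<close>

definition offdiagonal_block :: "real^('N::finite \<times> 'n)^('N \<times> 'n) \<Rightarrow> real^'n^'n" where
  "offdiagonal_block Z = (THE Y. \<forall>i j. i \<noteq> j \<longrightarrow> block i j Z = Y)"

definition vector_block :: "real^('N::finite \<times> 'n) \<Rightarrow> real^'n" where
  "vector_block z = (THE y. \<forall>i. (\<chi> a. z $ (i, a)) = y)"

definition calR :: "('n::finite, 'm::finite) lq \<Rightarrow> real^'n^'n \<Rightarrow> real^'m^'m" where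
  "calR L P = cR L + transpose (cD L) ** P ** cD L"

definition Theta :: "('n::finite, 'm::finite) lq \<Rightarrow> real^'n^'n \<Rightarrow> real^'n^'m" where
  "Theta L P =
     - (matrix_inv (calR L P) **
        (transpose (cB L) ** P + transpose (cD L) ** P ** cC L + cS L))"

definition Theta_bar :: "('n::finite, 'm::finite) lq \<Rightarrow> real^'n^'n \<Rightarrow> real^'n^'n \<Rightarrow> real^'n^'m" where
  "Theta_bar L P Y =
     - (matrix_inv (calR L P) **
        (transpose (cB L) ** (P + Y) + transpose (cD L) ** P ** (cC L + cCbar L) + cS L))"

definition theta :: "('n::finite, 'm::finite) lq \<Rightarrow> real^'n^'n \<Rightarrow> real^'n \<Rightarrow> real^'m" where
  "theta L P p =
     - (matrix_inv (calR L P) *v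
        (transpose (cB L) *v p + (transpose (cD L) ** P) *v csigma L + cr L))"

definition theta_bar :: "('n::finite, 'm::finite) lq \<Rightarrow> real^'n^'n \<Rightarrow> real^'n^'n \<Rightarrow> real^'n^'m" where
  "theta_bar L P Y = matrix_inv (calR L P) ** (transpose (cB L) ** Y)"

end

theory Submission
 imports Defs
begin

text \<open>Completing the square with the Riccati system turns the social cost of a control \<open>u\<close> with
 state \<open>X\<close> into the expected initial value of \<open>v(t,x) = x\<^sup>T P x + 2 p\<^sup>T x + k\<close> plus the integral of
 \<open>\<langle>N (u - \<phi>(X)), u - \<phi>(X)\<rangle>\<close> with \<open>N\<close> uniformly positive, so the optimal control is the feedback
 \<open>\<phi>\<close> and it is unique.  Only second moments of Ito processes enter this identity: they follow from the
 Ito isometry and Fubini, without Ito's formula.  The block structure of \<open>P\<close> and \<open>p\<close> comes from the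
 invariance of the Hamilton-Jacobi-Bellman equation under exchanging two agents.\<close>

section \<open>Square integrable functions\<close>

text \<open>\<open>state_of\<close> picks some solution of the state equation, so a cost means
  nothing until that equation is solved, and two costs can be compared only once solutions are
  unique. Most of the development serves this purpose: Ito integrals with continuous versions, then
  Picard iteration. \<open>has_ito_integral\<close> determines the integral at a single time and up
  to null sets; hence processes are treated as square integrable functions on the product of time
  and probability space, and identities hold almost everywhere there. Positivity of
  \<open>N = R + 2 M1(P)\<close> comes from \<open>R\<close>, because \<open>P\<close> is positive
  semidefinite. The same bound yields continuity of the feedback and of the Riccati derivatives, so
  no matrix inverse is ever differentiated or estimated. The identity for the cost is assembled from
  scalars: each entry \<open>P_ij(t)\<close> multiplies the moment function of
  \<open>X_i X_j\<close>, and the constant process 1 makes products of the linear and constant terms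
  of the value function as well.\<close>

abbreviation bm :: "'a measure => ('a => 'b::topological_space) set" where
 "bm \<equiv> borel_measurable"

abbreviation LI :: "'b measure => ('b => 'a) => 'a::{banach, second_countable_topology}" where
 "LI N f \<equiv> integral\<^sup>L N f"

abbreviation NI :: "'b measure => ('b => ennreal) => ennreal" where
 "NI N f \<equiv> integral\<^sup>N N f"

lemmas LI_integrable_add = Bochner_Integration.integrable_add
 and LI_integrable_bound = Bochner_Integration.integrable_bound
 and LI_integrable_sum = Bochner_Integration.integrable_sum
 and LI_integral_add = Bochner_Integration.integral_add
 and LI_integral_cong = Bochner_Integration.integral_cong
 and LI_integral_diff = Bochner_Integration.integral_diff
 and LI_integral_sum = Bochner_Integration.integral_sum

text \<open>Measurability is a separate conjunct because integrability of the squared norm does not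
  imply it. Functions rather than classes are used; almost everywhere equality is tracked
  explicitly.\<close>

definition L2 :: "'b measure => ('b => 'a::euclidean_space) => bool" where
 "L2 N f \<longleftrightarrow> f \<in> bm N \<and> integrable N (%x. (norm (f x))\<^sup>2)"

abbreviation nsq :: "'b measure => ('b => 'a::real_normed_vector) => ennreal" where
 "nsq N f \<equiv> \<integral>\<^sup>+x. ennreal ((norm (f x))\<^sup>2) \<partial>N"

abbreviation rsq :: "'b measure => ('b => 'a::real_normed_vector) => real" where
 "rsq N f \<equiv> \<integral>x. (norm (f x))\<^sup>2 \<partial>N"

text \<open>Stated with the nonnegative integral, so that it makes sense before the limit is known
  to be square integrable and matches the two limits in \<open>has_ito_integral\<close>.\<close>

definition L2conv :: "'b measure => (nat => 'b => 'a::euclidean_space) => ('b => 'a) => bool" where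
 "L2conv N f g \<longleftrightarrow> (%l. \<integral>\<^sup>+x. ennreal ((norm (g x - f l x))\<^sup>2) \<partial>N) \<longlonglongrightarrow> 0"

lemma L2_measurable: "L2 N f ==> f \<in> bm N"
 by (simp add: L2_def)

lemma L2_iff_nn:
 "L2 N f \<longleftrightarrow> f \<in> bm N \<and> (nsq N f) < \<infinity>"
 unfolding L2_def by (auto simp: integrable_iff_bounded)

lemma L2_nn_integral:
 "L2 N f ==> (nsq N f) = ennreal (rsq N f)"
 unfolding L2_def by (intro nn_integral_eq_integral) auto

lemma L2_bound:
 fixes f :: "'b => 'a::euclidean_space" and g :: "'b => 'c::euclidean_space"
 assumes g: "L2 N g" and f: "f \<in> bm N"
  and le: "AE x in N. norm (f x) \<le> K * norm (g x)"
 shows "L2 N f"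
 unfolding L2_def
proof
 show "integrable N (%x. (norm (f x))\<^sup>2)"
 proof (rule LI_integrable_bound)
  show "integrable N (%x. K\<^sup>2 * (norm (g x))\<^sup>2)"
   using g by (simp add: L2_def)
  show "AE x in N. norm ((norm (f x))\<^sup>2) \<le> norm (K\<^sup>2 * (norm (g x))\<^sup>2)"
   using le
  proof eventually_elim
   case (elim x)
   then have "(norm (f x))\<^sup>2 \<le> (K * norm (g x))\<^sup>2" by (intro power_mono) auto
   then show ?case by (simp add: power_mult_distrib)
  qed
 qed (use f in measurable)
qed (rule f)

lemma norm_add_sq_le: "(norm (x + y))\<^sup>2 \<le> 2 * (norm x)\<^sup>2 + 2 * (norm (y::'a::euclidean_space))\<^sup>2"
proof -
 have "(norm (x + y))\<^sup>2 \<le> (norm x + norm y)\<^sup>2" by (intro power_mono norm_triangle_ineq) auto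
 also have "... \<le> 2 * (norm x)\<^sup>2 + 2 * (norm y)\<^sup>2"
  using sum_squares_bound[of "norm x" "norm y"] by (simp add: power2_sum)
 finally show ?thesis .
qed

lemma L2_add:
 fixes f g :: "'b => 'a::euclidean_space"
 assumes "L2 N f" "L2 N g" shows "L2 N (%x. f x + g x)"
proof -
 have [measurable]: "f \<in> bm N" "g \<in> bm N"
  using assms by (auto simp: L2_def)
 have "integrable N (%x. (norm (f x + g x))\<^sup>2)"
 proof (rule LI_integrable_bound)
  show "integrable N (%x. 2 * (norm (f x))\<^sup>2 + 2 * (norm (g x))\<^sup>2)"
   using assms by (simp add: L2_def)
  show "AE x in N. norm ((norm (f x + g x))\<^sup>2) \<le> norm (2 * (norm (f x))\<^sup>2 + 2 * (norm (g x))\<^sup>2)"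
   using norm_add_sq_le by (auto intro!: AE_I2)
 qed measurable
 then show ?thesis by (simp add: L2_def)
qed

lemma L2_linear:
 fixes A :: "'a::euclidean_space => 'c::euclidean_space"
 assumes A: "bounded_linear A" and f: "L2 N f" shows "L2 N (%x. A (f x))"
proof -
 interpret bounded_linear A by fact
 obtain K where "\<And>x. norm (A x) \<le> norm x * K" using bounded by blast
 then show ?thesis
  by (intro L2_bound[OF f, where K=K])
   (use f in \<open>auto simp: L2_def mult.commute intro!: measurable_compose[OF _ borel_measurable_continuous_onI[OF linear_continuous_on[OF A]]]\<close>)
qed

lemma L2_scaleR: "L2 N f ==> L2 N (%x. c *\<^sub>R f x)"
 using L2_linear[OF bounded_linear_scaleR_right] .

lemma L2_diff: "L2 N f ==> L2 N g ==> L2 N (%x. f x - g x)"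
 using L2_add[of N f "%x. (-1) *\<^sub>R g x"] L2_scaleR[of N g "-1"] by simp

lemma L2_zero: "L2 N (%x. 0)"
 by (simp add: L2_def)

lemma L2_sum: "(\<And>i. i \<in> I ==> L2 N (f i)) ==> L2 N (%x. \<Sum>i\<in>I. f i x)"
 by (induction I rule: infinite_finite_induct) (auto intro: L2_add L2_zero)

lemma L2_cong_AE:
 assumes "L2 N f" "g \<in> bm N" "AE x in N. f x = g x" shows "L2 N g"
 by (rule L2_bound[OF assms(1,2), where K=1]) (use assms(3) in auto)

lemma L2_mult_integrable:
 fixes f :: "'b => 'a::euclidean_space" and g :: "'b => 'c::euclidean_space"
 assumes "L2 N f" "L2 N g"
 shows "integrable N (%x. norm (f x) * norm (g x))"
proof (rule LI_integrable_bound)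
 show "integrable N (%x. (norm (f x))\<^sup>2 + (norm (g x))\<^sup>2)"
  using assms by (simp add: L2_def)
 have "norm (f x) * norm (g x) \<le> (norm (f x))\<^sup>2 + (norm (g x))\<^sup>2" for x
  using sum_squares_bound[of "norm (f x)" "norm (g x)"]
   mult_nonneg_nonneg[of "norm (f x)" "norm (g x)"] norm_ge_zero[of "f x"] norm_ge_zero[of "g x"]
  by linarith
 then show "AE x in N. norm (norm (f x) * norm (g x)) \<le> norm ((norm (f x))\<^sup>2 + (norm (g x))\<^sup>2)"
  by (auto intro!: AE_I2)
qed (use assms in \<open>auto simp: L2_def intro!: borel_measurable_times borel_measurable_norm\<close>)

lemma L2_inner_integrable:
 fixes f g :: "'b => 'a::euclidean_space"
 assumes "L2 N f" "L2 N g"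
 shows "integrable N (%x. f x \<bullet> g x)"
 by (rule LI_integrable_bound[OF L2_mult_integrable[OF assms]])
  (use assms in \<open>auto simp: L2_def Cauchy_Schwarz_ineq2 intro!: borel_measurable_inner\<close>)

text \<open>The two functions may take values in different spaces, so that a vector-valued path can
  be paired with a scalar indicator. The inequality is transported from nonnegative integrals to
  real ones.\<close>

lemma L2_Cauchy_Schwarz:
 fixes f :: "'b => 'a::euclidean_space" and g :: "'b => 'c::euclidean_space"
 assumes f: "L2 N f" and g: "L2 N g"
 shows "(LI N (%x. norm (f x) * norm (g x)))\<^sup>2 \<le> rsq N f * rsq N g"
proof -
 have m: "f \<in> bm N" "g \<in> bm N" using f g by (auto simp: L2_def)
 have "(NI N (%x. ennreal (norm (f x)) * ennreal (norm (g x))))\<^sup>2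
   \<le> (NI N (%x. (ennreal (norm (f x)))\<^sup>2)) * (NI N (%x. (ennreal (norm (g x)))\<^sup>2))"
  by (rule Cauchy_Schwarz_nn_integral) (use m in measurable)
 also have "(NI N (%x. ennreal (norm (f x)) * ennreal (norm (g x)))) = ennreal (LI N (%x. norm (f x) * norm (g x)))"
  using L2_mult_integrable[OF f g] by (simp add: ennreal_mult'[symmetric] nn_integral_eq_integral)
 also have "(NI N (%x. (ennreal (norm (f x)))\<^sup>2)) = ennreal (rsq N f)"
  using L2_nn_integral[OF f] by (simp add: ennreal_power)
 also have "(NI N (%x. (ennreal (norm (g x)))\<^sup>2)) = ennreal (rsq N g)"
  using L2_nn_integral[OF g] by (simp add: ennreal_power)
 finally show ?thesis
  by (simp add: ennreal_mult'[symmetric] ennreal_power integral_nonneg_AE)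
qed

lemma L2_inner_abs_le:
 fixes f g :: "'b => 'a::euclidean_space"
 assumes f: "L2 N f" and g: "L2 N g"
 shows "\<bar>\<integral>x. f x \<bullet> g x \<partial>N\<bar> \<le> sqrt (rsq N f) * sqrt (rsq N g)"
proof -
 have "\<bar>\<integral>x. f x \<bullet> g x \<partial>N\<bar> \<le> (LI N (%x. \<bar>f x \<bullet> g x\<bar>))"
  using integral_norm_bound[of N "%x. f x \<bullet> g x"] by simp
 also have "... \<le> (LI N (%x. norm (f x) * norm (g x)))"
  using L2_inner_integrable[OF f g] L2_mult_integrable[OF f g]
  by (intro integral_mono) (auto simp: Cauchy_Schwarz_ineq2)
 also have "... \<le> sqrt ((rsq N f) * rsq N g)"
  by (rule real_le_rsqrt) (rule L2_Cauchy_Schwarz[OF f g])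
 finally show ?thesis by (simp add: real_sqrt_mult)
qed

lemma L2conv_real:
 assumes "\<And>l. L2 N (f l)" "L2 N g"
 shows "L2conv N f g \<longleftrightarrow> (%l. \<integral>x. (norm (g x - f l x))\<^sup>2 \<partial>N) \<longlonglongrightarrow> 0"
proof -
 have "nsq N (%x. g x - f l x) = ennreal (rsq N (%x. g x - f l x))" for l
  by (rule L2_nn_integral[OF L2_diff[OF assms(2) assms(1)]])
 then show ?thesis unfolding L2conv_def
  by (simp add: integral_nonneg_AE tendsto_ennreal_iff[where x=0, simplified])
qed

text \<open>With \<open>df = f - fl\<close> and \<open>dg = g - gl\<close> the difference of the
  integrands is \<open>df . g + f . dg - df . dg\<close>. Next to the errors only norms of the
  limits occur, so no bound on the approximating sequences is needed.\<close>

lemma L2_inner_tendsto: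
 fixes f g :: "'b => 'a::euclidean_space"
 assumes fl: "\<And>l. L2 N (fl l)" and f: "L2 N f" and gl: "\<And>l. L2 N (gl l)" and g: "L2 N g"
  and cf: "L2conv N fl f" and cg: "L2conv N gl g"
 shows "(%l. \<integral>x. fl l x \<bullet> gl l x \<partial>N) \<longlonglongrightarrow> (LI N (%x. f x \<bullet> g x))"
proof -
 let ?n = "%f::'b=>'a. sqrt (rsq N f)"
 have cf': "(%l. ?n (%x. f x - fl l x)) \<longlonglongrightarrow> 0"
  using cf unfolding L2conv_real[OF fl f] by (auto intro: tendsto_eq_intros)
 have cg': "(%l. ?n (%x. g x - gl l x)) \<longlonglongrightarrow> 0"
  using cg unfolding L2conv_real[OF gl g] by (auto intro: tendsto_eq_intros)
 have "(%l. (LI N (%x. f x \<bullet> g x)) - (LI N (%x. fl l x \<bullet> gl l x))) \<longlonglongrightarrow> 0"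
 proof (rule Lim_null_comparison)
  let ?u = "%l. ?n (%x. f x - fl l x) * ?n g + ?n f * ?n (%x. g x - gl l x)
    + ?n (%x. f x - fl l x) * ?n (%x. g x - gl l x)"
  show "?u \<longlonglongrightarrow> 0"
   using tendsto_add[OF tendsto_add[OF tendsto_mult_left_zero[OF cf', of "?n g"] tendsto_mult_right_zero[OF cg', of "?n f"]]
     tendsto_mult_zero[OF cf' cg']] by (simp only: add_0_left)
  show "\<forall>\<^sub>F l in sequentially. norm ((LI N (%x. f x \<bullet> g x)) - (LI N (%x. fl l x \<bullet> gl l x))) \<le> ?u l"
  proof (intro always_eventually allI)
   fix l
   have df: "L2 N (%x. f x - fl l x)" and dg: "L2 N (%x. g x - gl l x)"
    using L2_diff f fl g gl by blast+
   have "(LI N (%x. f x \<bullet> g x)) - (LI N (%x. fl l x \<bullet> gl l x))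
    = (LI N (%x. (f x \<bullet> g x - fl l x \<bullet> gl l x)))"
    using L2_inner_integrable f g fl gl by (intro LI_integral_diff[symmetric]) auto
   also have "... = (LI N (%x. (f x - fl l x) \<bullet> g x + f x \<bullet> (g x - gl l x) - (f x - fl l x) \<bullet> (g x - gl l x)))"
    by (intro LI_integral_cong) (auto simp: algebra_simps)
   also have "... = (LI N (%x. (f x - fl l x) \<bullet> g x)) + (LI N (%x. f x \<bullet> (g x - gl l x)))
     - (LI N (%x. (f x - fl l x) \<bullet> (g x - gl l x)))"
    using L2_inner_integrable[OF df g] L2_inner_integrable[OF f dg] L2_inner_integrable[OF df dg]
    by simp
   finally show "norm ((LI N (%x. f x \<bullet> g x)) - (LI N (%x. fl l x \<bullet> gl l x))) \<le> ?u l"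
    using L2_inner_abs_le[OF df g] L2_inner_abs_le[OF f dg] L2_inner_abs_le[OF df dg]
    unfolding real_norm_def by linarith
  qed
 qed
 from tendsto_diff[OF tendsto_const[of "\<integral>x. f x \<bullet> g x \<partial>N"] this] show ?thesis by simp
qed

lemma L2conv_const: "L2conv N (%l. f) f"
 by (simp add: L2conv_def)

lemma L2_norm_add_le:
 fixes f g :: "'b => 'a::euclidean_space"
 assumes "f \<in> bm N" "g \<in> bm N"
 shows "nsq N (%x. f x + g x)
  \<le> 2 * nsq N f + 2 * nsq N g"
proof -
 note [measurable] = assms
 have "nsq N (%x. f x + g x)
  \<le> (NI N (%x. 2 * ennreal ((norm (f x))\<^sup>2) + 2 * ennreal ((norm (g x))\<^sup>2)))"
 proof (intro nn_integral_mono)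
  fix x
  have "ennreal ((norm (f x + g x))\<^sup>2) \<le> ennreal (2 * (norm (f x))\<^sup>2 + 2 * (norm (g x))\<^sup>2)"
   by (intro ennreal_leI norm_add_sq_le)
  then show "ennreal ((norm (f x + g x))\<^sup>2) \<le> 2 * ennreal ((norm (f x))\<^sup>2) + 2 * ennreal ((norm (g x))\<^sup>2)"
   by (simp add: ennreal_plus ennreal_mult')
 qed
 then show ?thesis by (simp add: nn_integral_add nn_integral_cmult)
qed

lemma nn_norm_sq_eq_0:
 assumes "f \<in> bm N" "nsq N f = 0"
 shows "AE x in N. f x = 0"
proof -
 have "(%x. ennreal ((norm (f x))\<^sup>2)) \<in> bm N" using assms(1) by measurable
 from nn_integral_0_iff_AE[OF this] assms(2) show ?thesis by auto
qed

lemma L2_norm_sq_eq_0: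
 assumes "L2 N f" "rsq N f = 0" shows "AE x in N. f x = 0"
 by (rule nn_norm_sq_eq_0) (use assms L2_nn_integral[OF assms(1)] in \<open>auto simp: L2_def\<close>)

text \<open>A sequence with geometrically decaying increments converges almost everywhere, since
 \<open>|d| \<le> 2\<^sup>-\<^sup>k + 2\<^sup>k |d|\<^sup>2\<close>, and in the quadratic mean, by Fatou.\<close>

lemma L2_fast_Cauchy:
 fixes f :: "nat => 'b => 'a::euclidean_space"
 assumes f: "\<And>k. L2 N (f k)" and C: "0 \<le> C"
  and d: "\<And>k. (nsq N (%x. f (Suc k) x - f k x)) \<le> ennreal (C * (1/4)^k)"
 shows "AE x in N. convergent (%k. f k x)"
  and "\<And>k. (nsq N (%x. lim (%k. f k x) - f k x)) \<le> ennreal (4 * C * (1/4)^k)"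
  and "L2 N (%x. lim (%k. f k x))"
  and "L2conv N f (%x. lim (%k. f k x))"
proof -
 have fm[measurable]: "\<And>k. f k \<in> bm N" using f by (simp add: L2_def)
 let ?d = "%k x. norm (f (Suc k) x - f k x)"
 have "(NI N (%x. (\<Sum>k. ennreal (2^k * (?d k x)\<^sup>2)))) = (\<Sum>k. \<integral>\<^sup>+x. ennreal (2^k * (?d k x)\<^sup>2) \<partial>N)"
  by (intro nn_integral_suminf) measurable
 also have "... \<le> (\<Sum>k. ennreal (C * (1/2)^k))"
 proof (intro suminf_le allI)
  fix k
  have "(NI N (%x. ennreal (2^k * (?d k x)\<^sup>2))) = ennreal (2^k) * (NI N (%x. ennreal ((?d k x)\<^sup>2)))"
   by (simp add: ennreal_mult' nn_integral_cmult)
  also have "... \<le> ennreal (2^k) * ennreal (C * (1/4)^k)"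
   using d by (intro mult_left_mono) auto
  also have "... = ennreal (C * (1/2)^k)"
   using C by (simp add: ennreal_mult'[symmetric] power_divide power_mult_distrib[symmetric] field_simps)
  finally show "(NI N (%x. ennreal (2^k * (?d k x)\<^sup>2))) \<le> ennreal (C * (1/2)^k)" .
 qed auto
 also have "... < \<infinity>"
  using C by (subst suminf_ennreal2) (auto intro!: summable_mult)
 finally have fin: "(NI N (%x. (\<Sum>k. ennreal (2^k * (?d k x)\<^sup>2)))) \<noteq> \<infinity>" by simp
 have "AE x in N. (\<Sum>k. ennreal (2^k * (?d k x)\<^sup>2)) \<noteq> \<infinity>"
  by (rule nn_integral_PInf_AE[OF _ fin]) measurable
 then show conv: "AE x in N. convergent (%k. f k x)"
 proof eventually_elim
  case (elim x)
  have s: "summable (%k. 2^k * (?d k x)\<^sup>2)"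
   using elim by (intro summable_suminf_not_top) (auto simp: top_ennreal_def infinity_ennreal_def)
  have "?d k x \<le> (1/2)^k + 2^k * (?d k x)\<^sup>2" for k
  proof (cases "?d k x \<le> (1/2)^k")
   case True
   moreover have "0 \<le> 2^k * (?d k x)\<^sup>2" by simp
   ultimately show ?thesis by linarith
  next
   case False
   then have "1 \<le> 2^k * ?d k x" by (simp add: field_simps power_divide)
   then have "?d k x * 1 \<le> ?d k x * (2^k * ?d k x)" by (intro mult_left_mono) auto
   moreover have "0 \<le> (1/2::real)^k" by simp
   moreover have "?d k x * (2^k * ?d k x) = 2^k * (?d k x)\<^sup>2"
    by (simp add: power2_eq_square)
   ultimately show ?thesis by linarith
  qed
  moreover have "summable (%k. (1/2)^k + 2^k * (?d k x)\<^sup>2)"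
   by (rule summable_add[OF summable_geometric s]) simp
  ultimately have "summable (%k. f (Suc k) x - f k x)"
   by (rule summable_comparison_test'[where N=0, rotated])
  then have "convergent (%n. \<Sum>k<n. f (Suc k) x - f k x)"
   by (rule summable_iff_convergent[THEN iffD1])
  moreover have "(\<Sum>k<n. f (Suc k) x - f k x) = f n x - f 0 x" for n
   by (rule sum_lessThan_telescope)
  ultimately have "convergent (%n. f n x - f 0 x)" by simp
  then show "convergent (%k. f k x)"
   using convergent_add[of "%n. f n x - f 0 x" "%n. f 0 x"] by (simp add: convergent_const)
 qed
 \<comment> \<open>Peeling off the first increment doubles both squares:
   \<open>2 * (4C/4) + 2C = 4C\<close> reproduces the constant 4.\<close>
 have mk: "nsq N (%x. f (k + m) x - f k x) \<le> ennreal (4 * C * (1/4)^k)" for m k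
 proof (induction m arbitrary: k)
  case 0
  then show ?case using C by simp
 next
  case (Suc m)
  have "nsq N (%x. f (k + Suc m) x - f k x)
   = nsq N (%x. (f (Suc k + m) x - f (Suc k) x) + (f (Suc k) x - f k x))"
   by simp
  also have "... \<le> 2 * nsq N (%x. f (Suc k + m) x - f (Suc k) x)
   + 2 * (NI N (%x. ennreal ((?d k x)\<^sup>2)))"
   by (rule L2_norm_add_le) measurable
  also have "... \<le> 2 * ennreal (4 * C * (1/4)^Suc k) + 2 * ennreal (C * (1/4)^k)"
   by (intro add_mono mult_left_mono Suc.IH d) auto
  also have "... = ennreal (2 * (4 * C * (1/4)^Suc k) + 2 * (C * (1/4)^k))"
   using C by (subst ennreal_plus) (auto simp: ennreal_mult')
  also have "... = ennreal (4 * C * (1/4)^k)" by (simp add: field_simps)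
  finally show ?case .
 qed
 show lk: "nsq N (%x. lim (%k. f k x) - f k x) \<le> ennreal (4 * C * (1/4)^k)" for k
 proof -
  have "nsq N (%x. lim (%k. f k x) - f k x)
   = (NI N (%x. liminf (%m. ennreal ((norm (f (k + m) x - f k x))\<^sup>2))))"
  proof (rule nn_integral_cong_AE)
   show "AE x in N. ennreal ((norm (lim (%k. f k x) - f k x))\<^sup>2)
     = liminf (%m. ennreal ((norm (f (k + m) x - f k x))\<^sup>2))"
    using conv
   proof eventually_elim
    case (elim x)
    then have "(%m. f m x) \<longlonglongrightarrow> lim (%k. f k x)" by (simp add: convergent_LIMSEQ_iff)
    then have "(%m. f (m + k) x) \<longlonglongrightarrow> lim (%k. f k x)" by (rule LIMSEQ_ignore_initial_segment)
    then have "(%m. ennreal ((norm (f (k + m) x - f k x))\<^sup>2))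
      \<longlonglongrightarrow> ennreal ((norm (lim (%k. f k x) - f k x))\<^sup>2)"
     by (intro tendsto_ennrealI tendsto_intros) (simp add: add.commute)
    from lim_imp_Liminf[OF _ this] show ?case by simp
   qed
  qed
  also have "... \<le> liminf (%m. \<integral>\<^sup>+x. ennreal ((norm (f (k + m) x - f k x))\<^sup>2) \<partial>N)"
   by (rule nn_integral_liminf) measurable
  also have "... \<le> liminf (%m::nat. ennreal (4 * C * (1/4)^k))"
   by (intro Liminf_mono always_eventually allI mk)
  also have "... = ennreal (4 * C * (1/4)^k)" by (simp add: Liminf_const)
  finally show ?thesis .
 qed
 have [measurable]: "(%x. lim (%k. f k x)) \<in> bm N" by measurable
 have "L2 N (%x. lim (%k. f k x) - f 0 x)"
  unfolding L2_iff_nn using lk[of 0] by (auto simp: le_less_trans)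
 from L2_add[OF this f[of 0]] show "L2 N (%x. lim (%k. f k x))" by simp
 have "(%k. ennreal (4 * C * (1/4)^k)) \<longlonglongrightarrow> ennreal 0"
  by (rule tendsto_ennrealI[OF tendsto_mult_right_zero[OF LIMSEQ_power_zero]]) simp
 then have z: "(%k. ennreal (4 * C * (1/4)^k)) \<longlonglongrightarrow> 0" by simp
 show "L2conv N f (%x. lim (%k. f k x))"
  unfolding L2conv_def
  by (rule tendsto_sandwich[OF _ _ tendsto_const z]) (simp_all add: lk)
qed

section \<open>Brownian motions relative to a filtration\<close>

text \<open>Only what the integral needs is recorded: increments have mean zero and covariance
  \<open>t - s\<close> when tested on events of \<open>F s\<close>. Such identities pass to the
  right-continuous filtration by \<open>L2\<close> limits, which is easier than transferring
  independence from the past.\<close>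

locale brownian_filtration = prob_space M
 for M :: "'w measure" +
 fixes F :: "real => 'w measure" and W :: "'j::finite => real => 'w => real"
 assumes F_sub: "\<And>t. 0 \<le> t ==> subalgebra M (F t)"
  and F_mono: "\<And>s t. 0 \<le> s ==> s \<le> t ==> sets (F s) \<subseteq> sets (F t)"
  and F_null: "\<And>t. 0 \<le> t ==> null_sets M \<subseteq> sets (F t)"
  and W_adapted: "\<And>j t. 0 \<le> t ==> W j t \<in> bm (F t)"
  and W_cont: "\<And>j. AE w in M. continuous_on {0..} (%t. W j t w)"
  and W_L2: "\<And>j s t. 0 \<le> s ==> s \<le> t ==> L2 M (%w. W j t w - W j s w)"
  and W_mean: "\<And>j s t A. 0 \<le> s ==> s \<le> t ==> A \<in> sets (F s) ==>
   (LI M (%w. indicator A w * (W j t w - W j s w))) = 0"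
  and W_cov: "\<And>i j s t A. 0 \<le> s ==> s \<le> t ==> A \<in> sets (F s) ==>
   (LI M (%w. indicator A w * ((W i t w - W i s w) * (W j t w - W j s w))))
    = (if i = j then t - s else 0) * measure M A"
begin

lemma space_F: "0 \<le> t ==> space (F t) = space M"
 using F_sub[of t] by (simp add: subalgebra_def)

lemma F_subalg: "0 \<le> s ==> s \<le> t ==> subalgebra (F t) (F s)"
 using F_mono space_F by (simp add: subalgebra_def)

lemma F_measurable_mono: "0 \<le> s ==> s \<le> t ==> f \<in> measurable (F s) N ==> f \<in> measurable (F t) N"
 using measurable_from_subalg[OF F_subalg] .

lemma F_measurable_M: "0 \<le> s ==> f \<in> measurable (F s) N ==> f \<in> measurable M N"
 using measurable_from_subalg[OF F_sub] .

text \<open>The hypothesis on indicators says that the conditional expectation of \<open>f\<close>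
  given \<open>F s\<close> is the constant \<open>c\<close>; then any \<open>F s\<close>-measurable
  factor can be pulled out.\<close>

lemma cond_const:
 assumes s: "0 \<le> s" and f: "integrable M f"
  and eq: "\<And>A. A \<in> sets (F s) ==> (LI M (%w. indicator A w * f w)) = c * measure M A"
  and Y: "Y \<in> bm (F s)" and Yf: "integrable M (%w. Y w * f w)"
 shows "(LI M (%w. Y w * f w)) = c * (LI M (%w. Y w))"
proof -
 interpret S: finite_measure_subalgebra M "F s"
  by unfold_locales (rule F_sub[OF s])
 have "AE w in M. real_cond_exp M (F s) f w = c"
 proof (rule S.real_cond_exp_charact)
  fix A assume A: "A \<in> sets (F s)"
  then have "A \<in> sets M" using F_sub[OF s] by (auto simp: subalgebra_def)
  then show "(\<integral>w\<in>A. f w \<partial>M) = (\<integral>w\<in>A. c \<partial>M)"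
   using eq[OF A] by (simp add: set_lebesgue_integral_def mult.commute emeasure_eq_measure)
 qed (use f in auto)
 then have "(LI M (%w. Y w * real_cond_exp M (F s) f w)) = (LI M (%w. c * Y w))"
  using F_measurable_M[OF s Y] by (intro integral_cong_AE) (auto simp: mult.commute)
 then show ?thesis
  using S.real_cond_exp_intg(2)[OF Yf Y] f by simp
qed

lemma incr_mean:
 assumes "0 \<le> s" "s \<le> t" "Y \<in> bm (F s)" "L2 M Y"
 shows "(LI M (%w. Y w * (W j t w - W j s w))) = 0"
 using cond_const[of s "%w. W j t w - W j s w" 0 Y] W_mean[OF assms(1,2)]
  L2_inner_integrable[OF assms(4) W_L2[OF assms(1,2), of j]]
  L2_inner_integrable[OF _ W_L2[OF assms(1,2), of j], of "%_. 1"] assms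
 by (simp add: L2_def)

lemma L2_bdd: "f \<in> bm M ==> (\<And>w. w \<in> space M ==> norm (f w) \<le> K) ==> L2 M f"
 by (rule L2_bound[of M "%_. 1::real" f K]) (auto simp: L2_def)

lemma L2_bdd_mult:
 assumes "L2 M f" "Y \<in> bm M" "\<And>w. w \<in> space M ==> \<bar>Y w\<bar> \<le> K"
 shows "L2 M (%w. Y w * f w :: real)"
 by (rule L2_bound[OF assms(1), of _ K])
  (use assms in \<open>auto simp: L2_def abs_mult intro!: mult_right_mono\<close>)

text \<open>The motion that runs longer is cut at the earlier end time. What comes after is an
  increment of mean zero against a weight known by then, so only the common stretch counts.
  Boundedness of \<open>Y\<close> keeps the weighted increment in \<open>L2\<close>.\<close>

lemma incr_cov:
 assumes s: "0 \<le> s" "s \<le> b" "s \<le> d"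
  and Y: "Y \<in> bm (F s)" "\<And>w. w \<in> space M ==> \<bar>Y w\<bar> \<le> K"
 shows "(LI M (%w. Y w * ((W i b w - W i s w) * (W j d w - W j s w))))
  = (if i = j then min b d - s else 0) * (LI M (%w. Y w))"
proof -
 have same: "(LI M (%w. Y w * ((W i b w - W i s w) * (W j b w - W j s w))))
   = (if i = j then b - s else 0) * (LI M (%w. Y w))" if "s \<le> b" for i j b
 proof (rule cond_const[OF s(1) _ _ Y(1)])
  show "integrable M (%w. (W i b w - W i s w) * (W j b w - W j s w))"
   using L2_inner_integrable[OF W_L2[of s b i] W_L2[of s b j]] s that by simp
  show "integrable M (%w. Y w * ((W i b w - W i s w) * (W j b w - W j s w)))"
   using L2_inner_integrable[OF L2_bdd_mult[OF W_L2[of s b i] F_measurable_M[OF s(1) Y(1)] Y(2)] W_L2[of s b j]] s that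
   by (simp add: mult.assoc)
 qed (use W_cov[OF s(1) that] in simp)
 have cross: "(LI M (%w. Y w * ((W i b w - W i s w) * (W j d w - W j s w))))
  = (if i = j then b - s else 0) * (LI M (%w. Y w))" if "s \<le> b" "b \<le> d" for i j b d
 proof -
  let ?Z = "%w. Y w * (W i b w - W i s w)"
  have Z: "L2 M ?Z"
   by (rule L2_bdd_mult[OF W_L2 F_measurable_M[OF s(1) Y(1)] Y(2)]) (use s that in auto)
  have "0 \<le> b" using s that by simp
  have Zm: "?Z \<in> bm (F b)"
   using F_measurable_mono[OF s(1) \<open>s \<le> b\<close> Y(1)] W_adapted[OF \<open>0 \<le> b\<close>, of i]
    F_measurable_mono[OF s(1) \<open>s \<le> b\<close> W_adapted[OF s(1), of i]] by measurable
  have "(LI M (%w. Y w * ((W i b w - W i s w) * (W j d w - W j s w))))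
   = (LI M (%w. ?Z w * (W j b w - W j s w) + ?Z w * (W j d w - W j b w)))"
   by (intro LI_integral_cong) (auto simp: algebra_simps)
  also have "... = (LI M (%w. ?Z w * (W j b w - W j s w))) + (LI M (%w. ?Z w * (W j d w - W j b w)))"
   using L2_inner_integrable[OF Z W_L2[of s b j]] L2_inner_integrable[OF Z W_L2[of b d j]] s that
   by simp
  also have "(LI M (%w. ?Z w * (W j d w - W j b w))) = 0"
   by (rule incr_mean[OF \<open>0 \<le> b\<close> that(2) Zm Z])
  finally show ?thesis using same[OF that(1), of i j] by (simp add: mult.assoc)
 qed
 show ?thesis
 proof (cases "b \<le> d")
  case True
  then show ?thesis using cross[OF s(2) True, of i j] by simp
 next
  case False
  have "(LI M (%w. Y w * ((W i b w - W i s w) * (W j d w - W j s w))))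
   = (LI M (%w. Y w * ((W j d w - W j s w) * (W i b w - W i s w))))"
   by (simp add: mult.commute mult.left_commute)
  also have "... = (if j = i then d - s else 0) * (LI M (%w. Y w))"
   by (rule cross) (use s False in auto)
  finally show ?thesis using False by auto
 qed
qed

definition bdd_meas :: "real => ('w => 'a::euclidean_space) => bool" where
 "bdd_meas a \<eta> \<longleftrightarrow> \<eta> \<in> bm (F a) \<and> (\<exists>K. \<forall>w\<in>space M. norm (\<eta> w) \<le> K)"

lemma bdd_meas_L2: "0 \<le> a ==> bdd_meas a \<eta> ==> L2 M \<eta>"
 unfolding bdd_meas_def using L2_bdd F_measurable_M by blast

lemma term_L2:
 assumes "0 \<le> a" "a \<le> b" "0 \<le> c" "bdd_meas c \<eta>"
 shows "L2 M (%w. (W i b w - W i a w) *\<^sub>R \<eta> w)"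
proof -
 obtain K where K: "\<And>w. w \<in> space M ==> norm (\<eta> w) \<le> K" and m: "\<eta> \<in> bm M"
  using assms F_measurable_M unfolding bdd_meas_def by blast
 show ?thesis
 proof (rule L2_bound[OF W_L2[OF assms(1,2), of i], of _ K])
  show "AE x in M. norm ((W i b x - W i a x) *\<^sub>R \<eta> x) \<le> K * norm (W i b x - W i a x)"
   using K by (auto intro!: AE_I2 mult_right_mono simp: mult.commute)
  show "(%w. (W i b w - W i a w) *\<^sub>R \<eta> w) \<in> bm M"
   using m L2_measurable[OF W_L2[OF assms(1,2), of i]] by measurable
 qed
qed

lemma bdd_meas_inner:
 assumes "0 \<le> a" "a \<le> c" "bdd_meas a \<eta>" "bdd_meas c \<zeta>"
 obtains K where "(%w. \<eta> w \<bullet> \<zeta> w) \<in> bm (F c)" "\<And>w. w \<in> space M ==> \<bar>\<eta> w \<bullet> \<zeta> w\<bar> \<le> K"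
proof -
 obtain K1 K2 where K: "\<And>w. w \<in> space M ==> norm (\<eta> w) \<le> K1" "\<And>w. w \<in> space M ==> norm (\<zeta> w) \<le> K2"
  using assms unfolding bdd_meas_def by blast
 have "\<bar>\<eta> w \<bullet> \<zeta> w\<bar> \<le> K1 * K2" if "w \<in> space M" for w
  using Cauchy_Schwarz_ineq2[of "\<eta> w" "\<zeta> w"] mult_mono[OF K(1)[OF that] K(2)[OF that]] norm_ge_zero
  by (meson K(1) norm_ge_zero order_trans that)
 moreover have "(%w. \<eta> w \<bullet> \<zeta> w) \<in> bm (F c)"
  using assms F_measurable_mono[OF assms(1,2)] unfolding bdd_meas_def
  by (auto intro!: borel_measurable_inner)
 ultimately show ?thesis using that by blast
qed

text \<open>The first increment is cut at \<open>c\<close>. Its part before \<open>c\<close> is a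
  factor known at time \<open>c\<close> and drops out; the part after \<open>c\<close> starts
  together with the second increment, which is the case of \<open>incr_cov\<close>.\<close>

lemma term_isometry_ordered:
 assumes "0 \<le> a" "a \<le> b" "a \<le> c" "c \<le> d" "bdd_meas a \<eta>" "bdd_meas c \<zeta>"
 shows "(LI M (%w. ((W i b w - W i a w) *\<^sub>R \<eta> w) \<bullet> ((W j d w - W j c w) *\<^sub>R \<zeta> w)))
  = (if i = j then max 0 (min b d - c) else 0) * (LI M (%w. \<eta> w \<bullet> \<zeta> w))"
proof -
 obtain K where K: "(%w. \<eta> w \<bullet> \<zeta> w) \<in> bm (F c)" "\<And>w. w \<in> space M ==> \<bar>\<eta> w \<bullet> \<zeta> w\<bar> \<le> K"
  using bdd_meas_inner[OF assms(1,3,5,6)] by blast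
 have c: "0 \<le> c" using assms by simp
 have KM: "(%w. \<eta> w \<bullet> \<zeta> w) \<in> bm M" using F_measurable_M[OF c K(1)] .
 have past: "(LI M (%w. (\<eta> w \<bullet> \<zeta> w) * (W i e w - W i a w) * (W j d w - W j c w))) = 0"
  if "a \<le> e" "e \<le> c" for e
 proof (rule incr_mean[OF c assms(4)])
  have "0 \<le> e" using assms that by simp
  show "(%w. (\<eta> w \<bullet> \<zeta> w) * (W i e w - W i a w)) \<in> bm (F c)"
   using K(1) F_measurable_mono[OF assms(1,3) W_adapted[OF assms(1), of i]]
    F_measurable_mono[OF \<open>0 \<le> e\<close> that(2) W_adapted[OF \<open>0 \<le> e\<close>, of i]] by measurable
  show "L2 M (%w. (\<eta> w \<bullet> \<zeta> w) * (W i e w - W i a w))"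
   by (rule L2_bdd_mult[OF W_L2[OF assms(1) that(1)] KM K(2)])
 qed
 show ?thesis
 proof (cases "b \<le> c")
  case True
  have "(LI M (%w. ((W i b w - W i a w) *\<^sub>R \<eta> w) \<bullet> ((W j d w - W j c w) *\<^sub>R \<zeta> w)))
   = (LI M (%w. (\<eta> w \<bullet> \<zeta> w) * (W i b w - W i a w) * (W j d w - W j c w)))"
   by (intro LI_integral_cong) (auto simp: algebra_simps)
  also have "... = 0" by (rule past) (use assms True in auto)
  finally show ?thesis using True by simp
 next
  case False
  have i1: "integrable M (%w. (\<eta> w \<bullet> \<zeta> w) * (W i c w - W i a w) * (W j d w - W j c w))"
   using L2_inner_integrable[OF L2_bdd_mult[OF W_L2[OF assms(1,3)] KM K(2)] W_L2[OF c assms(4)]] by simp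
  have i2: "integrable M (%w. (\<eta> w \<bullet> \<zeta> w) * ((W i b w - W i c w) * (W j d w - W j c w)))"
   using L2_inner_integrable[OF L2_bdd_mult[OF W_L2[of c b] KM K(2)] W_L2[OF c assms(4)]] False c
   by (simp add: mult.assoc)
  have "(LI M (%w. ((W i b w - W i a w) *\<^sub>R \<eta> w) \<bullet> ((W j d w - W j c w) *\<^sub>R \<zeta> w)))
   = (\<integral>w. (\<eta> w \<bullet> \<zeta> w) * (W i c w - W i a w) * (W j d w - W j c w)
     + (\<eta> w \<bullet> \<zeta> w) * ((W i b w - W i c w) * (W j d w - W j c w)) \<partial>M)"
   by (intro LI_integral_cong) (auto simp: algebra_simps)
  also have "... = (LI M (%w. (\<eta> w \<bullet> \<zeta> w) * ((W i b w - W i c w) * (W j d w - W j c w))))"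
   using i1 i2 past[of c] assms by simp
  also have "... = (if i = j then min b d - c else 0) * (LI M (%w. \<eta> w \<bullet> \<zeta> w))"
   by (rule incr_cov[OF c _ assms(4) K]) (use False in auto)
  finally show ?thesis using False assms by (simp add: max_def)
 qed
qed

lemma term_isometry:
 assumes "0 \<le> a" "a \<le> b" "0 \<le> c" "c \<le> d" "bdd_meas a \<eta>" "bdd_meas c \<zeta>"
 shows "(LI M (%w. ((W i b w - W i a w) *\<^sub>R \<eta> w) \<bullet> ((W j d w - W j c w) *\<^sub>R \<zeta> w)))
  = (if i = j then max 0 (min b d - max a c) else 0) * (LI M (%w. \<eta> w \<bullet> \<zeta> w))"
proof (cases "a \<le> c")
 case True
 then show ?thesis using term_isometry_ordered[OF assms(1,2) True assms(4,5,6), of i j] by (simp add: max_def)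
next
 case False
 then have "c \<le> a" by simp
 then show ?thesis using term_isometry_ordered[OF assms(3,4) \<open>c \<le> a\<close> assms(2,6,5), of j i]
  by (auto simp: max_def inner_commute min.commute)
qed

end

section \<open>Ito integrals: isometry and martingale property\<close>

text \<open>Extension by zero outside \<open>[0,t]\<close>, seen on the product of the whole time
  line and the probability space, so that processes with different horizons live in one
  \<open>L2\<close> space.\<close>

definition cut :: "real => (real => 'w => 'a::euclidean_space) => real \<times> 'w => 'a" where
 "cut t H = (%(s, w). indicator {0..t} s *\<^sub>R H s w)"

lemma integral_sum2:
 fixes g :: "nat => nat => 'b => real"
 assumes "\<And>k l. k < K ==> l < L ==> integrable N (g k l)"
 shows "(LI N (%x. (\<Sum>k<K. \<Sum>l<L. g k l x))) = (\<Sum>k<K. \<Sum>l<L. \<integral>x. g k l x \<partial>N)"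
 using assms by (subst LI_integral_sum) (auto intro!: LI_integrable_sum sum.cong)

lemma bounded_const_image: "bounded ((%_. c :: 'a::euclidean_space) ` S)"
 by (rule bounded_subset[of "{c}"]) auto

context brownian_filtration
begin

abbreviation Lam :: "(real \<times> 'w) measure" where "Lam \<equiv> lborel \<Otimes>\<^sub>M M"

sublocale PS: pair_sigma_finite lborel M
 by unfold_locales

text \<open>Progressive measurability speaks about \<open>[0,t]\<close> only. Clamping the time
  gives joint measurability on the whole line with respect to \<open>F t\<close>, the form that
  Fubini and parameter integrals ask for.\<close>

lemma progressive_clamp:
 fixes H :: "real => 'w => 'a::euclidean_space"
 assumes H: "progressive F T H" and t: "0 \<le> t" "t \<le> T"
 shows "(%(s, w). H (max 0 (min s t)) w) \<in> bm (lborel \<Otimes>\<^sub>M F t)"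
proof -
 have 1: "(%x. (max 0 (min (fst x) t), snd x)) \<in> lborel \<Otimes>\<^sub>M F t \<rightarrow>\<^sub>M restrict_space borel {0..t} \<Otimes>\<^sub>M F t"
 proof (rule measurable_Pair)
  show "(%x. max 0 (min (fst x) t)) \<in> lborel \<Otimes>\<^sub>M F t \<rightarrow>\<^sub>M restrict_space borel {0..t}"
   by (rule measurable_restrict_space2) (use t in auto)
 qed simp
 have 2: "(%(s, w). H s w) \<in> bm (restrict_space borel {0..t} \<Otimes>\<^sub>M F t)"
  using H t unfolding progressive_def by auto
 show ?thesis using measurable_compose[OF 1 2] by (simp add: split_beta')
qed

lemma pair_F_measurable_M:
 assumes t: "0 \<le> t" and f: "f \<in> measurable (N \<Otimes>\<^sub>M F t) K" shows "f \<in> measurable (N \<Otimes>\<^sub>M M) K"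
proof -
 have id: "(%w. w) \<in> M \<rightarrow>\<^sub>M F t"
  using F_measurable_M[OF t measurable_ident] by (simp add: id_def)
 have "(%x. x) \<in> N \<Otimes>\<^sub>M M \<rightarrow>\<^sub>M N \<Otimes>\<^sub>M F t"
  by (rule measurable_pair) (use measurable_compose[OF measurable_snd id] in \<open>auto simp: comp_def\<close>)
 from measurable_compose[OF this f] show ?thesis by simp
qed

lemma cut_measurable:
 assumes H: "progressive F T H" and t: "0 \<le> t" "t \<le> T"
 shows "cut t H \<in> bm Lam"
proof -
 have "(%(s, w). H (max 0 (min s t)) w) \<in> bm Lam"
  by (rule pair_F_measurable_M[OF t(1) progressive_clamp[OF H t]])
 then have "(%x. indicator {0..t} (fst x) *\<^sub>R H (max 0 (min (fst x) t)) (snd x)) \<in> bm Lam"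
  by (simp add: split_beta')
 also have "(%x. indicator {0..t} (fst x) *\<^sub>R H (max 0 (min (fst x) t)) (snd x)) = cut t H"
  by (auto simp: cut_def fun_eq_iff split: split_indicator)
 finally show ?thesis .
qed

lemma cut_nn_integral:
 assumes "cut t H \<in> bm Lam"
 shows "(NI M (%w. (\<integral>\<^sup>+s\<in>{0..t}. ennreal ((norm (H s w))\<^sup>2) \<partial>lborel)))
  = nsq Lam (cut t H)"
proof -
 have "nsq Lam (cut t H)
  = (NI M (%w. (nsq lborel (%s. cut t H (s, w)))))"
  by (rule PS.nn_integral_snd[symmetric]) (use assms in measurable)
 also have "... = (NI M (%w. (\<integral>\<^sup>+s\<in>{0..t}. ennreal ((norm (H s w))\<^sup>2) \<partial>lborel)))"
  by (intro nn_integral_cong) (auto simp: cut_def split: split_indicator)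
 finally show ?thesis by simp
qed

lemma cut_diff: "cut t (%s w. H s w - G s w) = (%x. cut t H x - cut t G x)"
 by (auto simp: cut_def algebra_simps)

lemma cut_add: "cut t (%s w. H s w + G s w) = (%x. cut t H x + cut t G x)"
 by (auto simp: cut_def algebra_simps)

lemma cut_linear:
 assumes "bounded_linear A" shows "cut t (%s w. A (H s w)) = (%x. A (cut t H x))"
proof -
 interpret bounded_linear A by fact
 show ?thesis by (auto simp: cut_def scaleR)
qed

lemma cut_L2:
 assumes "progressive F T H" "0 \<le> t" "t \<le> T" "square_integrable_process M t H"
 shows "L2 Lam (cut t H)"
 using assms cut_measurable[OF assms(1-3)] unfolding L2_iff_nn square_integrable_process_def
 by (simp add: cut_nn_integral)

lemma progressive_mono: "progressive F T H ==> t \<le> T ==> progressive F t H"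
 unfolding progressive_def by auto

lemma cut_cut: "t \<le> T ==> cut t H = (%x. indicator {..t} (fst x) *\<^sub>R cut T H x)"
 by (auto simp: cut_def split: split_indicator)

section \<open>Simple integrands and their isometry\<close>

lemma simple_terms:
 fixes \<eta> :: "nat => 'w => 'a::euclidean_space"
 assumes S: "simple_integrand F t K \<tau> \<eta>" and k: "k < K"
 shows "0 \<le> \<tau> k" "\<tau> k \<le> \<tau> (Suc k)" "\<tau> (Suc k) \<le> t" "bdd_meas (\<tau> k) (\<eta> k)"
proof -
 have mono: "\<tau> i \<le> \<tau> j" if "i \<le> j" "j \<le> K" for i j
  using that
 proof (induction j)
  case (Suc j)
  then show ?case using S unfolding simple_integrand_def
   by (metis Suc_leD Suc_le_lessD le_Suc_eq order_refl order_trans)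
 qed simp
 show 0: "0 \<le> \<tau> k" using mono[of 0 k] S k by (simp add: simple_integrand_def)
 show "\<tau> k \<le> \<tau> (Suc k)" using S k by (simp add: simple_integrand_def)
 show "\<tau> (Suc k) \<le> t" using mono[of "Suc k" K] S k by (simp add: simple_integrand_def)
 show "bdd_meas (\<tau> k) (\<eta> k)"
 proof -
  have "\<eta> k \<in> bm (F (\<tau> k))" and b: "bounded (\<eta> k ` space (F (\<tau> k)))"
   using S k by (auto simp: simple_integrand_def)
  then show ?thesis unfolding bdd_meas_def space_F[OF 0] bounded_iff by blast
 qed
qed

lemma simple_integral_L2:
 assumes S: "simple_integrand F t K \<tau> \<eta>"
 shows "L2 M (simple_integral (W j) K \<tau> \<eta>)"
 unfolding simple_integral_def
 by (intro L2_sum term_L2[OF _ _ _ simple_terms(4)[OF S]]) (use simple_terms[OF S] in auto)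

lemma simple_process_progressive:
 fixes \<eta> :: "nat => 'w => 'a::euclidean_space"
 assumes S: "simple_integrand F t K \<tau> \<eta>"
 shows "progressive F t (simple_process K \<tau> \<eta>)"
 unfolding progressive_def
proof
 fix u assume u: "u \<in> {0..t}"
 have "(%x. \<Sum>k<K. indicator {\<tau> k<..\<tau> (Suc k)} (fst x) *\<^sub>R \<eta> k (snd x)) \<in> bm (restrict_space borel {0..u} \<Otimes>\<^sub>M F u)"
 proof (rule borel_measurable_sum)
  fix k assume "k \<in> {..<K}"
  then have k: "k < K" by simp
  show "(%x. indicator {\<tau> k<..\<tau> (Suc k)} (fst x) *\<^sub>R \<eta> k (snd x)) \<in> bm (restrict_space borel {0..u} \<Otimes>\<^sub>M F u)"
  \<comment> \<open>If the cell starts at \<open>u\<close> or later, \<open>\<eta> k\<close> need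
    not be \<open>F u\<close>-measurable, but then the indicator vanishes on
    \<open>[0,u]\<close>.\<close>
  proof (cases "\<tau> k < u")
   case True
   have [measurable]: "\<eta> k \<in> bm (F u)"
    using simple_terms[OF S k] True F_measurable_mono[of "\<tau> k" u] by (auto simp: bdd_meas_def)
   have [measurable]: "fst \<in> restrict_space borel {0..u} \<Otimes>\<^sub>M F u \<rightarrow>\<^sub>M borel"
    by (rule measurable_compose[OF measurable_fst]) (auto intro: measurable_restrict_space1)
   show ?thesis by measurable
  next
   case False
   have "(%x. 0) \<in> bm (restrict_space borel {0..u} \<Otimes>\<^sub>M F u)" by simp
   then show ?thesis
    by (rule measurable_cong[THEN iffD1, rotated])
     (use False in \<open>auto simp: space_pair_measure space_restrict_space split: split_indicator\<close>)
  qed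
 qed
 then show "(%(s, w). simple_process K \<tau> \<eta> s w) \<in> bm (restrict_space borel {0..u} \<Otimes>\<^sub>M F u)"
  by (simp add: simple_process_def split_beta')
qed

lemma cut_simple:
 assumes S: "simple_integrand F t K \<tau> \<eta>" and t: "t \<le> T"
 shows "cut T (simple_process K \<tau> \<eta>) = (%(s, w). simple_process K \<tau> \<eta> s w)"
proof (rule ext, clarify)
 fix s w
 show "cut T (simple_process K \<tau> \<eta>) (s, w) = simple_process K \<tau> \<eta> s w"
 proof (cases "s \<in> {0..T}")
  case False
  have "simple_process K \<tau> \<eta> s w = 0"
   unfolding simple_process_def
  proof (intro sum.neutral ballI)
   fix k assume "k \<in> {..<K}"
   then show "indicator {\<tau> k<..\<tau> (Suc k)} s *\<^sub>R \<eta> k w = 0"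
    using simple_terms[OF S, of k] False t by (auto split: split_indicator)
  qed
  then show ?thesis by (simp add: cut_def)
 qed (simp add: cut_def)
qed

lemma Lam_term:
 fixes \<eta> :: "'w => 'a::euclidean_space"
 assumes f: "integrable M f"
 shows "integrable Lam (%x. indicator {a<..b} (fst x) * (f (snd x) :: real))"
  and "(LI Lam (%x. indicator {a<..b} (fst x) * (f (snd x) :: real))) = max 0 (b - a) * (LI M (%w. f w))"
proof -
 have m: "(%x. indicator {a<..b} (fst x) * (f (snd x) :: real)) \<in> bm Lam"
  using borel_measurable_integrable[OF f] by measurable
 show i: "integrable Lam (%x. indicator {a<..b} (fst x) * (f (snd x) :: real))"
 proof (rule integrableI_bounded[OF m])
  have "(NI Lam (%x. ennreal (norm (indicator {a<..b} (fst x) * (f (snd x) :: real)))))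
   = (NI lborel (%s. (NI M (%w. ennreal (indicator {a<..b} s) * ennreal \<bar>f w\<bar>))))"
  proof -
   have "(%x. ennreal (norm (indicator {a<..b} (fst x) * (f (snd x) :: real)))) \<in> bm Lam"
    using m by measurable
   from nn_integral_fst[OF this] show ?thesis by (simp add: abs_mult ennreal_mult')
  qed
  also have "... = (NI lborel (%s. ennreal (indicator {a<..b} s) * (NI M (%w. ennreal \<bar>f w\<bar>))))"
   using f by (subst nn_integral_cmult) auto
  also have "... = (NI lborel (%s. ennreal (indicator {a<..b} s))) * (NI M (%w. ennreal \<bar>f w\<bar>))"
   by (subst nn_integral_multc) auto
  also have "... < \<infinity>"
  proof -
   have "(NI lborel (%s. ennreal (indicator {a<..b} s))) < \<infinity>"
    by (cases "a \<le> b") (auto simp: ennreal_indicator)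
   moreover have "(NI M (%w. ennreal \<bar>f w\<bar>)) < \<infinity>" using f by (simp add: integrable_iff_bounded)
   ultimately show ?thesis by (simp add: ennreal_mult_less_top)
  qed
  finally show "(NI Lam (%x. ennreal (norm (indicator {a<..b} (fst x) * (f (snd x) :: real))))) < \<infinity>" .
 qed
 have "(LI Lam (%x. indicator {a<..b} (fst x) * (f (snd x) :: real)))
  = (LI lborel (%s. (LI M (%w. indicator {a<..b} s * f w))))"
  using PS.integral_fst[of "%s w. indicator {a<..b} s * f w"] i by (simp add: split_beta')
 also have "... = max 0 (b - a) * (LI M (%w. f w))"
  by (cases "a \<le> b") (auto simp: max_def)
 finally show "(LI Lam (%x. indicator {a<..b} (fst x) * (f (snd x) :: real))) = max 0 (b - a) * (LI M (%w. f w))" .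
qed

lemma simple_process_L2:
 assumes S: "simple_integrand F t K \<tau> \<eta>"
 shows "L2 Lam (%(s, w). simple_process K \<tau> \<eta> s w)"
proof -
 have "L2 Lam (%x. \<Sum>k<K. indicator {\<tau> k<..\<tau> (Suc k)} (fst x) *\<^sub>R \<eta> k (snd x))"
 proof (rule L2_sum)
  fix k assume "k \<in> {..<K}"
  then have L: "L2 M (\<eta> k)" using simple_terms[OF S, of k] bdd_meas_L2 by auto
  have "integrable Lam (%x. indicator {\<tau> k<..\<tau> (Suc k)} (fst x) * (norm (\<eta> k (snd x)))\<^sup>2)"
   using L by (intro Lam_term) (simp add: L2_def)
  also have "(%x. indicator {\<tau> k<..\<tau> (Suc k)} (fst x) * (norm (\<eta> k (snd x)))\<^sup>2)
   = (%x. (norm (indicator {\<tau> k<..\<tau> (Suc k)} (fst x) *\<^sub>R \<eta> k (snd x)))\<^sup>2)"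
   by (auto simp: fun_eq_iff split: split_indicator)
  finally show "L2 Lam (%x. indicator {\<tau> k<..\<tau> (Suc k)} (fst x) *\<^sub>R \<eta> k (snd x))"
   unfolding L2_def using L2_measurable[OF L] by simp
 qed
 then show ?thesis by (simp add: simple_process_def split_beta')
qed

text \<open>Two grids are compared cell by cell without a common refinement: cells \<open>k\<close>
  and \<open>l\<close> meet in an interval of length \<open>max 0 (min .. - max ..)\<close>, and for
  \<open>i = j\<close> this number is both the covariance of the increments and the time measure of
  the overlap.\<close>

lemma simple_isometry:
 assumes S: "simple_integrand F t K \<tau> \<eta>" and S': "simple_integrand F t' K' \<tau>' \<eta>'"
 shows "(LI M (%w. simple_integral (W i) K \<tau> \<eta> w \<bullet> simple_integral (W j) K' \<tau>' \<eta>' w))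
  = (if i = j then 1 else 0) * (LI Lam (%(s, w). simple_process K \<tau> \<eta> s w \<bullet> simple_process K' \<tau>' \<eta>' s w))"
proof -
 let ?d = "if i = j then 1 else 0 :: real"
 let ?a = "%k l. max (\<tau> k) (\<tau>' l)" and ?b = "%k l. min (\<tau> (Suc k)) (\<tau>' (Suc l))"
 have int: "integrable M (%w. \<eta> k w \<bullet> \<eta>' l w)" if "k < K" "l < K'" for k l
  using simple_terms[OF S that(1)] simple_terms[OF S' that(2)]
  by (intro L2_inner_integrable bdd_meas_L2) auto
 have intW: "integrable M (%w. ((W i (\<tau> (Suc k)) w - W i (\<tau> k) w) *\<^sub>R \<eta> k w)
    \<bullet> ((W j (\<tau>' (Suc l)) w - W j (\<tau>' l) w) *\<^sub>R \<eta>' l w))" if "k < K" "l < K'" for k l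
  by (rule L2_inner_integrable[OF term_L2[OF _ _ _ simple_terms(4)[OF S that(1)]]
     term_L2[OF _ _ _ simple_terms(4)[OF S' that(2)]]])
   (use simple_terms[OF S that(1)] simple_terms[OF S' that(2)] in auto)
 have "(LI M (%w. simple_integral (W i) K \<tau> \<eta> w \<bullet> simple_integral (W j) K' \<tau>' \<eta>' w))
  = (\<Sum>k<K. \<Sum>l<K'. \<integral>w. ((W i (\<tau> (Suc k)) w - W i (\<tau> k) w) *\<^sub>R \<eta> k w)
    \<bullet> ((W j (\<tau>' (Suc l)) w - W j (\<tau>' l) w) *\<^sub>R \<eta>' l w) \<partial>M)"
  unfolding simple_integral_def inner_sum_left unfolding inner_sum_right
  by (rule integral_sum2[OF intW])
 also have "... = (\<Sum>k<K. \<Sum>l<K'. ?d * (max 0 (?b k l - ?a k l) * (LI M (%w. \<eta> k w \<bullet> \<eta>' l w))))"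
  by (intro sum.cong refl, subst term_isometry)
   (use simple_terms[OF S] simple_terms[OF S'] in auto)
 also have "... = ?d * (\<Sum>k<K. \<Sum>l<K'. max 0 (?b k l - ?a k l) * (LI M (%w. \<eta> k w \<bullet> \<eta>' l w)))"
  by (simp add: sum_distrib_left)
 also have "(\<Sum>k<K. \<Sum>l<K'. max 0 (?b k l - ?a k l) * (LI M (%w. \<eta> k w \<bullet> \<eta>' l w)))
  = (\<Sum>k<K. \<Sum>l<K'. \<integral>x. indicator {?a k l<..?b k l} (fst x) * (\<eta> k (snd x) \<bullet> \<eta>' l (snd x)) \<partial>Lam)"
  by (intro sum.cong refl Lam_term(2)[symmetric] int) auto
 also have "... = (LI Lam (%x. (\<Sum>k<K. \<Sum>l<K'. indicator {?a k l<..?b k l} (fst x) * (\<eta> k (snd x) \<bullet> \<eta>' l (snd x)))))"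
  by (rule integral_sum2[symmetric]) (rule Lam_term(1)[OF int])
 also have "(%x. (\<Sum>k<K. \<Sum>l<K'. indicator {?a k l<..?b k l} (fst x) * (\<eta> k (snd x) \<bullet> \<eta>' l (snd x))))
  = (%(s, w). simple_process K \<tau> \<eta> s w \<bullet> simple_process K' \<tau>' \<eta>' s w)"
  unfolding simple_process_def inner_sum_left unfolding inner_sum_right
  by (auto simp: fun_eq_iff intro!: sum.cong split: split_indicator)
 finally show ?thesis .
qed

section \<open>From simple to general integrands\<close>

lemma ito_approx:
 fixes H :: "real => 'w => 'a::euclidean_space"
 assumes I: "has_ito_integral M F (W j) t H J" and t: "0 \<le> t"
 obtains K \<tau> \<eta> where "\<And>l::nat. simple_integrand F t (K l) (\<tau> l) (\<eta> l)"
  "L2conv Lam (%l. cut t (simple_process (K l) (\<tau> l) (\<eta> l))) (cut t H)"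
  "L2conv M (%l. simple_integral (W j) (K l) (\<tau> l) (\<eta> l)) J"
  "L2 Lam (cut t H)" "L2 M J"
proof -
 obtain K \<tau> \<eta> where S: "\<And>l::nat. simple_integrand F t (K l) (\<tau> l) (\<eta> l)"
  and c1: "(%l. \<integral>\<^sup>+w. (\<integral>\<^sup>+s\<in>{0..t}. ennreal ((norm (H s w - simple_process (K l) (\<tau> l) (\<eta> l) s w))\<^sup>2) \<partial>lborel) \<partial>M) \<longlonglongrightarrow> 0"
  and c2: "(%l. \<integral>\<^sup>+w. ennreal ((norm (J w - simple_integral (W j) (K l) (\<tau> l) (\<eta> l) w))\<^sup>2) \<partial>M) \<longlonglongrightarrow> 0"
  using I unfolding has_ito_integral_def by blast
 have H: "progressive F t H" "square_integrable_process M t H" and J: "J \<in> bm M"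
  using I unfolding has_ito_integral_def by auto
 have L: "L2 Lam (cut t H)" using cut_L2[OF H(1) t order_refl H(2)] .
 have m: "cut t (%s w. H s w - simple_process (K l) (\<tau> l) (\<eta> l) s w) \<in> bm Lam" for l
  unfolding cut_diff using cut_measurable[OF H(1) t] cut_measurable[OF simple_process_progressive[OF S] t order_refl]
  by (intro borel_measurable_diff) auto
 have c1': "L2conv Lam (%l. cut t (simple_process (K l) (\<tau> l) (\<eta> l))) (cut t H)"
  using c1 unfolding L2conv_def cut_nn_integral[OF m] cut_diff .
 have c2': "L2conv M (%l. simple_integral (W j) (K l) (\<tau> l) (\<eta> l)) J"
  using c2 unfolding L2conv_def .
 have "\<forall>\<^sub>F l in sequentially. (nsq M (%w. J w - simple_integral (W j) (K l) (\<tau> l) (\<eta> l) w)) < 1"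
  using c2 by (rule order_tendstoD) simp
 \<comment> \<open>\<open>has_ito_integral\<close> only demands that \<open>J\<close> be measurable;
   one simple integral at finite distance makes it square integrable.\<close>
 then obtain l where l: "nsq M (%w. J w - simple_integral (W j) (K l) (\<tau> l) (\<eta> l) w) < 1"
  using eventually_happens'[OF sequentially_bot] by blast
 have "L2 M (%w. J w - simple_integral (W j) (K l) (\<tau> l) (\<eta> l) w)"
  unfolding L2_iff_nn using J L2_measurable[OF simple_integral_L2[OF S]] l
  by (auto intro: less_trans)
 from L2_add[OF this simple_integral_L2[OF S, of j l]] have "L2 M J" by simp
 with S c1' c2' L that show ?thesis by blast
qed

lemma ito_intro:
 fixes H :: "real => 'w => 'a::euclidean_space"
 assumes t: "0 \<le> t" and H: "progressive F t H" and L: "L2 Lam (cut t H)" and J: "J \<in> bm M"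
  and S: "\<And>l::nat. simple_integrand F t (K l) (\<tau> l) (\<eta> l)"
  and c1: "L2conv Lam (%l. cut t (simple_process (K l) (\<tau> l) (\<eta> l))) (cut t H)"
  and c2: "L2conv M (%l. simple_integral (W j) (K l) (\<tau> l) (\<eta> l)) J"
 shows "has_ito_integral M F (W j) t H J"
proof -
 have m: "cut t (%s w. H s w - simple_process (K l) (\<tau> l) (\<eta> l) s w) \<in> bm Lam" for l
  unfolding cut_diff using cut_measurable[OF H(1) t] cut_measurable[OF simple_process_progressive[OF S] t order_refl]
  by (intro borel_measurable_diff) auto
 have "square_integrable_process M t H"
  unfolding square_integrable_process_def cut_nn_integral[OF L2_measurable[OF L]]
  using L by (simp add: L2_iff_nn)
 moreover have "(%l. \<integral>\<^sup>+w. (\<integral>\<^sup>+s\<in>{0..t}. ennreal ((norm (H s w - simple_process (K l) (\<tau> l) (\<eta> l) s w))\<^sup>2) \<partial>lborel) \<partial>M) \<longlonglongrightarrow> 0"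
  using c1 unfolding L2conv_def cut_nn_integral[OF m] cut_diff .
 ultimately show ?thesis
  unfolding has_ito_integral_def using H J S c2[unfolded L2conv_def] by blast
qed

lemma ito_L2: "has_ito_integral M F (W j) t H J ==> 0 \<le> t ==> L2 M J"
 by (erule (1) ito_approx)

lemma ito_cut_L2: "has_ito_integral M F (W j) t H J ==> 0 \<le> t ==> L2 Lam (cut t H)"
 by (erule (1) ito_approx)

lemma ito_isometry:
 assumes I: "has_ito_integral M F (W i) t H J" and I': "has_ito_integral M F (W j) t' H' J'"
  and t: "0 \<le> t" "0 \<le> t'"
 shows "(LI M (%w. J w \<bullet> J' w)) = (if i = j then 1 else 0) * (LI Lam (%x. cut t H x \<bullet> cut t' H' x))"
proof -
 obtain K \<tau> \<eta> where A: "\<And>l::nat. simple_integrand F t (K l) (\<tau> l) (\<eta> l)"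
  "L2conv Lam (%l. cut t (simple_process (K l) (\<tau> l) (\<eta> l))) (cut t H)"
  "L2conv M (%l. simple_integral (W i) (K l) (\<tau> l) (\<eta> l)) J"
  "L2 Lam (cut t H)" "L2 M J" using ito_approx[OF I t(1)] by blast
 obtain K' \<tau>' \<eta>' where A': "\<And>l::nat. simple_integrand F t' (K' l) (\<tau>' l) (\<eta>' l)"
  "L2conv Lam (%l. cut t' (simple_process (K' l) (\<tau>' l) (\<eta>' l))) (cut t' H')"
  "L2conv M (%l. simple_integral (W j) (K' l) (\<tau>' l) (\<eta>' l)) J'"
  "L2 Lam (cut t' H')" "L2 M J'" using ito_approx[OF I' t(2)] by blast
 have L: "L2 Lam (cut t (simple_process (K l) (\<tau> l) (\<eta> l)))" for l
  unfolding cut_simple[OF A(1) order_refl] by (rule simple_process_L2[OF A(1)])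
 have L': "L2 Lam (cut t' (simple_process (K' l) (\<tau>' l) (\<eta>' l)))" for l
  unfolding cut_simple[OF A'(1) order_refl] by (rule simple_process_L2[OF A'(1)])
 have 1: "(%l. \<integral>w. simple_integral (W i) (K l) (\<tau> l) (\<eta> l) w \<bullet> simple_integral (W j) (K' l) (\<tau>' l) (\<eta>' l) w \<partial>M)
  \<longlonglongrightarrow> (LI M (%w. J w \<bullet> J' w))"
  by (rule L2_inner_tendsto[OF simple_integral_L2[OF A(1)] A(5) simple_integral_L2[OF A'(1)] A'(5) A(3) A'(3)])
 have 2: "(%l. \<integral>x. cut t (simple_process (K l) (\<tau> l) (\<eta> l)) x \<bullet> cut t' (simple_process (K' l) (\<tau>' l) (\<eta>' l)) x \<partial>Lam)
  \<longlonglongrightarrow> (LI Lam (%x. cut t H x \<bullet> cut t' H' x))"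
  by (rule L2_inner_tendsto[OF L A(4) L' A'(4) A(2) A'(2)])
 have "(LI M (%w. simple_integral (W i) (K l) (\<tau> l) (\<eta> l) w \<bullet> simple_integral (W j) (K' l) (\<tau>' l) (\<eta>' l) w))
  = (if i = j then 1 else 0) * (LI Lam (%x. cut t (simple_process (K l) (\<tau> l) (\<eta> l)) x \<bullet> cut t' (simple_process (K' l) (\<tau>' l) (\<eta>' l)) x))" for l
  using simple_isometry[OF A(1)[of l] A'(1)[of l], of i j]
  by (simp add: cut_simple[OF A(1) order_refl] cut_simple[OF A'(1) order_refl] split_beta')
 with tendsto_mult_left[OF 2, of "if i = j then 1 else 0"] 1 show ?thesis
  using LIMSEQ_unique by (simp only:) blast
qed

lemma ito_diff_norm:
 assumes I: "has_ito_integral M F (W i) t H J" and I': "has_ito_integral M F (W i) t' H' J'"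
  and t: "0 \<le> t" "0 \<le> t'"
 shows "rsq M (%w. J w - J' w) = rsq Lam (%x. cut t H x - cut t' H' x)"
proof -
 have e: "rsq N (%x. f x - g x) = (LI N (%x. f x \<bullet> f x)) - 2 * (LI N (%x. f x \<bullet> g x)) + (LI N (%x. g x \<bullet> g x))"
  if f: "L2 N f" and g: "L2 N g" for N and f g :: "_ => 'a"
 proof -
  have "rsq N (%x. f x - g x) = (LI N (%x. f x \<bullet> f x - 2 * (f x \<bullet> g x) + g x \<bullet> g x))"
   by (intro LI_integral_cong) (auto simp: power2_norm_eq_inner algebra_simps inner_commute)
  then show ?thesis
   using L2_inner_integrable[OF f f] L2_inner_integrable[OF f g] L2_inner_integrable[OF g g] by simp
 qed
 show ?thesis
  unfolding e[OF ito_L2[OF I t(1)] ito_L2[OF I' t(2)]] e[OF ito_cut_L2[OF I t(1)] ito_cut_L2[OF I' t(2)]]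
  using ito_isometry[OF I I t(1,1)] ito_isometry[OF I I' t] ito_isometry[OF I' I' t(2,2)] by simp
qed

lemma simple_has_ito:
 assumes t: "0 \<le> t" and S: "simple_integrand F t K \<tau> \<eta>"
 shows "has_ito_integral M F (W j) t (simple_process K \<tau> \<eta>) (simple_integral (W j) K \<tau> \<eta>)"
 by (rule ito_intro[OF t simple_process_progressive[OF S] _ _ S L2conv_const L2conv_const])
  (use simple_process_L2[OF S] L2_measurable[OF simple_integral_L2[OF S]] cut_simple[OF S order_refl] in auto)

text \<open>Clamping the grid at \<open>s\<close> collapses late cells to the point
  \<open>s\<close>. Their coefficients must be replaced by zero, as they need not be
  \<open>F s\<close>-measurable; the process on \<open>[0,s]\<close> does not notice, the clamped
  cells being empty.\<close>

lemma simple_restrict: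
 fixes \<eta> :: "nat => 'w => 'a::euclidean_space"
 assumes s: "0 \<le> s" "s \<le> t" and S: "simple_integrand F t K \<tau> \<eta>"
 shows "simple_integrand F s K (%k. min (\<tau> k) s) (%k. if \<tau> k < s then \<eta> k else (%_. 0))"
  and "cut s (simple_process K (%k. min (\<tau> k) s) (%k. if \<tau> k < s then \<eta> k else (%_. 0)))
   = cut s (simple_process K \<tau> \<eta>)"
 using S s unfolding simple_integrand_def
 by (auto simp: bounded_const_image min_def cut_def simple_process_def fun_eq_iff intro!: sum.cong split: split_indicator)

text \<open>Martingale property in weak form: a square integrable \<open>z\<close> known at time
  \<open>s\<close> does not see the integral after \<open>s\<close>. For simple integrands this is
  \<open>incr_mean\<close> cell by cell, and the approximations of \<open>J\<close> clamped at
  \<open>s\<close> approximate \<open>J'\<close>.\<close>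

lemma ito_orthogonal:
 assumes I: "has_ito_integral M F (W j) t H J" and I': "has_ito_integral M F (W j) s H J'"
  and s: "0 \<le> s" "s \<le> t" and z: "z \<in> bm (F s)" "L2 M z"
 shows "(LI M (%w. z w \<bullet> J w)) = (LI M (%w. z w \<bullet> J' w))"
proof -
 have t: "0 \<le> t" using s by simp
 obtain K \<tau> \<eta> where A: "\<And>l::nat. simple_integrand F t (K l) (\<tau> l) (\<eta> l)"
  "L2conv Lam (%l. cut t (simple_process (K l) (\<tau> l) (\<eta> l))) (cut t H)"
  "L2conv M (%l. simple_integral (W j) (K l) (\<tau> l) (\<eta> l)) J"
  "L2 Lam (cut t H)" "L2 M J" using ito_approx[OF I t(1)] by blast
 define \<sigma> where "\<sigma> l k = min (\<tau> l k) s" for l k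
 define \<zeta> where "\<zeta> l k = (if \<tau> l k < s then \<eta> l k else (%_. 0))" for l k
 have R: "simple_integrand F s (K l) (\<sigma> l) (\<zeta> l)"
  "cut s (simple_process (K l) (\<sigma> l) (\<zeta> l)) = cut s (simple_process (K l) (\<tau> l) (\<eta> l))" for l
  using simple_restrict[OF s A(1)[of l]] unfolding \<sigma>_def[abs_def] \<zeta>_def[abs_def] by auto
 have LR: "L2 M (simple_integral (W j) (K l) (\<sigma> l) (\<zeta> l))" for l
  by (rule simple_integral_L2[OF R(1)])
 have LJ': "L2 M J'" by (rule ito_L2[OF I' s(1)])
 \<comment> \<open>By the isometry the distance to \<open>J'\<close> is the distance of the
   integrands on \<open>[0,s]\<close>, which is at most the one on \<open>[0,t]\<close>.\<close>
 have cR: "L2conv M (%l. simple_integral (W j) (K l) (\<sigma> l) (\<zeta> l)) J'"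
  unfolding L2conv_real[OF LR LJ']
 proof (rule tendsto_sandwich[OF _ _ tendsto_const])
  have cs: "L2 Lam (cut t (simple_process (K l) (\<tau> l) (\<eta> l)))" for l
   unfolding cut_simple[OF A(1) order_refl] by (rule simple_process_L2[OF A(1)])
  show "(%l. \<integral>x. (norm (cut t H x - cut t (simple_process (K l) (\<tau> l) (\<eta> l)) x))\<^sup>2 \<partial>Lam) \<longlonglongrightarrow> 0"
   using A(2) unfolding L2conv_real[OF cs A(4)] .
  show "\<forall>\<^sub>F l in sequentially. (rsq M (%x. J' x - simple_integral (W j) (K l) (\<sigma> l) (\<zeta> l) x))
   \<le> rsq Lam (%x. cut t H x - cut t (simple_process (K l) (\<tau> l) (\<eta> l)) x)"
  proof (intro always_eventually allI)
   fix l
   have "rsq M (%x. J' x - simple_integral (W j) (K l) (\<sigma> l) (\<zeta> l) x)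
    = rsq Lam (%x. cut s H x - cut s (simple_process (K l) (\<tau> l) (\<eta> l)) x)"
    using ito_diff_norm[OF I' simple_has_ito[OF s(1) R(1)] s(1) s(1)] by (simp only: R(2))
   also have "... \<le> rsq Lam (%x. cut t H x - cut t (simple_process (K l) (\<tau> l) (\<eta> l)) x)"
   proof (rule integral_mono)
    have d: "L2 Lam (%x. cut t H x - cut t (simple_process (K l) (\<tau> l) (\<eta> l)) x)"
     by (rule L2_diff[OF A(4) cs])
    then show "integrable Lam (%x. (norm (cut t H x - cut t (simple_process (K l) (\<tau> l) (\<eta> l)) x))\<^sup>2)"
     by (simp add: L2_def)
    show "integrable Lam (%x. (norm (cut s H x - cut s (simple_process (K l) (\<tau> l) (\<eta> l)) x))\<^sup>2)"
     using L2_diff[OF ito_cut_L2[OF I' s(1)] ito_cut_L2[OF simple_has_ito[OF s(1) R(1), of j l] s(1)]]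
     by (simp add: L2_def R(2))
    show "(norm (cut s H x - cut s (simple_process (K l) (\<tau> l) (\<eta> l)) x))\<^sup>2
     \<le> (norm (cut t H x - cut t (simple_process (K l) (\<tau> l) (\<eta> l)) x))\<^sup>2" for x
     unfolding cut_cut[OF s(2)] by (auto split: split_indicator)
   qed
   finally show "rsq M (%x. J' x - simple_integral (W j) (K l) (\<sigma> l) (\<zeta> l) x)
   \<le> rsq Lam (%x. cut t H x - cut t (simple_process (K l) (\<tau> l) (\<eta> l)) x)" .
  qed
 qed auto
 have eq: "(LI M (%w. z w \<bullet> simple_integral (W j) (K l) (\<tau> l) (\<eta> l) w))
  = (LI M (%w. z w \<bullet> simple_integral (W j) (K l) (\<sigma> l) (\<zeta> l) w))" for l
 proof -
  have zero: "(LI M (%w. z w \<bullet> ((W j b w - W j a w) *\<^sub>R h w))) = 0"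
   if h: "s \<le> a" "a \<le> b" "bdd_meas a h" for a b h
  proof -
   have a: "0 \<le> a" using s that by simp
   obtain C where C: "\<And>w. w \<in> space M ==> norm (h w) \<le> C" and hm: "h \<in> bm (F a)"
    using h(3) unfolding bdd_meas_def by blast
   have m: "(%w. z w \<bullet> h w) \<in> bm (F a)"
    using hm F_measurable_mono[OF s(1) that(1) z(1)] by (intro borel_measurable_inner)
   have "(LI M (%w. (z w \<bullet> h w) * (W j b w - W j a w))) = 0"
   proof (rule incr_mean[OF a that(2) m])
    show "L2 M (%w. z w \<bullet> h w)"
    proof (rule L2_bound[OF z(2) F_measurable_M[OF a m], where K=C], rule AE_I2)
     fix w assume "w \<in> space M"
     then show "norm (z w \<bullet> h w) \<le> C * norm (z w)"
      using Cauchy_Schwarz_ineq2[of "z w" "h w"] mult_left_mono[OF C norm_ge_zero, of w "z w"]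
      by (simp add: mult.commute)
    qed
   qed
   then show ?thesis by (simp add: mult.commute)
  qed
  let ?T = "%k w. (W j (\<tau> l (Suc k)) w - W j (\<tau> l k) w) *\<^sub>R \<eta> l k w"
  let ?U = "%k w. (W j (\<sigma> l (Suc k)) w - W j (\<sigma> l k) w) *\<^sub>R \<zeta> l k w"
  have LT: "L2 M (?T k)" if "k < K l" for k
   by (rule term_L2[OF _ _ _ simple_terms(4)[OF A(1) that]]) (use simple_terms[OF A(1) that] in auto)
  have LU: "L2 M (?U k)" if "k < K l" for k
   by (rule term_L2[OF _ _ _ simple_terms(4)[OF R(1) that]]) (use simple_terms[OF R(1) that] in auto)
  have tm: "(LI M (%w. z w \<bullet> ?T k w)) = (LI M (%w. z w \<bullet> ?U k w))" if k: "k < K l" for k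
  proof -
   note B = simple_terms[OF A(1) k]
   \<comment> \<open>A cell lies before \<open>s\<close>, after \<open>s\<close>, or straddles
     \<open>s\<close>; a straddling cell is cut at \<open>s\<close>, where its coefficient is
     measurable as well.\<close>
   consider "\<tau> l (Suc k) \<le> s" "\<tau> l k < s" | "s \<le> \<tau> l k" | "\<tau> l k < s" "s < \<tau> l (Suc k)" by linarith
   then show ?thesis
   proof cases
    case 1
    then show ?thesis by (simp add: \<sigma>_def \<zeta>_def)
   next
    case 2
    then show ?thesis using zero[OF 2 B(2,4)] by (simp add: \<zeta>_def)
   next
    case 3
    have b: "bdd_meas s (\<eta> l k)"
     using B(1,4) 3 F_measurable_mono[of "\<tau> l k" s] by (auto simp: bdd_meas_def)
    have L1: "L2 M (%w. (W j s w - W j (\<tau> l k) w) *\<^sub>R \<eta> l k w)"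
     and L2': "L2 M (%w. (W j (\<tau> l (Suc k)) w - W j s w) *\<^sub>R \<eta> l k w)"
     by (rule term_L2[OF _ _ s(1) b]; use 3 B s in simp)+
    have "(LI M (%w. z w \<bullet> ?T k w)) = (\<integral>w. z w \<bullet> ((W j s w - W j (\<tau> l k) w) *\<^sub>R \<eta> l k w)
      + z w \<bullet> ((W j (\<tau> l (Suc k)) w - W j s w) *\<^sub>R \<eta> l k w) \<partial>M)"
     by (intro LI_integral_cong) (auto simp: algebra_simps)
    also have "... = (LI M (%w. z w \<bullet> ((W j s w - W j (\<tau> l k) w) *\<^sub>R \<eta> l k w)))"
     using L2_inner_integrable[OF z(2) L1] L2_inner_integrable[OF z(2) L2'] zero[of s "\<tau> l (Suc k)", OF _ _ b] 3
     by (subst LI_integral_add) auto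
    finally show ?thesis using 3 by (simp add: \<sigma>_def \<zeta>_def)
   qed
  qed
  have "(LI M (%w. z w \<bullet> simple_integral (W j) (K l) (\<tau> l) (\<eta> l) w)) = (\<Sum>k<K l. \<integral>w. z w \<bullet> ?T k w \<partial>M)"
   unfolding simple_integral_def inner_sum_right using L2_inner_integrable[OF z(2) LT]
   by (subst LI_integral_sum) auto
  also have "... = (\<Sum>k<K l. \<integral>w. z w \<bullet> ?U k w \<partial>M)" using tm by simp
  also have "... = (LI M (%w. z w \<bullet> simple_integral (W j) (K l) (\<sigma> l) (\<zeta> l) w))"
   unfolding simple_integral_def inner_sum_right using L2_inner_integrable[OF z(2) LU]
   by (subst LI_integral_sum) auto
  finally show ?thesis .
 qed
 have "(%l. \<integral>w. z w \<bullet> simple_integral (W j) (K l) (\<tau> l) (\<eta> l) w \<partial>M) \<longlonglongrightarrow> (LI M (%w. z w \<bullet> J w))"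
  by (rule L2_inner_tendsto[OF z(2) z(2) simple_integral_L2[OF A(1)] A(5) L2conv_const A(3)])
 moreover have "(%l. \<integral>w. z w \<bullet> simple_integral (W j) (K l) (\<tau> l) (\<eta> l) w \<partial>M) \<longlonglongrightarrow> (LI M (%w. z w \<bullet> J' w))"
  unfolding eq by (rule L2_inner_tendsto[OF z(2) z(2) LR LJ' L2conv_const cR])
 ultimately show ?thesis using LIMSEQ_unique by blast
qed

section \<open>Linear images and modifications on null sets\<close>

lemma simple_linear:
 fixes A :: "'a::euclidean_space => 'c::euclidean_space"
 assumes A: "bounded_linear A" and S: "simple_integrand F t K \<tau> \<eta>"
 shows "simple_integrand F t K \<tau> (%k w. A (\<eta> k w))"
  and "simple_process K \<tau> (%k w. A (\<eta> k w)) = (%s w. A (simple_process K \<tau> \<eta> s w))"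
  and "simple_integral (W j) K \<tau> (%k w. A (\<eta> k w)) = (%w. A (simple_integral (W j) K \<tau> \<eta> w))"
proof -
 interpret bounded_linear A by fact
 show "simple_integrand F t K \<tau> (%k w. A (\<eta> k w))"
  unfolding simple_integrand_def
 proof (intro conjI allI impI)
  fix k assume k: "k < K"
  have "\<eta> k \<in> bm (F (\<tau> k))" and b: "bounded (\<eta> k ` space (F (\<tau> k)))"
   using S k by (auto simp: simple_integrand_def)
  then show "(%w. A (\<eta> k w)) \<in> bm (F (\<tau> k))"
   by (intro measurable_compose[OF _ borel_measurable_continuous_onI[OF linear_continuous_on[OF A]]])
  show "bounded ((%w. A (\<eta> k w)) ` space (F (\<tau> k)))"
   using bounded_linear_image[OF b A] by (simp add: image_image)
 qed (use S in \<open>simp_all add: simple_integrand_def\<close>)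
 show "simple_process K \<tau> (%k w. A (\<eta> k w)) = (%s w. A (simple_process K \<tau> \<eta> s w))"
  "simple_integral (W j) K \<tau> (%k w. A (\<eta> k w)) = (%w. A (simple_integral (W j) K \<tau> \<eta> w))"
  unfolding simple_process_def[abs_def] simple_integral_def[abs_def] by (simp_all only: sum scaleR)
qed

lemma L2conv_linear:
 fixes A :: "'a::euclidean_space => 'c::euclidean_space"
 assumes A: "bounded_linear A" and f: "\<And>l. L2 N (f l)" and g: "L2 N g" and c: "L2conv N f g"
 shows "L2conv N (%l x. A (f l x)) (%x. A (g x))"
proof -
 interpret bounded_linear A by fact
 obtain K where K: "\<And>x. norm (A x) \<le> norm x * K" using bounded by blast
 show ?thesis
  unfolding L2conv_real[OF L2_linear[OF A f] L2_linear[OF A g]]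
 proof (rule tendsto_sandwich[OF _ _ tendsto_const])
  show "(%l. K\<^sup>2 * rsq N (%x. g x - f l x)) \<longlonglongrightarrow> 0"
   using tendsto_mult_right_zero c unfolding L2conv_real[OF f g] by blast
  show "\<forall>\<^sub>F l in sequentially. (rsq N (%x. A (g x) - A (f l x))) \<le> K\<^sup>2 * rsq N (%x. g x - f l x)"
  proof (intro always_eventually allI)
   fix l
   have "rsq N (%x. A (g x) - A (f l x)) \<le> (LI N (%x. K\<^sup>2 * (norm (g x - f l x))\<^sup>2))"
   proof (rule integral_mono)
    show "integrable N (%x. (norm (A (g x) - A (f l x)))\<^sup>2)"
     using L2_diff[OF L2_linear[OF A g] L2_linear[OF A f]] by (simp add: L2_def)
    show "integrable N (%x. K\<^sup>2 * (norm (g x - f l x))\<^sup>2)"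
     using L2_diff[OF g f] by (simp add: L2_def)
    show "(norm (A (g x) - A (f l x)))\<^sup>2 \<le> K\<^sup>2 * (norm (g x - f l x))\<^sup>2" for x
     using power_mono[OF K[of "g x - f l x"] norm_ge_zero, of 2] by (simp add: diff power_mult_distrib mult.commute)
   qed
   then show "rsq N (%x. A (g x) - A (f l x)) \<le> K\<^sup>2 * rsq N (%x. g x - f l x)" by simp
  qed
 qed auto
qed

lemma ito_linear:
 fixes A :: "'a::euclidean_space => 'c::euclidean_space"
 assumes A: "bounded_linear A" and I: "has_ito_integral M F (W j) t H J" and t: "0 \<le> t"
 shows "has_ito_integral M F (W j) t (%s w. A (H s w)) (%w. A (J w))"
proof -
 obtain K \<tau> \<eta> where B: "\<And>l::nat. simple_integrand F t (K l) (\<tau> l) (\<eta> l)"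
  "L2conv Lam (%l. cut t (simple_process (K l) (\<tau> l) (\<eta> l))) (cut t H)"
  "L2conv M (%l. simple_integral (W j) (K l) (\<tau> l) (\<eta> l)) J"
  "L2 Lam (cut t H)" "L2 M J" using ito_approx[OF I t(1)] by blast
 have Am: "A \<in> bm borel"
  by (rule borel_measurable_continuous_onI[OF linear_continuous_on[OF A]])
 have H: "progressive F t H" using I by (simp add: has_ito_integral_def)
 show ?thesis
 proof (rule ito_intro[OF t _ _ _ simple_linear(1)[OF A B(1)]])
  show "progressive F t (%s w. A (H s w))"
   using H unfolding progressive_def
   by (auto simp: split_beta' intro!: measurable_compose[OF _ Am])
  have cs: "L2 Lam (cut t (simple_process (K l) (\<tau> l) (\<eta> l)))" for l
   unfolding cut_simple[OF B(1) order_refl] by (rule simple_process_L2[OF B(1)])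
  show "L2 Lam (cut t (%s w. A (H s w)))" unfolding cut_linear[OF A] by (rule L2_linear[OF A B(4)])
  show "(%w. A (J w)) \<in> bm M" using L2_measurable[OF L2_linear[OF A B(5)]] .
  show "L2conv Lam (%l. cut t (simple_process (K l) (\<tau> l) (%k w. A (\<eta> l k w)))) (cut t (%s w. A (H s w)))"
   unfolding simple_linear(2)[OF A B(1)] cut_linear[OF A]
   by (rule L2conv_linear[OF A cs B(4) B(2)])
  show "L2conv M (%l. simple_integral (W j) (K l) (\<tau> l) (%k w. A (\<eta> l k w))) (%w. A (J w))"
   unfolding simple_linear(3)[OF A B(1)]
   by (rule L2conv_linear[OF A simple_integral_L2[OF B(1)] B(5) B(3)])
 qed
qed

text \<open>Both convergences are in mean square, so only almost everywhere classes of integrand and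
  integral matter; progressive measurability of the new integrand has to be supplied.\<close>

lemma ito_AE_eq:
 assumes I: "has_ito_integral M F (W j) t H J" and t: "0 \<le> t"
  and G: "progressive F t G" and HG: "AE x in Lam. cut t H x = cut t G x"
  and J': "J' \<in> bm M" "AE w in M. J w = J' w"
 shows "has_ito_integral M F (W j) t G J'"
proof -
 obtain K \<tau> \<eta> where B: "\<And>l::nat. simple_integrand F t (K l) (\<tau> l) (\<eta> l)"
  "L2conv Lam (%l. cut t (simple_process (K l) (\<tau> l) (\<eta> l))) (cut t H)"
  "L2conv M (%l. simple_integral (W j) (K l) (\<tau> l) (\<eta> l)) J"
  "L2 Lam (cut t H)" "L2 M J" using ito_approx[OF I t(1)] by blast
 show ?thesis
 proof (rule ito_intro[OF t G _ J'(1) B(1)])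
  show "L2 Lam (cut t G)" by (rule L2_cong_AE[OF B(4) cut_measurable[OF G t order_refl] HG])
  have "nsq Lam (%x. cut t H x - cut t (simple_process (K l) (\<tau> l) (\<eta> l)) x)
   = nsq Lam (%x. cut t G x - cut t (simple_process (K l) (\<tau> l) (\<eta> l)) x)" for l
   by (intro nn_integral_cong_AE) (use HG in auto)
  then show "L2conv Lam (%l. cut t (simple_process (K l) (\<tau> l) (\<eta> l))) (cut t G)"
   using B(2) by (simp add: L2conv_def)
  have "nsq M (%x. J x - simple_integral (W j) (K l) (\<tau> l) (\<eta> l) x)
   = nsq M (%x. J' x - simple_integral (W j) (K l) (\<tau> l) (\<eta> l) x)" for l
   by (intro nn_integral_cong_AE) (use J'(2) in auto)
  then show "L2conv M (%l. simple_integral (W j) (K l) (\<tau> l) (\<eta> l)) J'"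
   using B(3) by (simp add: L2conv_def)
 qed
qed

lemma ito_zero: "0 \<le> t ==> has_ito_integral M F (W j) t (%_ _. 0) (%_. 0)"
 using simple_has_ito[of t 1 "%k. if k = 0 then 0 else t" "%_ _. 0" j]
 by (simp add: bounded_const_image simple_integrand_def simple_process_def[abs_def] simple_integral_def[abs_def])

end

section \<open>Density of simple integrands\<close>

text \<open>The average over the previous interval of the grid keeps the approximation adapted.\<close>

definition step_avg :: "nat => real => (real => 'a::euclidean_space) => nat => 'a" where
 "step_avg n T f k = (if k = 0 then 0 else
  (real n / T) *\<^sub>R (LI lborel (%r. indicator {real (k - 1) * T / real n<..real k * T / real n} r *\<^sub>R f r)))"

definition step_fun :: "nat => real => (real => 'a::euclidean_space) => real => 'a" where
 "step_fun n T f s = (\<Sum>k<n. indicator {real k * T / real n<..real (Suc k) * T / real n} s *\<^sub>R step_avg n T f k)"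

lemma integrable_bdd:
 fixes f :: "real => 'a::euclidean_space"
 assumes T: "0 < T" and f: "f \<in> bm borel" and b: "\<And>s. norm (f s) \<le> B * indicator {0..T} s"
 shows "integrable lborel f"
proof (rule LI_integrable_bound)
 show "integrable lborel (%s. B * indicator {0..T} s :: real)" using T by simp
 show "AE s in lborel. norm (f s) \<le> norm (B * indicator {0..T} s)"
  using b abs_ge_self order_trans by (intro AE_I2) fastforce
qed (use f in simp)

context
 fixes T :: real and n :: nat
 assumes T: "0 < T" and n: "0 < n"
begin

abbreviation (input) "gr k \<equiv> real k * T / real n"

lemma gr_mono: "k \<le> l ==> gr k \<le> gr l"
 using T by (intro divide_right_mono mult_right_mono) auto

lemma gr_diff: "gr (Suc k) - gr k = T / n"
 using n by (simp add: field_simps)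

lemma grid_partition:
 "(\<Sum>k<m. indicator {gr k<..gr (Suc k)} s) = (indicator {0<..gr m} s :: real)"
proof (induction m)
 case (Suc m)
 have "gr 0 \<le> gr m" "gr m \<le> gr (Suc m)" by (intro gr_mono; simp)+
 then show ?case using Suc by (auto split: split_indicator)
qed simp

text \<open>Existence of the cell comes from a count: the indicators of all cells sum to one on
  \<open>(0,T]\<close>, so they cannot all vanish.\<close>

lemma grid_cell:
 assumes "0 < s" "s \<le> T"
 obtains k where "k < n" "gr k < s" "s \<le> gr (Suc k)"
proof -
 have one: "(\<Sum>k<n. indicator {gr k<..gr (Suc k)} s) = (1::real)"
  unfolding grid_partition using assms n by simp
 have zero: "(\<Sum>k<n. indicator {gr k<..gr (Suc k)} s) = (0::real)"
  if "\<not> (\<exists>k<n. s \<in> {gr k<..gr (Suc k)})"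
 proof (rule sum.neutral, rule ballI, rule indicator_simps(2))
  fix k assume "k \<in> {..<n}"
  then show "s \<notin> {gr k<..gr (Suc k)}" using that unfolding lessThan_iff by blast
 qed
 have "\<exists>k<n. s \<in> {gr k<..gr (Suc k)}"
  by (rule ccontr) (use zero one zero_neq_one[where 'a=real] in \<open>simp only: not_False_eq_True\<close>)
 then show ?thesis using that unfolding greaterThanAtMost_iff by blast
qed

lemma cell_unique:
 assumes "gr k < s" "s \<le> gr (Suc k)" "gr l < s" "s \<le> gr (Suc l)"
 shows "k = l"
 using gr_mono[of "Suc k" l] gr_mono[of "Suc l" k] assms by (cases k l rule: linorder_cases) auto

lemma step_fun_cell:
 assumes "k < n" "gr k < s" "s \<le> gr (Suc k)"
 shows "step_fun n T f s = step_avg n T f k"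
proof -
 have "step_fun n T f s = (\<Sum>l<n. if l = k then step_avg n T f k else 0)"
  unfolding step_fun_def
 proof (intro sum.cong refl)
  fix l
  show "indicator {gr l<..gr (Suc l)} s *\<^sub>R step_avg n T f l = (if l = k then step_avg n T f k else 0)"
  proof (cases "l = k")
   case True
   then have "s \<in> {gr l<..gr (Suc l)}" using assms by simp
   then show ?thesis using True by (simp only: indicator_simps scaleR_one if_True refl)
  next
   case False
   then have nl: "s \<notin> {gr l<..gr (Suc l)}" using cell_unique[OF assms(2,3), of l] by auto
   show ?thesis by (simp only: indicator_simps(2)[OF nl] scaleR_zero_left False if_False)
  qed
 qed
 then show ?thesis using assms(1) by simp
qed

lemma step_fun_out: "s \<notin> {0<..T} ==> step_fun n T f s = 0"
 unfolding step_fun_def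
proof (intro sum.neutral ballI)
 fix k assume "s \<notin> {0<..T}" "k \<in> {..<n}"
 then have "gr 0 \<le> gr k" "gr (Suc k) \<le> gr n" by (intro gr_mono; simp)+
 then show "indicator {gr k<..gr (Suc k)} s *\<^sub>R step_avg n T f k = 0"
  using \<open>s \<notin> {0<..T}\<close> n by (auto split: split_indicator)
qed

lemma integrable_cell:
 fixes f :: "real => 'a::euclidean_space"
 assumes f: "integrable lborel f"
 shows "integrable lborel (%r. indicator {a<..b} r *\<^sub>R f r)"
 using integrable_mult_indicator[OF _ f, of "{a<..b}"] by simp

text \<open>An average over the preceding cell stays within any ball that contains the values there.
  Centre \<open>0\<close> gives boundedness, centre \<open>g s\<close> gives convergence at points
  of continuity.\<close>

lemma norm_step_avg_le:
 fixes f :: "real => 'a::euclidean_space"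
 assumes f: "integrable lborel f" and k: "0 < k"
  and le: "\<And>r. gr (k - 1) < r ==> r \<le> gr k ==> norm (f r - c) \<le> B"
 shows "norm (step_avg n T f k - c) \<le> B"
proof -
 let ?i = "%r. indicator {gr (k - 1)<..gr k} r :: real"
 have d: "gr k - gr (k - 1) = T / n" using gr_diff[of "k - 1"] k by simp
 then have dp: "gr (k - 1) \<le> gr k" using T n by (simp add: gr_mono)
 have ic: "integrable lborel (%r. ?i r *\<^sub>R c)" for c :: 'a
  using dp by (intro integrable_scaleR_left) (auto simp: integrable_indicator_iff)
 have "(LI lborel (%r. ?i r *\<^sub>R c)) = (T / n) *\<^sub>R c"
  using dp d by simp
 then have "step_avg n T f k - c = (real n / T) *\<^sub>R ((LI lborel (%r. ?i r *\<^sub>R f r)) - (LI lborel (%r. ?i r *\<^sub>R c)))"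
  using k T n by (simp add: step_avg_def scaleR_diff_right)
 also have "(LI lborel (%r. ?i r *\<^sub>R f r)) - (LI lborel (%r. ?i r *\<^sub>R c)) = (LI lborel (%r. ?i r *\<^sub>R (f r - c)))"
  using integrable_cell[OF f] ic by (simp add: scaleR_diff_right)
 finally have "norm (step_avg n T f k - c) = (real n / T) * norm (LI lborel (%r. ?i r *\<^sub>R (f r - c)))"
  using T n by simp
 also have "... \<le> (real n / T) * (LI lborel (%r. ?i r * B))"
 proof (intro mult_left_mono order_trans[OF integral_norm_bound] integral_mono)
  show "integrable lborel (%r. norm (?i r *\<^sub>R (f r - c)))"
   using integrable_cell[OF f, of "gr (k - 1)" "gr k"] ic[of c]
   by (intro integrable_norm) (simp add: scaleR_diff_right)
  show "integrable lborel (%r. ?i r * B)"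
   using dp by (intro integrable_mult_left) (auto simp: integrable_indicator_iff)
  show "norm (?i r *\<^sub>R (f r - c)) \<le> ?i r * B" for r
   using le[of r] by (auto split: split_indicator)
 qed (use T in auto)
 also have "... = B" using dp d T n by simp
 finally show ?thesis .
qed

lemma norm_step_fun_le:
 fixes f :: "real => 'a::euclidean_space"
 assumes f: "integrable lborel f" and B: "\<And>r. norm (f r) \<le> B"
 shows "norm (step_fun n T f s) \<le> B * indicator {0..T} s"
proof (cases "s \<in> {0<..T}")
 case True
 then obtain k where k: "k < n" "gr k < s" "s \<le> gr (Suc k)" using grid_cell[of s] by auto
 have "0 \<le> B" using B[of 0] norm_ge_zero order_trans by blast
 then have "norm (step_avg n T f k) \<le> B"
  using norm_step_avg_le[OF f, of k 0 B] B by (cases "k = 0") (auto simp: step_avg_def)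
 then show ?thesis using True step_fun_cell[OF k, of f] by simp
next
 case False
 have "0 \<le> B" using B[of 0] norm_ge_zero order_trans by blast
 then show ?thesis using step_fun_out[OF False, of f] by simp
qed

lemma step_avg_diff:
 fixes f g :: "real => 'a::euclidean_space"
 assumes f: "integrable lborel f" and g: "integrable lborel g"
 shows "step_avg n T (%s. f s - g s) k = step_avg n T f k - step_avg n T g k"
 using integrable_cell[OF f] integrable_cell[OF g]
 by (simp add: step_avg_def scaleR_diff_right)

lemma step_fun_diff:
 fixes f g :: "real => 'a::euclidean_space"
 assumes f: "integrable lborel f" and g: "integrable lborel g"
 shows "step_fun n T (%s. f s - g s) s = step_fun n T f s - step_fun n T g s"
 by (simp add: step_fun_def step_avg_diff[OF f g] scaleR_diff_right sum_subtractf)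

lemma step_fun_measurable: "step_fun n T f \<in> bm borel"
 unfolding step_fun_def[abs_def] by measurable

text \<open>Averaging with a shift by one cell is a contraction of \<open>L1\<close>: every average
  is bounded by the average of the norm over the preceding cell, and the mass on the last cell only
  helps.\<close>

lemma step_fun_L1:
 fixes f :: "real => 'a::euclidean_space"
 assumes f: "integrable lborel f"
 shows "integrable lborel (%s. norm (step_fun n T f s))"
  and "(LI lborel (%s. norm (step_fun n T f s))) \<le> (LI lborel (%s. norm (f s)))"
proof -
 let ?i = "%k s. indicator {gr k<..gr (Suc k)} s :: real"
 have le: "gr k \<le> gr (Suc k)" for k by (rule gr_mono) simp
 have ic: "integrable lborel (%s. ?i k s * c)" for k c
  using le by (intro integrable_mult_left) (auto simp: integrable_indicator_iff)
 have b: "norm (step_fun n T f s) \<le> (\<Sum>k<n. ?i k s * norm (step_avg n T f k))" for s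
  unfolding step_fun_def by (rule order_trans[OF norm_sum]) simp
 have i1: "integrable lborel (%s. \<Sum>k<n. ?i k s * norm (step_avg n T f k))"
  by (intro LI_integrable_sum ic)
 show i: "integrable lborel (%s. norm (step_fun n T f s))"
  by (rule LI_integrable_bound[OF i1])
   (use step_fun_measurable[of f] b in \<open>auto intro!: AE_I2 abs_ge_self order_trans[OF b]\<close>)
 have avg: "(T / n) * norm (step_avg n T f (Suc k)) \<le> (LI lborel (%r. ?i k r * norm (f r)))" for k
 proof -
  have "(T / n) * norm (step_avg n T f (Suc k)) = norm (LI lborel (%r. ?i k r *\<^sub>R f r))"
   using T n by (simp add: step_avg_def)
  also have "... \<le> (LI lborel (%r. ?i k r * norm (f r)))"
   using integral_norm_bound[of lborel "%r. ?i k r *\<^sub>R f r"] by simp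
  finally show ?thesis .
 qed
 have i2: "integrable lborel (%r. ?i k r * norm (f r))" for k
  using integrable_norm[OF integrable_cell[OF f, of "gr k" "gr (Suc k)"]] by simp
 obtain m where m: "n = Suc m" using n by (cases n) auto
 have "(LI lborel (%s. norm (step_fun n T f s))) \<le> (LI lborel (%s. (\<Sum>k<n. ?i k s * norm (step_avg n T f k))))"
  by (rule integral_mono[OF i i1 b])
 also have "... = (\<Sum>k<n. (T / n) * norm (step_avg n T f k))"
  using ic le gr_diff by (subst LI_integral_sum) auto
 \<comment> \<open>The first cell contributes nothing because its value is zero by definition; this
   makes the shift of the index possible.\<close>
 also have "... = (\<Sum>k<m. (T / n) * norm (step_avg n T f (Suc k)))"
  unfolding m sum.lessThan_Suc_shift by (simp add: step_avg_def)
 also have "... \<le> (\<Sum>k<m. (LI lborel (%r. ?i k r * norm (f r))))"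
  by (intro sum_mono avg)
 also have "... = (LI lborel (%r. (\<Sum>k<m. ?i k r) * norm (f r)))"
  unfolding sum_distrib_right by (rule LI_integral_sum[symmetric]) (rule i2)
 also have "... \<le> (LI lborel (%r. norm (f r)))"
 proof (rule integral_mono)
  show "integrable lborel (%r. (\<Sum>k<m. ?i k r) * norm (f r))"
   unfolding sum_distrib_right by (intro LI_integrable_sum i2)
  show "(\<Sum>k<m. ?i k r) * norm (f r) \<le> norm (f r)" for r
   unfolding grid_partition by (auto split: split_indicator)
 qed (use f in auto)
 finally show "(LI lborel (%s. norm (step_fun n T f s))) \<le> (LI lborel (%s. norm (f s)))" .
qed

end

lemma step_fun_continuous:
 fixes g :: "real => 'a::euclidean_space"
 assumes T: "0 < T" and g: "continuous_on UNIV g" and i: "integrable lborel (%s. indicator {0..T} s *\<^sub>R g s)"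
  and s: "0 < s" "s < T"
 shows "(%n. step_fun (Suc n) T (%s. indicator {0..T} s *\<^sub>R g s) s) \<longlonglongrightarrow> g s"
proof (rule LIMSEQ_I)
 fix e :: real assume e: "0 < e"
 have "isCont g s" using g by (simp add: continuous_on_eq_continuous_at)
 then obtain d where d: "0 < d" "\<And>r. dist r s < d ==> dist (g r) (g s) < e/2"
  using e unfolding continuous_at_eps_delta by (metis half_gt_zero)
 \<comment> \<open>The averaging cell and the cell of \<open>s\<close> together span
   \<open>2T/n\<close>. Below \<open>d\<close> this keeps the averaging cell inside the continuity
   neighbourhood; below \<open>s\<close> it excludes the first cell, where the value is
   zero.\<close>
 obtain N :: nat where N: "2 * T / d + 2 * T / s < real N" using reals_Archimedean2 by blast
 show "\<exists>no. \<forall>n\<ge>no. norm (step_fun (Suc n) T (%s. indicator {0..T} s *\<^sub>R g s) s - g s) < e"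
 proof (intro exI[of _ N] allI impI)
  fix n assume "N \<le> n"
  let ?n = "Suc n"
  have "0 < 2 * T / d" "0 < 2 * T / s" using d s T by auto
  then have "2 * T / d < real ?n" "2 * T / s < real ?n" using N \<open>N \<le> n\<close> by linarith+
  then have small: "2 * (T / real ?n) < d" "2 * (T / real ?n) < s"
   using d s T by (simp_all add: field_simps)
  obtain k where k: "k < ?n" "real k * T / ?n < s" "s \<le> real (Suc k) * T / ?n"
   using grid_cell[OF T, of ?n s] s by auto
  have k0: "0 < k"
  proof (rule ccontr)
   assume "\<not> 0 < k"
   then have "s \<le> T / ?n" using k(3) by simp
   then show False using small(2) s T by (simp add: field_simps)
  qed
  have "norm (step_avg ?n T (%s. indicator {0..T} s *\<^sub>R g s) k - g s) \<le> e/2"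
  proof (rule norm_step_avg_le[OF T _ i k0])
   fix r assume r: "real (k - 1) * T / ?n < r" "r \<le> real k * T / ?n"
   have eq: "real (Suc k) * T / ?n - real (k - 1) * T / ?n = 2 * (T / ?n)"
   proof -
    have "real (Suc k) - real (k - 1) = 2" using k0 by (simp add: of_nat_diff)
    moreover have "real (Suc k) * T / ?n - real (k - 1) * T / ?n = (real (Suc k) - real (k - 1)) * T / ?n"
     by (simp only: diff_divide_distrib left_diff_distrib)
    ultimately show ?thesis by simp
   qed
   define a b c where "a = real (k - 1) * T / ?n" and "b = real k * T / ?n" and "c = real (Suc k) * T / ?n"
   have "\<bar>r - s\<bar> < d" using r k(2,3) small(1) eq
    unfolding a_def[symmetric] b_def[symmetric] c_def[symmetric] by linarith
   moreover have "0 \<le> a" using T by (simp add: a_def)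
   then have "r \<in> {0..T}" using r k(2) s unfolding a_def[symmetric] b_def[symmetric] by simp
   ultimately show "norm (indicator {0..T} r *\<^sub>R g r - g s) \<le> e/2"
    using d(2)[of r] by (simp add: dist_norm less_imp_le)
  qed simp
  then show "norm (step_fun ?n T (%s. indicator {0..T} s *\<^sub>R g s) s - g s) < e"
   unfolding step_fun_cell[OF T zero_less_Suc k] using e by linarith
 qed
qed

text \<open>For continuous functions the averages converge pointwise. A bounded measurable
  \<open>f\<close> is approximated in \<open>L1\<close> by truncated continuous functions
  \<open>h m\<close>, and the contraction property of \<open>step_fun\<close> controls the averages
  of \<open>f - h m\<close>: three terms, each below \<open>e/3\<close>.\<close>

lemma step_fun_tendsto_L1:
 fixes f :: "real => 'a::euclidean_space"
 assumes T: "0 < T" and f: "f \<in> bm borel" and B: "\<And>s. norm (f s) \<le> B * indicator {0..T} s"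
 shows "(%n. \<integral>s. norm (f s - step_fun (Suc n) T f s) \<partial>lborel) \<longlonglongrightarrow> 0"
proof (rule LIMSEQ_I)
 fix e :: real assume e: "0 < e"
 have B0: "0 \<le> B" using B[of 0] norm_ge_zero[of "f 0"] T by (auto simp del: norm_ge_zero)
 have fi: "integrable lborel f" by (rule integrable_bdd[OF T f B])
 have "f \<in> bm lebesgue" using f by (simp add: measurable_completion)
 then have "f measurable_on UNIV" by (rule lebesgue_measurable_imp_measurable_on) simp
 then obtain N g where N: "negligible N" and gc: "\<And>n. continuous_on UNIV (g n :: real => 'a)"
  and lim: "\<And>x. x \<notin> N ==> (%n. g n x) \<longlonglongrightarrow> (if x \<in> UNIV then f x else 0)"
  unfolding measurable_on_def by blast
 \<comment> \<open>Retraction onto the ball of radius \<open>B\<close>: it fixes the values of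
   \<open>f\<close> and supplies the common bound for dominated convergence that the approximations
   \<open>g n\<close> lack.\<close>
 let ?c = "closest_point (cball 0 B) :: 'a => 'a"
 have cc: "continuous_on S ?c" for S
  by (rule continuous_on_closest_point) (use B0 in auto)
 have cB: "norm (?c x) \<le> B" for x
  using closest_point_in_set[of "cball 0 B :: 'a set" x] B0 by auto
 define h where "h n s = indicator {0..T} s *\<^sub>R ?c (g n s)" for n s
 have hc: "continuous_on UNIV (%s. ?c (g n s))" for n
  by (rule continuous_on_compose2[OF cc gc]) auto
 have hm: "h n \<in> bm borel" for n
  unfolding h_def[abs_def] using borel_measurable_continuous_onI[OF hc] by measurable
 have hB: "norm (h n s) \<le> B * indicator {0..T} s" for n s
  using cB by (auto simp: h_def split: split_indicator)
 have hi: "integrable lborel (h n)" for n by (rule integrable_bdd[OF T hm hB])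
 have Nae: "AE s in lborel. s \<notin> N"
  using AE_not_in[of N lebesgue] N by (simp add: negligible_iff_null_sets AE_completion_iff)
 have "(%n. \<integral>s. norm (f s - h n s) \<partial>lborel) \<longlonglongrightarrow> (\<integral>s. 0 \<partial>(lborel::real measure))"
 proof (rule integral_dominated_convergence[where w="%s. 2 * B * indicator {0..T} s"])
  show "AE s in lborel. (%n. norm (f s - h n s)) \<longlonglongrightarrow> 0"
   using Nae
  proof eventually_elim
   case (elim s)
   show ?case
   proof (cases "s \<in> {0..T}")
    case True
    have "(%n. ?c (g n s)) \<longlonglongrightarrow> ?c (f s)"
     using continuous_on_tendsto_compose[OF cc[of UNIV] lim[OF elim]] by simp
    moreover have "?c (f s) = f s" using B[of s] True by (intro closest_point_self) simp
    ultimately have "(%n. h n s) \<longlonglongrightarrow> f s" using True by (simp add: h_def)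
    then show ?thesis using tendsto_norm_zero[OF LIM_zero] tendsto_diff[OF tendsto_const, of "%n. h n s" "f s" _ "f s"]
     by (auto intro!: tendsto_norm_zero)
   next
    case False
    then show ?thesis using B[of s] by (simp add: h_def)
   qed
  qed
  show "AE s in lborel. norm (norm (f s - h n s)) \<le> 2 * B * indicator {0..T} s" for n
  proof (rule AE_I2)
   fix s
   show "norm (norm (f s - h n s)) \<le> 2 * B * indicator {0..T} s"
    using norm_triangle_ineq4[of "f s" "h n s"] B[of s] hB[of n s] by simp
  qed
 qed (use T hm f in auto)
 then have "(%n. \<integral>s. norm (f s - h n s) \<partial>lborel) \<longlonglongrightarrow> 0" by simp
 then obtain m where m: "(LI lborel (%s. norm (f s - h m s))) < e/3"
 proof -
  have "\<forall>\<^sub>F m in sequentially. (LI lborel (%s. norm (f s - h m s))) < e/3"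
   by (rule order_tendstoD(2)[OF \<open>(%n. \<integral>s. norm (f s - h n s) \<partial>lborel) \<longlonglongrightarrow> 0\<close>]) (use e in simp)
  then show ?thesis using eventually_happens'[OF sequentially_bot] that by blast
 qed
 have si: "integrable lborel (step_fun (Suc n) T u)" if "integrable lborel u" for n and u :: "real => 'a"
  using step_fun_L1(1)[OF T _ that, of "Suc n"] step_fun_measurable[of T "Suc n" u] T
  by (simp add: integrable_norm_iff)
 have "(%n. \<integral>s. norm (h m s - step_fun (Suc n) T (h m) s) \<partial>lborel) \<longlonglongrightarrow> (\<integral>s. 0 \<partial>(lborel::real measure))"
 proof (rule integral_dominated_convergence[where w="%s. 2 * B * indicator {0..T} s"])
  have nz: "AE s in lborel. s \<noteq> (0::real) \<and> s \<noteq> T"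
   using AE_lborel_singleton[of "0::real"] AE_lborel_singleton[of T] by eventually_elim simp
  show "AE s in lborel. (%n. norm (h m s - step_fun (Suc n) T (h m) s)) \<longlonglongrightarrow> 0"
   using nz
  proof eventually_elim
   case (elim s)
   show ?case
   proof (cases "s \<in> {0..T}")
    case True
    have "(%n. step_fun (Suc n) T (h m) s) \<longlonglongrightarrow> ?c (g m s)"
     unfolding h_def[abs_def]
     by (rule step_fun_continuous[OF T hc]) (use hi[of m] True elim in \<open>auto simp: h_def[abs_def]\<close>)
    then have "(%n. step_fun (Suc n) T (h m) s) \<longlonglongrightarrow> h m s" using True by (simp add: h_def)
    from tendsto_diff[OF tendsto_const[of "h m s"] this] show ?thesis
     by (intro tendsto_norm_zero) simp
   next
    case False
    then have "step_fun (Suc n) T (h m) s = 0" for n by (intro step_fun_out[OF T]) auto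
    then show ?thesis using False by (simp add: h_def)
   qed
  qed
  show "AE s in lborel. norm (norm (h m s - step_fun (Suc n) T (h m) s)) \<le> 2 * B * indicator {0..T} s" for n
  proof (rule AE_I2)
   fix s
   have "norm (step_fun (Suc n) T (h m) s) \<le> B * indicator {0..T} s"
    by (rule norm_step_fun_le[OF T _ hi]) (use cB B0 in \<open>auto simp: h_def split: split_indicator\<close>)
   then show "norm (norm (h m s - step_fun (Suc n) T (h m) s)) \<le> 2 * B * indicator {0..T} s"
    using norm_triangle_ineq4[of "h m s" "step_fun (Suc n) T (h m) s"] hB[of m s] by simp
  qed
 qed (use T hm step_fun_measurable[OF T, of "Suc _" "h m"] in \<open>auto intro!: borel_measurable_norm borel_measurable_diff\<close>)
 then have "(%n. \<integral>s. norm (h m s - step_fun (Suc n) T (h m) s) \<partial>lborel) \<longlonglongrightarrow> 0" by simp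
 then obtain n0 where n0: "\<And>n. n \<ge> n0 ==> (LI lborel (%s. norm (h m s - step_fun (Suc n) T (h m) s))) < e/3"
 proof -
  have "\<forall>\<^sub>F n in sequentially. (LI lborel (%s. norm (h m s - step_fun (Suc n) T (h m) s))) < e/3"
   by (rule order_tendstoD(2)[OF \<open>(%n. \<integral>s. norm (h m s - step_fun (Suc n) T (h m) s) \<partial>lborel) \<longlonglongrightarrow> 0\<close>]) (use e in simp)
  then show ?thesis using that unfolding eventually_sequentially by blast
 qed
 show "\<exists>no. \<forall>n\<ge>no. norm ((LI lborel (%s. norm (f s - step_fun (Suc n) T f s))) - 0) < e"
 proof (intro exI[of _ n0] allI impI)
  fix n assume n: "n \<ge> n0"
  let ?S = "step_fun (Suc n) T"
  have d: "integrable lborel (%s. f s - h m s)" using fi hi by simp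
  have "(LI lborel (%s. norm (f s - ?S f s)))
   \<le> (LI lborel (%s. norm (f s - h m s) + norm (h m s - ?S (h m) s) + norm (?S (%s. f s - h m s) s)))"
  proof (rule integral_mono)
   show "integrable lborel (%s. norm (f s - ?S f s))" using fi si[OF fi] by simp
   show "integrable lborel (%s. norm (f s - h m s) + norm (h m s - ?S (h m) s) + norm (?S (%s. f s - h m s) s))"
    using fi hi[of m] si[OF hi[of m]] si[OF d] by simp
   show "norm (f s - ?S f s) \<le> norm (f s - h m s) + norm (h m s - ?S (h m) s) + norm (?S (%s. f s - h m s) s)" for s
   proof -
    have eq: "f s - ?S f s = (f s - h m s) + (h m s - ?S (h m) s) - ?S (%s. f s - h m s) s"
     by (simp add: step_fun_diff[OF T _ fi hi])
    show ?thesis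
     unfolding eq using norm_triangle_ineq[of "f s - h m s" "h m s - ?S (h m) s"]
      norm_triangle_ineq4[of "(f s - h m s) + (h m s - ?S (h m) s)" "?S (%s. f s - h m s) s"]
     by linarith
   qed
  qed
  also have "... = (LI lborel (%s. norm (f s - h m s))) + (LI lborel (%s. norm (h m s - ?S (h m) s)))
    + (LI lborel (%s. norm (?S (%s. f s - h m s) s)))"
   using fi hi[of m] si[OF hi[of m]] si[OF d] by simp
  also have "... < e"
   using step_fun_L1(2)[OF T _ d, of "Suc n"] m n0[OF n] by simp
  finally show "norm ((LI lborel (%s. norm (f s - ?S f s))) - 0) < e"
   by (simp add: integral_nonneg_AE)
 qed
qed

context brownian_filtration
begin

text \<open>Pathwise convergence in \<open>L1\<close> becomes convergence in mean square because the
  error is at most \<open>2B\<close>, whence \<open>|d|^2 \<le> 2B |d|\<close>; dominated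
  convergence then integrates over the paths.\<close>

lemma bdd_pair_approx:
 fixes H :: "real => 'w => 'a::euclidean_space"
 assumes T: "0 < T" and H: "progressive F T H" and B: "\<And>s w. norm (H s w) \<le> B" and e: "0 < e"
 shows "\<exists>K \<tau> \<eta>. simple_integrand F T K \<tau> \<eta> \<and>
  (nsq Lam (%x. cut T H x - cut T (simple_process K \<tau> \<eta>) x)) < ennreal e"
proof -
 have B0: "0 \<le> B" using B[of 0] norm_ge_zero order_trans by blast
 define f where "f w s = cut T H (s, w)" for w s
 have cm: "cut T H \<in> bm Lam" using cut_measurable[OF H] T by simp
 have fm: "f w \<in> bm borel" if "w \<in> space M" for w
  unfolding f_def[abs_def] using measurable_compose[OF measurable_Pair2'[OF that] cm] by simp
 have fB: "norm (f w s) \<le> B * indicator {0..T} s" for w s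
  using B by (auto simp: f_def cut_def split: split_indicator)
 define \<tau> where "\<tau> n k = real k * T / real (Suc n)" for n k
 define \<eta> where "\<eta> n k w = step_avg (Suc n) T (f w) k" for n k w
 have fi: "integrable lborel (f w)" if "w \<in> space M" for w
  by (rule integrable_bdd[OF T fm[OF that] fB])
 have S: "simple_integrand F T (Suc n) (\<tau> n) (\<eta> n)" for n
  unfolding simple_integrand_def
 proof (intro conjI allI impI)
  show "\<tau> n 0 = 0" "\<tau> n (Suc n) = T" by (simp_all add: \<tau>_def)
  fix k assume k: "k < Suc n"
  show "\<tau> n k \<le> \<tau> n (Suc k)" unfolding \<tau>_def by (rule gr_mono[OF T]) auto
  have t: "0 \<le> \<tau> n k" "\<tau> n k \<le> T"
   using T k gr_mono[OF T, of "Suc n" k "Suc n"] by (auto simp: \<tau>_def)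
  show "\<eta> n k \<in> bm (F (\<tau> n k))"
  proof (cases "k = 0")
   case True
   then show ?thesis by (simp add: \<eta>_def[abs_def] step_avg_def)
  next
   case False
   let ?a = "real (k - 1) * T / real (Suc n)"
   have a: "0 \<le> ?a" using T by simp
   \<comment> \<open>The average uses \<open>H\<close> up to time \<open>\<tau> n k\<close> only,
     where the clamped process agrees with \<open>H\<close>; so the parameter integral is measurable
     in \<open>F (\<tau> n k)\<close>.\<close>
   have m: "(%(s, w). H (max 0 (min s (\<tau> n k))) w) \<in> bm (lborel \<Otimes>\<^sub>M F (\<tau> n k))"
    by (rule progressive_clamp[OF H t])
   then have "(%x. indicator {?a<..\<tau> n k} (fst x) *\<^sub>R H (max 0 (min (fst x) (\<tau> n k))) (snd x))
     \<in> bm (lborel \<Otimes>\<^sub>M F (\<tau> n k))" by (simp add: split_beta')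
   from measurable_compose[OF measurable_pair_swap' this]
   have "(%(w, s). indicator {?a<..\<tau> n k} s *\<^sub>R H (max 0 (min s (\<tau> n k))) w)
     \<in> bm (F (\<tau> n k) \<Otimes>\<^sub>M lborel)" by (simp add: split_beta')
   then have "(%w. \<integral>s. indicator {?a<..\<tau> n k} s *\<^sub>R H (max 0 (min s (\<tau> n k))) w \<partial>lborel) \<in> bm (F (\<tau> n k))"
    by (rule lborel.borel_measurable_lebesgue_integral)
   also have "(%w. \<integral>s. indicator {?a<..\<tau> n k} s *\<^sub>R H (max 0 (min s (\<tau> n k))) w \<partial>lborel)
    = (%w. \<integral>s. indicator {?a<..\<tau> n k} s *\<^sub>R f w s \<partial>lborel)"
   proof (intro ext LI_integral_cong refl)
    fix w s
    have "s \<in> {0..T} \<and> max 0 (min s (\<tau> n k)) = s" if s: "?a < s" "s \<le> \<tau> n k"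
    proof -
     have "0 < s" using a s(1) by (rule le_less_trans)
     then show ?thesis using s(2) t by simp
    qed
    then show "indicator {?a<..\<tau> n k} s *\<^sub>R H (max 0 (min s (\<tau> n k))) w = indicator {?a<..\<tau> n k} s *\<^sub>R f w s"
     by (auto simp: f_def cut_def split: split_indicator)
   qed
   finally show ?thesis using False by (simp add: \<eta>_def[abs_def] step_avg_def \<tau>_def)
  qed
  show "bounded (\<eta> n k ` space (F (\<tau> n k)))"
   unfolding bounded_iff space_F[OF t(1)]
  proof (intro exI[of _ B] ballI, clarify)
   fix w assume w: "w \<in> space M"
   have "norm (f w r - 0) \<le> B" for r using B B0 by (auto simp: f_def cut_def split: split_indicator)
   then show "norm (\<eta> n k w) \<le> B"
    using norm_step_avg_le[OF T _ fi[OF w], of "Suc n" k 0 B] B0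
    by (cases "k = 0") (auto simp: \<eta>_def step_avg_def)
  qed
 qed
 have sp: "simple_process (Suc n) (\<tau> n) (\<eta> n) s w = step_fun (Suc n) T (f w) s" for n s w
  by (simp add: simple_process_def step_fun_def \<tau>_def \<eta>_def)
 have cs: "cut T (simple_process (Suc n) (\<tau> n) (\<eta> n)) = (%x. step_fun (Suc n) T (f (snd x)) (fst x))" for n
  unfolding cut_simple[OF S order_refl] by (auto simp: sp)
 have sm: "cut T (simple_process (Suc n) (\<tau> n) (\<eta> n)) \<in> bm Lam" for n
  using cut_measurable[OF simple_process_progressive[OF S]] T by simp
 define \<phi> where "\<phi> n w = (LI lborel (%s. norm (f w s - step_fun (Suc n) T (f w) s)))" for n w
 have sB: "norm (step_fun (Suc n) T (f w) s) \<le> B * indicator {0..T} s" if "w \<in> space M" for n w s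
  by (rule norm_step_fun_le[OF T _ fi[OF that]]) (use B B0 in \<open>auto simp: f_def cut_def split: split_indicator\<close>)
 have dB: "norm (f w s - step_fun (Suc n) T (f w) s) \<le> 2 * B * indicator {0..T} s" if "w \<in> space M" for n w s
  using norm_triangle_ineq4[of "f w s" "step_fun (Suc n) T (f w) s"] fB[of w s] sB[OF that, of n s] by simp
 have di: "integrable lborel (%s. norm (f w s - step_fun (Suc n) T (f w) s))" if w: "w \<in> space M" for n w
  by (rule integrable_norm, rule integrable_bdd[OF T _ dB[OF w]])
   (use fm[OF w] step_fun_measurable[OF T, of "Suc n" "f w"] in auto)
 have pm: "(%x. norm (cut T H x - cut T (simple_process (Suc n) (\<tau> n) (\<eta> n)) x)) \<in> bm Lam" for n
  using cm sm[of n] by measurable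
 have \<phi>m: "\<phi> n \<in> bm M" for n
 proof -
  from measurable_compose[OF measurable_pair_swap' pm[of n]]
  have "(%(w, s). norm (f w s - step_fun (Suc n) T (f w) s)) \<in> bm (M \<Otimes>\<^sub>M lborel)"
   by (simp add: split_beta' cs f_def[abs_def])
  then show ?thesis unfolding \<phi>_def[abs_def] by (rule lborel.borel_measurable_lebesgue_integral)
 qed
 have "(%n. \<integral>w. \<phi> n w \<partial>M) \<longlonglongrightarrow> (LI M (%w. 0))"
 proof (rule integral_dominated_convergence[where w="%_. 2 * B * T"])
  show "AE w in M. (%n. \<phi> n w) \<longlonglongrightarrow> 0"
   unfolding \<phi>_def using step_fun_tendsto_L1[OF T fm fB] by (intro AE_I2)
  show "AE w in M. norm (\<phi> n w) \<le> 2 * B * T" for n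
  proof (rule AE_I2)
   fix w assume w: "w \<in> space M"
   have "\<phi> n w \<le> (LI lborel (%s. 2 * B * indicator {0..T} s))"
    unfolding \<phi>_def by (rule integral_mono[OF di[OF w]]) (use T dB[OF w] in auto)
   moreover have "0 \<le> \<phi> n w" by (simp add: \<phi>_def integral_nonneg_AE)
   ultimately show "norm (\<phi> n w) \<le> 2 * B * T" using T by simp
  qed
 qed (use \<phi>m in auto)
 then have lim: "(%n. 2 * B * (LI M (%w. \<phi> n w))) \<longlonglongrightarrow> 0" by (simp add: tendsto_mult_right_zero)
 obtain n where n: "2 * B * (LI M (%w. \<phi> n w)) < e"
  using eventually_happens'[OF sequentially_bot order_tendstoD(2)[OF lim e]] by blast
 have \<phi>0: "0 \<le> \<phi> n w" for w by (simp add: \<phi>_def integral_nonneg_AE)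
 have \<phi>i: "integrable M (\<phi> n)"
 proof (rule LI_integrable_bound)
  show "integrable M (%_. 2 * B * T)" by simp
  show "AE w in M. norm (\<phi> n w) \<le> norm (2 * B * T)"
  proof (rule AE_I2)
   fix w assume w: "w \<in> space M"
   have "\<phi> n w \<le> (LI lborel (%s. 2 * B * indicator {0..T} s))"
    unfolding \<phi>_def by (rule integral_mono[OF di[OF w]]) (use T dB[OF w] in auto)
   then show "norm (\<phi> n w) \<le> norm (2 * B * T)" using \<phi>0[of w] T B0 by simp
  qed
 qed (rule \<phi>m)
 let ?S = "simple_process (Suc n) (\<tau> n) (\<eta> n)"
 have "nsq Lam (%x. cut T H x - cut T ?S x)
  = (NI M (%w. (nsq lborel (%s. f w s - step_fun (Suc n) T (f w) s))))"
 proof -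
  have "(%x. ennreal ((norm (cut T H x - cut T ?S x))\<^sup>2)) \<in> bm Lam"
   using pm[of n] by measurable
  from PS.nn_integral_snd[OF this] show ?thesis by (simp add: cs f_def[abs_def])
 qed
 also have "... \<le> (NI M (%w. ennreal (2 * B * \<phi> n w)))"
 proof (rule nn_integral_mono)
  fix w assume w: "w \<in> space M"
  have "nsq lborel (%s. f w s - step_fun (Suc n) T (f w) s)
   \<le> (NI lborel (%s. ennreal (2 * B * norm (f w s - step_fun (Suc n) T (f w) s))))"
  proof (intro nn_integral_mono ennreal_leI)
   fix s
   have "norm (f w s - step_fun (Suc n) T (f w) s) \<le> 2 * B"
    using dB[OF w, of s n] B0 by (auto split: split_indicator_asm)
   then show "(norm (f w s - step_fun (Suc n) T (f w) s))\<^sup>2 \<le> 2 * B * norm (f w s - step_fun (Suc n) T (f w) s)"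
    unfolding power2_eq_square by (intro mult_right_mono) auto
  qed
  also have "... = ennreal (LI lborel (%s. 2 * B * norm (f w s - step_fun (Suc n) T (f w) s)))"
   using di[OF w, of n] B0 by (intro nn_integral_eq_integral) auto
  finally show "nsq lborel (%s. f w s - step_fun (Suc n) T (f w) s) \<le> ennreal (2 * B * \<phi> n w)"
   by (simp add: \<phi>_def)
 qed
 also have "... = ennreal (LI M (%w. 2 * B * \<phi> n w))"
  using \<phi>i \<phi>0 B0 by (intro nn_integral_eq_integral) auto
 also have "... < ennreal e"
  using n e by (intro ennreal_lessI) auto
 finally show ?thesis using S by blast
qed

text \<open>Truncating large values gives bounded processes that converge in mean square by
  dominated convergence. Two errors below \<open>e/4\<close> suffice, since each is doubled by
  \<open>L2_norm_add_le\<close>.\<close>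

lemma simple_dense:
 fixes H :: "real => 'w => 'a::euclidean_space"
 assumes T: "0 < T" and H: "progressive F T H" and L: "L2 Lam (cut T H)" and e: "0 < e"
 shows "\<exists>K \<tau> \<eta>. simple_integrand F T K \<tau> \<eta> \<and>
  (nsq Lam (%x. cut T H x - cut T (simple_process K \<tau> \<eta>) x)) < ennreal e"
proof -
 define G where "G m s w = (if norm (H s w) \<le> real m then H s w else 0)" for m :: nat and s w
 have G: "progressive F T (G m)" for m
  unfolding progressive_def
 proof
  fix t assume "t \<in> {0..T}"
  then have [measurable]: "(%x. H (fst x) (snd x)) \<in> bm (restrict_space borel {0..t} \<Otimes>\<^sub>M F t)"
   using H by (auto simp: progressive_def split_beta')
  have "(%x. if norm (H (fst x) (snd x)) \<le> real m then H (fst x) (snd x) else 0) \<in> bm (restrict_space borel {0..t} \<Otimes>\<^sub>M F t)"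
   by measurable
  then show "(%(s, w). G m s w) \<in> bm (restrict_space borel {0..t} \<Otimes>\<^sub>M F t)"
   by (simp add: G_def split_beta')
 qed
 have Gm: "cut T (G m) \<in> bm Lam" for m using cut_measurable[OF G] T by simp
 have Hm: "cut T H \<in> bm Lam" using L by (simp add: L2_def)
 have "(%m. \<integral>\<^sup>+x. ennreal ((norm (cut T H x - cut T (G m) x))\<^sup>2) \<partial>Lam) \<longlonglongrightarrow> (NI Lam (%x. 0))"
 proof (rule nn_integral_dominated_convergence[where w="%x. ennreal ((norm (cut T H x))\<^sup>2)"])
  show "AE x in Lam. ennreal ((norm (cut T H x - cut T (G m) x))\<^sup>2) \<le> ennreal ((norm (cut T H x))\<^sup>2)" for m
   by (intro AE_I2 ennreal_leI power_mono) (auto simp: cut_def G_def split: split_indicator)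
  show "AE x in Lam. (%m. ennreal ((norm (cut T H x - cut T (G m) x))\<^sup>2)) \<longlonglongrightarrow> 0"
  proof (rule AE_I2)
   fix x :: "real \<times> 'w"
   obtain m0 :: nat where m0: "norm (H (fst x) (snd x)) \<le> real m0" using real_arch_simple by blast
   show "(%m. ennreal ((norm (cut T H x - cut T (G m) x))\<^sup>2)) \<longlonglongrightarrow> 0"
   proof (rule tendsto_eventually, rule eventually_sequentiallyI[of m0])
    fix m assume "m0 \<le> m"
    then have "norm (H (fst x) (snd x)) \<le> real m" using m0 by linarith
    then show "ennreal ((norm (cut T H x - cut T (G m) x))\<^sup>2) = 0"
     by (auto simp: cut_def G_def split_beta')
   qed
  qed
  show "nsq Lam (cut T H) < \<infinity>" using L by (simp add: L2_iff_nn)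
 qed (use Gm Hm in measurable)
 then have "(%m. \<integral>\<^sup>+x. ennreal ((norm (cut T H x - cut T (G m) x))\<^sup>2) \<partial>Lam) \<longlonglongrightarrow> 0" by simp
 then obtain m where m: "nsq Lam (%x. cut T H x - cut T (G m) x) < ennreal (e/4)"
  using order_tendstoD(2)[of _ 0 sequentially "ennreal (e/4)"] e eventually_happens'[OF sequentially_bot] by fastforce
 obtain K \<tau> \<eta> where S: "simple_integrand F T K \<tau> \<eta>"
  and s: "nsq Lam (%x. cut T (G m) x - cut T (simple_process K \<tau> \<eta>) x) < ennreal (e/4)"
 proof -
  have "norm (G m s w) \<le> real m" for s w by (simp add: G_def)
  from bdd_pair_approx[OF T G this, of "e/4"] e that show ?thesis by auto
 qed
 have Sm: "cut T (simple_process K \<tau> \<eta>) \<in> bm Lam"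
  using cut_measurable[OF simple_process_progressive[OF S]] T by simp
 have "nsq Lam (%x. cut T H x - cut T (simple_process K \<tau> \<eta>) x)
  \<le> 2 * nsq Lam (%x. cut T H x - cut T (G m) x)
   + 2 * nsq Lam (%x. cut T (G m) x - cut T (simple_process K \<tau> \<eta>) x)"
  using L2_norm_add_le[of "%x. cut T H x - cut T (G m) x" Lam "%x. cut T (G m) x - cut T (simple_process K \<tau> \<eta>) x"]
   Gm[of m] Hm Sm by simp
 also have "... < 2 * ennreal (e/4) + 2 * ennreal (e/4)"
  using m s by (intro add_strict_mono ennreal_mult_strict_left_mono) auto
 also have "... = ennreal e"
  using e by (simp add: ennreal_plus[symmetric] ennreal_mult'[symmetric] ennreal_numeral[symmetric] del: ennreal_plus ennreal_numeral)
 finally show ?thesis using S by blast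
qed

end

section \<open>Continuous versions of the Ito integral\<close>

lemma two_ennreal: "0 \<le> a ==> 0 \<le> b ==> 2 * ennreal a + 2 * ennreal b = ennreal (2 * a + 2 * b)"
 by (simp add: ennreal_mult')

context brownian_filtration
begin

text \<open>Time is rounded down to multiples of \<open>1/(n+1)\<close> and clamped to
  \<open>[0,u]\<close>: countably many \<open>F u\<close>-measurable values, which converge by
  continuity. Continuity is asked of every path, hence the regular version in
  \<open>regular_W\<close>.\<close>

lemma continuous_adapted_progressive:
 fixes X :: "real => 'w => 'a::euclidean_space"
 assumes ad: "\<And>t. 0 \<le> t ==> t \<le> T ==> X t \<in> bm (F t)"
  and cont: "\<And>w. w \<in> space M ==> continuous_on {0..T} (%t. X t w)"
 shows "progressive F T X"
 unfolding progressive_def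
proof
 fix u assume u: "u \<in> {0..T}"
 let ?N = "restrict_space borel {0..u} \<Otimes>\<^sub>M F u :: (real \<times> 'w) measure"
 have fst[measurable]: "fst \<in> ?N \<rightarrow>\<^sub>M borel"
  by (rule measurable_compose[OF measurable_fst]) (auto intro: measurable_restrict_space1)
 define r where "r n s = real_of_int \<lfloor>real (Suc n) * s\<rfloor> / real (Suc n)" for n :: nat and s :: real
 have "(%x. X (max 0 (min u (r n (fst x)))) (snd x)) \<in> bm ?N" for n
 proof -
  have 1: "(%x. X (max 0 (min u (real_of_int i / real (Suc n)))) (snd x)) \<in> bm ?N" for i :: int
  proof (rule measurable_compose[OF measurable_snd])
   let ?t = "max 0 (min u (real_of_int i / real (Suc n)))"
   have t: "0 \<le> ?t" "?t \<le> u" using u by auto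
   show "X ?t \<in> bm (F u)"
    by (rule F_measurable_mono[OF t ad]) (use t u in auto)
  qed
  have 2: "(%x. \<lfloor>real (Suc n) * fst x\<rfloor>) \<in> ?N \<rightarrow>\<^sub>M count_space UNIV" by measurable
  show ?thesis using measurable_compose_countable[OF 1 2] by (simp add: r_def)
 qed
 moreover have "(%n. X (max 0 (min u (r n (fst x)))) (snd x)) \<longlonglongrightarrow> X (fst x) (snd x)" if x: "x \<in> space ?N" for x
 proof -
  have w: "snd x \<in> space M" and s: "fst x \<in> {0..u}"
  proof -
   have u0: "0 \<le> u" using u by simp
   have "x \<in> ({0..u} \<inter> space borel) \<times> space M"
    using x unfolding space_pair_measure space_restrict_space space_F[OF u0] .
   then show "snd x \<in> space M" "fst x \<in> {0..u}" by (simp_all add: mem_Times_iff)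
  qed
  have "(%n. r n (fst x)) \<longlonglongrightarrow> fst x"
  proof (rule tendsto_sandwich)
   show "\<forall>\<^sub>F n in sequentially. fst x - inverse (real (Suc n)) \<le> r n (fst x)"
   proof (intro always_eventually allI)
    fix n
    have "real (Suc n) * fst x - 1 \<le> real_of_int \<lfloor>real (Suc n) * fst x\<rfloor>" by linarith
    from divide_right_mono[OF this, of "real (Suc n)"] show "fst x - inverse (real (Suc n)) \<le> r n (fst x)"
     unfolding r_def by (simp add: diff_divide_distrib inverse_eq_divide)
   qed
   show "\<forall>\<^sub>F n in sequentially. r n (fst x) \<le> fst x"
   proof (intro always_eventually allI)
    fix n
    have "real_of_int \<lfloor>real (Suc n) * fst x\<rfloor> \<le> real (Suc n) * fst x" by linarith
    from divide_right_mono[OF this, of "real (Suc n)"] show "r n (fst x) \<le> fst x"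
     unfolding r_def by simp
   qed
   show "(%n. fst x - inverse (real (Suc n))) \<longlonglongrightarrow> fst x"
    using tendsto_diff[OF tendsto_const LIMSEQ_inverse_real_of_nat, of "fst x"] by simp
  qed simp
  then have "(%n. max 0 (min u (r n (fst x)))) \<longlonglongrightarrow> max 0 (min u (fst x))"
   by (intro tendsto_max tendsto_min tendsto_const)
  also have "max 0 (min u (fst x)) = fst x" using s by auto
  finally have "(%n. max 0 (min u (r n (fst x)))) \<longlonglongrightarrow> fst x" .
  then show ?thesis
  proof (rule continuous_on_tendsto_compose[OF cont[OF w]])
   show "\<forall>\<^sub>F n in sequentially. max 0 (min u (r n (fst x))) \<in> {0..T}"
    by (intro always_eventually allI) (use u in auto)
  qed (use s u in auto)
 qed
 ultimately have "(%x. X (fst x) (snd x)) \<in> bm ?N"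
  by (rule borel_measurable_LIMSEQ_metric)
 then show "(%(s, w). X s w) \<in> bm ?N" by (simp add: split_beta')
qed

text \<open>Doob's maximal inequality on a finite grid, by decomposing according to the first exceedance.\<close>

lemma Doob_finite:
 fixes D :: "nat => 'w => 'a::euclidean_space"
 assumes t0: "\<And>i. 0 \<le> t i" and mono: "\<And>i. i < n ==> t i \<le> t n"
  and tm: "\<And>i j. i \<le> j ==> t i \<le> t j"
  and m: "\<And>i. D i \<in> bm (F (t i))" and L: "\<And>i. L2 M (D i)"
  and orth: "\<And>i z. i \<le> n ==> z \<in> bm (F (t i)) ==> L2 M z ==>
   (LI M (%w. z w \<bullet> D n w)) = (LI M (%w. z w \<bullet> D i w))"
  and l: "0 < l"
 shows "measure M {w\<in>space M. \<exists>i\<le>n. norm (D i w) > l} \<le> rsq M (D n) / l\<^sup>2"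
proof -
 have mM[measurable]: "D i \<in> bm M" for i by (rule F_measurable_M[OF t0 m])
 define A where "A i = {w\<in>space M. norm (D i w) > l \<and> (\<forall>j<i. norm (D j w) \<le> l)}" for i
 have AF: "A i \<in> sets (F (t i))" for i
 proof -
  have [measurable]: "D j \<in> bm (F (t i))" if "j \<le> i" for j
   using F_measurable_mono[OF t0 tm[OF that] m] .
  have "{w\<in>space (F (t i)). norm (D i w) > l \<and> (\<forall>j\<in>{..<i}. norm (D j w) \<le> l)} \<in> sets (F (t i))"
   by (intro sets.sets_Collect_conj sets.sets_Collect_finite_All) (auto intro: borel_measurable_less borel_measurable_le)
  moreover have "A i = {w\<in>space (F (t i)). norm (D i w) > l \<and> (\<forall>j\<in>{..<i}. norm (D j w) \<le> l)}"
   unfolding A_def space_F[OF t0] lessThan_iff Ball_def by blast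
  ultimately show ?thesis by simp
 qed
 have AM[measurable]: "A i \<in> sets M" for i
  using AF F_sub[OF t0] by (auto simp: subalgebra_def)
 have disj: "disjoint_family_on A {..n}"
  unfolding disjoint_family_on_def
 proof (intro ballI impI)
  fix i j :: nat assume "i \<noteq> j"
  then show "A i \<inter> A j = {}"
   by (cases i j rule: linorder_cases) (auto simp: A_def not_le[symmetric])
 qed
 have U: "{w\<in>space M. \<exists>i\<le>n. norm (D i w) > l} = (\<Union>i\<in>{..n}. A i)"
 proof (intro equalityI subsetI)
  fix w assume "w \<in> {w\<in>space M. \<exists>i\<le>n. norm (D i w) > l}"
  then obtain i where i: "i \<le> n" "norm (D i w) > l" and w: "w \<in> space M" by auto
  define k where "k = (LEAST i. norm (D i w) > l)"
  have "norm (D k w) > l" "k \<le> i" "\<And>j. j < k ==> norm (D j w) \<le> l"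
   unfolding k_def using i(2) by (auto intro: LeastI Least_le dest: not_less_Least)
  then show "w \<in> (\<Union>i\<in>{..n}. A i)" using i w by (auto simp: A_def intro!: bexI[of _ k])
 qed (auto simp: A_def)
 have step: "l\<^sup>2 * measure M (A i) \<le> (LI M (%w. indicator (A i) w * (norm (D n w))\<^sup>2))" if i: "i \<le> n" for i
 proof -
  define z where "z w = indicator (A i) w *\<^sub>R D i w" for w
  have zm: "z \<in> bm (F (t i))"
   unfolding z_def[abs_def] using AF[of i] m[of i] by measurable
  have zL: "L2 M z"
   by (rule L2_bound[OF L[of i] F_measurable_M[OF t0 zm], where K=1]) (auto simp: z_def split: split_indicator)
  have nL: "L2 M (%w. indicator (A i) w *\<^sub>R D n w)"
   by (rule L2_bound[OF L[of n], where K=1]) (auto split: split_indicator)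
  have ii: "integrable M (indicator (A i) :: _ => real)"
   by (rule integrable_real_indicator[OF AM]) (simp add: emeasure_eq_measure)
  have "l\<^sup>2 * measure M (A i) = (LI M (%w. l\<^sup>2 * indicator (A i) w))" by simp
  also have "... \<le> (LI M (%w. z w \<bullet> D i w))"
  proof (rule integral_mono[OF _ L2_inner_integrable[OF zL L]])
   show "l\<^sup>2 * indicator (A i) w \<le> z w \<bullet> D i w" for w
    using l power_mono[of l "norm (D i w)" 2]
    by (auto simp: z_def A_def power2_norm_eq_inner split: split_indicator)
  qed (use ii in simp)
  \<comment> \<open>Orthogonality makes both integrals equal, so this combination has the same
    value; then \<open>2 <a,b> - |a|^2 \<le> |b|^2\<close> takes the place of the conditional Jensen
    inequality.\<close>
  also have "... = 2 * (LI M (%w. z w \<bullet> D n w)) - (LI M (%w. z w \<bullet> D i w))"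
   using orth[OF i zm zL] by simp
  also have "... = (LI M (%w. 2 * (z w \<bullet> D n w) - z w \<bullet> D i w))"
   using L2_inner_integrable[OF zL L[of n]] L2_inner_integrable[OF zL L[of i]] by simp
  also have "... \<le> (LI M (%w. indicator (A i) w * (norm (D n w))\<^sup>2))"
  proof (rule integral_mono)
   show "integrable M (%w. 2 * (z w \<bullet> D n w) - z w \<bullet> D i w)"
    using L2_inner_integrable[OF zL L[of n]] L2_inner_integrable[OF zL L[of i]] by simp
   show "integrable M (%w. indicator (A i) w * (norm (D n w))\<^sup>2)"
    using L2_inner_integrable[OF nL L[of n]] by (simp add: power2_norm_eq_inner)
   fix w
   have "0 \<le> (norm (D n w - D i w))\<^sup>2" by simp
   then have "2 * (D i w \<bullet> D n w) - D i w \<bullet> D i w \<le> (norm (D n w))\<^sup>2"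
    by (simp add: power2_norm_eq_inner algebra_simps inner_commute)
   then show "2 * (z w \<bullet> D n w) - z w \<bullet> D i w \<le> indicator (A i) w * (norm (D n w))\<^sup>2"
    by (auto simp: z_def split: split_indicator)
  qed
  finally show ?thesis .
 qed
 have "measure M (\<Union>i\<in>{..n}. A i) = (\<Sum>i\<le>n. measure M (A i))"
  by (rule finite_measure_finite_Union) (use disj in auto)
 then have "l\<^sup>2 * measure M (\<Union>i\<in>{..n}. A i) = (\<Sum>i\<le>n. l\<^sup>2 * measure M (A i))"
  by (simp add: sum_distrib_left)
 also have "... \<le> (\<Sum>i\<le>n. \<integral>w. indicator (A i) w * (norm (D n w))\<^sup>2 \<partial>M)"
  by (intro sum_mono step) auto
 also have "... = (LI M (%w. (\<Sum>i\<le>n. indicator (A i) w * (norm (D n w))\<^sup>2)))"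
 proof (rule LI_integral_sum[symmetric])
  fix i
  have "L2 M (%w. indicator (A i) w *\<^sub>R D n w)"
   by (rule L2_bound[OF L[of n], where K=1]) (auto split: split_indicator)
  from L2_inner_integrable[OF this L[of n]] show "integrable M (%w. indicator (A i) w * (norm (D n w))\<^sup>2)"
   by (simp add: power2_norm_eq_inner)
 qed
 also have "... \<le> rsq M (D n)"
 proof (rule integral_mono')
  show "integrable M (%w. (norm (D n w))\<^sup>2)" using L[of n] by (simp add: L2_def)
  fix w
  have "(\<Sum>i\<le>n. indicator (A i) w :: real) = indicator (\<Union>i\<in>{..n}. A i) w"
   by (rule indicator_UN_disjoint[symmetric]) (use disj in auto)
  also have "... \<le> 1" by (auto split: split_indicator)
  finally have "(\<Sum>i\<le>n. indicator (A i) w :: real) * (norm (D n w))\<^sup>2 \<le> 1 * (norm (D n w))\<^sup>2"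
   by (rule mult_right_mono) simp
  then show "(\<Sum>i\<le>n. indicator (A i) w * (norm (D n w))\<^sup>2) \<le> (norm (D n w))\<^sup>2"
   by (simp add: sum_distrib_right)
 qed simp
 finally show ?thesis unfolding U using l by (simp add: field_simps)
qed

text \<open>Dyadic grids are nested, so the exceedance events increase and their union keeps the
  bound. Off the union every path satisfies the closed condition \<open>\<le> l\<close> at dyadic
  points, which survives the limit to arbitrary times.\<close>

lemma Doob_continuous:
 fixes D :: "real => 'w => 'a::euclidean_space"
 assumes T: "0 < T" and m: "\<And>t. 0 \<le> t ==> t \<le> T ==> D t \<in> bm (F t)"
  and L: "\<And>t. 0 \<le> t ==> t \<le> T ==> L2 M (D t)"
  and orth: "\<And>s z. 0 \<le> s ==> s \<le> T ==> z \<in> bm (F s) ==> L2 M z ==>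
   (LI M (%w. z w \<bullet> D T w)) = (LI M (%w. z w \<bullet> D s w))"
  and cont: "\<And>w. w \<in> space M ==> continuous_on {0..T} (%t. D t w)"
  and l: "0 < l"
 obtains A where "A \<in> sets M" "measure M A \<le> rsq M (D T) / l\<^sup>2"
  "\<And>w t. w \<in> space M - A ==> t \<in> {0..T} ==> norm (D t w) \<le> l"
proof -
 \<comment> \<open>The cap at \<open>T\<close> serves indices beyond \<open>2^n\<close>, since
   \<open>Doob_finite\<close> asks for all indices.\<close>
 define t where "t n i = min T (real i * T / 2^n)" for n i :: nat
 define A where "A n = {w\<in>space M. \<exists>i\<le>2^n. norm (D (t n i) w) > l}" for n
 have t: "0 \<le> t n i" "t n i \<le> T" for n i using T by (auto simp: t_def)
 have tT: "t n (2^n) = T" for n by (simp add: t_def)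
 have tm: "t n i \<le> t n j" if "i \<le> j" for n i j
  unfolding t_def using that T by (intro min.mono divide_right_mono mult_right_mono) auto
 have DM[measurable]: "D (t n i) \<in> bm M" for n i
  using F_measurable_M[OF t(1) m[OF t]] .
 have AM: "A n \<in> sets M" for n
 proof -
  have "{w\<in>space M. \<exists>i\<in>{..2^n}. norm (D (t n i) w) > l} \<in> sets M"
   by (intro sets.sets_Collect_finite_Ex) auto
  then show ?thesis by (simp add: A_def Bex_def)
 qed
 have b: "measure M (A n) \<le> rsq M (D T) / l\<^sup>2" for n
  unfolding A_def
  using Doob_finite[of "t n" "2^n" "%i. D (t n i)" l] t tm m L orth l by (simp add: tT)
 have sub: "A n \<subseteq> A (Suc n)" for n
 proof
  fix w assume "w \<in> A n"
  then obtain i where i: "i \<le> 2^n" "norm (D (t n i) w) > l" "w \<in> space M" by (auto simp: A_def)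
  have "t (Suc n) (2 * i) = t n i" by (simp add: t_def)
  then show "w \<in> A (Suc n)" using i unfolding A_def by (auto intro!: exI[of _ "2 * i"])
 qed
 have "(%n. measure M (A n)) \<longlonglongrightarrow> measure M (\<Union>n. A n)"
  by (rule finite_Lim_measure_incseq) (use AM sub in \<open>auto intro: incseq_SucI\<close>)
 then have mU: "measure M (\<Union>n. A n) \<le> rsq M (D T) / l\<^sup>2"
  by (rule LIMSEQ_le_const2) (use b in auto)
 show ?thesis
 proof (rule that[OF _ mU])
  show "(\<Union>n. A n) \<in> sets M" using AM by auto
  fix w s assume w: "w \<in> space M - (\<Union>n. A n)" and s: "s \<in> {0..T}"
  define i where "i n = nat \<lfloor>s / T * 2^n\<rfloor>" for n
  have sT: "0 \<le> s / T" "s / T \<le> 1" using s T by auto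
  have i1: "real (i n) \<le> s / T * 2^n" "s / T * 2^n < real (i n) + 1" for n
  proof -
   have "0 \<le> s / T * 2^n" by (rule mult_nonneg_nonneg[OF sT(1)]) simp
   then show "real (i n) \<le> s / T * 2^n" "s / T * 2^n < real (i n) + 1" unfolding i_def by linarith+
  qed
  have i2: "i n \<le> 2^n" for n
  proof -
   have "s / T * 2^n \<le> 1 * 2^n" using sT by (intro mult_right_mono) auto
   then have "real (i n) \<le> 2^n" using i1(1)[of n] by linarith
   then show ?thesis by simp
  qed
  have "(%n. real (i n) * T / 2^n) \<longlonglongrightarrow> s"
  proof (rule tendsto_sandwich)
   show "\<forall>\<^sub>F n in sequentially. s - T * (1/2)^n \<le> real (i n) * T / 2^n"
   proof (intro always_eventually allI)
    fix n
    have "s \<le> (real (i n) + 1) * T / 2^n" using i1(2)[of n] T by (simp add: field_simps)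
    moreover have "(real (i n) + 1) * T / 2^n = real (i n) * T / 2^n + T / 2^n"
     by (simp add: add_divide_distrib distrib_right)
    moreover have "T * (1/2)^n = T / 2^n" by (simp add: power_divide)
    ultimately show "s - T * (1/2)^n \<le> real (i n) * T / 2^n" by linarith
   qed
   show "\<forall>\<^sub>F n in sequentially. real (i n) * T / 2^n \<le> s"
   proof (intro always_eventually allI)
    fix n show "real (i n) * T / 2^n \<le> s"
     using mult_right_mono[OF i1(1)[of n], of "T / 2^n"] T by (simp add: field_simps)
   qed
   have "(%n. T * (1/2)^n) \<longlonglongrightarrow> 0" by (rule tendsto_mult_right_zero[OF LIMSEQ_power_zero]) simp
   from tendsto_diff[OF tendsto_const this, of s] show "(%n. s - T * (1/2)^n) \<longlonglongrightarrow> s" by simp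
  qed simp
  then have "(%n. t n (i n)) \<longlonglongrightarrow> min T s" unfolding t_def by (intro tendsto_min tendsto_const)
  then have ts: "(%n. t n (i n)) \<longlonglongrightarrow> s" using s by (simp add: min_def split: if_splits)
  have "(%n. D (t n (i n)) w) \<longlonglongrightarrow> D s w"
   using continuous_on_tendsto_compose[OF cont ts] w s t by auto
  from tendsto_norm[OF this] show "norm (D s w) \<le> l"
   by (rule LIMSEQ_le_const2) (use w i2 in \<open>fastforce simp: A_def not_less\<close>)
 qed
qed

text \<open>Setting the motion to zero on a null set that contains all discontinuous paths preserves
  adaptedness, because every \<open>F t\<close> contains the null sets.\<close>

lemma regular_W:
 obtains B where "\<And>t. 0 \<le> t ==> B t \<in> bm (F t)" "\<And>w. w \<in> space M ==> continuous_on {0..} (%t. B t w :: real)"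
  "AE w in M. \<forall>t. B t w = W j t w"
proof -
 obtain Z where Z: "{w\<in>space M. \<not> continuous_on {0..} (%t. W j t w)} \<subseteq> Z" "Z \<in> null_sets M"
  using W_cont[of j] by (auto elim!: AE_E simp: null_sets_def)
 define B where "B t w = (if w \<in> Z then 0 else W j t w)" for t w
 show ?thesis
 proof (rule that[of B])
  fix t :: real assume t: "0 \<le> t"
  have [measurable]: "Z \<in> sets (F t)" using F_null[OF t] Z(2) by auto
  have [measurable]: "W j t \<in> bm (F t)" by (rule W_adapted[OF t])
  show "B t \<in> bm (F t)" unfolding B_def[abs_def] by measurable
 next
  fix w assume "w \<in> space M"
  then show "continuous_on {0..} (%t. B t w)" using Z(1) by (cases "w \<in> Z") (auto simp: B_def)
 next
  show "AE w in M. \<forall>t. B t w = W j t w"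
   using AE_not_in[OF Z(2)] by eventually_elim (simp add: B_def)
 qed
qed

text \<open>For each approximation the running integral is continuous in time. Squared errors of
  order \<open>(1/16)^l\<close> allow Doob's inequality at level \<open>(1/2)^l\<close> with
  exceptional probability \<open>(1/4)^l\<close>; Borel-Cantelli and the Weierstrass test give
  uniform convergence along almost every path.\<close>

theorem ito_exists:
 fixes H :: "real => 'w => 'a::euclidean_space"
 assumes T: "0 < T" and H: "progressive F T H" and L: "L2 Lam (cut T H)"
 obtains J where "progressive F T J" "AE w in M. continuous_on {0..T} (%t. J t w)"
  "\<And>t. t \<in> {0..T} ==> has_ito_integral M F (W j) t H (J t)"
proof -
 obtain B where B: "\<And>t. 0 \<le> t ==> B t \<in> bm (F t)" "\<And>w. w \<in> space M ==> continuous_on {0..} (%t. B t w :: real)"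
  "AE w in M. \<forall>t. B t w = W j t w" using regular_W[of j] by blast
 \<comment> \<open>The extra factor \<open>1/4\<close> absorbs the doubling in
   \<open>L2_norm_add_le\<close>, so that consecutive approximations differ by at most
   \<open>(1/16)^l\<close>.\<close>
 define good where "good l q \<longleftrightarrow> (case q of (K, \<tau>, \<eta>) => simple_integrand F T K \<tau> \<eta> \<and>
  nsq Lam (%x. cut T H x - cut T (simple_process K \<tau> \<eta>) x) < ennreal ((1/16)^l / 4))" for l :: nat and q
 have "\<forall>l. \<exists>q. good l q" using simple_dense[OF T H L] by (simp add: good_def)
 from choice[OF this] obtain q where q: "\<forall>l. good l (q l)" by (elim exE)
 define K where "K l = fst (q l)" for l
 define \<tau> where "\<tau> l = fst (snd (q l))" for l
 define \<eta> where "\<eta> l = snd (snd (q l))" for l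
 have S: "simple_integrand F T (K l) (\<tau> l) (\<eta> l)"
  and err: "nsq Lam (%x. cut T H x - cut T (simple_process (K l) (\<tau> l) (\<eta> l)) x) < ennreal ((1/16)^l / 4)" for l
  using q by (simp_all add: good_def K_def \<tau>_def \<eta>_def split_beta')
 let ?S = "%l. simple_process (K l) (\<tau> l) (\<eta> l)"
 \<comment> \<open>The grid clamped at \<open>t\<close>, with the regular motion \<open>B\<close>.
   No coefficient is set to zero: increments of cells that start after \<open>t\<close> vanish, and
   the formula is visibly continuous in \<open>t\<close>.\<close>
 define X where "X l t w = (\<Sum>k<K l. (B (min (\<tau> l (Suc k)) t) w - B (min (\<tau> l k) t) w) *\<^sub>R \<eta> l k w)" for l t w
 define \<sigma> where "\<sigma> l t k = min (\<tau> l k) t" for l t k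
 define \<zeta> where "\<zeta> l t k = (if \<tau> l k < t then \<eta> l k else (%_. 0))" for l t k
 have R: "simple_integrand F t (K l) (\<sigma> l t) (\<zeta> l t)"
  "cut t (simple_process (K l) (\<sigma> l t) (\<zeta> l t)) = cut t (?S l)" if "t \<in> {0..T}" for l t
  using simple_restrict[OF _ _ S[of l], of t] that unfolding \<sigma>_def[abs_def] \<zeta>_def[abs_def] by auto
 have Xeq: "AE w in M. simple_integral (W j) (K l) (\<sigma> l t) (\<zeta> l t) w = X l t w" if "t \<in> {0..T}" for l t
  using B(3)
 proof eventually_elim
  case (elim w)
  show ?case unfolding simple_integral_def X_def \<sigma>_def \<zeta>_def
  proof (intro sum.cong refl)
   fix k assume "k \<in> {..<K l}"
   then have "\<tau> l k \<le> \<tau> l (Suc k)" using simple_terms(2)[OF S[of l], of k] by simp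
   then show "(W j (min (\<tau> l (Suc k)) t) w - W j (min (\<tau> l k) t) w) *\<^sub>R (if \<tau> l k < t then \<eta> l k else (%_. 0)) w
    = (B (min (\<tau> l (Suc k)) t) w - B (min (\<tau> l k) t) w) *\<^sub>R \<eta> l k w"
    using elim by (auto simp: min_def)
  qed
 qed
 have Xm: "X l t \<in> bm (F t)" if t: "0 \<le> t" "t \<le> T" for l t
  unfolding X_def[abs_def]
 proof (rule borel_measurable_sum)
  fix k assume "k \<in> {..<K l}"
  then have k: "k < K l" by simp
  note st = simple_terms[OF S k]
  show "(%w. (B (min (\<tau> l (Suc k)) t) w - B (min (\<tau> l k) t) w) *\<^sub>R \<eta> l k w) \<in> bm (F t)"
  proof (cases "\<tau> l k < t")
   case True
   have [measurable]: "\<eta> l k \<in> bm (F t)"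
    using st True F_measurable_mono[of "\<tau> l k" t] by (auto simp: bdd_meas_def)
   have 1: "0 \<le> min (\<tau> l (Suc k)) t" "0 \<le> min (\<tau> l k) t" using st t by auto
   have [measurable]: "B (min (\<tau> l (Suc k)) t) \<in> bm (F t)" "B (min (\<tau> l k) t) \<in> bm (F t)"
    using F_measurable_mono[OF 1(1) _ B(1)[OF 1(1)]] F_measurable_mono[OF 1(2) _ B(1)[OF 1(2)]] by auto
   show ?thesis by measurable
  next
   case False
   then have "min (\<tau> l (Suc k)) t = t" "min (\<tau> l k) t = t" using st by auto
   then show ?thesis by simp
  qed
 qed
 have Xc: "continuous_on {0..T} (%t. X l t w)" if w: "w \<in> space M" for l w
  unfolding X_def
 proof (intro continuous_on_sum continuous_on_scaleR continuous_on_diff continuous_on_const)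
  fix k assume "k \<in> {..<K l}"
  then have k: "k < K l" by simp
  note st = simple_terms[OF S k]
  have c: "continuous_on {0..T} (%t. B (min a t) w)" if "0 \<le> a" for a
   by (rule continuous_on_compose2[OF B(2)[OF w]]) (use that in \<open>auto intro!: continuous_intros\<close>)
  show "continuous_on {0..T} (%t. B (min (\<tau> l (Suc k)) t) w)" "continuous_on {0..T} (%t. B (min (\<tau> l k) t) w)"
   using c st by auto
 qed
 have XM: "X l t \<in> bm M" if "t \<in> {0..T}" for l t
  by (rule F_measurable_M[OF _ Xm]) (use that in auto)
 have XI: "has_ito_integral M F (W j) t (?S l) (X l t)" if t: "t \<in> {0..T}" for l t
 proof (rule ito_AE_eq[OF simple_has_ito[OF _ R(1)[OF t]] _ _ _ XM[OF t] Xeq[OF t]])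
  show "progressive F t (?S l)" using progressive_mono[OF simple_process_progressive[OF S]] t by simp
  show "AE x in Lam. cut t (simple_process (K l) (\<sigma> l t) (\<zeta> l t)) x = cut t (?S l) x" by (simp add: R(2)[OF t])
 qed (use t in auto)
 have XL: "L2 M (X l t)" if t: "t \<in> {0..T}" for l t
  using ito_L2[OF XI[OF t]] t by simp
 have SL: "L2 Lam (cut t (?S l))" if t: "t \<in> {0..T}" for l t
  using ito_cut_L2[OF XI[OF t]] t by simp
 have dT: "nsq Lam (%x. cut T (?S (Suc l)) x - cut T (?S l) x) \<le> ennreal ((1/16)^l)" for l
 proof -
  have T': "T \<in> {0..T}" using T by simp
  have m: "cut T H \<in> bm Lam" "cut T (?S (Suc l)) \<in> bm Lam" "cut T (?S l) \<in> bm Lam"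
   using L SL[OF T'] by (auto simp: L2_def)
  have "nsq Lam (%x. cut T (?S (Suc l)) x - cut T (?S l) x)
   = nsq Lam (%x. (cut T H x - cut T (?S l) x) + - (cut T H x - cut T (?S (Suc l)) x))"
   by simp
  also have "... \<le> 2 * nsq Lam (%x. cut T H x - cut T (?S l) x)
   + 2 * nsq Lam (%x. - (cut T H x - cut T (?S (Suc l)) x))"
   by (rule L2_norm_add_le) (use m in measurable)
  also have "... \<le> 2 * ennreal ((1/16)^l / 4) + 2 * ennreal ((1/16)^Suc l / 4)"
   unfolding norm_minus_cancel
   by (intro add_mono mult_left_mono less_imp_le[OF err]) auto
  also have "... = ennreal (2 * ((1/16)^l / 4) + 2 * ((1/16)^Suc l / 4))"
   by (rule two_ennreal) auto
  also have "... \<le> ennreal ((1/16)^l)" by (rule ennreal_leI) (simp add: field_simps)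
  finally show ?thesis .
 qed
 have dXr: "rsq M (%w. X (Suc l) t w - X l t w) \<le> (1/16)^l" if t: "t \<in> {0..T}" for l t
 proof -
  have t': "0 \<le> t" using t by simp
  have eq: "rsq M (%w. X (Suc l) t w - X l t w) = rsq Lam (%x. cut t (?S (Suc l)) x - cut t (?S l) x)"
   by (rule ito_diff_norm[OF XI[OF t] XI[OF t] t' t'])
  have "ennreal (rsq Lam (%x. cut t (?S (Suc l)) x - cut t (?S l) x)) = nsq Lam (%x. cut t (?S (Suc l)) x - cut t (?S l) x)"
   using L2_nn_integral[OF L2_diff[OF SL[OF t] SL[OF t]]] by simp
  also have "... \<le> nsq Lam (%x. cut T (?S (Suc l)) x - cut T (?S l) x)"
   by (intro nn_integral_mono ennreal_leI power_mono) (use t in \<open>auto simp: cut_def split: split_indicator\<close>)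
  also have "... \<le> ennreal ((1/16)^l)" by (rule dT)
  finally show ?thesis unfolding eq by (simp add: ennreal_le_iff)
 qed
 have dX: "nsq M (%w. X (Suc l) t w - X l t w) \<le> ennreal (1 * (1/4)^l)" if t: "t \<in> {0..T}" for l t
 proof -
  have "(1/16::real)^l \<le> (1/4)^l" by (intro power_mono) auto
  then show ?thesis
   using L2_nn_integral[OF L2_diff[OF XL[OF t] XL[OF t]]] dXr[OF t, of l] by (simp add: ennreal_leI)
 qed
 \<comment> \<open>The pointwise limit is jointly measurable; where it does not exist, the default
   value of \<open>lim\<close> is harmless.\<close>
 define J where "J t w = lim (%l. X l t w)" for t w
 have Xprog: "progressive F T (X l)" for l
  by (rule continuous_adapted_progressive[OF Xm Xc])
 have Jprog: "progressive F T J"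
  unfolding progressive_def J_def[abs_def]
  using Xprog by (auto simp: progressive_def split_beta' intro!: borel_measurable_lim_metric)
 have JI: "has_ito_integral M F (W j) t H (J t)" if t: "t \<in> {0..T}" for t
 proof (rule ito_intro[OF _ progressive_mono[OF H] _ _ R(1)[OF t]])
  show "0 \<le> t" "t \<le> T" using t by auto
  show "J t \<in> bm M"
   unfolding J_def[abs_def] by (rule borel_measurable_lim_metric[OF XM[OF t]])
  have cm: "cut t H \<in> bm Lam" using cut_measurable[OF H] t by simp
  show "L2 Lam (cut t H)"
   by (rule L2_bound[OF L cm, where K=1]) (use t in \<open>auto simp: cut_def split: split_indicator\<close>)
  show "L2conv Lam (%l. cut t (simple_process (K l) (\<sigma> l t) (\<zeta> l t))) (cut t H)"
   unfolding R(2)[OF t] L2conv_def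
  proof (rule tendsto_sandwich[OF _ _ tendsto_const])
   have "(%l. ennreal ((1/16)^l / 4)) \<longlonglongrightarrow> ennreal (0 / 4)"
    by (intro tendsto_ennrealI tendsto_divide LIMSEQ_power_zero tendsto_const) auto
   then show "(%l. ennreal ((1/16)^l / 4)) \<longlonglongrightarrow> 0" by simp
   have "nsq Lam (%x. cut t H x - cut t (?S l) x)
    \<le> nsq Lam (%x. cut T H x - cut T (?S l) x)" for l
    by (intro nn_integral_mono ennreal_leI power_mono) (use t in \<open>auto simp: cut_def split: split_indicator\<close>)
   then show "\<forall>\<^sub>F l in sequentially. (nsq Lam (%x. cut t H x - cut t (?S l) x)) \<le> ennreal ((1/16)^l / 4)"
    using less_imp_le[OF err] order_trans by (intro always_eventually allI) blast
  qed simp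
  have c: "L2conv M (%l. X l t) (J t)"
   unfolding J_def by (rule L2_fast_Cauchy(4)[OF XL[OF t] _ dX[OF t]]) simp
  have "nsq M (%x. J t x - simple_integral (W j) (K l) (\<sigma> l t) (\<zeta> l t) x)
   = nsq M (%x. J t x - X l t x)" for l
   by (intro nn_integral_cong_AE) (use Xeq[OF t, of l] in auto)
  then show "L2conv M (%l. simple_integral (W j) (K l) (\<sigma> l t) (\<zeta> l t)) (J t)"
   using c by (simp add: L2conv_def)
 qed
 have "\<exists>A. A \<in> sets M \<and> measure M A \<le> (1/4)^l \<and> (\<forall>w\<in>space M - A. \<forall>t\<in>{0..T}. norm (X (Suc l) t w - X l t w) \<le> (1/2)^l)" for l
 proof -
  have o: "(LI M (%w. z w \<bullet> X l T w)) = (LI M (%w. z w \<bullet> X l s w))"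
   if "0 \<le> s" "s \<le> T" "z \<in> bm (F s)" "L2 M z" for s z l
   by (rule ito_orthogonal[OF XI XI that]) (use that T in auto)
  obtain A where A: "A \<in> sets M" "measure M A \<le> rsq M (%w. X (Suc l) T w - X l T w) / ((1/2)^l)\<^sup>2"
   "\<And>w t. w \<in> space M - A ==> t \<in> {0..T} ==> norm (X (Suc l) t w - X l t w) \<le> (1/2)^l"
  proof (rule Doob_continuous[OF T, of "%t w. X (Suc l) t w - X l t w" "(1/2)^l"])
   show "(%w. X (Suc l) t w - X l t w) \<in> bm (F t)" if "0 \<le> t" "t \<le> T" for t
    using Xm[OF that] by (intro borel_measurable_diff)
   show "L2 M (%w. X (Suc l) t w - X l t w)" if "0 \<le> t" "t \<le> T" for t
    using XL that by (intro L2_diff) auto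
   show "continuous_on {0..T} (%t. X (Suc l) t w - X l t w)" if "w \<in> space M" for w
    using Xc[OF that] by (intro continuous_on_diff)
   show "(LI M (%w. z w \<bullet> (X (Suc l) T w - X l T w))) = (LI M (%w. z w \<bullet> (X (Suc l) s w - X l s w)))"
    if z: "0 \<le> s" "s \<le> T" "z \<in> bm (F s)" "L2 M z" for s z
    using o[OF z, of l] o[OF z, of "Suc l"] L2_inner_integrable[OF z(4) XL] z T
    by (simp add: inner_diff_right)
  qed auto
  note A(2)
  also have "rsq M (%w. X (Suc l) T w - X l T w) / ((1/2)^l)\<^sup>2 \<le> (1/16)^l / ((1/2)^l)\<^sup>2"
   using dXr[of T l] T by (intro divide_right_mono) auto
  also have "(1/16::real)^l / ((1/2)^l)\<^sup>2 = ((1/16) / ((1/2) * (1/2)))^l"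
   by (simp only: power2_eq_square power_mult_distrib[symmetric] power_divide[symmetric])
  also have "... = (1/4)^l" by simp
  finally show ?thesis using A(1,3) by blast
 qed
 then have "\<forall>l. \<exists>A. A \<in> sets M \<and> measure M A \<le> (1/4)^l \<and> (\<forall>w\<in>space M - A. \<forall>t\<in>{0..T}. norm (X (Suc l) t w - X l t w) \<le> (1/2)^l)"
  by blast
 then have "\<exists>A. \<forall>l. A l \<in> sets M \<and> measure M (A l) \<le> (1/4)^l \<and> (\<forall>w\<in>space M - A l. \<forall>t\<in>{0..T}. norm (X (Suc l) t w - X l t w) \<le> (1/2)^l)"
  by (rule choice)
 then obtain A where A: "\<And>l. A l \<in> sets M" "\<And>l. measure M (A l) \<le> (1/4)^l"
  "\<And>l w t. w \<in> space M - A l ==> t \<in> {0..T} ==> norm (X (Suc l) t w - X l t w) \<le> (1/2)^l"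
  by blast
 have "AE w in M. eventually (%l. w \<in> space M - A l) sequentially"
 proof (rule borel_cantelli_AE1[OF A(1)])
  show "emeasure M (A l) < \<infinity>" for l by (simp add: emeasure_eq_measure)
  show "summable (%l. measure M (A l))"
   by (rule summable_comparison_test'[of "%l. (1/4)^l" 0]) (use A(2) in \<open>auto intro: summable_geometric\<close>)
 qed
 then have "AE w in M. continuous_on {0..T} (%t. J t w)"
 proof (rule AE_mp, intro AE_I2 impI)
  fix w assume w: "w \<in> space M" and ev: "eventually (%l. w \<in> space M - A l) sequentially"
  have "uniform_limit {0..T} (%n t. \<Sum>l<n. X (Suc l) t w - X l t w) (%t. \<Sum>l. X (Suc l) t w - X l t w) sequentially"
  proof (rule Weierstrass_m_test_ev)
   show "\<forall>\<^sub>F l in sequentially. \<forall>t\<in>{0..T}. norm (X (Suc l) t w - X l t w) \<le> (1/2)^l"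
    using ev by eventually_elim (use A(3) in blast)
  qed (simp add: summable_geometric)
  then have "uniform_limit {0..T} (%n t. X 0 t w + (\<Sum>l<n. X (Suc l) t w - X l t w)) (%t. X 0 t w + (\<Sum>l. X (Suc l) t w - X l t w)) sequentially"
   by (intro uniform_limit_intros)
  then have u: "uniform_limit {0..T} (%n t. X n t w) (%t. X 0 t w + (\<Sum>l. X (Suc l) t w - X l t w)) sequentially"
   by (simp add: sum_lessThan_telescope[of "%n. X n _ w"])
  have Jeq: "J t w = X 0 t w + (\<Sum>l. X (Suc l) t w - X l t w)" if "t \<in> {0..T}" for t
   unfolding J_def using tendsto_uniform_limitI[OF u that] by (rule limI)
  have Jc: "continuous_on {0..T} (%t. X 0 t w + (\<Sum>l. X (Suc l) t w - X l t w))"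
   by (rule uniform_limit_theorem[OF _ u]) (use Xc[OF w] in auto)
  show "continuous_on {0..T} (%t. J t w)"
   by (rule continuous_on_eq[OF Jc]) (simp add: Jeq)
 qed
 with Jprog JI that show ?thesis by blast
qed

end

section \<open>Second moments of Ito processes\<close>

lemma norm_indicator_sq:
 "(norm (indicator A s :: real))\<^sup>2 = indicator A s" "(indicator A s :: real)\<^sup>2 = indicator A s"
 by (auto split: split_indicator)

lemma indefinite_integral_measurable:
 fixes f :: "'b => real => 'a::euclidean_space"
 assumes f: "(%(x, r). f x r) \<in> bm (N \<Otimes>\<^sub>M lborel)" and t: "t \<in> bm N"
 shows "(%x. \<integral>r. indicator {..t x} r *\<^sub>R f x r \<partial>lborel) \<in> bm N"
proof -
 note [measurable] = f t
 have "(%(x, r). (if r \<le> t x then f x r else 0)) \<in> bm (N \<Otimes>\<^sub>M lborel)" by measurable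
 moreover have "(%(x, r). (if r \<le> t x then f x r else 0)) = (%(x, r). indicator {..t x} r *\<^sub>R f x r)"
  by (auto simp: fun_eq_iff split: split_indicator)
 ultimately show ?thesis using lborel.borel_measurable_lebesgue_integral by simp
qed

text \<open>Integration by parts for absolutely continuous functions, by Fubini on the two triangles.\<close>

lemma integral_product:
 fixes f g :: "real => 'a::euclidean_space"
 assumes f: "integrable lborel f" and g: "integrable lborel g"
 defines "IF \<equiv> %s. \<integral>r. indicator {..s} r *\<^sub>R f r \<partial>lborel" and "IG \<equiv> %s. \<integral>r. indicator {..s} r *\<^sub>R g r \<partial>lborel"
 shows "integrable lborel (%s. f s \<bullet> IG s)" "integrable lborel (%s. IF s \<bullet> g s)"
  and "(LI lborel (%s. f s)) \<bullet> (LI lborel (%s. g s)) = (LI lborel (%s. f s \<bullet> IG s)) + (LI lborel (%s. IF s \<bullet> g s))"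
proof -
 note [measurable] = borel_measurable_integrable[OF f] borel_measurable_integrable[OF g]
 have ind: "integrable lborel (%r. indicator A r *\<^sub>R h r)" if "integrable lborel h" "A \<in> sets borel" for A and h :: "real => 'a"
  using integrable_mult_indicator[OF _ that(1), of A] that(2) by simp
 have key: "integrable lborel (%s. f s \<bullet> (LI lborel (%r. indicator {..s} r *\<^sub>R g r)))"
  if f: "integrable lborel f" and g: "integrable lborel g" for f g :: "real => 'a"
 proof (rule LI_integrable_bound)
  note [measurable] = borel_measurable_integrable[OF f] borel_measurable_integrable[OF g]
  show "integrable lborel (%s. norm (f s) * (LI lborel (%r. norm (g r))))" using f by simp
  have "(%s. \<integral>r. indicator {..s} r *\<^sub>R g r \<partial>lborel) \<in> bm lborel"
   by (rule indefinite_integral_measurable[where t="%s. s"]) measurable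
  then show "(%s. f s \<bullet> (LI lborel (%r. indicator {..s} r *\<^sub>R g r))) \<in> bm lborel" by measurable
  show "AE s in lborel. norm (f s \<bullet> (LI lborel (%r. indicator {..s} r *\<^sub>R g r))) \<le> norm (norm (f s) * (LI lborel (%r. norm (g r))))"
  proof (rule AE_I2)
   fix s
   have "norm (LI lborel (%r. indicator {..s} r *\<^sub>R g r)) \<le> (LI lborel (%r. norm (indicator {..s} r *\<^sub>R g r)))"
    by (rule integral_norm_bound)
   also have "... \<le> (LI lborel (%r. norm (g r)))"
    by (rule integral_mono[OF integrable_norm[OF ind[OF g]] integrable_norm[OF g]]) (auto split: split_indicator)
   finally have "norm (f s) * norm (LI lborel (%r. indicator {..s} r *\<^sub>R g r)) \<le> norm (f s) * (LI lborel (%r. norm (g r)))"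
    by (rule mult_left_mono) simp
   then show "norm (f s \<bullet> (LI lborel (%r. indicator {..s} r *\<^sub>R g r))) \<le> norm (norm (f s) * (LI lborel (%r. norm (g r))))"
    using Cauchy_Schwarz_ineq2[of "f s" "\<integral>r. indicator {..s} r *\<^sub>R g r \<partial>lborel"] by (simp add: integral_nonneg_AE)
  qed
 qed
 show 1: "integrable lborel (%s. f s \<bullet> IG s)" unfolding IG_def by (rule key[OF f g])
 show 2: "integrable lborel (%s. IF s \<bullet> g s)" unfolding IF_def using key[OF g f] by (simp add: inner_commute)
 have mm: "(%(s, r). f s \<bullet> g r) \<in> bm (lborel \<Otimes>\<^sub>M lborel)" by measurable
 have prod: "integrable (lborel \<Otimes>\<^sub>M lborel) (%(s, r). norm (f s) * norm (g r))"
 proof (rule lborel_pair.Fubini_integrable)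
  show "(%(s, r). norm (f s) * norm (g r)) \<in> bm (lborel \<Otimes>\<^sub>M lborel)" by measurable
  show "integrable lborel (%s. \<integral>r. norm (case (s, r) of (s, r) => norm (f s) * norm (g r)) \<partial>lborel)"
   using f g by (simp add: abs_mult)
  show "AE s in lborel. integrable lborel (%r. case (s, r) of (s, r) => norm (f s) * norm (g r))"
   using g by simp
 qed
 have tri: "integrable (lborel \<Otimes>\<^sub>M lborel) (%(s, r). (if r < s then 0 else 1) * (f s \<bullet> g r))"
 proof (rule LI_integrable_bound[OF prod])
  show "(%(s, r). (if r < s then 0 else 1) * (f s \<bullet> g r)) \<in> bm (lborel \<Otimes>\<^sub>M lborel)"
   using mm by measurable
  show "AE x in lborel \<Otimes>\<^sub>M lborel. norm (case x of (s, r) => (if r < s then 0 else 1) * (f s \<bullet> g r)) \<le> norm (case x of (s, r) => norm (f s) * norm (g r))"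
   by (rule AE_I2) (auto simp: Cauchy_Schwarz_ineq2)
 qed
 \<comment> \<open>\<open>IG\<close> includes the point \<open>r = s\<close>, while the triangles
   are separated by \<open>r < s\<close>; a single point is a null set.\<close>
 have lt: "(LI lborel (%r. indicator {..s} r *\<^sub>R h r)) = (LI lborel (%r. (if r < s then h r else 0)))"
  if "integrable lborel h" for s and h :: "real => 'a"
 proof (rule integral_cong_AE)
  show "AE r in lborel. indicator {..s} r *\<^sub>R h r = (if r < s then h r else 0)"
   using AE_lborel_singleton[of s] by eventually_elim (auto split: split_indicator)
 qed (use borel_measurable_integrable[OF that] in measurable)
 have ge: "integrable lborel (%r. (if r < s then 0 else 1) *\<^sub>R h r)" if "integrable lborel h" for s and h :: "real => 'a"
 proof -
  have "(%r. (if r < s then 0 else 1) *\<^sub>R h r) = (%r. indicator {s..} r *\<^sub>R h r)" by (auto split: split_indicator)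
  then show ?thesis using ind[OF that, of "{s..}"] by simp
 qed
 have "(LI lborel (%s. f s)) \<bullet> (LI lborel (%s. g s)) = (LI lborel (%s. f s \<bullet> (LI lborel (%r. g r))))"
  using f by simp
 also have "... = (LI lborel (%s. f s \<bullet> IG s + (LI lborel (%r. (if r < s then 0 else 1) * (f s \<bullet> g r)))))"
 proof (intro LI_integral_cong refl)
  fix s
  have "(LI lborel (%r. g r)) = (LI lborel (%r. (if r < s then g r else 0) + (if r < s then 0 else 1) *\<^sub>R g r))"
   by (intro LI_integral_cong) auto
  also have "... = (LI lborel (%r. (if r < s then g r else 0))) + (LI lborel (%r. (if r < s then 0 else 1) *\<^sub>R g r))"
  proof (rule LI_integral_add[OF _ ge[OF g]])
   have "(%r. if r < s then g r else 0) = (%r. indicator {..<s} r *\<^sub>R g r)" by (auto split: split_indicator)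
   then show "integrable lborel (%r. if r < s then g r else 0)" using ind[OF g, of "{..<s}"] by simp
  qed
  finally have "(LI lborel (%r. g r)) = IG s + (LI lborel (%r. (if r < s then 0 else 1) *\<^sub>R g r))"
   unfolding IG_def lt[OF g] .
  then have "f s \<bullet> (LI lborel (%r. g r)) = f s \<bullet> IG s + f s \<bullet> (LI lborel (%r. (if r < s then 0 else 1) *\<^sub>R g r))"
   by (simp add: inner_add_right)
  also have "f s \<bullet> (LI lborel (%r. (if r < s then 0 else 1) *\<^sub>R g r)) = (LI lborel (%r. f s \<bullet> ((if r < s then 0 else 1) *\<^sub>R g r)))"
   using ge[OF g, of s] by (simp only: integral_inner_right)
  finally show "f s \<bullet> (LI lborel (%r. g r)) = f s \<bullet> IG s + (LI lborel (%r. (if r < s then 0 else 1) * (f s \<bullet> g r)))"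
   by (simp only: inner_scaleR_right)
 qed
 also have "... = (LI lborel (%s. f s \<bullet> IG s)) + (LI lborel (%s. (LI lborel (%r. (if r < s then 0 else 1) * (f s \<bullet> g r)))))"
  by (rule LI_integral_add[OF 1]) (use lborel_pair.integrable_fst[OF tri] in simp)
 also have "(LI lborel (%s. (LI lborel (%r. (if r < s then 0 else 1) * (f s \<bullet> g r)))))
  = (LI lborel (%r. (LI lborel (%s. (if r < s then 0 else 1) * (f s \<bullet> g r)))))"
  by (rule lborel_pair.Fubini_integral[OF tri, symmetric])
 also have "... = (LI lborel (%r. IF r \<bullet> g r))"
 proof (intro LI_integral_cong refl)
  fix r
  have "(LI lborel (%s. (if r < s then 0 else 1) * (f s \<bullet> g r))) = (LI lborel (%s. (indicator {..r} s *\<^sub>R f s) \<bullet> g r))"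
   by (intro LI_integral_cong) (auto split: split_indicator)
  also have "... = IF r \<bullet> g r"
   unfolding IF_def using ind[OF f, of "{..r}"] by (simp only: integral_inner_left atMost_borel)
  finally show "(LI lborel (%s. (if r < s then 0 else 1) * (f s \<bullet> g r))) = IF r \<bullet> g r" .
 qed
 finally show "(LI lborel (%s. f s)) \<bullet> (LI lborel (%s. g s)) = (LI lborel (%s. f s \<bullet> IG s)) + (LI lborel (%s. IF s \<bullet> g s))" .
qed

section \<open>The drift integral of a process\<close>

context brownian_filtration
begin

definition drift :: "(real => 'w => 'a::euclidean_space) => real => 'w => 'a" where
 "drift b t w = (\<integral>s\<in>{0..t}. b s w \<partial>lborel)"

lemma drift_cut: "t \<le> T ==> drift b t w = (LI lborel (%r. indicator {..t} r *\<^sub>R cut T b (r, w)))"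
 unfolding drift_def set_lebesgue_integral_def
 by (intro LI_integral_cong) (auto simp: cut_def split: split_indicator)

lemma progressive_at:
 assumes H: "progressive F T H" and t: "t \<in> {0..T}"
 shows "H t \<in> bm (F t)"
proof -
 have m: "(%(s, w). H s w) \<in> bm (restrict_space borel {0..t} \<Otimes>\<^sub>M F t)"
  using H t by (auto simp: progressive_def)
 have "Pair t \<in> F t \<rightarrow>\<^sub>M restrict_space borel {0..t} \<Otimes>\<^sub>M F t"
  by (rule measurable_Pair1') (use t in \<open>auto simp: space_restrict_space\<close>)
 from measurable_compose[OF this m] show ?thesis by simp
qed

text \<open>Both the upper limit and the path are parameters, so measurability is read off a
  parameter integral of the clamped process; the clamp is invisible for times up to
  \<open>u\<close>.\<close>

lemma progressive_drift:
 fixes b :: "real => 'w => 'a::euclidean_space"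
 assumes b: "progressive F T b" shows "progressive F T (drift b)"
 unfolding progressive_def
proof
 fix u assume u: "u \<in> {0..T}"
 let ?N = "restrict_space borel {0..u} \<Otimes>\<^sub>M F u :: (real \<times> 'w) measure"
 have fst[measurable]: "fst \<in> ?N \<rightarrow>\<^sub>M borel"
  by (rule measurable_compose[OF measurable_fst]) (auto intro: measurable_restrict_space1)
 have "(%(s, w). b (max 0 (min s u)) w) \<in> bm (lborel \<Otimes>\<^sub>M F u)"
  by (rule progressive_clamp[OF b]) (use u in auto)
 then have [measurable]: "(%x. b (max 0 (min (fst x) u)) (snd x)) \<in> bm (lborel \<Otimes>\<^sub>M F u)"
  by (simp add: split_beta')
 have "(%y. (snd y, snd (fst y))) \<in> ?N \<Otimes>\<^sub>M lborel \<rightarrow>\<^sub>M lborel \<Otimes>\<^sub>M F u" by measurable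
 from measurable_compose[OF this \<open>(%x. b (max 0 (min (fst x) u)) (snd x)) \<in> bm (lborel \<Otimes>\<^sub>M F u)\<close>]
 have "(%(x, r). indicator {0..} r *\<^sub>R b (max 0 (min r u)) (snd x)) \<in> bm (?N \<Otimes>\<^sub>M lborel)"
  by (simp add: split_beta')
 from indefinite_integral_measurable[OF this fst]
 have "(%x. \<integral>r. indicator {..fst x} r *\<^sub>R (indicator {0..} r *\<^sub>R b (max 0 (min r u)) (snd x)) \<partial>lborel) \<in> bm ?N" .
 then show "(%(s, w). drift b s w) \<in> bm ?N"
 proof (rule measurable_cong[THEN iffD1, rotated])
  fix x assume "x \<in> space ?N"
  then have "fst x \<le> u" by (auto simp: space_pair_measure space_restrict_space)
  then show "(LI lborel (%r. indicator {..fst x} r *\<^sub>R (indicator {0..} r *\<^sub>R b (max 0 (min r u)) (snd x)))) = (case x of (s, w) => drift b s w)"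
   unfolding drift_def set_lebesgue_integral_def split_beta'
   by (intro LI_integral_cong) (auto split: split_indicator)
 qed
qed

lemma L2_path:
 assumes L: "L2 Lam G" shows "AE w in M. L2 lborel (%s. G (s, w))"
proof -
 have "integrable Lam (%(s, w). (norm (G (s, w)))\<^sup>2)" using L by (simp add: L2_def split_beta')
 from PS.AE_integrable_snd[OF this] show ?thesis
 proof (rule AE_mp, intro AE_I2 impI)
  fix w assume "w \<in> space M" "integrable lborel (%s. (norm (G (s, w)))\<^sup>2)"
  moreover have "G \<in> bm Lam" using L by (simp add: L2_def)
  ultimately show "L2 lborel (%s. G (s, w))"
   unfolding L2_def using measurable_compose[OF measurable_Pair2'] by auto
 qed
qed

lemma L2_time:
 assumes L: "L2 Lam G" shows "AE s in lborel. L2 M (%w. G (s, w))"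
proof -
 have "integrable Lam (%(s, w). (norm (G (s, w)))\<^sup>2)" using L by (simp add: L2_def split_beta')
 from PS.AE_integrable_fst[OF this] show ?thesis
 proof (rule AE_mp, intro AE_I2 impI)
  fix s :: real assume "integrable M (%w. (norm (G (s, w)))\<^sup>2)"
  moreover have "G \<in> bm Lam" using L by (simp add: L2_def)
  ultimately show "L2 M (%w. G (s, w))"
   unfolding L2_def using measurable_compose[OF measurable_Pair1'] by auto
 qed
qed

lemma path_integrable:
 assumes L: "L2 lborel (%s. cut t b (s, w))"
 shows "integrable lborel (%s. cut t b (s, w))"
proof -
 have i: "L2 lborel (indicator {0..t} :: real => real)"
  unfolding L2_def by (cases "0 \<le> t") (auto simp: norm_indicator_sq)
 have m: "(%s. cut t b (s, w)) \<in> bm lborel" using L by (simp add: L2_def)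
 show ?thesis
  by (rule LI_integrable_bound[OF L2_mult_integrable[OF L i] m])
   (auto simp: cut_def split: split_indicator)
qed

text \<open>Cauchy-Schwarz against the indicator of \<open>[0,t]\<close>, whose squared norm is the
  factor \<open>t\<close>.\<close>

lemma drift_norm_le:
 assumes L: "L2 lborel (%s. cut t b (s, w))" and t: "0 \<le> t"
 shows "(norm (drift b t w))\<^sup>2 \<le> t * rsq lborel (%s. cut t b (s, w))"
proof -
 have i: "L2 lborel (indicator {0..t} :: real => real)"
  unfolding L2_def using t by (auto simp: norm_indicator_sq)
 have "norm (drift b t w) \<le> (LI lborel (%s. norm (cut t b (s, w))))"
  unfolding drift_def set_lebesgue_integral_def using integral_norm_bound[of lborel "%s. cut t b (s, w)"]
  by (simp add: cut_def)
 also have "... = (LI lborel (%s. norm (cut t b (s, w)) * norm (indicator {0..t} s :: real)))"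
  by (intro LI_integral_cong) (auto simp: cut_def split: split_indicator)
 finally have "(norm (drift b t w))\<^sup>2 \<le> (LI lborel (%s. norm (cut t b (s, w)) * norm (indicator {0..t} s :: real)))\<^sup>2"
  by (intro power_mono) auto
 also have "... \<le> rsq lborel (%s. cut t b (s, w)) * rsq lborel (%s. indicator {0..t} s :: real)"
  by (rule L2_Cauchy_Schwarz[OF L i])
 also have "rsq lborel (%s. indicator {0..t} s :: real) = t" using t by (simp add: norm_indicator_sq)
 finally show ?thesis by (simp add: mult.commute)
qed

lemma cut_L2_mono:
 assumes "L2 Lam (cut T H)" "progressive F T H" "0 \<le> t" "t \<le> T"
 shows "L2 Lam (cut t H)"
 by (rule L2_bound[OF assms(1) cut_measurable[OF assms(2-4)], where K=1])
  (use assms(4) in \<open>auto simp: cut_def split: split_indicator\<close>)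

lemma cut_const_L2:
 assumes z: "L2 M z" shows "L2 Lam (cut t (%_. z))"
proof -
 have zm[measurable]: "z \<in> bm M" using z by (simp add: L2_def)
 have m: "cut t (%_. z) \<in> bm Lam" unfolding cut_def by measurable
 \<comment> \<open>Left end \<open>-1\<close>, because \<open>Lam_term\<close> deals with half-open
   intervals and time 0 has to be included.\<close>
 have i: "integrable Lam (%x. indicator {-1<..t} (fst x) * (norm (z (snd x)))\<^sup>2)"
  using Lam_term(1)[of "%w. (norm (z w))\<^sup>2"] z by (simp add: L2_def)
 have "integrable Lam (%x. (norm (cut t (%_. z) x))\<^sup>2)"
  by (rule LI_integrable_bound[OF i])
   (use m in \<open>auto simp: cut_def split: split_indicator\<close>)
 with m show ?thesis by (simp add: L2_def)
qed

lemma drift_L2: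
 assumes b: "progressive F T b" "L2 Lam (cut T b)" and t: "0 \<le> t" "t \<le> T"
 shows "L2 M (drift b t)" "rsq M (drift b t) \<le> t * rsq Lam (cut t b)"
proof -
 have L: "L2 Lam (cut t b)" by (rule cut_L2_mono[OF b(2,1) t])
 have m: "drift b t \<in> bm M"
  using F_measurable_M[OF t(1) progressive_at[OF progressive_drift[OF b(1)]]] t by auto
 have i: "integrable Lam (%(s, w). (norm (cut t b (s, w)))\<^sup>2)" using L by (simp add: L2_def split_beta')
 have I: "integrable M (%w. t * rsq lborel (%s. cut t b (s, w)))"
  using PS.integrable_snd[OF i] by simp
 have le: "AE w in M. (norm (drift b t w))\<^sup>2 \<le> t * rsq lborel (%s. cut t b (s, w))"
  using L2_path[OF L] by eventually_elim (rule drift_norm_le[OF _ t(1)])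
 have J: "integrable M (%w. (norm (drift b t w))\<^sup>2)"
  by (rule LI_integrable_bound[OF I]) (use m le t in \<open>auto elim!: eventually_mono simp: integral_nonneg_AE\<close>)
 then show "L2 M (drift b t)" using m by (simp add: L2_def)
 have "rsq M (drift b t) \<le> (LI M (%w. t * rsq lborel (%s. cut t b (s, w))))"
  by (rule integral_mono_AE[OF J I le])
 also have "... = t * rsq Lam (cut t b)"
  using PS.integral_snd[OF i] by (simp add: split_beta')
 finally show "rsq M (drift b t) \<le> t * rsq Lam (cut t b)" .
qed

lemma cut_L2_of_bounded_moments:
 fixes H :: "real => 'w => 'a::euclidean_space"
 assumes T: "0 \<le> T" and H: "progressive F T H" and L: "\<And>t. t \<in> {0..T} ==> L2 M (H t)"
  and C: "\<And>t. t \<in> {0..T} ==> (rsq M (H t)) \<le> C"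
 shows "L2 Lam (cut T H)"
 unfolding L2_iff_nn
proof
 show m: "cut T H \<in> bm Lam" by (rule cut_measurable[OF H T]) simp
 have "nsq Lam (cut T H) = (NI lborel (%s. (nsq M (%w. cut T H (s, w)))))"
  by (rule nn_integral_fst[symmetric]) (use m in measurable)
 also have "... \<le> (NI lborel (%s. ennreal (C * indicator {0..T} s)))"
 proof (rule nn_integral_mono)
  fix s
  show "nsq M (%w. cut T H (s, w)) \<le> ennreal (C * indicator {0..T} s)"
   using C[of s] L2_nn_integral[OF L[of s]] by (cases "s \<in> {0..T}") (auto simp: cut_def ennreal_leI)
 qed
 also have "... = ennreal (LI lborel (%s. C * indicator {0..T} s))"
 proof (rule nn_integral_eq_integral)
  have "0 \<le> C" using C[of 0] T order_trans[of 0 "\<integral>w. (norm (H 0 w))\<^sup>2 \<partial>M" C] by (simp add: integral_nonneg_AE)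
  then show "AE s in lborel. 0 \<le> C * indicator {0..T} s" by simp
 qed (use T in simp)
 also have "... < \<infinity>" by simp
 finally show "nsq Lam (cut T H) < \<infinity>" .
qed

lemma drift_cut_L2:
 assumes T: "0 \<le> T" and b: "progressive F T b" "L2 Lam (cut T b)"
 shows "L2 Lam (cut T (drift b))"
proof (rule cut_L2_of_bounded_moments[OF T progressive_drift[OF b(1)]])
 fix t assume t: "t \<in> {0..T}"
 then have t': "0 \<le> t" "t \<le> T" by auto
 show "L2 M (drift b t)" by (rule drift_L2(1)[OF b t'])
 have "rsq Lam (cut t b) \<le> rsq Lam (cut T b)"
 proof (rule integral_mono)
  show "integrable Lam (%x. (norm (cut t b x))\<^sup>2)" using cut_L2_mono[OF b(2,1) t'] by (simp add: L2_def)
  show "integrable Lam (%x. (norm (cut T b x))\<^sup>2)" using b(2) by (simp add: L2_def)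
 qed (use t' in \<open>auto simp: cut_def split: split_indicator\<close>)
 moreover have "0 \<le> rsq Lam (cut t b)" by (simp add: integral_nonneg_AE)
 ultimately have "t * rsq Lam (cut t b) \<le> T * rsq Lam (cut T b)"
  using t' by (intro mult_mono) auto
 then show "rsq M (drift b t) \<le> T * rsq Lam (cut T b)"
  using drift_L2(2)[OF b t'] by linarith
qed

lemma ito_cut_process_L2:
 fixes H J :: "real => 'w => 'a::euclidean_space"
 assumes T: "0 \<le> T" and J: "progressive F T J" and I: "\<And>t. t \<in> {0..T} ==> has_ito_integral M F (W j) t H (J t)"
 shows "L2 Lam (cut T J)"
proof (rule cut_L2_of_bounded_moments[OF T J])
 have L: "L2 Lam (cut T H)" using ito_cut_L2[OF I[of T] T] T by simp
 have H: "progressive F T H" using I[of T] T by (simp add: has_ito_integral_def)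
 fix t assume t: "t \<in> {0..T}"
 then have t': "0 \<le> t" "t \<le> T" by auto
 show "L2 M (J t)" by (rule ito_L2[OF I[OF t] t'(1)])
 have "rsq M (J t) = rsq Lam (cut t H)"
  using ito_isometry[OF I[OF t] I[OF t] t'(1,1)] by (simp add: power2_norm_eq_inner)
 also have "... \<le> rsq Lam (cut T H)"
 proof (rule integral_mono)
  show "integrable Lam (%x. (norm (cut t H x))\<^sup>2)" using cut_L2_mono[OF L H t'] by (simp add: L2_def)
  show "integrable Lam (%x. (norm (cut T H x))\<^sup>2)" using L by (simp add: L2_def)
 qed (use t' in \<open>auto simp: cut_def split: split_indicator\<close>)
 finally show "rsq M (J t) \<le> rsq Lam (cut T H)" .
qed

lemma inner_drift:
 assumes z: "L2 M z" and L: "L2 Lam (cut t b)" and D: "L2 M (drift b t)"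
 shows "(LI M (%w. z w \<bullet> drift b t w)) = (LI Lam (%x. cut t (%_. z) x \<bullet> cut t b x))"
proof -
 have i: "integrable Lam (%x. cut t (%_. z) x \<bullet> cut t b x)"
  by (rule L2_inner_integrable[OF cut_const_L2[OF z] L])
 then have i': "integrable Lam (%(s, w). cut t (%_. z) (s, w) \<bullet> cut t b (s, w))" by (simp add: split_beta')
 have "(LI Lam (%x. cut t (%_. z) x \<bullet> cut t b x)) = (LI M (%w. (LI lborel (%s. cut t (%_. z) (s, w) \<bullet> cut t b (s, w)))))"
  using PS.integral_snd[OF i'] by (simp add: split_beta')
 also have "... = (LI M (%w. z w \<bullet> drift b t w))"
 proof (rule integral_cong_AE)
  show "(%w. \<integral>s. cut t (%_. z) (s, w) \<bullet> cut t b (s, w) \<partial>lborel) \<in> bm M"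
   using PS.integrable_snd[OF i'] by simp
  show "(%w. z w \<bullet> drift b t w) \<in> bm M"
   using L2_measurable[OF z] L2_measurable[OF D] by measurable
  show "AE w in M. (LI lborel (%s. cut t (%_. z) (s, w) \<bullet> cut t b (s, w))) = z w \<bullet> drift b t w"
   using L2_path[OF L]
  proof eventually_elim
   case (elim w)
   have "(LI lborel (%s. cut t (%_. z) (s, w) \<bullet> cut t b (s, w))) = (LI lborel (%s. z w \<bullet> cut t b (s, w)))"
    by (intro LI_integral_cong) (auto simp: cut_def split: split_indicator)
   also have "... = z w \<bullet> (LI lborel (%s. cut t b (s, w)))"
    using path_integrable[OF elim] by simp
   finally show ?case by (simp add: drift_def set_lebesgue_integral_def cut_def)
  qed
 qed
 finally show ?thesis by simp
qed

lemma drift_product: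
 fixes b g :: "real => 'w => 'a::euclidean_space"
 assumes t: "0 \<le> t" and b: "progressive F t b" "L2 Lam (cut t b)" and g: "progressive F t g" "L2 Lam (cut t g)"
 shows "(LI M (%w. drift b t w \<bullet> drift g t w))
  = (LI Lam (%x. cut t b x \<bullet> cut t (drift g) x)) + (LI Lam (%x. cut t (drift b) x \<bullet> cut t g x))"
proof -
 have i1: "integrable Lam (%x. cut t b x \<bullet> cut t (drift g) x)"
  by (rule L2_inner_integrable[OF b(2) drift_cut_L2[OF t g]])
 have i2: "integrable Lam (%x. cut t (drift b) x \<bullet> cut t g x)"
  by (rule L2_inner_integrable[OF drift_cut_L2[OF t b] g(2)])
 have i1': "integrable Lam (%(s, w). cut t b (s, w) \<bullet> cut t (drift g) (s, w))"
  and i2': "integrable Lam (%(s, w). cut t (drift b) (s, w) \<bullet> cut t g (s, w))"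
  using i1 i2 by (simp_all add: split_beta')
 have "(LI Lam (%x. cut t b x \<bullet> cut t (drift g) x)) + (LI Lam (%x. cut t (drift b) x \<bullet> cut t g x))
  = (LI M (%w. (LI lborel (%s. cut t b (s, w) \<bullet> cut t (drift g) (s, w))) + (LI lborel (%s. cut t (drift b) (s, w) \<bullet> cut t g (s, w)))))"
  using PS.integral_snd[OF i1'] PS.integral_snd[OF i2'] PS.integrable_snd[OF i1'] PS.integrable_snd[OF i2']
  by (simp add: split_beta')
 also have "... = (LI M (%w. drift b t w \<bullet> drift g t w))"
 proof (rule integral_cong_AE)
  show "(%w. (LI lborel (%s. cut t b (s, w) \<bullet> cut t (drift g) (s, w))) + (LI lborel (%s. cut t (drift b) (s, w) \<bullet> cut t g (s, w)))) \<in> bm M"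
   using PS.integrable_snd[OF i1'] PS.integrable_snd[OF i2'] by simp
  show "(%w. drift b t w \<bullet> drift g t w) \<in> bm M"
   using L2_measurable[OF drift_L2(1)[OF b t order_refl]] L2_measurable[OF drift_L2(1)[OF g t order_refl]]
   by measurable
  show "AE w in M. (LI lborel (%s. cut t b (s, w) \<bullet> cut t (drift g) (s, w))) + (LI lborel (%s. cut t (drift b) (s, w) \<bullet> cut t g (s, w)))
   = drift b t w \<bullet> drift g t w"
   using L2_path[OF b(2)] L2_path[OF g(2)]
  proof eventually_elim
   case (elim w)
   let ?f = "%s. cut t b (s, w)" and ?g = "%s. cut t g (s, w)"
   have I: "(LI lborel (%r. indicator {..s} r *\<^sub>R cut t h (r, w))) = drift h s w" if "s \<in> {0..t}" for s and h :: "real => 'w => 'a"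
    using drift_cut[of s t h w] that by simp
   have e1: "(LI lborel (%s. cut t b (s, w) \<bullet> cut t (drift g) (s, w)))
    = (LI lborel (%s. ?f s \<bullet> (LI lborel (%r. indicator {..s} r *\<^sub>R ?g r))))"
   proof (intro LI_integral_cong refl)
    fix s show "cut t b (s, w) \<bullet> cut t (drift g) (s, w) = ?f s \<bullet> (LI lborel (%r. indicator {..s} r *\<^sub>R ?g r))"
     using I[of s g] by (cases "s \<in> {0..t}") (auto simp: cut_def)
   qed
   have e2: "(LI lborel (%s. cut t (drift b) (s, w) \<bullet> cut t g (s, w)))
    = (LI lborel (%s. (LI lborel (%r. indicator {..s} r *\<^sub>R ?f r)) \<bullet> ?g s))"
   proof (intro LI_integral_cong refl)
    fix s show "cut t (drift b) (s, w) \<bullet> cut t g (s, w) = (LI lborel (%r. indicator {..s} r *\<^sub>R ?f r)) \<bullet> ?g s"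
     using I[of s b] by (cases "s \<in> {0..t}") (auto simp: cut_def)
   qed
   have d: "drift h t w = (LI lborel (%s. cut t h (s, w)))" for h :: "real => 'w => 'a"
    by (simp add: drift_def set_lebesgue_integral_def cut_def)
   show ?case unfolding e1 e2 d
    by (rule integral_product(3)[OF path_integrable[OF elim(1)] path_integrable[OF elim(2)], symmetric])
  qed
 qed
 finally show ?thesis by simp
qed

end

section \<open>Ito processes and expectations of products\<close>

context brownian_filtration
begin

text \<open>The stochastic integrals are given separately for every time, as in the state equation;
  their integrability conditions sit inside \<open>has_ito_integral\<close>. No path regularity is
  required.\<close>

definition ito_process ::
 "real => ('w => 'a::euclidean_space) => (real => 'w => 'a) => ('j => real => 'w => 'a) => (real => 'w => 'a) => bool" where
 "ito_process T x0 b \<sigma> X \<longleftrightarrow>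
  x0 \<in> bm (F 0) \<and> L2 M x0 \<and> progressive F T b \<and> L2 Lam (cut T b) \<and>
  progressive F T X \<and> L2 Lam (cut T X) \<and>
  (\<forall>t\<in>{0..T}. \<exists>J. (\<forall>j. has_ito_integral M F (W j) t (\<sigma> j) (J j)) \<and>
    (AE w in M. X t w = x0 w + drift b t w + (\<Sum>j\<in>UNIV. J j w)))"

text \<open>The martingale part, recovered by subtraction: it is jointly measurable without any
  choice of versions of the integrals.\<close>

definition noise :: "('w => 'a::euclidean_space) => (real => 'w => 'a) => (real => 'w => 'a) => real => 'w => 'a" where
 "noise x0 b X t w = X t w - x0 w - drift b t w"

lemma ito_processD:
 assumes "ito_process T x0 b \<sigma> X"
 shows "x0 \<in> bm (F 0)" "L2 M x0" "progressive F T b" "L2 Lam (cut T b)"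
  "progressive F T X" "L2 Lam (cut T X)"
 using assms by (auto simp: ito_process_def)

lemma ito_process_noise:
 assumes X: "ito_process T x0 b \<sigma> X" and t: "t \<in> {0..T}"
 obtains J where "\<And>j. has_ito_integral M F (W j) t (\<sigma> j) (J j)" "AE w in M. noise x0 b X t w = (\<Sum>j\<in>UNIV. J j w)"
  "L2 M (noise x0 b X t)" "L2 M (X t)"
proof -
 have t': "0 \<le> t" "t \<le> T" using t by auto
 obtain J where J: "\<And>j. has_ito_integral M F (W j) t (\<sigma> j) (J j)"
  and e: "AE w in M. X t w = x0 w + drift b t w + (\<Sum>j\<in>UNIV. J j w)"
  using X t unfolding ito_process_def by blast
 have e': "AE w in M. noise x0 b X t w = (\<Sum>j\<in>UNIV. J j w)"
  using e by eventually_elim (simp add: noise_def)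
 have L: "L2 M (%w. \<Sum>j\<in>UNIV. J j w)" by (intro L2_sum ito_L2[OF J t'(1)])
 have Xm: "X t \<in> bm M"
  using F_measurable_M[OF t'(1) progressive_at[OF ito_processD(5)[OF X] t]] .
 have D: "L2 M (drift b t)" by (rule drift_L2(1)[OF ito_processD(3,4)[OF X] t'])
 have nm: "noise x0 b X t \<in> bm M"
  unfolding noise_def[abs_def] using Xm L2_measurable[OF D] L2_measurable[OF ito_processD(2)[OF X]] by measurable
 have N: "L2 M (noise x0 b X t)" by (rule L2_cong_AE[OF L nm]) (use e' in auto)
 have "L2 M (%w. noise x0 b X t w + x0 w + drift b t w)"
  by (intro L2_add N D ito_processD(2)[OF X])
 then have "L2 M (X t)" by (simp add: noise_def)
 with J e' N that show ?thesis by blast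
qed

lemma noise_cut_L2:
 assumes X: "ito_process T x0 b \<sigma> X" and T: "0 \<le> T"
 shows "L2 Lam (cut T (noise x0 b X))"
proof -
 have "cut T (noise x0 b X) = (%x. cut T X x - cut T (%_. x0) x - cut T (drift b) x)"
  by (auto simp: cut_def noise_def algebra_simps)
 then show ?thesis
  using L2_diff[OF L2_diff[OF ito_processD(6)[OF X] cut_const_L2[OF ito_processD(2)[OF X]]] drift_cut_L2[OF T ito_processD(3,4)[OF X]]]
  by simp
qed

lemma noise_orthogonal:
 assumes X: "ito_process T x0 b \<sigma> X" and s: "0 \<le> s" "s \<le> t" "t \<le> T"
  and z: "z \<in> bm (F s)" "L2 M z"
 shows "(LI M (%w. z w \<bullet> noise x0 b X t w)) = (LI M (%w. z w \<bullet> noise x0 b X s w))"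
proof -
 have st: "s \<in> {0..T}" "t \<in> {0..T}" and t0: "0 \<le> t" using s by auto
 obtain J where J: "\<And>j. has_ito_integral M F (W j) t (\<sigma> j) (J j)" "AE w in M. noise x0 b X t w = (\<Sum>j\<in>UNIV. J j w)"
  "L2 M (noise x0 b X t)" using ito_process_noise[OF X st(2)] by blast
 obtain I where I: "\<And>j. has_ito_integral M F (W j) s (\<sigma> j) (I j)" "AE w in M. noise x0 b X s w = (\<Sum>j\<in>UNIV. I j w)"
  "L2 M (noise x0 b X s)" using ito_process_noise[OF X st(1)] by blast
 have sum: "(LI M (%w. z w \<bullet> n w)) = (\<Sum>j\<in>UNIV. \<integral>w. z w \<bullet> G j w \<partial>M)"
  if "AE w in M. n w = (\<Sum>j\<in>UNIV. G j w)" "\<And>j. L2 M (G j)" "L2 M n" for n and G :: "'j => 'w => 'a"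
 proof -
  have "(LI M (%w. z w \<bullet> n w)) = (LI M (%w. (\<Sum>j\<in>UNIV. z w \<bullet> G j w)))"
  proof (rule integral_cong_AE)
   show "(%w. z w \<bullet> n w) \<in> bm M" using L2_measurable[OF z(2)] L2_measurable[OF that(3)] by measurable
   show "(%w. \<Sum>j\<in>UNIV. z w \<bullet> G j w) \<in> bm M"
    using L2_measurable[OF z(2)] L2_measurable[OF that(2)] by measurable
  qed (use that(1) in \<open>auto simp: inner_sum_right\<close>)
  then show ?thesis
   using L2_inner_integrable[OF z(2) that(2)] by (simp add: LI_integral_sum)
 qed
 show ?thesis
  unfolding sum[OF J(2) ito_L2[OF J(1) t0] J(3)] sum[OF I(2) ito_L2[OF I(1) s(1)] I(3)]
  by (intro sum.cong refl ito_orthogonal[OF J(1) I(1) s(1,2) z])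
qed

text \<open>By orthogonality the noise may be taken at time 0, where the isometry over a null set of
  times makes each integral vanish almost surely.\<close>

lemma noise_mean_zero:
 assumes X: "ito_process T x0 b \<sigma> X" and t: "t \<in> {0..T}" and z: "z \<in> bm (F 0)" "L2 M z"
 shows "(LI M (%w. z w \<bullet> noise x0 b X t w)) = 0"
proof -
 have 0: "0 \<in> {0..T}" using t by auto
 obtain I where I: "\<And>j. has_ito_integral M F (W j) 0 (\<sigma> j) (I j)" "AE w in M. noise x0 b X 0 w = (\<Sum>j\<in>UNIV. I j w)"
  "L2 M (noise x0 b X 0)" using ito_process_noise[OF X 0] by blast
 have Iz: "AE w in M. I j w = 0" for j
 proof (rule L2_norm_sq_eq_0[OF ito_L2[OF I(1) order_refl]])
  have "rsq M (I j) = rsq Lam (cut 0 (\<sigma> j))"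
   using ito_isometry[OF I(1) I(1) order_refl order_refl, of j j] by (simp add: power2_norm_eq_inner)
  also have "... = (LI Lam (%(s, w). (norm (cut 0 (\<sigma> j) (s, w)))\<^sup>2))" by (simp add: split_beta')
  also have "... = (LI lborel (%s. (rsq M (%w. cut 0 (\<sigma> j) (s, w)))))"
   using ito_cut_L2[OF I(1) order_refl, of j] by (intro PS.integral_fst[symmetric]) (simp add: L2_def split_beta')
  also have "... = (\<integral>s. 0 \<partial>(lborel :: real measure))"
  proof (rule integral_cong_AE)
   show "(%s. \<integral>w. (norm (cut 0 (\<sigma> j) (s, w)))\<^sup>2 \<partial>M) \<in> bm lborel"
    using PS.integrable_fst[of "%s w. (norm (cut 0 (\<sigma> j) (s, w)))\<^sup>2"] ito_cut_L2[OF I(1) order_refl, of j]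
    by (simp add: L2_def split_beta')
   show "AE s in lborel. (rsq M (%w. cut 0 (\<sigma> j) (s, w))) = 0"
    using AE_lborel_singleton[of "0::real"] by eventually_elim (simp add: cut_def)
  qed simp
  finally show "rsq M (I j) = 0" by simp
 qed
 have "(LI M (%w. z w \<bullet> noise x0 b X t w)) = (LI M (%w. z w \<bullet> noise x0 b X 0 w))"
  by (rule noise_orthogonal[OF X _ _ _ z]) (use t in auto)
 also have "... = (LI M (%w. 0))"
 proof (rule integral_cong_AE)
  have "AE w in M. \<forall>j. I j w = 0" using Iz by (simp add: AE_all_countable)
  then show "AE w in M. z w \<bullet> noise x0 b X 0 w = 0" using I(2) by eventually_elim simp
  show "(%w. z w \<bullet> noise x0 b X 0 w) \<in> bm M"
   using L2_measurable[OF z(2)] L2_measurable[OF I(3)] by measurable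
 qed simp
 finally show ?thesis by simp
qed

lemma noise_isometry:
 assumes X: "ito_process T x0 b \<sigma> X" and Y: "ito_process T y0 g \<rho> Y" and t: "t \<in> {0..T}"
 shows "(LI M (%w. noise x0 b X t w \<bullet> noise y0 g Y t w)) = (LI Lam (%x. (\<Sum>j\<in>UNIV. cut t (\<sigma> j) x \<bullet> cut t (\<rho> j) x)))"
  and "\<And>j. L2 Lam (cut t (\<sigma> j))"
proof -
 have t0: "0 \<le> t" using t by auto
 obtain J where J: "\<And>j. has_ito_integral M F (W j) t (\<sigma> j) (J j)" "AE w in M. noise x0 b X t w = (\<Sum>j\<in>UNIV. J j w)"
  "L2 M (noise x0 b X t)" using ito_process_noise[OF X t] by blast
 obtain I where I: "\<And>j. has_ito_integral M F (W j) t (\<rho> j) (I j)" "AE w in M. noise y0 g Y t w = (\<Sum>j\<in>UNIV. I j w)"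
  "L2 M (noise y0 g Y t)" using ito_process_noise[OF Y t] by blast
 note LJ = ito_L2[OF J(1) t0] and LI = ito_L2[OF I(1) t0]
 show "L2 Lam (cut t (\<sigma> j))" for j by (rule ito_cut_L2[OF J(1) t0])
 have "(LI M (%w. noise x0 b X t w \<bullet> noise y0 g Y t w)) = (LI M (%w. (\<Sum>j\<in>UNIV. \<Sum>i\<in>UNIV. J j w \<bullet> I i w)))"
 proof (rule integral_cong_AE)
  show "AE w in M. noise x0 b X t w \<bullet> noise y0 g Y t w = (\<Sum>j\<in>UNIV. \<Sum>i\<in>UNIV. J j w \<bullet> I i w)"
   using J(2) I(2) by eventually_elim (simp only: inner_sum_left, simp only: inner_sum_right)
 qed (use L2_measurable[OF J(3)] L2_measurable[OF I(3)] L2_measurable[OF LJ] L2_measurable[OF LI] in measurable)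
 also have "... = (\<Sum>j\<in>UNIV. \<Sum>i\<in>UNIV. \<integral>w. J j w \<bullet> I i w \<partial>M)"
  using L2_inner_integrable[OF LJ LI]
  by (simp add: LI_integral_sum)
 also have "... = (\<Sum>j\<in>UNIV. \<Sum>i\<in>UNIV. if i = j then \<integral>x. cut t (\<sigma> j) x \<bullet> cut t (\<rho> j) x \<partial>Lam else 0)"
  by (intro sum.cong refl) (use ito_isometry[OF J(1) I(1) t0 t0] in auto)
 also have "... = (\<Sum>j\<in>UNIV. \<integral>x. cut t (\<sigma> j) x \<bullet> cut t (\<rho> j) x \<partial>Lam)"
  by (simp add: sum.delta)
 also have "... = (LI Lam (%x. (\<Sum>j\<in>UNIV. cut t (\<sigma> j) x \<bullet> cut t (\<rho> j) x)))"
  using L2_inner_integrable[OF ito_cut_L2[OF J(1) t0] ito_cut_L2[OF I(1) t0]]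
  by (intro LI_integral_sum[symmetric]) auto
 finally show "(LI M (%w. noise x0 b X t w \<bullet> noise y0 g Y t w)) = (LI Lam (%x. (\<Sum>j\<in>UNIV. cut t (\<sigma> j) x \<bullet> cut t (\<rho> j) x)))" .
qed

text \<open>Conditioning on time \<open>s\<close> replaces the terminal noise by the noise at time \<open>s\<close>.\<close>

lemma drift_noise:
 fixes b :: "real => 'w => 'a::euclidean_space"
 assumes Y: "ito_process T y0 g \<rho> Y" and b: "progressive F T b" "L2 Lam (cut T b)" and t: "t \<in> {0..T}"
 shows "(LI M (%w. drift b t w \<bullet> noise y0 g Y t w)) = (LI Lam (%x. cut t b x \<bullet> cut t (noise y0 g Y) x))"
proof -
 have t': "0 \<le> t" "t \<le> T" "0 \<le> T" using t by auto
 obtain I where NL: "L2 M (noise y0 g Y t)" using ito_process_noise[OF Y t] by blast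
 have bL: "L2 Lam (cut t b)" by (rule cut_L2_mono[OF b(2,1) t'(1,2)])
 have NcT: "L2 Lam (cut T (noise y0 g Y))" by (rule noise_cut_L2[OF Y t'(3)])
 have Nc: "L2 Lam (cut t (noise y0 g Y))"
 proof (rule L2_bound[OF NcT, where K=1])
  show "cut t (noise y0 g Y) \<in> bm Lam"
   unfolding cut_cut[OF t'(2)] using L2_measurable[OF NcT] by measurable
 qed (use t' in \<open>auto simp: cut_def split: split_indicator\<close>)
 have i1: "integrable Lam (%(s, w). cut t b (s, w) \<bullet> cut t (%_. noise y0 g Y t) (s, w))"
  using L2_inner_integrable[OF bL cut_const_L2[OF NL]] by (simp add: split_beta')
 have i2: "integrable Lam (%(s, w). cut t b (s, w) \<bullet> cut t (noise y0 g Y) (s, w))"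
  using L2_inner_integrable[OF bL Nc] by (simp add: split_beta')
 have "(LI M (%w. drift b t w \<bullet> noise y0 g Y t w)) = (LI Lam (%x. cut t b x \<bullet> cut t (%_. noise y0 g Y t) x))"
  using inner_drift[OF NL bL drift_L2(1)[OF b t'(1,2)]] by (simp add: inner_commute)
 also have "... = (LI lborel (%s. (LI M (%w. cut t b (s, w) \<bullet> cut t (%_. noise y0 g Y t) (s, w)))))"
  using PS.integral_fst[OF i1] by (simp add: split_beta')
 also have "... = (LI lborel (%s. (LI M (%w. cut t b (s, w) \<bullet> cut t (noise y0 g Y) (s, w)))))"
 proof (rule integral_cong_AE)
  show "AE s in lborel. (LI M (%w. cut t b (s, w) \<bullet> cut t (%_. noise y0 g Y t) (s, w)))
   = (LI M (%w. cut t b (s, w) \<bullet> cut t (noise y0 g Y) (s, w)))"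
   using L2_time[OF bL]
  proof eventually_elim
   case (elim s)
   show ?case
   proof (cases "s \<in> {0..t}")
    case True
    then have sT: "s \<in> {0..T}" using t' by auto
    have "L2 M (b s)" using elim True by (simp add: cut_def)
    from noise_orthogonal[OF Y _ _ t'(2) progressive_at[OF b(1) sT] this] True
    show ?thesis by (simp add: cut_def)
   qed (simp add: cut_def)
  qed
 qed (use PS.integrable_fst[OF i1] PS.integrable_fst[OF i2] in auto)
 also have "... = (LI Lam (%x. cut t b x \<bullet> cut t (noise y0 g Y) x))"
  using PS.integral_fst[OF i2] by (simp add: split_beta')
 finally show ?thesis .
qed

text \<open>The product rule in expectation. Writing both processes as initial value plus drift plus
  noise gives nine products, two of which vanish. All but the product of the initial values are time
  integrals, and in their sum the three parts of \<open>X\<close> and of \<open>Y\<close> are put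
  together again.\<close>

theorem ito_moment:
 fixes X Y :: "real => 'w => 'a::euclidean_space"
 assumes X: "ito_process T x0 b \<sigma> X" and Y: "ito_process T y0 g \<rho> Y" and t: "t \<in> {0..T}"
 defines "R \<equiv> %x. cut t b x \<bullet> cut t Y x + cut t X x \<bullet> cut t g x + (\<Sum>j\<in>UNIV. cut t (\<sigma> j) x \<bullet> cut t (\<rho> j) x)"
 shows "integrable Lam R"
  and "(LI M (%w. X t w \<bullet> Y t w)) = (LI M (%w. x0 w \<bullet> y0 w)) + (LI Lam (%x. R x))"
proof -
 have t': "0 \<le> t" "t \<le> T" "0 \<le> T" using t by auto
 note DX = ito_processD[OF X] and DY = ito_processD[OF Y]
 have bL: "L2 Lam (cut t b)" and gL: "L2 Lam (cut t g)" and XL: "L2 Lam (cut t X)" and YL: "L2 Lam (cut t Y)"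
  using cut_L2_mono[OF _ _ t'(1,2)] DX DY by blast+
 have pb: "progressive F t b" "progressive F t g" using progressive_mono t'(2) DX(3) DY(3) by blast+
 have dbL: "L2 Lam (cut t (drift b))" and dgL: "L2 Lam (cut t (drift g))"
  using drift_cut_L2[OF t'(1) pb(1) bL] drift_cut_L2[OF t'(1) pb(2) gL] by auto
 have x0L: "L2 Lam (cut t (%_. x0))" and y0L: "L2 Lam (cut t (%_. y0))" using cut_const_L2 DX(2) DY(2) by blast+
 obtain NX: "L2 M (noise x0 b X t)" "L2 M (X t)" using ito_process_noise[OF X t] by blast
 obtain NY: "L2 M (noise y0 g Y t)" "L2 M (Y t)" using ito_process_noise[OF Y t] by blast
 have db: "L2 M (drift b t)" and dg: "L2 M (drift g t)"
  using drift_L2(1)[OF DX(3,4) t'(1,2)] drift_L2(1)[OF DY(3,4) t'(1,2)] by auto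
 have cn: "cut t (noise z h Z) = (%x. cut t Z x - cut t (%_. z) x - cut t (drift h) x)"
  for z and h Z :: "real => 'w => 'a"
  by (auto simp: cut_def noise_def algebra_simps)
 have nXL: "L2 Lam (cut t (noise x0 b X))" and nYL: "L2 Lam (cut t (noise y0 g Y))"
  unfolding cn by (intro L2_diff XL YL x0L y0L dbL dgL)+
 note i = L2_inner_integrable
 have S: "integrable Lam (%x. \<Sum>j\<in>UNIV. cut t (\<sigma> j) x \<bullet> cut t (\<rho> j) x)"
  using noise_isometry(2)[OF X X t] noise_isometry(2)[OF Y Y t] by (intro LI_integrable_sum i) auto
 show "integrable Lam R" unfolding R_def
  using i[OF bL YL] i[OF XL gL] S by simp
 have a1: "(LI M (%w. x0 w \<bullet> drift g t w)) = (LI Lam (%x. cut t (%_. x0) x \<bullet> cut t g x))"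
  by (rule inner_drift[OF DX(2) gL dg])
 have a2: "(LI M (%w. drift b t w \<bullet> y0 w)) = (LI Lam (%x. cut t b x \<bullet> cut t (%_. y0) x))"
  using inner_drift[OF DY(2) bL db] by (simp add: inner_commute)
 have a3: "(LI M (%w. drift b t w \<bullet> drift g t w))
  = (LI Lam (%x. cut t b x \<bullet> cut t (drift g) x)) + (LI Lam (%x. cut t (drift b) x \<bullet> cut t g x))"
  by (rule drift_product[OF t'(1) pb(1) bL pb(2) gL])
 have a4: "(LI M (%w. x0 w \<bullet> noise y0 g Y t w)) = 0" by (rule noise_mean_zero[OF Y t DX(1,2)])
 have a5: "(LI M (%w. noise x0 b X t w \<bullet> y0 w)) = 0"
  using noise_mean_zero[OF X t DY(1,2)] by (simp add: inner_commute)
 have a6: "(LI M (%w. drift b t w \<bullet> noise y0 g Y t w)) = (LI Lam (%x. cut t b x \<bullet> cut t (noise y0 g Y) x))"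
  by (rule drift_noise[OF Y DX(3,4) t])
 have a7: "(LI M (%w. noise x0 b X t w \<bullet> drift g t w)) = (LI Lam (%x. cut t (noise x0 b X) x \<bullet> cut t g x))"
  using drift_noise[OF X DY(3,4) t] by (simp add: inner_commute)
 have a8: "(LI M (%w. noise x0 b X t w \<bullet> noise y0 g Y t w)) = (LI Lam (%x. (\<Sum>j\<in>UNIV. cut t (\<sigma> j) x \<bullet> cut t (\<rho> j) x)))"
  by (rule noise_isometry(1)[OF X Y t])
 let ?n = "noise x0 b X t" and ?m = "noise y0 g Y t"
 have "(LI M (%w. X t w \<bullet> Y t w)) = (\<integral>w. x0 w \<bullet> y0 w + x0 w \<bullet> drift g t w + drift b t w \<bullet> y0 w + drift b t w \<bullet> drift g t w
  + x0 w \<bullet> ?m w + ?n w \<bullet> y0 w + drift b t w \<bullet> ?m w + ?n w \<bullet> drift g t w + ?n w \<bullet> ?m w \<partial>M)"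
  by (intro LI_integral_cong refl) (simp add: noise_def inner_diff_left inner_diff_right)
 also have "... = (LI M (%w. x0 w \<bullet> y0 w)) + (LI M (%w. x0 w \<bullet> drift g t w)) + (LI M (%w. drift b t w \<bullet> y0 w)) + (LI M (%w. drift b t w \<bullet> drift g t w))
  + (LI M (%w. x0 w \<bullet> ?m w)) + (LI M (%w. ?n w \<bullet> y0 w)) + (LI M (%w. drift b t w \<bullet> ?m w)) + (LI M (%w. ?n w \<bullet> drift g t w)) + (LI M (%w. ?n w \<bullet> ?m w))"
  using i[OF DX(2) DY(2)] i[OF DX(2) dg] i[OF db DY(2)] i[OF db dg] i[OF DX(2) NY(1)] i[OF NX(1) DY(2)]
   i[OF db NY(1)] i[OF NX(1) dg] i[OF NX(1) NY(1)] by simp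
 also have "... = (LI M (%w. x0 w \<bullet> y0 w)) + (\<integral>x. cut t (%_. x0) x \<bullet> cut t g x + cut t b x \<bullet> cut t (%_. y0) x
   + cut t b x \<bullet> cut t (drift g) x + cut t (drift b) x \<bullet> cut t g x
   + cut t b x \<bullet> cut t (noise y0 g Y) x + cut t (noise x0 b X) x \<bullet> cut t g x
   + (\<Sum>j\<in>UNIV. cut t (\<sigma> j) x \<bullet> cut t (\<rho> j) x) \<partial>Lam)"
  unfolding a1 a2 a3 a4 a5 a6 a7 a8
  using i[OF x0L gL] i[OF bL y0L] i[OF bL dgL] i[OF dbL gL] i[OF bL nYL] i[OF nXL gL] S by simp
 also have "(%x. cut t (%_. x0) x \<bullet> cut t g x + cut t b x \<bullet> cut t (%_. y0) x
   + cut t b x \<bullet> cut t (drift g) x + cut t (drift b) x \<bullet> cut t g x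
   + cut t b x \<bullet> cut t (noise y0 g Y) x + cut t (noise x0 b X) x \<bullet> cut t g x
   + (\<Sum>j\<in>UNIV. cut t (\<sigma> j) x \<bullet> cut t (\<rho> j) x)) = R"
  unfolding R_def cn by (rule ext) (simp add: inner_diff_left inner_diff_right)
 finally show "(LI M (%w. X t w \<bullet> Y t w)) = (LI M (%w. x0 w \<bullet> y0 w)) + (LI Lam (%x. R x))" .
qed

lemma ito_process_linear:
 fixes A :: "'a::euclidean_space => 'c::euclidean_space"
 assumes A: "bounded_linear A" and X: "ito_process T x0 b \<sigma> X"
 shows "ito_process T (%w. A (x0 w)) (%s w. A (b s w)) (%j s w. A (\<sigma> j s w)) (%s w. A (X s w))"
proof -
 interpret bounded_linear A by fact
 note D = ito_processD[OF X]
 have Am: "A \<in> bm borel"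
  by (rule borel_measurable_continuous_onI[OF linear_continuous_on[OF A]])
 have prog: "progressive F T (%s w. A (H s w))" if "progressive F T H" for H
  using that unfolding progressive_def by (auto simp: split_beta' intro!: measurable_compose[OF _ Am])
 show ?thesis
  unfolding ito_process_def
 proof (intro conjI ballI)
  show "(%w. A (x0 w)) \<in> bm (F 0)" by (rule measurable_compose[OF D(1) Am])
  show "L2 M (%w. A (x0 w))" by (rule L2_linear[OF A D(2)])
  show "progressive F T (%s w. A (b s w))" "progressive F T (%s w. A (X s w))" using prog D by auto
  show "L2 Lam (cut T (%s w. A (b s w)))" "L2 Lam (cut T (%s w. A (X s w)))"
   unfolding cut_linear[OF A] using L2_linear[OF A] D by auto
  fix t assume t: "t \<in> {0..T}"
  then have t': "0 \<le> t" "t \<le> T" by auto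
  obtain J where J: "\<And>j. has_ito_integral M F (W j) t (\<sigma> j) (J j)"
   and e: "AE w in M. X t w = x0 w + drift b t w + (\<Sum>j\<in>UNIV. J j w)"
   using X t unfolding ito_process_def by blast
  show "\<exists>J. (\<forall>j. has_ito_integral M F (W j) t (%s w. A (\<sigma> j s w)) (J j)) \<and>
    (AE w in M. A (X t w) = A (x0 w) + drift (%s w. A (b s w)) t w + (\<Sum>j\<in>UNIV. J j w))"
  proof (intro exI[of _ "%j w. A (J j w)"] conjI allI)
   show "has_ito_integral M F (W j) t (%s w. A (\<sigma> j s w)) (%w. A (J j w))" for j
    by (rule ito_linear[OF A J t'(1)])
   show "AE w in M. A (X t w) = A (x0 w) + drift (%s w. A (b s w)) t w + (\<Sum>j\<in>UNIV. A (J j w))"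
    using e L2_path[OF cut_L2_mono[OF D(4,3) t']]
   proof eventually_elim
    case (elim w)
    have "drift (%s w. A (b s w)) t w = (LI lborel (%s. A (cut t b (s, w))))"
     by (simp add: drift_def set_lebesgue_integral_def cut_def scaleR)
    also have "... = A (LI lborel (%s. cut t b (s, w)))"
     by (rule integral_bounded_linear[OF A path_integrable[OF elim(2)]])
    finally have "drift (%s w. A (b s w)) t w = A (drift b t w)"
     by (simp add: drift_def set_lebesgue_integral_def cut_def)
    then show ?case using elim(1) by (simp add: add sum)
   qed
  qed
 qed
qed

end

section \<open>Stochastic differential equations with Lipschitz coefficients\<close>

lemma exp_tail_nn:
 assumes l: "0 < l"
 shows "(NI lborel (%t. ennreal (exp (- l * t)) * indicator {s..T} t)) \<le> ennreal (exp (- l * s) / l)"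
proof (cases "s \<le> T")
 case True
 have "(NI lborel (%t. ennreal (exp (- l * t)) * indicator {s..T} t)) = ennreal (- exp (- l * T) / l - (- exp (- l * s) / l))"
 proof (rule nn_integral_FTC_Icc)
  fix x
  show "((%t. - exp (- l * t) / l) has_real_derivative exp (- l * x)) (at x)"
   using l by (auto intro!: derivative_eq_intros)
 qed (use True in auto)
 also have "... \<le> ennreal (exp (- l * s) / l)"
  using l by (intro ennreal_leI) simp
 finally show ?thesis .
qed simp

text \<open>An exponential weight turns the Volterra inequality into a contraction.\<close>

lemma weighted_contraction:
 fixes u h :: "real => ennreal" and C T :: real
 assumes [measurable]: "u \<in> bm borel" "h \<in> bm borel"
  and C: "0 < C" and le: "\<And>t. t \<in> {0..T} ==> u t \<le> (\<integral>\<^sup>+s\<in>{0..t}. (u s + ennreal C * h s) \<partial>lborel)"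
  and fin: "(\<integral>\<^sup>+s\<in>{0..T}. u s \<partial>lborel) < \<infinity>"
 defines "w \<equiv> %t. ennreal (exp (- (1 + 4 * C) * t)) * indicator {0..T} t"
 shows "(NI lborel (%t. w t * u t)) \<le> ennreal (1/4) * (NI lborel (%t. w t * h t))"
proof -
 let ?l = "1 + 4 * C"
 have l: "0 < ?l" using C by simp
 have wm[measurable]: "w \<in> bm borel" unfolding w_def by measurable
 let ?G = "\<integral>\<^sup>+t. w t * u t \<partial>lborel" and ?H = "\<integral>\<^sup>+t. w t * h t \<partial>lborel"
 have "?G \<le> (NI lborel (%t. (NI lborel (%s. w t * ((u s + ennreal C * h s) * indicator {0..t} s)))))"
 proof (rule nn_integral_mono)
  fix t :: real
  show "w t * u t \<le> (NI lborel (%s. w t * ((u s + ennreal C * h s) * indicator {0..t} s)))"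
  proof (cases "t \<in> {0..T}")
   case True
   have "w t * u t \<le> w t * (\<integral>\<^sup>+s\<in>{0..t}. (u s + ennreal C * h s) \<partial>lborel)"
    by (rule mult_left_mono[OF le[OF True]]) simp
   then show ?thesis by (subst nn_integral_cmult) auto
  qed (simp add: w_def)
 qed
 also have "... = (NI lborel (%s. (NI lborel (%t. w t * ((u s + ennreal C * h s) * indicator {0..t} s)))))"
 proof (rule lborel_pair.Fubini')
  have "(%(s, t). w t * ((u s + ennreal C * h s) * (if 0 \<le> s \<and> s \<le> t then 1 else 0))) \<in> bm (lborel \<Otimes>\<^sub>M lborel)"
   by measurable
  also have "(%(s, t). w t * ((u s + ennreal C * h s) * (if 0 \<le> s \<and> s \<le> t then 1 else 0)))
   = (%(s, t). w t * ((u s + ennreal C * h s) * indicator {0..t} s))"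
   by (auto simp: fun_eq_iff split: split_indicator)
  finally show "(%(s, t). w t * ((u s + ennreal C * h s) * indicator {0..t} s)) \<in> bm (lborel \<Otimes>\<^sub>M lborel)" .
 qed
 also have "... \<le> (NI lborel (%s. ennreal (1 / ?l) * (w s * (u s + ennreal C * h s))))"
 proof (rule nn_integral_mono)
  fix s :: real
  have "(NI lborel (%t. w t * ((u s + ennreal C * h s) * indicator {0..t} s)))
   \<le> (NI lborel (%t. (u s + ennreal C * h s) * indicator {0..T} s * (ennreal (exp (- ?l * t)) * indicator {s..T} t)))"
   by (rule nn_integral_mono) (auto simp: w_def mult_ac split: split_indicator)
  also have "... = (u s + ennreal C * h s) * indicator {0..T} s * (NI lborel (%t. ennreal (exp (- ?l * t)) * indicator {s..T} t))"
   by (rule nn_integral_cmult) measurable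
  also have "... \<le> (u s + ennreal C * h s) * indicator {0..T} s * ennreal (exp (- ?l * s) / ?l)"
   by (intro mult_left_mono exp_tail_nn[OF l]) simp
  also have "ennreal (exp (- ?l * s) / ?l) = ennreal (1 / ?l) * ennreal (exp (- ?l * s))"
   using l by (subst ennreal_mult[symmetric]) auto
  also have "(u s + ennreal C * h s) * indicator {0..T} s * (ennreal (1 / ?l) * ennreal (exp (- ?l * s)))
   = ennreal (1 / ?l) * (w s * (u s + ennreal C * h s))"
   by (simp add: w_def mult_ac)
  finally show "(NI lborel (%t. w t * ((u s + ennreal C * h s) * indicator {0..t} s))) \<le> ennreal (1 / ?l) * (w s * (u s + ennreal C * h s))" .
 qed
 also have "... = ennreal (1 / ?l) * (?G + ennreal C * ?H)"
 proof -
  have "(NI lborel (%s. w s * (u s + ennreal C * h s))) = (NI lborel (%s. w s * u s + ennreal C * (w s * h s)))"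
   by (intro nn_integral_cong) (simp add: distrib_left mult_ac)
  also have "... = ?G + ennreal C * ?H" by (simp add: nn_integral_add nn_integral_cmult)
  finally show ?thesis by (simp add: nn_integral_cmult)
 qed
 finally have key: "?G \<le> ennreal (1 / ?l) * (?G + ennreal C * ?H)" .
 have "?G \<le> (\<integral>\<^sup>+s\<in>{0..T}. u s \<partial>lborel)"
 proof (rule nn_integral_mono)
  fix t :: real
  have "exp (- ?l * t) \<le> 1" if "0 \<le> t"
  proof -
   have "0 \<le> ?l * t" using l that by (intro mult_nonneg_nonneg) auto
   then show ?thesis unfolding exp_le_one_iff mult_minus_left by simp
  qed
  then have "ennreal (exp (- ?l * t)) * u t \<le> 1 * u t" if "0 \<le> t" using that by (intro mult_right_mono) auto
  then show "w t * u t \<le> u t * indicator {0..T} t" by (auto simp: w_def split: split_indicator)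
 qed
 then have "?G < \<infinity>" using fin by (rule le_less_trans)
 then obtain g where g: "?G = ennreal g" "0 \<le> g" by (cases ?G) auto
 show ?thesis
 proof (cases ?H)
  case (real r)
  have "ennreal g \<le> ennreal (1 / ?l * (g + C * r))"
   using key g real C l by (simp add: ennreal_mult'[symmetric] ennreal_plus[symmetric] del: ennreal_plus)
  then have "g \<le> 1 / ?l * (g + C * r)" using g real C l by (simp add: ennreal_le_iff)
  then have "?l * g \<le> g + C * r" using l by (simp add: field_simps)
  then have "C * (4 * g) \<le> C * r" by (simp add: algebra_simps)
  then have "g \<le> 1/4 * r" using C by simp
  then show ?thesis using g real by (simp add: ennreal_mult'[symmetric] ennreal_leI)
 qed (simp add: ennreal_mult_top)
qed

section \<open>Lipschitz coefficients and mean square estimates\<close>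

context brownian_filtration
begin

definition msq :: "(real => 'w => 'a::euclidean_space) => real => real => ennreal" where
 "msq Z T s = nsq M (%w. cut T Z (s, w))"

lemma msq_measurable:
 assumes "cut T Z \<in> bm Lam" shows "msq Z T \<in> bm borel"
proof -
 have "(%x. ennreal ((norm (cut T Z x))\<^sup>2)) \<in> bm (lborel \<Otimes>\<^sub>M M)" using assms by measurable
 from borel_measurable_nn_integral_fst[OF this] show ?thesis by (simp add: msq_def[abs_def])
qed

lemma msq_integral:
 assumes m: "cut T Z \<in> bm Lam" and f: "f \<in> bm borel"
 shows "(NI lborel (%s. f s * msq Z T s)) = (NI Lam (%x. f (fst x) * ennreal ((norm (cut T Z x))\<^sup>2)))"
proof -
 note [measurable] = f m
 have m': "(%x. f (fst x) * ennreal ((norm (cut T Z x))\<^sup>2)) \<in> bm Lam"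
  by measurable
 have "(NI Lam (%x. f (fst x) * ennreal ((norm (cut T Z x))\<^sup>2)))
  = (NI lborel (%s. (NI M (%w. f s * ennreal ((norm (cut T Z (s, w)))\<^sup>2)))))"
  using nn_integral_fst[OF m'] by simp
 also have "... = (NI lborel (%s. f s * msq Z T s))"
 proof (intro nn_integral_cong)
  fix s
  have "(%w. ennreal ((norm (cut T Z (s, w)))\<^sup>2)) \<in> bm M"
   using measurable_compose[OF measurable_Pair1' m, of s] by measurable
  then show "(NI M (%w. f s * ennreal ((norm (cut T Z (s, w)))\<^sup>2))) = f s * msq Z T s"
   unfolding msq_def by (rule nn_integral_cmult)
 qed
 finally show ?thesis by simp
qed

text \<open>Coefficients are random. Measurability is expressed by what the iteration uses, namely
  that inserting a progressive process yields a progressive process; the Lipschitz bound is uniform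
  in the sample point.\<close>

definition lipschitz_coeff :: "real => real => (real => 'w => 'a::euclidean_space => 'a) => bool" where
 "lipschitz_coeff T K b \<longleftrightarrow> 0 \<le> K \<and>
  (\<forall>X. progressive F T X \<longrightarrow> progressive F T (%s w. b s w (X s w))) \<and>
  (\<forall>s\<in>{0..T}. \<forall>w x y. norm (b s w x - b s w y) \<le> K * norm (x - y)) \<and>
  L2 Lam (cut T (%s w. b s w 0))"

lemma coeff_L2:
 assumes b: "lipschitz_coeff T K b" and T: "0 \<le> T" and X: "progressive F T X" "L2 Lam (cut T X)"
 shows "progressive F T (%s w. b s w (X s w))" "L2 Lam (cut T (%s w. b s w (X s w)))"
proof -
 show p: "progressive F T (%s w. b s w (X s w))" using b X by (simp add: lipschitz_coeff_def)
 have L0: "L2 Lam (cut T (%s w. b s w 0))" using b by (simp add: lipschitz_coeff_def)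
 have "L2 Lam (%x. cut T (%s w. b s w (X s w)) x - cut T (%s w. b s w 0) x)"
 proof (rule L2_bound[OF X(2), where K=K])
  show "(%x. cut T (%s w. b s w (X s w)) x - cut T (%s w. b s w 0) x) \<in> bm Lam"
   using cut_measurable[OF p T order_refl] L2_measurable[OF L0] by measurable
  show "AE x in Lam. norm (cut T (%s w. b s w (X s w)) x - cut T (%s w. b s w 0) x) \<le> K * norm (cut T X x)"
  proof (rule AE_I2)
   fix x
   have "\<forall>s\<in>{0..T}. \<forall>w x. norm (b s w x - b s w 0) \<le> K * norm x"
    using b unfolding lipschitz_coeff_def by (metis diff_zero)
   then show "norm (cut T (%s w. b s w (X s w)) x - cut T (%s w. b s w 0) x) \<le> K * norm (cut T X x)"
    by (cases "fst x \<in> {0..T}") (auto simp: cut_def split_beta')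
  qed
 qed
 from L2_add[OF this L0] show "L2 Lam (cut T (%s w. b s w (X s w)))" by simp
qed

lemma cut_lipschitz:
 assumes b: "lipschitz_coeff T K b" and t: "t \<le> T"
 shows "norm (cut t (%s w. b s w (X s w)) x - cut t (%s w. b s w (X' s w)) x) \<le> K * norm (cut t (%s w. X s w - X' s w) x)"
 using b t unfolding lipschitz_coeff_def
 by (cases "fst x \<in> {0..t}") (auto simp: cut_def split_beta')

lemma path_continuous_drift:
 assumes i: "integrable lborel (%s. cut T b (s, w))"
 shows "continuous_on {0..T} (%t. drift b t w)"
proof -
 let ?f = "%s. cut T b (s, w)"
 note [measurable] = borel_measurable_integrable[OF i]
 have "continuous_on UNIV (%t. \<integral>r. indicator {..t} r *\<^sub>R ?f r \<partial>lborel)"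
  unfolding continuous_on_sequentially
 proof (intro allI ballI impI, clarify)
  fix x and a :: real assume x: "x \<longlonglongrightarrow> a"
  show "((%t. \<integral>r. indicator {..t} r *\<^sub>R ?f r \<partial>lborel) \<circ> x) \<longlonglongrightarrow> (LI lborel (%r. indicator {..a} r *\<^sub>R ?f r))"
   unfolding comp_def
  proof (rule integral_dominated_convergence[where w="%r. norm (?f r)"])
   show "integrable lborel (%r. norm (?f r))" using i by simp
   show "AE r in lborel. (%n. indicator {..x n} r *\<^sub>R ?f r) \<longlonglongrightarrow> indicator {..a} r *\<^sub>R ?f r"
    using AE_lborel_singleton[of a]
   proof eventually_elim
    case (elim r)
    then consider "r < a" | "a < r" by linarith
    then have "\<forall>\<^sub>F n in sequentially. indicator {..x n} r *\<^sub>R ?f r = indicator {..a} r *\<^sub>R ?f r"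
    proof cases
     case 1
     show ?thesis by (rule eventually_mono[OF order_tendstoD(1)[OF x 1]]) (use 1 in auto)
    next
     case 2
     show ?thesis by (rule eventually_mono[OF order_tendstoD(2)[OF x 2]]) (use 2 in auto)
    qed
    then show ?case by (rule tendsto_eventually)
   qed
   show "AE r in lborel. norm (indicator {..x n} r *\<^sub>R ?f r) \<le> norm (?f r)" for n
    by (auto split: split_indicator)
  qed measurable
 qed
 then have "continuous_on {0..T} (%t. \<integral>r. indicator {..t} r *\<^sub>R ?f r \<partial>lborel)"
  by (rule continuous_on_subset) simp
 then show ?thesis by (rule continuous_on_eq) (simp add: drift_cut[of _ T])
qed

lemma progressive_add:
 fixes X Y :: "real => 'w => 'a::euclidean_space"
 assumes "progressive F T X" "progressive F T Y"
 shows "progressive F T (%s w. X s w + Y s w)"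
 using assms unfolding progressive_def by (auto simp: split_beta' intro!: borel_measurable_add)

lemma progressive_const:
 fixes z :: "'w => 'a::euclidean_space"
 assumes "z \<in> bm (F 0)" shows "progressive F T (%_. z)"
 unfolding progressive_def
proof
 fix t assume "t \<in> {0..T}"
 then have "z \<in> bm (F t)" using F_measurable_mono[OF order_refl _ assms] by simp
 then show "(%(s, w). z w) \<in> bm (restrict_space borel {0..t} \<Otimes>\<^sub>M F t)" by measurable
qed

lemma progressive_sum:
 fixes X :: "'i => real => 'w => 'a::euclidean_space"
 assumes "\<And>i. i \<in> I ==> progressive F T (X i)"
 shows "progressive F T (%s w. \<Sum>i\<in>I. X i s w)"
 using assms unfolding progressive_def by (auto simp: split_beta' intro!: borel_measurable_sum)

lemma ito_process_exists:
 fixes b :: "real => 'w => 'a::euclidean_space"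
 assumes T: "0 < T" and x0: "x0 \<in> bm (F 0)" "L2 M x0"
  and b: "progressive F T b" "L2 Lam (cut T b)" and \<sigma>: "\<And>j. progressive F T (\<sigma> j)" "\<And>j. L2 Lam (cut T (\<sigma> j))"
 shows "\<exists>X. ito_process T x0 b \<sigma> X \<and> (AE w in M. continuous_on {0..T} (%t. X t w))"
proof -
 have "\<forall>j. \<exists>J. progressive F T J \<and> (AE w in M. continuous_on {0..T} (%t. J t w)) \<and>
  (\<forall>t\<in>{0..T}. has_ito_integral M F (W j) t (\<sigma> j) (J t))"
 proof
  fix j
  obtain J where "progressive F T J" "AE w in M. continuous_on {0..T} (%t. J t w)"
   "\<And>t. t \<in> {0..T} ==> has_ito_integral M F (W j) t (\<sigma> j) (J t)"
   using ito_exists[OF T \<sigma>[of j], where j=j] by blast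
  then show "\<exists>J. progressive F T J \<and> (AE w in M. continuous_on {0..T} (%t. J t w)) \<and>
   (\<forall>t\<in>{0..T}. has_ito_integral M F (W j) t (\<sigma> j) (J t))" by blast
 qed
 then have "\<exists>J. \<forall>j. progressive F T (J j) \<and> (AE w in M. continuous_on {0..T} (%t. J j t w)) \<and>
  (\<forall>t\<in>{0..T}. has_ito_integral M F (W j) t (\<sigma> j) (J j t))" by (rule choice)
 then obtain J where J: "\<And>j. progressive F T (J j)" "\<And>j. AE w in M. continuous_on {0..T} (%t. J j t w)"
  "\<And>j t. t \<in> {0..T} ==> has_ito_integral M F (W j) t (\<sigma> j) (J j t)" by blast
 define X where "X t w = x0 w + drift b t w + (\<Sum>j\<in>UNIV. J j t w)" for t w
 have Xp: "progressive F T X" unfolding X_def[abs_def]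
  by (intro progressive_add progressive_sum progressive_const[OF x0(1)] progressive_drift[OF b(1)] J(1))
 have cX: "cut T X = (%x. cut T (%_. x0) x + cut T (drift b) x + (\<Sum>j\<in>UNIV. cut T (J j) x))"
  by (auto simp: cut_def X_def scaleR_add_right scaleR_sum_right)
 have T0: "0 \<le> T" using T by simp
 have XL: "L2 Lam (cut T X)" unfolding cX
  by (intro L2_add L2_sum cut_const_L2[OF x0(2)] drift_cut_L2[OF T0 b] ito_cut_process_L2[OF T0 J(1,3)])
 have "ito_process T x0 b \<sigma> X"
  unfolding ito_process_def using x0 b Xp XL J(3) by (auto simp: X_def intro!: exI[of _ "%j. J j _"])
 moreover have "AE w in M. continuous_on {0..T} (%t. X t w)"
 proof -
  have "AE w in M. \<forall>j. continuous_on {0..T} (%t. J j t w)" using J(2) by (simp add: AE_all_countable)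
  with L2_path[OF b(2)] show ?thesis
  proof eventually_elim
   case (elim w)
   then show ?case unfolding X_def
    by (intro continuous_on_add continuous_on_sum continuous_on_const path_continuous_drift path_integrable) auto
  qed
 qed
 ultimately show ?thesis by blast
qed

text \<open>The square is polarised into three instances of \<open>ito_moment\<close>, in which the
  equal initial values cancel; so the difference need not itself be shown to be an Ito
  process.\<close>

lemma ito_process_diff_moment:
 fixes X Y :: "real => 'w => 'a::euclidean_space"
 assumes X: "ito_process T x0 b \<sigma> X" and Y: "ito_process T x0 g \<rho> Y" and t: "t \<in> {0..T}"
 defines "R \<equiv> %x. 2 * ((cut t b x - cut t g x) \<bullet> (cut t X x - cut t Y x)) + (\<Sum>j\<in>UNIV. (norm (cut t (\<sigma> j) x - cut t (\<rho> j) x))\<^sup>2)"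
 shows "integrable Lam R" "rsq M (%w. X t w - Y t w) = (LI Lam (%x. R x))"
proof -
 obtain XL: "L2 M (X t)" using ito_process_noise[OF X t] by blast
 obtain YL: "L2 M (Y t)" using ito_process_noise[OF Y t] by blast
 note i = L2_inner_integrable
 note xx = ito_moment[OF X X t] and xy = ito_moment[OF X Y t] and yy = ito_moment[OF Y Y t]
 define U where "U x = cut t b x \<bullet> cut t X x + cut t X x \<bullet> cut t b x + (\<Sum>j\<in>UNIV. cut t (\<sigma> j) x \<bullet> cut t (\<sigma> j) x)" for x
 define V where "V x = cut t b x \<bullet> cut t Y x + cut t X x \<bullet> cut t g x + (\<Sum>j\<in>UNIV. cut t (\<sigma> j) x \<bullet> cut t (\<rho> j) x)" for x
 define Q where "Q x = cut t g x \<bullet> cut t Y x + cut t Y x \<bullet> cut t g x + (\<Sum>j\<in>UNIV. cut t (\<rho> j) x \<bullet> cut t (\<rho> j) x)" for x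
 note xx = xx[folded U_def] and xy = xy[folded V_def] and yy = yy[folded Q_def]
 have R: "R = (%x. U x - 2 * V x + Q x)"
  unfolding R_def U_def V_def Q_def power2_norm_eq_inner inner_diff_left inner_diff_right
  by (simp add: sum.distrib sum_subtractf sum_distrib_left inner_commute algebra_simps)
 show "integrable Lam R" unfolding R using xx(1) xy(1) yy(1) by simp
 have "rsq M (%w. X t w - Y t w) = (LI M (%w. X t w \<bullet> X t w - 2 * (X t w \<bullet> Y t w) + Y t w \<bullet> Y t w))"
  by (intro LI_integral_cong) (auto simp: power2_norm_eq_inner inner_diff_left inner_diff_right inner_commute)
 also have "... = (LI M (%w. X t w \<bullet> X t w)) - 2 * (LI M (%w. X t w \<bullet> Y t w)) + (LI M (%w. Y t w \<bullet> Y t w))"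
  using i[OF XL XL] i[OF XL YL] i[OF YL YL] by simp
 also have "... = (LI Lam (%x. R x))"
  unfolding xx(2) xy(2) yy(2) R using xx(1) xy(1) yy(1) by simp
 finally show "rsq M (%w. X t w - Y t w) = (LI Lam (%x. R x))" .
qed

text \<open>The drift pairing is split by \<open>2 <a,b> \<le> |a|^2 + |b|^2\<close>; the drift and
  each of the \<open>CARD('j)\<close> noise coefficients contribute \<open>K^2\<close>. The
  additional \<open>1\<close> in \<open>C\<close> makes it positive when
  \<open>K = 0\<close>.\<close>

lemma sde_diff:
 fixes X X' Y Y' :: "real => 'w => 'a::euclidean_space"
 assumes T: "0 \<le> T" and b: "lipschitz_coeff T K b" and \<sigma>: "\<And>j. lipschitz_coeff T K (\<sigma> j)"
  and Y: "ito_process T x0 (%s w. b s w (X s w)) (%j s w. \<sigma> j s w (X s w)) Y"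
  and Y': "ito_process T x0 (%s w. b s w (X' s w)) (%j s w. \<sigma> j s w (X' s w)) Y'"
  and X: "progressive F T X" "L2 Lam (cut T X)" and X': "progressive F T X'" "L2 Lam (cut T X')"
  and t: "t \<in> {0..T}"
 defines "C \<equiv> K\<^sup>2 * (1 + real CARD('j)) + 1"
 shows "msq (%s w. Y s w - Y' s w) T t
  \<le> (\<integral>\<^sup>+s\<in>{0..t}. (msq (%s w. Y s w - Y' s w) T s + ennreal C * msq (%s w. X s w - X' s w) T s) \<partial>lborel)"
proof -
 have t': "0 \<le> t" "t \<le> T" using t by auto
 have C: "0 < C" unfolding C_def by (intro add_nonneg_pos mult_nonneg_nonneg) auto
 obtain YL: "L2 M (Y t)" using ito_process_noise[OF Y t] by blast
 obtain YL': "L2 M (Y' t)" using ito_process_noise[OF Y' t] by blast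
 let ?dY = "%s w. Y s w - Y' s w" and ?dX = "%s w. X s w - X' s w"
 note DY = ito_processD(5,6)[OF Y] and DY' = ito_processD(5,6)[OF Y']
 have LY: "L2 Lam (cut T ?dY)" "L2 Lam (cut t ?dY)" unfolding cut_diff
  by (intro L2_diff DY DY' cut_L2_mono[OF DY(2,1) t'] cut_L2_mono[OF DY'(2,1) t'])+
 have LX: "L2 Lam (cut T ?dX)" "L2 Lam (cut t ?dX)" unfolding cut_diff
  by (intro L2_diff X X' cut_L2_mono[OF X(2,1) t'] cut_L2_mono[OF X'(2,1) t'])+
 let ?B = "%X. cut t (%s w. b s w (X s w))" and ?S = "%j X. cut t (%s w. \<sigma> j s w (X s w))"
 let ?R = "%x. 2 * ((?B X x - ?B X' x) \<bullet> (cut t Y x - cut t Y' x)) + (\<Sum>j\<in>UNIV. (norm (?S j X x - ?S j X' x))\<^sup>2)"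
 have Rle: "?R x \<le> (norm (cut t ?dY x))\<^sup>2 + C * (norm (cut t ?dX x))\<^sup>2" for x
 proof -
  have sq: "(norm (cut t (%s w. c s w (X s w)) x - cut t (%s w. c s w (X' s w)) x))\<^sup>2 \<le> K\<^sup>2 * (norm (cut t ?dX x))\<^sup>2"
   if "lipschitz_coeff T K c" for c
   using power_mono[OF cut_lipschitz[OF that t'(2), of X x X'] norm_ge_zero, of 2] by (simp add: power_mult_distrib)
  have "2 * ((?B X x - ?B X' x) \<bullet> (cut t Y x - cut t Y' x)) \<le> (norm (?B X x - ?B X' x))\<^sup>2 + (norm (cut t ?dY x))\<^sup>2"
  proof -
   have "0 \<le> (norm ((?B X x - ?B X' x) - (cut t Y x - cut t Y' x)))\<^sup>2" by simp
   then show ?thesis unfolding cut_diff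
    by (simp add: power2_norm_eq_inner inner_diff_left inner_diff_right inner_commute)
  qed
  also have "... \<le> K\<^sup>2 * (norm (cut t ?dX x))\<^sup>2 + (norm (cut t ?dY x))\<^sup>2"
   using sq[OF b] by simp
  finally have 1: "2 * ((?B X x - ?B X' x) \<bullet> (cut t Y x - cut t Y' x)) \<le> K\<^sup>2 * (norm (cut t ?dX x))\<^sup>2 + (norm (cut t ?dY x))\<^sup>2" .
  have "(\<Sum>j\<in>UNIV. (norm (?S j X x - ?S j X' x))\<^sup>2) \<le> (\<Sum>j\<in>(UNIV::'j set). K\<^sup>2 * (norm (cut t ?dX x))\<^sup>2)"
   by (intro sum_mono sq \<sigma>)
  then have 2: "(\<Sum>j\<in>UNIV. (norm (?S j X x - ?S j X' x))\<^sup>2) \<le> real CARD('j) * (K\<^sup>2 * (norm (cut t ?dX x))\<^sup>2)" by simp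
  have "0 \<le> (norm (cut t ?dX x))\<^sup>2" by simp
  moreover have "C * (norm (cut t ?dX x))\<^sup>2 = K\<^sup>2 * (norm (cut t ?dX x))\<^sup>2 + real CARD('j) * (K\<^sup>2 * (norm (cut t ?dX x))\<^sup>2) + (norm (cut t ?dX x))\<^sup>2"
   unfolding C_def by (simp add: algebra_simps)
  ultimately show ?thesis using 1 2 by linarith
 qed
 have "rsq M (?dY t) = (LI Lam (%x. ?R x))"
  by (rule ito_process_diff_moment(2)[OF Y Y' t])
 also have "... \<le> (LI Lam (%x. (norm (cut t ?dY x))\<^sup>2 + C * (norm (cut t ?dX x))\<^sup>2))"
  by (rule integral_mono[OF ito_process_diff_moment(1)[OF Y Y' t]]) (use LY LX Rle in \<open>auto simp: L2_def\<close>)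
 finally have le: "rsq M (?dY t) \<le> (LI Lam (%x. (norm (cut t ?dY x))\<^sup>2 + C * (norm (cut t ?dX x))\<^sup>2))" .
 have "msq ?dY T t = nsq M (?dY t)"
  unfolding msq_def using t by (simp add: cut_def)
 also have "... = ennreal (rsq M (?dY t))"
  by (rule L2_nn_integral[OF L2_diff[OF YL YL']])
 also have "... \<le> ennreal (LI Lam (%x. (norm (cut t ?dY x))\<^sup>2 + C * (norm (cut t ?dX x))\<^sup>2))"
  by (rule ennreal_leI[OF le])
 also have "... = (NI Lam (%x. ennreal ((norm (cut t ?dY x))\<^sup>2 + C * (norm (cut t ?dX x))\<^sup>2)))"
  by (rule nn_integral_eq_integral[symmetric]) (use LY LX C in \<open>auto simp: L2_def\<close>)
 also have "... = (\<integral>\<^sup>+x. indicator {0..t} (fst x) * ennreal ((norm (cut T ?dY x))\<^sup>2)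
   + (indicator {0..t} (fst x) * ennreal C) * ennreal ((norm (cut T ?dX x))\<^sup>2) \<partial>Lam)"
 proof (intro nn_integral_cong)
  fix x :: "real \<times> 'w"
  show "ennreal ((norm (cut t ?dY x))\<^sup>2 + C * (norm (cut t ?dX x))\<^sup>2) = indicator {0..t} (fst x) * ennreal ((norm (cut T ?dY x))\<^sup>2)
   + (indicator {0..t} (fst x) * ennreal C) * ennreal ((norm (cut T ?dX x))\<^sup>2)"
   using t' C by (auto simp: cut_def split_beta' ennreal_mult' split: split_indicator)
 qed
 also have "... = (NI Lam (%x. indicator {0..t} (fst x) * ennreal ((norm (cut T ?dY x))\<^sup>2)))
   + (NI Lam (%x. (indicator {0..t} (fst x) * ennreal C) * ennreal ((norm (cut T ?dX x))\<^sup>2)))"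
 proof -
  note [measurable] = L2_measurable[OF LY(1)] L2_measurable[OF LX(1)]
  show ?thesis by (rule nn_integral_add) measurable
 qed
 also have "... = (NI lborel (%s. indicator {0..t} s * msq ?dY T s)) + (NI lborel (%s. (indicator {0..t} s * ennreal C) * msq ?dX T s))"
  using msq_integral[OF L2_measurable[OF LY(1)], of "indicator {0..t}"]
   msq_integral[OF L2_measurable[OF LX(1)], of "%s. indicator {0..t} s * ennreal C"] by simp
 also have "... = (NI lborel (%s. indicator {0..t} s * msq ?dY T s + (indicator {0..t} s * ennreal C) * msq ?dX T s))"
 proof -
  note [measurable] = msq_measurable[OF L2_measurable[OF LY(1)]] msq_measurable[OF L2_measurable[OF LX(1)]]
  show ?thesis by (rule nn_integral_add[symmetric]) measurable
 qed
 also have "... = (\<integral>\<^sup>+s\<in>{0..t}. (msq ?dY T s + ennreal C * msq ?dX T s) \<partial>lborel)"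
  by (intro nn_integral_cong) (auto split: split_indicator)
 finally show ?thesis .
qed

lemma sde_contraction:
 fixes X X' Y Y' :: "real => 'w => 'a::euclidean_space"
 assumes T: "0 \<le> T" and b: "lipschitz_coeff T K b" and \<sigma>: "\<And>j. lipschitz_coeff T K (\<sigma> j)"
  and Y: "ito_process T x0 (%s \<omega>. b s \<omega> (X s \<omega>)) (%j s \<omega>. \<sigma> j s \<omega> (X s \<omega>)) Y"
  and Y': "ito_process T x0 (%s \<omega>. b s \<omega> (X' s \<omega>)) (%j s \<omega>. \<sigma> j s \<omega> (X' s \<omega>)) Y'"
  and X: "progressive F T X" "L2 Lam (cut T X)" and X': "progressive F T X'" "L2 Lam (cut T X')"
 defines "w \<equiv> %t. ennreal (exp (- (1 + 4 * (K\<^sup>2 * (1 + real CARD('j)) + 1)) * t)) * indicator {0..T} t"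
 shows "(NI lborel (%t. w t * msq (%s \<omega>. Y s \<omega> - Y' s \<omega>) T t))
  \<le> ennreal (1/4) * (NI lborel (%t. w t * msq (%s \<omega>. X s \<omega> - X' s \<omega>) T t))"
 unfolding w_def
proof (rule weighted_contraction)
 note DY = ito_processD(5,6)[OF Y] and DY' = ito_processD(5,6)[OF Y']
 have LY: "L2 Lam (cut T (%s \<omega>. Y s \<omega> - Y' s \<omega>))" unfolding cut_diff by (intro L2_diff DY DY')
 have LX: "L2 Lam (cut T (%s \<omega>. X s \<omega> - X' s \<omega>))" unfolding cut_diff by (intro L2_diff X X')
 show "msq (%s \<omega>. Y s \<omega> - Y' s \<omega>) T \<in> bm borel" "msq (%s \<omega>. X s \<omega> - X' s \<omega>) T \<in> bm borel"
  using msq_measurable L2_measurable[OF LY] L2_measurable[OF LX] by auto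
 show "0 < K\<^sup>2 * (1 + real CARD('j)) + 1" by (intro add_nonneg_pos mult_nonneg_nonneg) auto
 show "msq (%s \<omega>. Y s \<omega> - Y' s \<omega>) T t \<le> (\<integral>\<^sup>+s\<in>{0..t}. (msq (%s \<omega>. Y s \<omega> - Y' s \<omega>) T s
   + ennreal (K\<^sup>2 * (1 + real CARD('j)) + 1) * msq (%s \<omega>. X s \<omega> - X' s \<omega>) T s) \<partial>lborel)" if "t \<in> {0..T}" for t
  by (rule sde_diff[OF T b \<sigma> Y Y' X X' that])
 have "(\<integral>\<^sup>+s\<in>{0..T}. msq (%s \<omega>. Y s \<omega> - Y' s \<omega>) T s \<partial>lborel) = (NI Lam (%x. indicator {0..T} (fst x) * ennreal ((norm (cut T (%s \<omega>. Y s \<omega> - Y' s \<omega>) x))\<^sup>2)))"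
  using msq_integral[OF L2_measurable[OF LY], of "indicator {0..T}"] by (simp add: mult.commute)
 also have "... \<le> nsq Lam (cut T (%s \<omega>. Y s \<omega> - Y' s \<omega>))"
  by (intro nn_integral_mono) (auto split: split_indicator)
 also have "... < \<infinity>" using LY by (simp add: L2_iff_nn)
 finally show "(\<integral>\<^sup>+s\<in>{0..T}. msq (%s \<omega>. Y s \<omega> - Y' s \<omega>) T s \<partial>lborel) < \<infinity>" .
qed

text \<open>On \<open>[0,T]\<close> the weight is at least \<open>exp (- l T)\<close>; together with
  \<open>weight_upper\<close> this makes the weighted and the plain norm equivalent.\<close>

lemma weight_lower:
 fixes Z :: "real => 'w => 'a::euclidean_space"
 assumes l: "0 \<le> l" and m: "cut T Z \<in> bm Lam"
 shows "nsq Lam (cut T Z)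
  \<le> ennreal (exp (l * T)) * (NI lborel (%t. (ennreal (exp (- l * t)) * indicator {0..T} t) * msq Z T t))"
proof -
 have "nsq Lam (cut T Z)
  \<le> (NI Lam (%x. ennreal (exp (l * T)) * ((ennreal (exp (- l * fst x)) * indicator {0..T} (fst x)) * ennreal ((norm (cut T Z x))\<^sup>2))))"
 proof (rule nn_integral_mono)
  fix x :: "real \<times> 'w"
  show "ennreal ((norm (cut T Z x))\<^sup>2) \<le> ennreal (exp (l * T)) * ((ennreal (exp (- l * fst x)) * indicator {0..T} (fst x)) * ennreal ((norm (cut T Z x))\<^sup>2))"
  proof (cases "fst x \<in> {0..T}")
   case True
   then have "l * fst x \<le> l * T" using l by (intro mult_left_mono) auto
   then have "1 \<le> exp (l * T) * exp (- l * fst x)" by (simp add: exp_add[symmetric])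
   then have "1 * (norm (cut T Z x))\<^sup>2 \<le> (exp (l * T) * exp (- l * fst x)) * (norm (cut T Z x))\<^sup>2"
    by (rule mult_right_mono) simp
   then have "ennreal ((norm (cut T Z x))\<^sup>2) \<le> ennreal ((exp (l * T) * exp (- l * fst x)) * (norm (cut T Z x))\<^sup>2)"
    by (intro ennreal_leI) simp
   then show ?thesis using True by (simp add: ennreal_mult mult.assoc)
  qed (simp add: cut_def split_beta')
 qed
 also have "... = ennreal (exp (l * T)) * (NI Lam (%x. (ennreal (exp (- l * fst x)) * indicator {0..T} (fst x)) * ennreal ((norm (cut T Z x))\<^sup>2)))"
 proof (rule nn_integral_cmult)
  note [measurable] = m
  show "(%x. (ennreal (exp (- l * fst x)) * indicator {0..T} (fst x)) * ennreal ((norm (cut T Z x))\<^sup>2)) \<in> bm Lam"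
   by measurable
 qed
 also have "(NI Lam (%x. (ennreal (exp (- l * fst x)) * indicator {0..T} (fst x)) * ennreal ((norm (cut T Z x))\<^sup>2)))
  = (NI lborel (%t. (ennreal (exp (- l * t)) * indicator {0..T} t) * msq Z T t))"
  by (rule msq_integral[OF m, symmetric]) measurable
 finally show ?thesis .
qed

lemma weight_upper:
 fixes Z :: "real => 'w => 'a::euclidean_space"
 assumes l: "0 \<le> l" and m: "cut T Z \<in> bm Lam"
 shows "(NI lborel (%t. (ennreal (exp (- l * t)) * indicator {0..T} t) * msq Z T t))
  \<le> nsq Lam (cut T Z)"
proof -
 have "(NI lborel (%t. (ennreal (exp (- l * t)) * indicator {0..T} t) * msq Z T t))
  = (NI Lam (%x. (ennreal (exp (- l * fst x)) * indicator {0..T} (fst x)) * ennreal ((norm (cut T Z x))\<^sup>2)))"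
  by (rule msq_integral[OF m]) measurable
 also have "... \<le> nsq Lam (cut T Z)"
 proof (rule nn_integral_mono)
  fix x :: "real \<times> 'w"
  have "ennreal (exp (- l * fst x)) * indicator {0..T} (fst x) \<le> 1"
   using l by (auto split: split_indicator)
  then show "(ennreal (exp (- l * fst x)) * indicator {0..T} (fst x)) * ennreal ((norm (cut T Z x))\<^sup>2) \<le> ennreal ((norm (cut T Z x))\<^sup>2)"
   using mult_right_mono[of _ 1 "ennreal ((norm (cut T Z x))\<^sup>2)"] by simp
 qed
 finally show ?thesis .
qed

text \<open>Both solutions are their own images, so the contraction bounds their finite weighted
  distance by a quarter of itself.\<close>

theorem sde_unique:
 fixes X Y :: "real => 'w => 'a::euclidean_space"
 assumes T: "0 \<le> T" and b: "lipschitz_coeff T K b" and \<sigma>: "\<And>j. lipschitz_coeff T K (\<sigma> j)"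
  and X: "ito_process T x0 (%s w. b s w (X s w)) (%j s w. \<sigma> j s w (X s w)) X"
  and Y: "ito_process T x0 (%s w. b s w (Y s w)) (%j s w. \<sigma> j s w (Y s w)) Y"
 shows "AE x in Lam. cut T X x = cut T Y x"
proof -
 let ?Z = "%s w. X s w - Y s w"
 define l where "l = 1 + 4 * (K\<^sup>2 * (1 + real CARD('j)) + 1)"
 have l: "0 \<le> l" unfolding l_def by (intro add_nonneg_nonneg mult_nonneg_nonneg) auto
 note DX = ito_processD(5,6)[OF X] and DY = ito_processD(5,6)[OF Y]
 have LZ: "L2 Lam (cut T ?Z)" unfolding cut_diff by (intro L2_diff DX DY)
 let ?G = "\<integral>\<^sup>+t. (ennreal (exp (- l * t)) * indicator {0..T} t) * msq ?Z T t \<partial>lborel"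
 have c: "?G \<le> ennreal (1/4) * ?G"
  unfolding l_def by (rule sde_contraction[OF T b \<sigma> X Y DX DY])
 have "?G < \<infinity>" using weight_upper[OF l L2_measurable[OF LZ]] LZ by (auto simp: L2_iff_nn intro: le_less_trans)
 then obtain g where g: "?G = ennreal g" "0 \<le> g" by (cases ?G) auto
 then have "g \<le> 1/4 * g" using c by (simp add: ennreal_mult'[symmetric])
 then have "?G = 0" using g by simp
 then have "nsq Lam (cut T ?Z) = 0"
  using weight_lower[OF l L2_measurable[OF LZ]] by simp
 from nn_norm_sq_eq_0[OF L2_measurable[OF LZ] this] show ?thesis by (simp add: cut_diff)
qed

text \<open>The Ito integrals follow by \<open>ito_AE_eq\<close>; for the drift the two almost
  everywhere quantifiers are exchanged, so that on almost every path the integrands agree at almost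
  every time.\<close>

lemma ito_process_cong:
 fixes X :: "real => 'w => 'a::euclidean_space"
 assumes X: "ito_process T x0 b \<sigma> X" and g: "progressive F T g" "AE x in Lam. cut T b x = cut T g x"
  and \<rho>: "\<And>j. progressive F T (\<rho> j)" "\<And>j. AE x in Lam. cut T (\<sigma> j) x = cut T (\<rho> j) x" and T: "0 \<le> T"
 shows "ito_process T x0 g \<rho> X"
proof -
 note D = ito_processD[OF X]
 have gL: "L2 Lam (cut T g)" by (rule L2_cong_AE[OF D(4) cut_measurable[OF g(1) T order_refl] g(2)])
 have "\<exists>J. (\<forall>j. has_ito_integral M F (W j) t (\<rho> j) (J j)) \<and> (AE w in M. X t w = x0 w + drift g t w + (\<Sum>j\<in>UNIV. J j w))"
  if t: "t \<in> {0..T}" for t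
 proof -
  from t have t': "0 \<le> t" "t \<le> T" by auto
  obtain J where J: "\<And>j. has_ito_integral M F (W j) t (\<sigma> j) (J j)"
   and e: "AE w in M. X t w = x0 w + drift b t w + (\<Sum>j\<in>UNIV. J j w)"
   using X t unfolding ito_process_def by blast
  have c: "AE x in Lam. cut t (\<sigma> j) x = cut t (\<rho> j) x" for j
   unfolding cut_cut[OF t'(2)] using \<rho>(2)[of j] by eventually_elim simp
  have "has_ito_integral M F (W j) t (\<rho> j) (J j)" for j
   by (rule ito_AE_eq[OF J t'(1) progressive_mono[OF \<rho>(1) t'(2)] c]) (use J in \<open>auto simp: has_ito_integral_def\<close>)
  moreover have "AE w in M. X t w = x0 w + drift g t w + (\<Sum>j\<in>UNIV. J j w)"
  proof -
   have [measurable]: "cut T b \<in> bm Lam" "cut T g \<in> bm Lam"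
    using D(4) gL by (auto dest: L2_measurable)
   have "{x \<in> space Lam. cut T b (fst x, snd x) = cut T g (fst x, snd x)} \<in> sets Lam" by measurable
   then have i: "AE w in M. AE s in lborel. cut T b (s, w) = cut T g (s, w)"
    using PS.AE_pair[OF g(2)] PS.AE_commute[of "%s w. cut T b (s, w) = cut T g (s, w)"] by simp
   show ?thesis using e i L2_path[OF D(4)] L2_path[OF gL]
   proof eventually_elim
    case (elim w)
    have "drift b t w = drift g t w"
     unfolding drift_cut[OF t'(2)]
    proof (rule integral_cong_AE)
     show "(%r. indicator {..t} r *\<^sub>R cut T b (r, w)) \<in> bm lborel"
      "(%r. indicator {..t} r *\<^sub>R cut T g (r, w)) \<in> bm lborel"
      using L2_measurable[OF elim(3)] L2_measurable[OF elim(4)] by measurable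
    qed (use elim(2) in auto)
    then show ?case using elim(1) by simp
   qed
  qed
  ultimately show ?thesis by blast
 qed
 then show ?thesis unfolding ito_process_def using D g(1) gL by blast
qed

text \<open>Picard iteration, contracting by \<open>1/4\<close> in the weighted norm. The limit
  \<open>X\<close> is controlled only almost everywhere in time and sample point, so the solution is
  taken to be \<open>Y\<close>, the process driven by the coefficients along \<open>X\<close>: it
  has continuous paths, agrees with \<open>X\<close> almost everywhere, and may therefore replace
  \<open>X\<close> in its own coefficients.\<close>

theorem sde_exists:
 fixes b :: "real => 'w => 'a::euclidean_space => 'a"
 assumes T: "0 < T" and b: "lipschitz_coeff T K b" and \<sigma>: "\<And>j. lipschitz_coeff T K (\<sigma> j)"
  and x0: "x0 \<in> bm (F 0)" "L2 M x0"
 shows "\<exists>X. ito_process T x0 (%s w. b s w (X s w)) (%j s w. \<sigma> j s w (X s w)) X \<and>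
  (AE w in M. continuous_on {0..T} (%t. X t w))"
proof -
 have T0: "0 \<le> T" using T by simp
 define l where "l = 1 + 4 * (K\<^sup>2 * (1 + real CARD('j)) + 1)"
 have l: "0 \<le> l" unfolding l_def by (intro add_nonneg_nonneg mult_nonneg_nonneg) auto
 define good where "good X \<longleftrightarrow> progressive F T X \<and> L2 Lam (cut T X)" for X :: "real => 'w => 'a"
 define sol where "sol X Y \<longleftrightarrow> ito_process T x0 (%s w. b s w (X s w)) (%j s w. \<sigma> j s w (X s w)) Y \<and>
  (AE w in M. continuous_on {0..T} (%t. Y t w))" for X Y :: "real => 'w => 'a"
 have ex: "\<exists>Y. sol X Y" if "good X" for X
  unfolding sol_def
  by (rule ito_process_exists[OF T x0 coeff_L2[OF b T0] coeff_L2[OF \<sigma> T0]]) (use that in \<open>auto simp: good_def\<close>)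
 define \<Phi> where "\<Phi> X = (SOME Y. sol X Y)" for X
 have \<Phi>: "sol X (\<Phi> X)" if "good X" for X unfolding \<Phi>_def using ex[OF that] by (rule someI_ex)
 have solg: "good Y" if "sol X Y" for X Y
 proof -
  have "ito_process T x0 (%s w. b s w (X s w)) (%j s w. \<sigma> j s w (X s w)) Y" using that by (simp add: sol_def)
  from ito_processD(5,6)[OF this] show ?thesis by (simp add: good_def)
 qed
 define Z where "Z k = (\<Phi> ^^ k) (%_ _. 0)" for k
 have Z0: "Z 0 = (%_ _. 0)" and ZS: "Z (Suc k) = \<Phi> (Z k)" for k by (simp_all add: Z_def)
 have Zg: "good (Z k)" for k
 proof (induction k)
  case 0
  have "cut T (%_ _. 0 :: 'a) = (%_::real \<times> 'w. 0)" by (auto simp: cut_def)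
  then show ?case unfolding Z0 good_def by (auto simp: L2_zero intro!: progressive_const)
 next
  case (Suc k)
  then show ?case unfolding ZS using solg[OF \<Phi>] by blast
 qed
 have Zs: "sol (Z k) (Z (Suc k))" for k unfolding ZS by (rule \<Phi>[OF Zg])
 let ?G = "%X Y. \<integral>\<^sup>+t. (ennreal (exp (- l * t)) * indicator {0..T} t) * msq (%s w. X s w - Y s w) T t \<partial>lborel"
 have contr: "?G Y Y' \<le> ennreal (1/4) * ?G X X'" if "good X" "good X'" "sol X Y" "sol X' Y'" for X X' Y Y'
  unfolding l_def by (rule sde_contraction[OF T0 b \<sigma>]) (use that in \<open>auto simp: good_def sol_def\<close>)
 have dm: "cut T (%s w. X s w - Y s w) \<in> bm Lam" if "good X" "good Y" for X Y
  using that L2_measurable unfolding cut_diff good_def by (intro borel_measurable_diff) auto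
 have dL: "L2 Lam (cut T (%s w. X s w - Y s w))" if "good X" "good Y" for X Y
  using that unfolding cut_diff good_def by (intro L2_diff) auto
 obtain g where g: "?G (Z 1) (Z 0) = ennreal g" "0 \<le> g"
 proof -
  have "?G (Z 1) (Z 0) < \<infinity>"
   using weight_upper[OF l dm[OF Zg Zg], of 1 0] dL[OF Zg Zg, of 1 0] by (auto simp: L2_iff_nn intro: le_less_trans)
  then show ?thesis using that by (cases "?G (Z 1) (Z 0)") auto
 qed
 have Gk: "?G (Z (Suc k)) (Z k) \<le> ennreal (g * (1/4)^k)" for k
 proof (induction k)
  case (Suc k)
  have "?G (Z (Suc (Suc k))) (Z (Suc k)) \<le> ennreal (1/4) * ?G (Z (Suc k)) (Z k)"
   by (rule contr[OF Zg Zg Zs Zs])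
  also have "... \<le> ennreal (1/4) * ennreal (g * (1/4)^k)" by (intro mult_left_mono Suc.IH) simp
  also have "... = ennreal (g * (1/4)^Suc k)" using g by (subst ennreal_mult[symmetric]) (auto simp: mult_ac)
  finally show ?case .
 qed (use g in simp)
 define C where "C = exp (l * T) * g"
 have C: "0 \<le> C" using g by (simp add: C_def)
 have dk: "nsq Lam (%x. cut T (Z (Suc k)) x - cut T (Z k) x) \<le> ennreal (C * (1/4)^k)" for k
 proof -
  have "nsq Lam (%x. cut T (Z (Suc k)) x - cut T (Z k) x) \<le> ennreal (exp (l * T)) * ?G (Z (Suc k)) (Z k)"
   using weight_lower[OF l dm[OF Zg Zg], of "Suc k" k] by (simp add: cut_diff)
  also have "... \<le> ennreal (exp (l * T)) * ennreal (g * (1/4)^k)" by (intro mult_left_mono Gk) simp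
  also have "... = ennreal (C * (1/4)^k)" using g by (subst ennreal_mult[symmetric]) (auto simp: C_def mult_ac)
  finally show ?thesis .
 qed
 have ZL: "L2 Lam (cut T (Z k))" for k using Zg[of k] by (simp add: good_def)
 define X where "X s w = lim (%k. Z k s w)" for s w
 have cX: "cut T X = (%x. lim (%k. cut T (Z k) x))"
 proof
  fix x show "cut T X x = lim (%k. cut T (Z k) x)"
   by (cases "fst x \<in> {0..T}") (auto simp: cut_def X_def split_beta')
 qed
 have Xg: "good X"
  unfolding good_def
 proof
  show "progressive F T X"
   unfolding progressive_def X_def[abs_def]
   using Zg by (auto simp: good_def progressive_def split_beta' intro!: borel_measurable_lim_metric)
  show "L2 Lam (cut T X)" unfolding cX by (rule L2_fast_Cauchy(3)[OF ZL C dk])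
 qed
 define Y where "Y = \<Phi> X"
 have Ys: "sol X Y" unfolding Y_def by (rule \<Phi>[OF Xg])
 have Yg: "good Y" by (rule solg[OF Ys])
 have XZ: "nsq Lam (%x. cut T X x - cut T (Z k) x) \<le> ennreal (4 * C * (1/4)^k)" for k
  unfolding cX by (rule L2_fast_Cauchy(2)[OF ZL C dk])
 \<comment> \<open>\<open>Y\<close> and \<open>Z (Suc k)\<close> are the images of \<open>X\<close>
   and \<open>Z k\<close>, so the contraction applies once more.\<close>
 have YZ: "nsq Lam (%x. cut T Y x - cut T (Z (Suc k)) x) \<le> ennreal (exp (l * T) * (C * (1/4)^k))" for k
 proof -
  have "nsq Lam (%x. cut T Y x - cut T (Z (Suc k)) x) \<le> ennreal (exp (l * T)) * ?G Y (Z (Suc k))"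
   using weight_lower[OF l dm[OF Yg Zg], of "Suc k"] by (simp add: cut_diff)
  also have "... \<le> ennreal (exp (l * T)) * (ennreal (1/4) * ?G X (Z k))"
   by (intro mult_left_mono contr Xg Zg Ys Zs) simp
  also have "... \<le> ennreal (exp (l * T)) * (ennreal (1/4) * ennreal (4 * C * (1/4)^k))"
   using weight_upper[OF l dm[OF Xg Zg], of k] XZ[of k] by (intro mult_left_mono) (auto simp: cut_diff intro: order_trans)
  also have "... = ennreal (exp (l * T) * (1/4 * (4 * C * (1/4)^k)))"
   using C by (subst ennreal_mult[symmetric]; simp)+
  finally show ?thesis by simp
 qed
 have YX: "AE x in Lam. cut T Y x = cut T X x"
 proof -
  have Ym: "cut T Y \<in> bm Lam" and Xm: "cut T X \<in> bm Lam"
   using Yg Xg by (auto simp: good_def L2_def)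
  have Zm: "cut T (Z k) \<in> bm Lam" for k using ZL by (simp add: L2_def)
  let ?D = "\<integral>\<^sup>+x. ennreal ((norm (cut T Y x - cut T X x))\<^sup>2) \<partial>Lam"
  let ?c = "2 * (exp (l * T) * C) + 2 * (4 * C)"
  have "?D \<le> ennreal (?c * (1/4)^k)" for k
  proof -
   have "?D = nsq Lam (%x. (cut T Y x - cut T (Z (Suc k)) x) + - (cut T X x - cut T (Z (Suc k)) x))"
    by simp
   also have "... \<le> 2 * nsq Lam (%x. cut T Y x - cut T (Z (Suc k)) x)
    + 2 * nsq Lam (%x. - (cut T X x - cut T (Z (Suc k)) x))"
    by (rule L2_norm_add_le) (use Ym Xm Zm in measurable)
   also have "... \<le> 2 * ennreal (exp (l * T) * (C * (1/4)^k)) + 2 * ennreal (4 * C * (1/4)^Suc k)"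
    unfolding norm_minus_cancel by (intro add_mono mult_left_mono YZ XZ) auto
   also have "... = ennreal (2 * (exp (l * T) * (C * (1/4)^k)) + 2 * (4 * C * (1/4)^Suc k))"
    by (rule two_ennreal) (use C in auto)
   also have "... \<le> ennreal (?c * (1/4)^k)"
    using C by (intro ennreal_leI) (simp add: algebra_simps)
   finally show ?thesis .
  qed
  moreover have "(%k. ennreal (?c * (1/4)^k)) \<longlonglongrightarrow> ennreal 0"
   by (rule tendsto_ennrealI[OF tendsto_mult_right_zero[OF LIMSEQ_power_zero]]) simp
  ultimately have "?D \<le> ennreal 0" by (intro LIMSEQ_le_const) auto
  then have "?D = 0" by simp
  then show ?thesis using nn_norm_sq_eq_0[of "%x. cut T Y x - cut T X x" Lam] Ym Xm by simp
 qed
 have cut_eq: "AE x in Lam. cut T (%s w. c s w (X s w)) x = cut T (%s w. c s w (Y s w)) x" for c :: "real => 'w => 'a => 'a"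
  using YX by eventually_elim (auto simp: cut_def split: split_indicator_asm split_indicator)
 have "progressive F T Y" "L2 Lam (cut T Y)" using Yg by (auto simp: good_def)
 note p = coeff_L2(1)[OF b T0 this] coeff_L2(1)[OF \<sigma> T0 this]
 have "ito_process T x0 (%s w. b s w (Y s w)) (%j s w. \<sigma> j s w (Y s w)) Y"
  by (rule ito_process_cong[OF _ p(1) cut_eq[of b] p(2) cut_eq[of "\<sigma> _"] T0]) (use Ys in \<open>simp add: sol_def\<close>)
 moreover have "AE w in M. continuous_on {0..T} (%t. Y t w)" using Ys by (simp add: sol_def)
 ultimately show ?thesis by blast
qed

end

section \<open>The augmented filtration\<close>

lemma bm_moments:
 assumes M: "prob_space M" and W: "standard_brownian_motion M B" and s: "0 \<le> s" "s \<le> t"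
 shows "L2 M (%w. B t w - B s w)" "(LI M (%w. B t w - B s w)) = 0" "(LI M (%w. (B t w - B s w)\<^sup>2)) = t - s"
proof -
 interpret prob_space M by fact
 have m: "B t \<in> bm M" "B s \<in> bm M"
  using W s unfolding standard_brownian_motion_def by auto
 have "L2 M (%w. B t w - B s w) \<and> (LI M (%w. B t w - B s w)) = 0 \<and> (LI M (%w. (B t w - B s w)\<^sup>2)) = t - s"
 proof (cases "s = t")
  case True
  then show ?thesis by (simp add: L2_def)
 next
  case False
  then have st: "s < t" using s by simp
  let ?\<sigma> = "sqrt (t - s)"
  have \<sigma>: "0 < ?\<sigma>" using st by simp
  have D: "distributed M lborel (%w. B t w - B s w) (normal_density 0 ?\<sigma>)"
   using W s(1) st unfolding standard_brownian_motion_def by blast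
  have n: "\<And>x. x \<in> space lborel ==> 0 \<le> normal_density 0 ?\<sigma> x" by simp
  have i2: "integrable lborel (%x. normal_density 0 ?\<sigma> x * x\<^sup>2)"
   using integrable_normal_moment[OF \<sigma>, of 0 2] by simp
  have "integrable M (%w. (B t w - B s w)\<^sup>2)"
   using distributed_integrable[OF D, of "%x. x\<^sup>2"] i2 n by simp
  moreover have "(LI M (%w. B t w - B s w)) = 0"
   using distributed_integral[OF D, of "%x. x"] n integral_normal_moment_nz_1[OF \<sigma>, of 0] by simp
  moreover have "(LI M (%w. (B t w - B s w)\<^sup>2)) = t - s"
   using distributed_integral[OF D, of "%x. x\<^sup>2"] n integral_normal_moment_even[OF \<sigma>, of 0 1] st
   by (simp add: fact_numeral)
  ultimately show ?thesis using m by (auto simp: L2_def)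
 qed
 then show "L2 M (%w. B t w - B s w)" "(LI M (%w. B t w - B s w)) = 0" "(LI M (%w. (B t w - B s w)\<^sup>2)) = t - s" by auto
qed

text \<open>Cylinder events over finitely many times up to \<open>s\<close>, an intersection-stable
  family; the final intersection with the space covers the case of empty \<open>K\<close>.\<close>

definition past_events :: "'w measure => (real => 'w => real) => real => 'w set set" where
 "past_events M B s = {(\<Inter>r\<in>K. B r -` C r \<inter> space M) \<inter> space M |K C. finite K \<and> K \<subseteq> {0..s} \<and> (\<forall>r\<in>K. C r \<in> sets borel)}"

definition incr_events :: "'w measure => (real => 'w => real) => real => real => 'w set set" where
 "incr_events M B s t = {(%w. B t w - B s w) -` C \<inter> space M |C. C \<in> sets borel}"

lemma past_events_Int_stable: "Int_stable (past_events M B s)"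
 unfolding Int_stable_def
proof (intro ballI)
 fix A A' assume "A \<in> past_events M B s" "A' \<in> past_events M B s"
 then obtain K C K' C' where 1: "A = (\<Inter>r\<in>K. B r -` C r \<inter> space M) \<inter> space M" "finite K" "K \<subseteq> {0..s}" "\<forall>r\<in>K. C r \<in> sets borel"
  and 2: "A' = (\<Inter>r\<in>K'. B r -` C' r \<inter> space M) \<inter> space M" "finite K'" "K' \<subseteq> {0..s}" "\<forall>r\<in>K'. C' r \<in> sets borel"
  unfolding past_events_def by blast
 define E where "E r = (if r \<in> K then C r else UNIV) \<inter> (if r \<in> K' then C' r else UNIV)" for r
 have "A \<inter> A' = (\<Inter>r\<in>K \<union> K'. B r -` E r \<inter> space M) \<inter> space M"
  unfolding 1 2 E_def by (auto split: if_splits)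
 moreover have "\<forall>r\<in>K \<union> K'. E r \<in> sets borel" using 1 2 by (auto simp: E_def)
 ultimately show "A \<inter> A' \<in> past_events M B s"
  unfolding past_events_def using 1 2 by (intro CollectI exI[of _ "K \<union> K'"] exI[of _ E]) auto
qed

lemma vimage_Int_stable: "Int_stable {f -` C \<inter> S |C. C \<in> sets N}"
 unfolding Int_stable_def
proof (intro ballI, clarify)
 fix C C' assume "C \<in> sets N" "C' \<in> sets N"
 then show "\<exists>E. (f -` C \<inter> S) \<inter> (f -` C' \<inter> S) = f -` E \<inter> S \<and> E \<in> sets N"
  by (intro exI[of _ "C \<inter> C'"]) auto
qed

lemma incr_events_Int_stable: "Int_stable (incr_events M B s t)"
 unfolding incr_events_def by (rule vimage_Int_stable)

text \<open>The past events are finite dimensional, and almost surely they are determined by the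
 increments over a grid ending at \<open>s\<close>, since the motion starts at the origin.\<close>

lemma bm_past_indep:
 assumes M: "prob_space M" and W: "standard_brownian_motion M B" and s: "0 \<le> s" "s < t"
 shows "prob_space.indep_set M (past_events M B s) (incr_events M B s t)"
proof -
 interpret prob_space M by fact
 have m[measurable]: "B r \<in> bm M" if "0 \<le> r" for r
  using W that unfolding standard_brownian_motion_def by auto
 have zero: "AE w in M. B 0 w = 0" using W unfolding standard_brownian_motion_def by auto
 have pm: "past_events M B s \<subseteq> events"
 proof
  fix A assume "A \<in> past_events M B s"
  then obtain K C where K: "A = (\<Inter>r\<in>K. B r -` C r \<inter> space M) \<inter> space M" "finite K" "K \<subseteq> {0..s}" "\<forall>r\<in>K. C r \<in> sets borel"
   unfolding past_events_def by blast
  have A: "A = {w\<in>space M. \<forall>r\<in>K. B r w \<in> C r}" unfolding K(1) by auto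
  have "B r -` C r \<inter> space M \<in> events" if "r \<in> K" for r
   using measurable_sets[OF m] K that by auto
  then have "{w\<in>space M. B r w \<in> C r} \<in> events" if "r \<in> K" for r
   using that by (auto simp: vimage_def Int_def conj_commute)
  then show "A \<in> events" unfolding A using K(2) by (intro sets.sets_Collect_finite_All) auto
 qed
 have im: "incr_events M B s t \<subseteq> events"
 proof
  fix A assume "A \<in> incr_events M B s t"
  then obtain C where "A = (%w. B t w - B s w) -` C \<inter> space M" "C \<in> sets borel" unfolding incr_events_def by blast
  moreover have "(%w. B t w - B s w) \<in> bm M"
   using s by (intro borel_measurable_diff m) auto
  ultimately show "A \<in> events" by (auto intro: measurable_sets)
 qed
 show ?thesis
  unfolding indep_sets2_eq
 proof (intro conjI ballI pm im)
  fix A E assume "A \<in> past_events M B s" and E: "E \<in> incr_events M B s t"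
  then obtain K C where K: "A = (\<Inter>r\<in>K. B r -` C r \<inter> space M) \<inter> space M" "finite K" "K \<subseteq> {0..s}" "\<forall>r\<in>K. C r \<in> sets borel"
   unfolding past_events_def by blast
  \<comment> \<open>Times 0 and \<open>s\<close> are added to the grid: the first makes all values
    telescoping sums of increments, the second makes the grid end where the future increment
    starts.\<close>
  define xs where "xs = sorted_list_of_set (insert 0 (insert s K))"
  have xs: "sorted xs" "distinct xs" "set xs = insert 0 (insert s K)"
  proof -
   have "finite (insert 0 (insert s K))" using K(2) by simp
   then show "sorted xs" "distinct xs" "set xs = insert 0 (insert s K)"
    unfolding xs_def by (simp_all only: set_sorted_list_of_set sorted_sorted_list_of_set distinct_sorted_list_of_set)
  qed
  then have sx: "sorted_wrt (<) xs" by (simp add: strict_sorted_iff)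
  have ne: "xs \<noteq> []" using xs(3) by auto
  define k where "k = length xs - 1"
  have len: "length xs = Suc k" using ne by (cases xs) (auto simp: k_def)
  \<comment> \<open>Here \<open>\<tau> (Suc k) = t\<close>, so increment number \<open>k\<close> is
    the future one and all lower ones lie in the past.\<close>
  define \<tau> where "\<tau> i = (if i \<le> k then xs ! i else t)" for i
  have in0: "x \<in> set xs ==> 0 \<le> x \<and> x \<le> s" for x using xs(3) K(3) s by auto
  have \<tau>0: "\<tau> 0 = 0"
  proof -
   obtain i where i: "i < length xs" "xs ! i = 0" using xs(3) by (metis in_set_conv_nth insertI1)
   have "xs ! 0 \<le> xs ! i" using sorted_nth_mono[OF xs(1), of 0 i] i by simp
   moreover have "0 \<le> xs ! 0" using in0[of "xs ! 0"] ne by simp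
   ultimately show ?thesis using i by (simp add: \<tau>_def)
  qed
  have \<tau>k: "\<tau> k = s"
  proof -
   obtain i where i: "i < length xs" "xs ! i = s" using xs(3) by (metis in_set_conv_nth insertCI)
   have "xs ! i \<le> xs ! k" using sorted_nth_mono[OF xs(1), of i k] i len by simp
   moreover have "xs ! k \<le> s" using in0[of "xs ! k"] len by simp
   ultimately show ?thesis using i by (simp add: \<tau>_def)
  qed
  have step: "\<tau> i < \<tau> (Suc i)" if "i < Suc k" for i
  proof (cases "i < k")
   case True
   then show ?thesis using sorted_wrt_nth_less[OF sx, of i "Suc i"] len by (simp add: \<tau>_def)
  next
   case False
   then have "i = k" using that by simp
   then show ?thesis using \<tau>k s by (simp add: \<tau>_def)
  qed
  define D where "D i w = B (\<tau> (Suc i)) w - B (\<tau> i) w" for i w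
  define Ev where "Ev i = {D i -` C \<inter> space M |C. C \<in> sets borel}" for i
  have "\<forall>(k::nat) \<tau>. 0 \<le> \<tau> 0 \<and> (\<forall>i<k. \<tau> i < \<tau> (Suc i)) \<longrightarrow>
    indep_vars (%_. borel) (%i w. B (\<tau> (Suc i)) w - B (\<tau> i) w) {..<k}"
   using W unfolding standard_brownian_motion_def by blast
  then have iv: "indep_vars (%_. borel) D {..<Suc k}"
   using \<tau>0 step unfolding D_def[abs_def] by simp
  then have ie: "indep_sets Ev {..<Suc k}" unfolding indep_vars_def2 Ev_def by simp
  have Evs: "Int_stable (Ev i)" for i
   unfolding Ev_def by (rule vimage_Int_stable)
  define I where "I b = (if b then {..<k} else {k})" for b
  have IU: "(\<Union>b\<in>UNIV. I b) = {..<Suc k}" by (auto simp: I_def UNIV_bool)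
  have "indep_sets (%b. sigma_sets (space M) (\<Union>i\<in>I b. Ev i)) UNIV"
   by (rule indep_sets_collect_sigma) (use ie Evs IU in \<open>auto simp: disjoint_family_on_def I_def\<close>)
  then have ind: "indep_set (sigma_sets (space M) (\<Union>i\<in>{..<k}. Ev i)) (sigma_sets (space M) (Ev k))"
   unfolding indep_set_def by (rule indep_sets_mono_sets) (auto simp: I_def split: bool.split)
  let ?S = "sigma (space M) (\<Union>i\<in>{..<k}. Ev i)"
  have sp: "(\<Union>i\<in>{..<k}. Ev i) \<subseteq> Pow (space M)" by (auto simp: Ev_def)
  have Dm: "D i \<in> bm ?S" if "i < k" for i
  proof (rule measurableI)
   fix C :: "real set" assume "C \<in> sets borel"
   then have "D i -` C \<inter> space M \<in> (\<Union>i\<in>{..<k}. Ev i)" using that by (auto simp: Ev_def)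
   then show "D i -` C \<inter> space ?S \<in> sets ?S" using sp by (simp add: sigma_sets.Basic)
  qed simp
  \<comment> \<open>The same cylinder event written with increments. It agrees with \<open>A\<close>
    only almost surely, since the motion starts at 0 only almost surely.\<close>
  define A' where "A' = {w\<in>space M. \<forall>i\<in>{..k}. \<tau> i \<in> K \<longrightarrow> (\<Sum>l<i. D l w) \<in> C (\<tau> i)}"
  have A'S: "A' \<in> sigma_sets (space M) (\<Union>i\<in>{..<k}. Ev i)"
  proof -
   have "{w\<in>space ?S. \<forall>i\<in>{..k}. \<tau> i \<in> K \<longrightarrow> (\<Sum>l<i. D l w) \<in> C (\<tau> i)} \<in> sets ?S"
   proof (intro sets.sets_Collect_finite_All)
    fix i assume i: "i \<in> {..k}"
    show "{w\<in>space ?S. \<tau> i \<in> K \<longrightarrow> (\<Sum>l<i. D l w) \<in> C (\<tau> i)} \<in> sets ?S"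
    proof (cases "\<tau> i \<in> K")
     case True
     have "(%w. \<Sum>l<i. D l w) \<in> bm ?S" using Dm i by (intro borel_measurable_sum) auto
     from measurable_sets[OF this, of "C (\<tau> i)"] K(4) True
     show ?thesis by (simp add: vimage_def Int_def conj_commute)
    qed simp
   qed simp
   then show ?thesis using sp by (simp add: A'_def)
  qed
  have A'M: "A' \<in> events" and EM: "E \<in> events" and AM: "A \<in> events"
   using ind A'S im E pm \<open>A \<in> past_events M B s\<close> unfolding indep_sets2_eq by auto
  have Ek: "E \<in> sigma_sets (space M) (Ev k)"
   using E \<tau>k by (auto simp: incr_events_def Ev_def D_def[abs_def] \<tau>_def intro!: sigma_sets.Basic)
  have AA: "AE w in M. w \<in> A \<longleftrightarrow> w \<in> A'"
   using zero AE_space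
  proof eventually_elim
   case (elim w)
   have S: "(\<Sum>l<i. D l w) = B (\<tau> i) w" for i
    unfolding D_def using elim(1) \<tau>0 sum_lessThan_telescope[of "%i. B (\<tau> i) w" i] by simp
   have "(\<forall>i\<in>{..k}. \<tau> i \<in> K \<longrightarrow> B (\<tau> i) w \<in> C (\<tau> i)) \<longleftrightarrow> (\<forall>r\<in>K. B r w \<in> C r)"
   proof (intro iffI ballI impI)
    fix r assume a: "\<forall>i\<in>{..k}. \<tau> i \<in> K \<longrightarrow> B (\<tau> i) w \<in> C (\<tau> i)" and r: "r \<in> K"
    then obtain i where "i < length xs" "xs ! i = r" using xs(3) by (metis in_set_conv_nth insertCI)
    then have "i \<in> {..k}" "\<tau> i = r" using len by (auto simp: \<tau>_def)
    then show "B r w \<in> C r" using a r by blast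
   qed auto
   moreover have "w \<in> A' \<longleftrightarrow> (\<forall>i\<in>{..k}. \<tau> i \<in> K \<longrightarrow> B (\<tau> i) w \<in> C (\<tau> i))"
    unfolding A'_def using elim(2) S by simp
   moreover have "w \<in> A \<longleftrightarrow> (\<forall>r\<in>K. B r w \<in> C r)" unfolding K(1) using elim(2) by auto
   ultimately show ?case by blast
  qed
  have "prob (A \<inter> E) = prob (A' \<inter> E)"
   by (rule finite_measure_eq_AE) (use AA AM A'M EM in auto)
  also have "... = prob A' * prob E"
   using ind A'S Ek unfolding indep_sets2_eq by blast
  also have "prob A' = prob A"
   by (rule finite_measure_eq_AE) (use AA AM A'M in auto)
  finally show "prob (A \<inter> E) = prob A * prob E" .
 qed
qed

section \<open>Martingale properties from the stochastic basis\<close>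

context
 fixes M F0 :: "'w measure" and W :: "'N::finite option => real => 'w => real"
 assumes basis: "stochastic_basis M F0 W"
begin

interpretation prob_space M
 using basis by (simp add: stochastic_basis_def)

lemma W_bm: "standard_brownian_motion M (W j)"
 using basis by (simp add: stochastic_basis_def)

lemma W_meas: "0 \<le> t ==> W j t \<in> bm M"
 using W_bm[of j] by (simp add: standard_brownian_motion_def)

lemma F0_sets: "sets F0 \<subseteq> sets M" and F0_space: "space F0 = space M"
 using basis by (auto simp: stochastic_basis_def subalgebra_def)

lemma gen_sub: "sets (generated_filtration M F0 W t) \<subseteq> sets M"
 and gen_space: "space (generated_filtration M F0 W t) = space M"
 and gen_sets: "sets (generated_filtration M F0 W t) = sigma_sets (space M)
   (sets F0 \<union> {W j s -` B \<inter> space M |j s B. 0 \<le> s \<and> s \<le> t \<and> B \<in> sets borel} \<union> null_sets M)"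
proof -
 let ?G = "sets F0 \<union> {W j s -` B \<inter> space M |j s B. 0 \<le> s \<and> s \<le> t \<and> B \<in> sets borel} \<union> null_sets M"
 have G: "?G \<subseteq> sets M"
  using F0_sets measurable_sets[OF W_meas] by (auto simp: null_sets_def)
 then have G': "?G \<subseteq> Pow (space M)" using sets.space_closed by blast
 show s: "sets (generated_filtration M F0 W t) = sigma_sets (space M) ?G"
  unfolding generated_filtration_def by (rule sets_measure_of[OF G'])
 show "sets (generated_filtration M F0 W t) \<subseteq> sets M"
  unfolding s by (rule sets.sigma_sets_subset[OF G])
 show "space (generated_filtration M F0 W t) = space M"
  unfolding generated_filtration_def by (rule space_measure_of[OF G'])
qed

text \<open>An intersection of sigma algebras is already a sigma algebra, so \<open>sigma\<close>
  adds nothing to it.\<close>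

lemma aug_iff:
 "A \<in> sets (augmented_filtration M F0 W t) \<longleftrightarrow> (\<forall>s>t. A \<in> sets (generated_filtration M F0 W s))"
 and aug_space: "space (augmented_filtration M F0 W t) = space M"
proof -
 let ?I = "\<Inter>s\<in>{t<..}. sets (generated_filtration M F0 W s)"
 have "?I \<subseteq> sets (generated_filtration M F0 W (t + 1))" by auto
 then have I: "?I \<subseteq> Pow (space M)" using gen_sub[of "t+1"] sets.space_closed[of M] by blast
 have "sigma_sets (space M) ?I \<subseteq> sets (generated_filtration M F0 W s)" if "t < s" for s
  using sets.sigma_sets_subset[of ?I "generated_filtration M F0 W s"] that by (auto simp: gen_space)
 then show "A \<in> sets (augmented_filtration M F0 W t) \<longleftrightarrow> (\<forall>s>t. A \<in> sets (generated_filtration M F0 W s))"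
  unfolding augmented_filtration_def sets_measure_of[OF I] by (auto intro: sigma_sets.Basic)
 show "space (augmented_filtration M F0 W t) = space M"
  unfolding augmented_filtration_def by (rule space_measure_of[OF I])
qed

lemma past_sub: "past_events M (W j) s \<subseteq> process_events M (W j)"
 and incr_sub: "0 \<le> s ==> 0 \<le> t ==> incr_events M (W j) s t \<subseteq> process_events M (W j)"
proof -
 let ?G = "{W j t -` B \<inter> space M |t B. 0 \<le> t \<and> B \<in> sets borel}"
 interpret P: sigma_algebra "space M" "process_events M (W j)"
  unfolding process_events_def by (rule sigma_algebra_sigma_sets) auto
 show "past_events M (W j) s \<subseteq> process_events M (W j)"
 proof
  fix A assume "A \<in> past_events M (W j) s"
  then obtain K C where K: "A = (\<Inter>r\<in>K. W j r -` C r \<inter> space M) \<inter> space M" "finite K" "K \<subseteq> {0..s}" "\<forall>r\<in>K. C r \<in> sets borel"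
   unfolding past_events_def by blast
  have "W j r -` C r \<inter> space M \<in> process_events M (W j)" if "r \<in> K" for r
   unfolding process_events_def using K that by (intro sigma_sets.Basic) fastforce
  note mem = this
  show "A \<in> process_events M (W j)"
  proof (cases "K = {}")
   case True
   then show ?thesis using K(1) P.top by simp
  next
   case False
   show ?thesis unfolding K(1) by (rule P.Int[OF P.finite_INT[OF K(2) False mem] P.top])
  qed
 qed
 show "incr_events M (W j) s t \<subseteq> process_events M (W j)" if st: "0 \<le> s" "0 \<le> t"
 proof
  fix A assume "A \<in> incr_events M (W j) s t"
  then obtain C where C: "A = (%w. W j t w - W j s w) -` C \<inter> space M" "C \<in> sets borel" unfolding incr_events_def by blast
  let ?S = "sigma (space M) (process_events M (W j))"
  have eq: "sets ?S = process_events M (W j)" by (rule P.sets_measure_of_eq)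
  have "W j r \<in> bm ?S" if "0 \<le> r" for r
  proof (rule measurableI)
   fix B :: "real set" assume "B \<in> sets borel"
   then have "W j r -` B \<inter> space M \<in> process_events M (W j)"
    unfolding process_events_def using that by (intro sigma_sets.Basic) blast
   then show "W j r -` B \<inter> space ?S \<in> sets ?S" unfolding eq P.space_measure_of_eq .
  qed simp
  then have "(%w. W j t w - W j s w) \<in> bm ?S" using st by (intro borel_measurable_diff)
  from measurable_sets[OF this C(2)] show "A \<in> process_events M (W j)"
   unfolding eq C(1) P.space_measure_of_eq .
 qed
qed

lemma joint_indep:
 assumes A0: "A0 \<in> sets F0" and A: "\<And>j. A j \<in> process_events M (W j)"
 shows "prob (A0 \<inter> (\<Inter>j. A j)) = prob A0 * (\<Prod>j\<in>UNIV. prob (A j))"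
proof -
 have ind: "indep_sets (case_option (sets F0) (%j. process_events M (W j))) UNIV"
  using basis by (simp add: stochastic_basis_def)
 have U: "(UNIV :: 'N option option set) = insert None (range Some)" by (rule UNIV_option_conv)
 have "prob (\<Inter>q\<in>UNIV. case_option A0 A q) = (\<Prod>q\<in>UNIV. prob (case_option A0 A q))"
  by (rule indep_setsD[OF ind]) (use A0 A in \<open>auto split: option.split\<close>)
 moreover have "(\<Inter>q\<in>UNIV. case_option A0 A q) = A0 \<inter> (\<Inter>j. A j)"
  unfolding U by auto
 moreover have "(\<Prod>q\<in>UNIV. prob (case_option A0 A q)) = prob A0 * (\<Prod>j\<in>UNIV. prob (A j))"
  unfolding U by (subst prod.insert) (auto simp: prod.reindex)
 ultimately show ?thesis by simp
qed

text \<open>Rectangles of initial events and past cylinder events of all motions form an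
  intersection-stable generator; null sets are included because the filtration contains
  them.\<close>

definition past_class :: "real => 'w set set" where
 "past_class s = {A0 \<inter> (\<Inter>j. A j) |A0 A. A0 \<in> sets F0 \<and> (\<forall>j. A j \<in> past_events M (W j) s)} \<union> null_sets M"

definition incr_class :: "real => real => 'w set set" where
 "incr_class s t = {\<Inter>j. C j |C. \<forall>j. C j \<in> incr_events M (W j) s t}"

lemma space_past: "space M \<in> past_events M B s" and space_incr: "space M \<in> incr_events M B s t"
 unfolding past_events_def incr_events_def
 by (intro CollectI exI[of _ "{}"] exI[of _ "%_. UNIV"], simp) (intro CollectI exI[of _ UNIV], simp)

lemma events_sub: "process_events M (W j) \<subseteq> events"
proof -
 have "{W j t -` B \<inter> space M |t B. 0 \<le> t \<and> B \<in> sets borel} \<subseteq> events"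
  using measurable_sets[OF W_meas] by auto
 then show ?thesis unfolding process_events_def by (rule sets.sigma_sets_subset)
qed

lemma past_Int_events:
 assumes "A0 \<in> sets F0" "\<forall>j. A j \<in> past_events M (W j) s"
 shows "A0 \<inter> (\<Inter>j. A j) \<in> events"
proof -
 have "A j \<in> events" for j using assms(2) past_sub[of j s] events_sub[of j] by blast
 then show ?thesis using assms(1) F0_sets by (intro sets.Int sets.finite_INT) auto
qed

text \<open>Joint independence of the initial sigma algebra and the motions factorises over the
  motions, and inside each motion \<open>bm_past_indep\<close> separates past and increment. Null
  sets are independent of everything.\<close>

lemma class_indep:
 assumes s: "0 \<le> s" "s < t"
 shows "indep_set (past_class s) (incr_class s t)"
proof -
 have t: "0 \<le> t" using s by simp
 have incrU: "(\<Inter>j. C j) \<in> events" if "\<forall>j. C j \<in> incr_events M (W j) s t" for C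
 proof -
  have "C j \<in> events" for j using that incr_sub[OF s(1) t, of j] events_sub[of j] by blast
  then show ?thesis by (intro sets.finite_INT) auto
 qed
 have pastU: "A0 \<inter> (\<Inter>j. A j) \<in> events" if "A0 \<in> sets F0" "\<forall>j. A j \<in> past_events M (W j) s" for A0 A
  by (rule past_Int_events[OF that])
 have key: "prob ((A0 \<inter> (\<Inter>j. A j)) \<inter> (\<Inter>j. C j)) = prob A0 * (\<Prod>j\<in>UNIV. prob (A j)) * (\<Prod>j\<in>UNIV. prob (C j))"
  if A0: "A0 \<in> sets F0" and A: "\<forall>j. A j \<in> past_events M (W j) s" and C: "\<forall>j. C j \<in> incr_events M (W j) s t" for A0 A C
 proof -
  have pe: "A j \<inter> C j \<in> process_events M (W j)" for j
  proof -
   interpret P: sigma_algebra "space M" "process_events M (W j)"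
    unfolding process_events_def by (rule sigma_algebra_sigma_sets) auto
   show ?thesis using A C past_sub[of j s] incr_sub[OF s(1) t, of j] by (intro P.Int) auto
  qed
  have "(A0 \<inter> (\<Inter>j. A j)) \<inter> (\<Inter>j. C j) = A0 \<inter> (\<Inter>j. A j \<inter> C j)" by auto
  then have "prob ((A0 \<inter> (\<Inter>j. A j)) \<inter> (\<Inter>j. C j)) = prob A0 * (\<Prod>j\<in>UNIV. prob (A j \<inter> C j))"
   using joint_indep[OF A0 pe] by simp
  also have "(\<Prod>j\<in>UNIV. prob (A j \<inter> C j)) = (\<Prod>j\<in>UNIV. prob (A j) * prob (C j))"
   using bm_past_indep[OF prob_space_axioms W_bm s] A C unfolding indep_sets2_eq
   by (intro prod.cong refl) blast
  finally show ?thesis by (simp add: prod.distrib)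
 qed
 have Sp: "(\<Inter>j::'N option. space M) = space M" by auto
 show ?thesis
  unfolding indep_sets2_eq
 proof (intro conjI ballI)
  show "past_class s \<subseteq> events" using pastU by (auto simp: past_class_def)
  show "incr_class s t \<subseteq> events" using incrU by (auto simp: incr_class_def)
  fix E G assume E: "E \<in> past_class s" and "G \<in> incr_class s t"
  then obtain C where C: "G = (\<Inter>j. C j)" "\<forall>j. C j \<in> incr_events M (W j) s t" by (auto simp: incr_class_def)
  have pG: "prob G = (\<Prod>j\<in>UNIV. prob (C j))"
  proof -
   have "prob ((space M \<inter> (\<Inter>j::'N option. space M)) \<inter> (\<Inter>j. C j)) = (\<Prod>j\<in>UNIV. prob (C j))"
    using key[of "space M" "%_. space M" C] C(2) space_past F0_space sets.top[of F0] by (simp add: prob_space)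
   moreover have "(space M \<inter> (\<Inter>j::'N option. space M)) \<inter> (\<Inter>j. C j) = G"
    using incrU[OF C(2)] sets.sets_into_space C(1) by (auto simp: Sp)
   ultimately show ?thesis by simp
  qed
  show "prob (E \<inter> G) = prob E * prob G"
  proof (cases "E \<in> null_sets M")
   case True
   have GM: "G \<in> events" using incrU[OF C(2)] C(1) by simp
   have "E \<inter> G \<in> null_sets M" by (rule null_set_Int2[OF True GM])
   then show ?thesis using True by (simp add: measure_eq_0_null_sets)
  next
   case False
   then obtain A0 A where A: "E = A0 \<inter> (\<Inter>j. A j)" "A0 \<in> sets F0" "\<forall>j. A j \<in> past_events M (W j) s"
    using E by (auto simp: past_class_def)
   have "prob E = prob A0 * (\<Prod>j\<in>UNIV. prob (A j))"
    unfolding A(1) using joint_indep[OF A(2), of A] A(3) past_sub by blast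
   then show ?thesis using key[OF A(2,3) C(2)] pG A(1) C(1) by simp
  qed
 qed
qed

lemma past_class_Int_stable: "Int_stable (past_class s)"
 unfolding Int_stable_def
proof (intro ballI)
 fix A A' assume A: "A \<in> past_class s" and A': "A' \<in> past_class s"
 have ev: "past_class s \<subseteq> events"
  using past_Int_events by (auto simp: past_class_def)
 show "A \<inter> A' \<in> past_class s"
 proof (cases "A \<in> null_sets M \<or> A' \<in> null_sets M")
  case True
  then have "A \<inter> A' \<in> null_sets M" using A A' ev by (auto intro: null_set_Int1 null_set_Int2)
  then show ?thesis by (simp add: past_class_def)
 next
  case False
  then obtain B0 B B0' B' where B: "A = B0 \<inter> (\<Inter>j. B j)" "B0 \<in> sets F0" "\<forall>j. B j \<in> past_events M (W j) s"
   "A' = B0' \<inter> (\<Inter>j. B' j)" "B0' \<in> sets F0" "\<forall>j. B' j \<in> past_events M (W j) s"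
   using A A' by (auto simp: past_class_def)
  have "A \<inter> A' = (B0 \<inter> B0') \<inter> (\<Inter>j. B j \<inter> B' j)" using B(1,4) by auto
  moreover have "B0 \<inter> B0' \<in> sets F0" using B by auto
  moreover have "\<forall>j. B j \<inter> B' j \<in> past_events M (W j) s"
   using B past_events_Int_stable unfolding Int_stable_def by blast
  ultimately show ?thesis unfolding past_class_def by blast
 qed
qed

lemma incr_class_Int_stable: "Int_stable (incr_class s t)"
 unfolding Int_stable_def
proof (intro ballI)
 fix A A' assume "A \<in> incr_class s t" "A' \<in> incr_class s t"
 then obtain B B' where B: "A = (\<Inter>j. B j)" "\<forall>j. B j \<in> incr_events M (W j) s t"
  "A' = (\<Inter>j. B' j)" "\<forall>j. B' j \<in> incr_events M (W j) s t" by (auto simp: incr_class_def)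
 have "A \<inter> A' = (\<Inter>j. B j \<inter> B' j)" using B by auto
 moreover have "\<forall>j. B j \<inter> B' j \<in> incr_events M (W j) s t"
  using B incr_events_Int_stable unfolding Int_stable_def by blast
 ultimately show "A \<inter> A' \<in> incr_class s t" unfolding incr_class_def by blast
qed

lemma gen_sub_past: "0 \<le> s ==> sets (generated_filtration M F0 W s) \<subseteq> sigma_sets (space M) (past_class s)"
 unfolding gen_sets
proof (rule sigma_sets_mono, intro subsetI)
 fix A assume s: "0 \<le> s" and A: "A \<in> sets F0 \<union> {W j r -` B \<inter> space M |j r B. 0 \<le> r \<and> r \<le> s \<and> B \<in> sets borel} \<union> null_sets M"
 have "A \<in> past_class s"
  using A
 proof (elim UnE)
  assume A: "A \<in> sets F0"
  then have "A = A \<inter> (\<Inter>j::'N option. space M)" using sets.sets_into_space F0_space by auto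
  then show ?thesis unfolding past_class_def using A space_past by blast
 next
  assume "A \<in> {W j r -` B \<inter> space M |j r B. 0 \<le> r \<and> r \<le> s \<and> B \<in> sets borel}"
  then obtain j r B where A: "A = W j r -` B \<inter> space M" "0 \<le> r" "r \<le> s" "B \<in> sets borel" by blast
  have "A \<in> past_events M (W j) s"
   unfolding past_events_def using A by (intro CollectI exI[of _ "{r}"] exI[of _ "%_. B"]) auto
  then have "\<forall>i. (if i = j then A else space M) \<in> past_events M (W i) s" using space_past by auto
  moreover have "A = space M \<inter> (\<Inter>i. if i = j then A else space M)" using A(1) by (auto split: if_splits)
  moreover have "space M \<in> sets F0" using sets.top[of F0] F0_space by simp
  ultimately show ?thesis unfolding past_class_def by blast
 next
  assume "A \<in> null_sets M" then show ?thesis by (simp add: past_class_def)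
 qed
 then show "A \<in> sigma_sets (space M) (past_class s)" by (rule sigma_sets.Basic)
qed

text \<open>Stated for the generated filtration: events of the augmented one may look
  infinitesimally beyond \<open>s\<close>, and the limit that deals with them is taken in
  \<open>basis_brownian_filtration\<close>.\<close>

lemma gen_indep:
 assumes s: "0 \<le> s" "s < t" and A: "A \<in> sets (generated_filtration M F0 W s)"
  and Y: "Y \<in> bm (sigma (space M) (incr_class s t))" "integrable M Y"
 shows "(LI M (%w. indicator A w * Y w)) = (LI M (%w. Y w)) * prob A"
proof -
 have ind: "indep_set (sigma_sets (space M) (past_class s)) (sigma_sets (space M) (incr_class s t))"
  by (rule indep_set_sigma_sets[OF class_indep[OF s] past_class_Int_stable incr_class_Int_stable])
 have AM: "A \<in> events" using A gen_sub by auto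
 have As: "A \<in> sigma_sets (space M) (past_class s)" using A gen_sub_past[OF s(1)] by auto
 interpret PC: sigma_algebra "space M" "sigma_sets (space M) (past_class s)"
  by (rule sigma_algebra_sigma_sets) (use class_indep[OF s] sets.space_closed in \<open>auto simp: indep_sets2_eq\<close>)
 have ic: "incr_class s t \<subseteq> Pow (space M)" using class_indep[OF s] sets.space_closed unfolding indep_sets2_eq by blast
 have iv: "indep_var borel (indicator A :: _ => real) borel Y"
  unfolding indep_var_eq
 proof (intro conjI)
  show "random_variable borel (indicator A)" using AM by simp
  show "random_variable borel Y" using Y(2) by simp
  have 1: "sigma_sets (space M) {(indicator A :: _ => real) -` B \<inter> space M |B. B \<in> sets borel} \<subseteq> sigma_sets (space M) (past_class s)"
  proof (rule PC.sigma_sets_subset, safe)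
   fix B :: "real set"
   have "(indicator A :: _ => real) -` B \<inter> space M = (if 1 \<in> B then A else {}) \<union> (if 0 \<in> B then space M - A else {})"
    using sets.sets_into_space[OF AM] by (auto split: split_indicator split_indicator_asm if_splits)
   then show "(indicator A :: _ => real) -` B \<inter> space M \<in> sigma_sets (space M) (past_class s)"
    using As by auto
  qed
  have 2: "sigma_sets (space M) {Y -` B \<inter> space M |B. B \<in> sets borel} \<subseteq> sigma_sets (space M) (incr_class s t)"
  proof (rule sigma_sets_mono, safe)
   fix B :: "real set" assume "B \<in> sets borel"
   from measurable_sets[OF Y(1) this] show "Y -` B \<inter> space M \<in> sigma_sets (space M) (incr_class s t)"
    using ic by simp
  qed
  show "indep_set (sigma_sets (space M) {(indicator A :: _ => real) -` B \<inter> space M |B. B \<in> sets borel})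
    (sigma_sets (space M) {Y -` B \<inter> space M |B. B \<in> sets borel})"
   using ind 1 2 unfolding indep_sets2_eq by blast
 qed
 have "integrable M (indicator A :: _ => real)"
  by (rule integrable_real_indicator[OF AM]) (simp add: emeasure_eq_measure)
 from indep_var_lebesgue_integral[OF iv this Y(2)] show ?thesis using AM by (simp add: mult.commute)
qed

lemma incr_measurable:
 assumes s: "0 \<le> s" "s < t"
 shows "(%w. W j t w - W j s w) \<in> bm (sigma (space M) (incr_class s t))"
proof (rule measurableI)
 have ic: "incr_class s t \<subseteq> Pow (space M)" using class_indep[OF s] sets.space_closed unfolding indep_sets2_eq by blast
 fix B :: "real set" assume B: "B \<in> sets borel"
 let ?A = "(%w. W j t w - W j s w) -` B \<inter> space M"
 have "?A \<in> incr_events M (W j) s t" using B by (auto simp: incr_events_def)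
 then have "\<forall>i. (if i = j then ?A else space M) \<in> incr_events M (W i) s t" using space_incr by auto
 moreover have "?A = (\<Inter>i. if i = j then ?A else space M)" by (auto split: if_splits)
 ultimately have "?A \<in> incr_class s t" unfolding incr_class_def by blast
 then show "(%w. W j t w - W j s w) -` B \<inter> space (sigma (space M) (incr_class s t)) \<in> sets (sigma (space M) (incr_class s t))"
  using ic by (simp add: sigma_sets.Basic)
qed simp

lemma incr_uncorrelated:
 assumes s: "0 \<le> s" "s \<le> t" and ij: "i \<noteq> j"
 shows "(LI M (%w. (W i t w - W i s w) * (W j t w - W j s w))) = 0"
proof -
 have t: "0 \<le> t" using s by simp
 have L: "L2 M (%w. W j t w - W j s w)" for j using bm_moments(1)[OF prob_space_axioms W_bm s] .
 have i1: "integrable M (%w. W j t w - W j s w)" for j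
  using L2_inner_integrable[OF L, of "%_. 1" j] by (simp add: L2_def inner_commute)
 have ind: "indep_sets (case_option (sets F0) (%j. process_events M (W j))) UNIV"
  using basis by (simp add: stochastic_basis_def)
 have iv: "indep_var borel (%w. W i t w - W i s w) borel (%w. W j t w - W j s w)"
  unfolding indep_var_eq
 proof (intro conjI)
  show "random_variable borel (%w. W i t w - W i s w)" "random_variable borel (%w. W j t w - W j s w)"
   using L by (auto simp: L2_def)
  have "sigma_sets (space M) {(%w. W k t w - W k s w) -` B \<inter> space M |B. B \<in> sets borel} \<subseteq> process_events M (W k)" for k
  proof -
   interpret P: sigma_algebra "space M" "process_events M (W k)"
    unfolding process_events_def by (rule sigma_algebra_sigma_sets) auto
   show ?thesis using incr_sub[OF s(1) t, of k] unfolding incr_events_def by (rule P.sigma_sets_subset)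
  qed
  moreover have "indep_set (process_events M (W i)) (process_events M (W j))"
   unfolding indep_sets2_eq
  proof (intro conjI ballI events_sub)
   fix a b assume a: "a \<in> process_events M (W i)" and b: "b \<in> process_events M (W j)"
   have "prob (\<Inter>q\<in>{Some i, Some j}. if q = Some i then a else b) = (\<Prod>q\<in>{Some i, Some j}. prob (if q = Some i then a else b))"
    by (rule indep_setsD[OF ind]) (use a b ij in auto)
   then show "prob (a \<inter> b) = prob a * prob b" using ij by (auto simp: Int_commute)
  qed
  ultimately show "indep_set (sigma_sets (space M) {(%w. W i t w - W i s w) -` B \<inter> space M |B. B \<in> sets borel})
   (sigma_sets (space M) {(%w. W j t w - W j s w) -` B \<inter> space M |B. B \<in> sets borel})"
   unfolding indep_sets2_eq by blast
 qed
 from indep_var_lebesgue_integral[OF iv i1 i1] show ?thesis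
  using bm_moments(2)[OF prob_space_axioms W_bm s] by simp
qed

text \<open>Right limits: the increments after \<open>s\<close> are \<open>L\<^sup>2\<close>-limits of increments after later times.\<close>

lemma basis_brownian_filtration: "brownian_filtration M (augmented_filtration M F0 W) W"
proof (unfold_locales)
 let ?G = "generated_filtration M F0 W"
 fix t :: real assume t: "0 \<le> t"
 show "subalgebra M (augmented_filtration M F0 W t)"
  unfolding subalgebra_def aug_space
 proof (intro conjI refl subsetI)
  fix A assume "A \<in> sets (augmented_filtration M F0 W t)"
  then have "A \<in> sets (?G (t + 1))" unfolding aug_iff by simp
  then show "A \<in> events" using gen_sub by blast
 qed
 show "null_sets M \<subseteq> sets (augmented_filtration M F0 W t)"
  unfolding subset_eq aug_iff gen_sets by (auto intro: sigma_sets.Basic)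
 fix j
 show "W j t \<in> bm (augmented_filtration M F0 W t)"
 proof (rule measurableI)
  fix B :: "real set" assume B: "B \<in> sets borel"
  show "W j t -` B \<inter> space (augmented_filtration M F0 W t) \<in> sets (augmented_filtration M F0 W t)"
   unfolding aug_iff aug_space gen_sets
  proof (intro allI impI)
   fix s assume "t < s"
   then have "W j t -` B \<inter> space M \<in> {W j s' -` B \<inter> space M |j s' B. 0 \<le> s' \<and> s' \<le> s \<and> B \<in> sets borel}"
    using t B less_imp_le by blast
   then show "W j t -` B \<inter> space M \<in> sigma_sets (space M)
    (sets F0 \<union> {W j s' -` B \<inter> space M |j s' B. 0 \<le> s' \<and> s' \<le> s \<and> B \<in> sets borel} \<union> null_sets M)"
    by (intro sigma_sets.Basic) blast
  qed
 qed simp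
next
 fix s t :: real assume st: "0 \<le> s" "s \<le> t"
 show "sets (augmented_filtration M F0 W s) \<subseteq> sets (augmented_filtration M F0 W t)"
 proof
  fix A assume "A \<in> sets (augmented_filtration M F0 W s)"
  then have "\<forall>r>s. A \<in> sets (generated_filtration M F0 W r)" by (simp only: aug_iff)
  then show "A \<in> sets (augmented_filtration M F0 W t)" unfolding aug_iff using st by (meson le_less_trans)
 qed
 show "L2 M (%w. W j t w - W j s w)" for j by (rule bm_moments(1)[OF prob_space_axioms W_bm st])
next
 show "AE w in M. continuous_on {0..} (%t. W j t w)" for j
  using W_bm[of j] by (simp add: standard_brownian_motion_def)
next
 fix s t :: real and A i j assume st: "0 \<le> s" "s \<le> t" and A: "A \<in> sets (augmented_filtration M F0 W s)"
 let ?G = "generated_filtration M F0 W"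
 have AM: "A \<in> events"
 proof -
  have "A \<in> sets (?G (s + 1))" using A unfolding aug_iff by simp
  then show ?thesis using gen_sub by blast
 qed
 have main: "(LI M (%w. indicator A w * (W j t w - W j s w))) = 0 \<and>
  (LI M (%w. indicator A w * ((W i t w - W i s w) * (W j t w - W j s w)))) = (if i = j then t - s else 0) * prob A" for i j
 proof (cases "s = t")
  case True
  then show ?thesis by simp
 next
  case False
  then have lt: "s < t" using st by simp
  \<comment> \<open>Strictly between \<open>s\<close> and \<open>t\<close> for every
    \<open>n\<close>; the double \<open>Suc\<close> keeps \<open>r 0\<close> below
    \<open>t\<close>.\<close>
  define r where "r n = s + (t - s) / real (Suc (Suc n))" for n
  have r: "s < r n" "r n < t" "0 \<le> r n" for n
  proof -
   have "0 < (t - s) / real (Suc (Suc n))" using lt by simp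
   then show "s < r n" by (simp add: r_def)
   then show "0 \<le> r n" using st by simp
   have "(t - s) / real (Suc (Suc n)) < (t - s) / 1" using lt by (intro divide_strict_left_mono) auto
   then show "r n < t" by (simp add: r_def)
  qed
  have rs: "r \<longlonglongrightarrow> s"
  proof -
   have "(%n. (t - s) * inverse (real (Suc (Suc n)))) \<longlonglongrightarrow> (t - s) * 0"
    by (intro tendsto_mult tendsto_const LIMSEQ_Suc[OF LIMSEQ_inverse_real_of_nat])
   then have "(%n. s + (t - s) / real (Suc (Suc n))) \<longlonglongrightarrow> s + 0"
    by (intro tendsto_add tendsto_const) (simp add: divide_inverse)
   then show ?thesis by (simp add: r_def[abs_def])
  qed
  \<comment> \<open>An event of the augmented filtration at \<open>s\<close> lies in every generated
    sigma algebra of a later time, where independence of the increments is available.\<close>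
  have AG: "A \<in> sets (?G (r n))" for n using A r(1) unfolding aug_iff by blast
  have L: "L2 M (%w. W j b w - W j a w)" if "0 \<le> a" "a \<le> b" for j a b
   by (rule bm_moments(1)[OF prob_space_axioms W_bm that])
  have i1: "integrable M (%w. W j b w - W j a w)" if "0 \<le> a" "a \<le> b" for j a b
   using L2_inner_integrable[OF L[OF that], of "%_. 1" j] by (simp add: L2_def inner_commute)
  have i2: "integrable M (%w. (W i b w - W i a w) * (W j b w - W j a w))" if "0 \<le> a" "a \<le> b" for i j a b
   using L2_inner_integrable[OF L[OF that] L[OF that], of i j] by simp
  have LA: "L2 M (%w. indicator A w * f w :: real)" if "L2 M f" for f
   by (rule L2_bound[OF that, where K=1]) (use that AM in \<open>auto simp: L2_def split: split_indicator\<close>)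
  have conv: "L2conv M (%n w. W j t w - W j (r n) w) (%w. W j t w - W j s w)" for j
   unfolding L2conv_real[OF L[OF r(3) less_imp_le[OF r(2)]] L[OF st]]
  proof -
   have "rsq M (%w. (W j t w - W j s w) - (W j t w - W j (r n) w)) = r n - s" for n
    using bm_moments(3)[OF prob_space_axioms W_bm st(1) less_imp_le[OF r(1)[of n]], of j] by simp
   moreover have "(%n. r n - s) \<longlonglongrightarrow> 0" using rs by (simp add: LIM_zero)
   ultimately show "(%n. \<integral>w. (norm ((W j t w - W j s w) - (W j t w - W j (r n) w)))\<^sup>2 \<partial>M) \<longlonglongrightarrow> 0" by simp
  qed
  have convA: "L2conv M (%n w. indicator A w * (W j t w - W j (r n) w)) (%w. indicator A w * (W j t w - W j s w))" for j
   unfolding L2conv_def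
  proof (rule tendsto_sandwich[OF _ _ tendsto_const conv[of j, unfolded L2conv_def]])
   show "\<forall>\<^sub>F n in sequentially. (nsq M (%w. indicator A w * (W j t w - W j s w) - indicator A w * (W j t w - W j (r n) w)))
    \<le> nsq M (%w. W j t w - W j s w - (W j t w - W j (r n) w))"
    by (intro always_eventually allI nn_integral_mono) (auto split: split_indicator)
  qed simp
  have m1: "(LI M (%w. indicator A w * (W j t w - W j (r n) w))) = 0" for n
   using gen_indep[OF r(3,2) AG incr_measurable[OF r(3,2)] i1[OF r(3) less_imp_le[OF r(2)]]]
    bm_moments(2)[OF prob_space_axioms W_bm r(3) less_imp_le[OF r(2)]] by simp
  have m2: "(LI M (%w. indicator A w * ((W i t w - W i (r n) w) * (W j t w - W j (r n) w)))) = (if i = j then t - r n else 0) * prob A" for n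
  proof -
   have m: "(%w. (W i t w - W i (r n) w) * (W j t w - W j (r n) w)) \<in> bm (sigma (space M) (incr_class (r n) t))"
    using incr_measurable[OF r(3,2)] by (intro borel_measurable_times)
   show ?thesis
    using gen_indep[OF r(3,2) AG m i2[OF r(3) less_imp_le[OF r(2)]]]
     bm_moments(3)[OF prob_space_axioms W_bm r(3) less_imp_le[OF r(2)]]
     incr_uncorrelated[OF r(3) less_imp_le[OF r(2)], of i j]
    by (auto simp: power2_eq_square)
  qed
  have one: "L2 M (%_. 1 :: real)" by (simp add: L2_def)
  have "(%n. \<integral>w. (indicator A w * (W j t w - W j (r n) w)) \<bullet> 1 \<partial>M) \<longlonglongrightarrow> (LI M (%w. (indicator A w * (W j t w - W j s w)) \<bullet> 1))"
   by (rule L2_inner_tendsto[OF LA[OF L[OF r(3) less_imp_le[OF r(2)]]] LA[OF L[OF st]] one one convA L2conv_const])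
  then have "(%n. 0) \<longlonglongrightarrow> (LI M (%w. indicator A w * (W j t w - W j s w)))" by (simp add: m1)
  then have 1: "(LI M (%w. indicator A w * (W j t w - W j s w))) = 0" using LIMSEQ_unique tendsto_const by blast
  have "(%n. \<integral>w. (indicator A w * (W i t w - W i (r n) w)) \<bullet> (W j t w - W j (r n) w) \<partial>M)
   \<longlonglongrightarrow> (LI M (%w. (indicator A w * (W i t w - W i s w)) \<bullet> (W j t w - W j s w)))"
   by (rule L2_inner_tendsto[OF LA[OF L[OF r(3) less_imp_le[OF r(2)]]] LA[OF L[OF st]] L[OF r(3) less_imp_le[OF r(2)]] L[OF st] convA conv])
  then have "(%n. (if i = j then t - r n else 0) * prob A) \<longlonglongrightarrow> (LI M (%w. indicator A w * ((W i t w - W i s w) * (W j t w - W j s w))))"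
   by (simp add: m2[symmetric] mult.assoc)
  moreover have "(%n. (if i = j then t - r n else 0) * prob A) \<longlonglongrightarrow> (if i = j then t - s else 0) * prob A"
   using rs by (auto intro!: tendsto_intros)
  ultimately show ?thesis using 1 LIMSEQ_unique by blast
 qed
 show "(LI M (%w. indicator A w * (W i t w - W i s w))) = 0" using main[of i i] by blast
 show "(LI M (%w. indicator A w * ((W i t w - W i s w) * (W j t w - W j s w)))) = (if i = j then t - s else 0) * measure M A"
  using main[of j i] by blast
qed

lemma F0_augmented: "0 \<le> t ==> sets F0 \<subseteq> sets (augmented_filtration M F0 W t)"
 unfolding subset_eq aug_iff gen_sets by (auto intro: sigma_sets.Basic)

end

section \<open>Block structure of the Riccati solution\<close>

lemma sum_matrix_vector: "(\<Sum>i\<in>I. A i) *v x = (\<Sum>i\<in>I. A i *v (x::real^'k::finite))"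
 by (induction I rule: infinite_finite_induct) (auto simp: matrix_vector_mult_add_rdistrib)

lemma matrix_vector_minus: "A *v (- y) = - (A *v y)" "(- A) *v y = - (A *v y)" for A :: "real^'k::finite^'l::finite"
 by (simp_all add: matrix_vector_mult_def vec_eq_iff sum_negf)

lemma inner_vmul: "x \<bullet> (y v* A) = (A *v x) \<bullet> (y :: real^'k::finite)"
 by (simp add: inner_commute[of x] dot_lmul_matrix inner_commute[of y])

lemma matrix_inv_cancel:
 fixes A :: "real^'k::finite^'k"
 assumes "invertible A"
 shows "A *v (matrix_inv A *v y) = y" and "matrix_inv A *v (A *v y) = y"
proof -
 have "A ** matrix_inv A = mat 1 \<and> matrix_inv A ** A = mat 1"
  unfolding matrix_inv_def using assms unfolding invertible_def by (rule someI_ex)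
 then show "A *v (matrix_inv A *v y) = y" and "matrix_inv A *v (A *v y) = y" by (simp_all add: matrix_vector_mul_assoc)
qed

lemma inner_transpose: "x \<bullet> (transpose A *v y) = (A *v x) \<bullet> (y :: real^'k::finite)"
 by (simp add: inner_vmul)

lemma sum_prod_UNIV: "(\<Sum>p\<in>UNIV. f p) = (\<Sum>i\<in>UNIV. \<Sum>a\<in>UNIV. f (i :: 'a::finite, a :: 'b::finite))"
 by (simp add: sum.cartesian_product UNIV_Times_UNIV)

section \<open>Stacked coefficients read block by block\<close>

definition blk :: "'N::finite => real^('N \<times> 'k) => real^'k" where
 "blk i x = (\<chi> a. x $ (i, a))"

definition mean :: "real^('N::finite \<times> 'k) => real^'k" where
 "mean x = (1 / real CARD('N)) *\<^sub>R (\<Sum>i\<in>UNIV. blk i x)"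

lemma blk_nth: "blk i x $ a = x $ (i, a)"
 by (simp add: blk_def)

lemma blk_add: "blk i (x + y) = blk i x + blk i y"
 and blk_diff: "blk i (x - y) = blk i x - blk i y"
 and blk_scaleR: "blk i (c *\<^sub>R x) = c *\<^sub>R blk i x"
 by (simp_all add: blk_def vec_eq_iff)

lemma blk_eq_iff: "x = y \<longleftrightarrow> (\<forall>i. blk i x = blk i y)"
 by (auto simp: blk_def vec_eq_iff)

lemma inner_blk: "x \<bullet> y = (\<Sum>i\<in>UNIV. blk i x \<bullet> blk i (y :: real^('N::finite \<times> 'k::finite)))"
 by (simp add: inner_vec_def sum_prod_UNIV blk_nth)

lemma blk_stack: "blk i (stack x) = x i"
 by (simp add: blk_def stack_def vec_eq_iff)

text \<open>Drift of the stacked state; \<open>df\<close> and \<open>gm\<close> are its coefficients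
  against the noise of one agent and against the common noise, \<open>cst\<close> is the stacked
  running cost. Only \<open>gm\<close> is free of the control.\<close>

definition dr :: "('n::finite, 'm::finite) lq => real^('N::finite \<times> 'n) => real^('N \<times> 'm) => real^('N \<times> 'n)" where
 "dr L x u = (bA L + bAbar L) *v x + bB L *v u + bb L"

definition df :: "('n::finite, 'm::finite) lq => 'N::finite => real^('N \<times> 'n) => real^('N \<times> 'm) => real^('N \<times> 'n)" where
 "df L i x u = (bC L i + bCbar L i) *v x + bD L i *v (be i *v u) + bsigma L i"

definition gm :: "('n::finite, 'm::finite) lq => real^('N::finite \<times> 'n) => real^('N \<times> 'n)" where
 "gm L x = (bGamma L + bGammabar L) *v x + bgamma L"

definition cst :: "('n::finite, 'm::finite) lq => real^('N::finite \<times> 'n) => real^('N \<times> 'm) => real" where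
 "cst L x u = x \<bullet> ((bQ L + bQbar L) *v x) + 2 * (u \<bullet> (bS L *v x)) + u \<bullet> (bR L *v u) + 2 * (bq L \<bullet> x) + 2 * (br L \<bullet> u)"

text \<open>For symmetric \<open>P\<close> and \<open>v(x) = x . P x + 2 p . x + k\<close> the
  gradient is \<open>2 (P x + p)\<close> and the Hessian \<open>2 P\<close>, so this is the
  generator of the controlled state applied to \<open>v\<close>, plus the running cost.\<close>

definition Ham :: "('n::finite, 'm::finite) lq => real^('N::finite \<times> 'n)^('N \<times> 'n) => real^('N \<times> 'n) =>
  real^('N \<times> 'n) => real^('N \<times> 'm) => real" where
 "Ham L P p x u = 2 * ((P *v x + p) \<bullet> dr L x u) + (\<Sum>i\<in>UNIV. df L i x u \<bullet> (P *v df L i x u))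
  + gm L x \<bullet> (P *v gm L x) + cst L x u"

lemma kron_id_blk: "blk i (kron (mat 1) A *v x) = A *v blk i (x :: real^('N::finite \<times> 'k::finite))"
proof -
 have "(kron (mat 1) A *v x) $ (i, a) = (A *v blk i x) $ a" for a
 proof -
  have "(kron (mat 1) A *v x) $ (i, a) = (\<Sum>l\<in>UNIV. \<Sum>b\<in>UNIV. (if i = l then 1 else 0) * A $ a $ b * x $ (l, b))"
   by (simp add: kron_def matrix_vector_mult_def sum_prod_UNIV mat_def)
  also have "... = (\<Sum>l\<in>UNIV. if i = l then \<Sum>b\<in>UNIV. A $ a $ b * x $ (l, b) else 0)"
   by (intro sum.cong refl) auto
  also have "... = (A *v blk i x) $ a" by (simp add: matrix_vector_mult_def blk_nth)
  finally show ?thesis .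
 qed
 then show ?thesis by (simp add: vec_eq_iff blk_nth)
qed

lemma kron_ones_blk: "blk i (kron ones_mat A *v x) = A *v (\<Sum>l\<in>UNIV. blk l (x :: real^('N::finite \<times> 'k::finite)))"
proof -
 have "(kron ones_mat A *v x) $ (i, a) = (A *v (\<Sum>l\<in>UNIV. blk l x)) $ a" for a
 proof -
  have "(kron ones_mat A *v x) $ (i, a) = (\<Sum>l\<in>UNIV. \<Sum>b\<in>UNIV. A $ a $ b * x $ (l, b))"
   by (simp add: kron_def matrix_vector_mult_def sum_prod_UNIV ones_mat_def)
  also have "... = (\<Sum>b\<in>UNIV. \<Sum>l\<in>UNIV. A $ a $ b * x $ (l, b))" by (rule sum.swap)
  also have "... = (A *v (\<Sum>l\<in>UNIV. blk l x)) $ a"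
   by (simp add: matrix_vector_mult_def blk_nth sum_distrib_left)
  finally show ?thesis .
 qed
 then show ?thesis by (simp add: vec_eq_iff blk_nth)
qed

lemma kron_row_blk:
 "blk l (kron (col_row (axis i 1) v) A *v x) = (if l = i then A *v (\<Sum>j\<in>UNIV. v $ j *\<^sub>R blk j (x :: real^('N::finite \<times> 'k::finite))) else 0)"
proof -
 have "(kron (col_row (axis i 1) v) A *v x) $ (l, a) = (if l = i then A *v (\<Sum>j\<in>UNIV. v $ j *\<^sub>R blk j x) else 0) $ a" for a
 proof -
  have "(kron (col_row (axis i 1) v) A *v x) $ (l, a) = (\<Sum>j\<in>UNIV. \<Sum>b\<in>UNIV. (if l = i then v $ j * A $ a $ b * x $ (j, b) else 0))"
   by (auto simp: kron_def matrix_vector_mult_def sum_prod_UNIV col_row_def axis_def intro!: sum.cong)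
  also have "... = (if l = i then (\<Sum>b\<in>UNIV. \<Sum>j\<in>UNIV. v $ j * A $ a $ b * x $ (j, b)) else 0)"
   by (auto intro: sum.swap)
  also have "... = (if l = i then A *v (\<Sum>j\<in>UNIV. v $ j *\<^sub>R blk j x) else 0) $ a"
   by (auto simp: matrix_vector_mult_def blk_nth sum_distrib_left mult_ac intro!: sum.cong)
  finally show ?thesis .
 qed
 then show ?thesis by (simp add: vec_eq_iff blk_nth)
qed

lemma kron_col_blk: "blk l (kron_col (axis i 1) A *v w) = (if l = (i::'N::finite) then A *v (w :: real^'k::finite) else 0)"
 by (auto simp: kron_col_def matrix_vector_mult_def axis_def vec_eq_iff blk_nth)

lemma be_blk: "be i *v u = blk i (u :: real^('N::finite \<times> 'm::finite))"
proof -
 have "(be i *v u) $ a = u $ (i, a)" for a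
 proof -
  have "(be i *v u) $ a = (\<Sum>l\<in>UNIV. \<Sum>b\<in>UNIV. (if l = i then 1 else 0) * (if b = a then 1 else 0) * u $ (l, b))"
   by (simp add: be_def transpose_def kron_col_def matrix_vector_mult_def sum_prod_UNIV axis_def mat_def)
  also have "... = (\<Sum>l\<in>UNIV. if l = i then (\<Sum>b\<in>UNIV. if b = a then u $ (l, b) else 0) else 0)"
   by (rule sum.cong[OF refl]) (simp add: if_distrib[of "%c. c * _"] cong: if_cong)
  finally show ?thesis by simp
 qed
 then show ?thesis by (simp add: vec_eq_iff blk_nth)
qed

lemma bB_blk: "blk i (bB L *v u) = cB L *v blk i u"
proof -
 have "(bB L *v u) $ (i, a) = (cB L *v blk i u) $ a" for a
 proof -
  have "(bB L *v u) $ (i, a) = (\<Sum>l\<in>UNIV. \<Sum>b\<in>UNIV. (if i = l then 1 else 0) * cB L $ a $ b * u $ (l, b))"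
   by (auto simp: bB_def bBi_def kron_col_def matrix_vector_mult_def sum_prod_UNIV axis_def intro!: sum.cong)
  also have "... = (\<Sum>l\<in>UNIV. if i = l then \<Sum>b\<in>UNIV. cB L $ a $ b * u $ (l, b) else 0)"
   by (intro sum.cong refl) auto
  also have "... = (cB L *v blk i u) $ a" by (simp add: matrix_vector_mult_def blk_nth)
  finally show ?thesis .
 qed
 then show ?thesis by (simp add: vec_eq_iff blk_nth)
qed

lemma mean_scale: "((1 / real CARD('N)) *\<^sub>R A) *v (\<Sum>l\<in>UNIV. blk l (x :: real^('N::finite \<times> 'k::finite))) = A *v mean x"
 by (simp add: mean_def scaleR_matrix_vector_assoc[symmetric] matrix_vector_mult_scaleR)

lemma dr_blk: "blk i (dr L x u) = cA L *v blk i x + cAbar L *v mean x + cB L *v blk i u + cb L"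
 by (simp add: dr_def blk_add matrix_vector_mult_add_rdistrib bA_def bAbar_def kron_id_blk kron_ones_blk mean_scale bB_blk)
  (simp add: bb_def kron_vec_def ones_vec_def blk_def vec_eq_iff)

lemma bC_blk:
 fixes x :: "real^('N::finite \<times> 'n::finite)"
 shows "blk l ((bC L i + bCbar L i) *v x) = (if l = i then cC L *v blk i x + cCbar L *v mean x else 0)"
proof -
 have "(\<Sum>j\<in>UNIV. axis i 1 $ j *\<^sub>R blk j x) = blk i x"
  by (simp add: axis_def if_distrib[of "%c. c *\<^sub>R _"] cong: if_cong)
 moreover have "(\<Sum>j\<in>UNIV. ((1 / real CARD('N)) *\<^sub>R ones_vec) $ j *\<^sub>R blk j x) = mean x"
  by (simp add: ones_vec_def mean_def scaleR_sum_right)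
 ultimately show ?thesis
  by (simp add: blk_add matrix_vector_mult_add_rdistrib bC_def bCbar_def kron_row_blk)
qed

lemma df_blk: "blk l (df L i x u) = (if l = i then cC L *v blk i x + cCbar L *v mean x + cD L *v blk i u + csigma L else 0)"
 by (simp add: df_def blk_add bC_blk bD_def kron_col_blk be_blk)
  (simp add: bsigma_def kron_vec_def axis_def blk_def vec_eq_iff)

lemma gm_blk: "blk i (gm L x) = cGamma L *v blk i x + cGammabar L *v mean x + cgamma L"
 by (simp add: gm_def blk_add matrix_vector_mult_add_rdistrib bGamma_def bGammabar_def kron_id_blk kron_ones_blk mean_scale)
  (simp add: bgamma_def kron_vec_def ones_vec_def blk_def vec_eq_iff)

lemma sum_blk_mean: "(\<Sum>l\<in>UNIV. blk l (x :: real^('N::finite \<times> 'k::finite))) = real CARD('N) *\<^sub>R mean x"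
 by (simp add: mean_def)

lemma cst_running:
 fixes x :: "real^('N::finite \<times> 'n::finite)" and u :: "real^('N \<times> 'm::finite)"
 shows "cst L x u = (1 / real CARD('N)) * (\<Sum>i\<in>UNIV. running_cost L (blk i x) (mean x) (blk i u))"
proof -
 let ?N = "real CARD('N)"
 have N: "?N \<noteq> 0" by simp
 have 1: "x \<bullet> (bQ L *v x) = (1 / ?N) * (\<Sum>i\<in>UNIV. (cQ L *v blk i x) \<bullet> blk i x)"
  by (simp add: bQ_def scaleR_matrix_vector_assoc[symmetric] inner_blk blk_scaleR kron_id_blk inner_commute sum_divide_distrib)
 have 2: "x \<bullet> (bQbar L *v x) = (cQbar L *v mean x) \<bullet> mean x"
 proof -
  have "x \<bullet> (bQbar L *v x) = (\<Sum>i\<in>UNIV. blk i x) \<bullet> (((1 / ?N\<^sup>2) *\<^sub>R cQbar L) *v (\<Sum>l\<in>UNIV. blk l x))"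
   by (simp add: bQbar_def inner_blk[of x] kron_ones_blk inner_sum_left)
  also have "... = (cQbar L *v mean x) \<bullet> mean x"
   unfolding sum_blk_mean using N
   by (simp add: scaleR_matrix_vector_assoc[symmetric] matrix_vector_mult_scaleR power2_eq_square inner_commute)
  finally show ?thesis .
 qed
 have 3: "u \<bullet> (bS L *v x) = (1 / ?N) * (\<Sum>i\<in>UNIV. (cS L *v blk i x) \<bullet> blk i u)"
  by (simp add: bS_def scaleR_matrix_vector_assoc[symmetric] inner_blk blk_scaleR kron_id_blk inner_commute sum_divide_distrib)
 have 4: "u \<bullet> (bR L *v u) = (1 / ?N) * (\<Sum>i\<in>UNIV. (cR L *v blk i u) \<bullet> blk i u)"
  by (simp add: bR_def scaleR_matrix_vector_assoc[symmetric] inner_blk blk_scaleR kron_id_blk inner_commute sum_divide_distrib)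
 have 5: "bq L \<bullet> x = (1 / ?N) * (\<Sum>i\<in>UNIV. cq L \<bullet> blk i x)"
 proof -
  have "blk i (bq L :: real^('N \<times> 'n)) = (1 / ?N) *\<^sub>R cq L" for i
   by (simp add: bq_def kron_vec_def ones_vec_def blk_def vec_eq_iff)
  then show ?thesis by (simp add: inner_blk[of _ x] sum_distrib_left)
 qed
 have 6: "br L \<bullet> u = (1 / ?N) * (\<Sum>i\<in>UNIV. cr L \<bullet> blk i u)"
 proof -
  have "blk i (br L :: real^('N \<times> 'm)) = (1 / ?N) *\<^sub>R cr L" for i
   by (simp add: br_def kron_vec_def ones_vec_def blk_def vec_eq_iff)
  then show ?thesis by (simp add: inner_blk[of _ u] sum_distrib_left)
 qed
 have "(\<Sum>i\<in>UNIV. running_cost L (blk i x) (mean x) (blk i u))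
  = (\<Sum>i\<in>UNIV. (cQ L *v blk i x) \<bullet> blk i x) + 2 * (\<Sum>i\<in>UNIV. (cS L *v blk i x) \<bullet> blk i u) + (\<Sum>i\<in>UNIV. (cR L *v blk i u) \<bullet> blk i u)
  + 2 * (\<Sum>i\<in>UNIV. cq L \<bullet> blk i x) + 2 * (\<Sum>i\<in>UNIV. cr L \<bullet> blk i u) + ?N * ((cQbar L *v mean x) \<bullet> mean x)"
  by (simp add: running_cost_def sum.distrib sum_distrib_left)
 then show ?thesis
  unfolding cst_def matrix_vector_mult_add_rdistrib inner_add_right 1 2 3 4 5 6
  by (simp add: field_simps)
qed

section \<open>Completing the square in the Hamiltonian\<close>

definition NN :: "('n::finite, 'm::finite) lq => real^('N::finite \<times> 'n)^('N \<times> 'n) => real^('N \<times> 'm)^('N \<times> 'm)" where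
 "NN L P = bR L + 2 *\<^sub>R M1 L P"

definition MM :: "('n::finite, 'm::finite) lq => real^('N::finite \<times> 'n)^('N \<times> 'n) => real^('N \<times> 'm)^('N \<times> 'n)" where
 "MM L P = P ** bB L + M2 L P + transpose (bS L)"

definition vv :: "('n::finite, 'm::finite) lq => real^('N::finite \<times> 'n)^('N \<times> 'n) => real^('N \<times> 'n) => real^('N \<times> 'm)" where
 "vv L P p = p v* bB L + M3 L P + br L"

text \<open>Half the coefficient of the linear control term in \<open>Ham\<close>, see
  \<open>Ham_expand\<close>; so \<open>fb\<close> is the stationary point of \<open>Ham\<close> in
  the control.\<close>

definition ww :: "('n::finite, 'm::finite) lq => real^('N::finite \<times> 'n)^('N \<times> 'n) => real^('N \<times> 'n) => real^('N \<times> 'n) => real^('N \<times> 'm)" where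
 "ww L P p x = transpose (MM L P) *v x + vv L P p"

definition fb :: "('n::finite, 'm::finite) lq => real^('N::finite \<times> 'n)^('N \<times> 'n) => real^('N \<times> 'n) => real^('N \<times> 'n) => real^('N \<times> 'm)" where
 "fb L P p x = - (matrix_inv (NN L P) *v ww L P p x)"

definition quad :: "real^'k::finite^'k => real^'k => real => real^'k => real" where
 "quad P p k x = x \<bullet> (P *v x) + 2 * (p \<bullet> x) + k"

lemma inner_NN:
 "w \<bullet> (NN L P *v u) = w \<bullet> (bR L *v u) + (\<Sum>i\<in>UNIV. (bD L i *v (be i *v w)) \<bullet> (P *v (bD L i *v (be i *v u))))"
 by (simp add: NN_def M1_def matrix_vector_mult_add_rdistrib scaleR_matrix_vector_assoc[symmetric] sum_matrix_vector
   inner_add_right inner_sum_right matrix_vector_mul_assoc[symmetric] inner_vmul)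

lemma inner_ww:
 "u \<bullet> ww L P p x = x \<bullet> (P *v (bB L *v u)) + (\<Sum>i\<in>UNIV. ((bC L i + bCbar L i) *v x) \<bullet> (P *v (bD L i *v (be i *v u)))) + u \<bullet> (bS L *v x)
  + p \<bullet> (bB L *v u) + (\<Sum>i\<in>UNIV. bsigma L i \<bullet> (P *v (bD L i *v (be i *v u)))) + br L \<bullet> u"
proof -
 have 1: "u \<bullet> (transpose (MM L P) *v x) = x \<bullet> (MM L P *v u)" by (simp only: inner_transpose inner_commute)
 have 2: "x \<bullet> (MM L P *v u) = x \<bullet> (P *v (bB L *v u)) + (\<Sum>i\<in>UNIV. ((bC L i + bCbar L i) *v x) \<bullet> (P *v (bD L i *v (be i *v u)))) + u \<bullet> (bS L *v x)"
  by (simp add: MM_def M2_def matrix_vector_mult_add_rdistrib[of "P ** bB L + _"] matrix_vector_mult_add_rdistrib[of "P ** bB L"]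
    sum_matrix_vector inner_add_right inner_sum_right
    matrix_vector_mul_assoc[symmetric] inner_vmul inner_commute[of "bS L *v x"])
 have 3: "vv L P p \<bullet> u = p \<bullet> (bB L *v u) + (\<Sum>i\<in>UNIV. bsigma L i \<bullet> (P *v (bD L i *v (be i *v u)))) + br L \<bullet> u"
  by (simp add: vv_def M3_def inner_add_left inner_sum_left dot_lmul_matrix matrix_vector_mul_assoc[symmetric])
 show ?thesis unfolding ww_def inner_add_right 1 2 using 3 by (simp add: inner_commute)
qed

lemma psd_inner_commute: "symmetric_mat P ==> x \<bullet> (P *v y) = y \<bullet> (P *v x)"
 by (metis inner_commute inner_transpose symmetric_mat_def)

text \<open>Sorted by degree: the brackets quadratic, linear and constant in \<open>x\<close> are
  those occurring in the three Riccati equations, and the control enters only through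
  \<open>ww\<close> and \<open>NN\<close>.\<close>

lemma Ham_expand:
 assumes P: "symmetric_mat P"
 shows "Ham L P p x u = (2 * (x \<bullet> (P *v ((bA L + bAbar L) *v x)))
   + (\<Sum>i\<in>UNIV. ((bC L i + bCbar L i) *v x) \<bullet> (P *v ((bC L i + bCbar L i) *v x)))
   + ((bGamma L + bGammabar L) *v x) \<bullet> (P *v ((bGamma L + bGammabar L) *v x)) + x \<bullet> ((bQ L + bQbar L) *v x))
  + 2 * (x \<bullet> (P *v bb L) + p \<bullet> ((bA L + bAbar L) *v x) + (\<Sum>i\<in>UNIV. bsigma L i \<bullet> (P *v ((bC L i + bCbar L i) *v x)))
   + bgamma L \<bullet> (P *v ((bGamma L + bGammabar L) *v x)) + bq L \<bullet> x)
  + (2 * (p \<bullet> bb L) + (\<Sum>i\<in>UNIV. bsigma L i \<bullet> (P *v bsigma L i)) + bgamma L \<bullet> (P *v bgamma L))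
  + 2 * (u \<bullet> ww L P p x) + u \<bullet> (NN L P *v u)"
proof -
 note c = psd_inner_commute[OF P]
 have sq: "df L i x u \<bullet> (P *v df L i x u) = a \<bullet> (P *v a) + d \<bullet> (P *v d) + s \<bullet> (P *v s)
  + 2 * (a \<bullet> (P *v d)) + 2 * (s \<bullet> (P *v a)) + 2 * (s \<bullet> (P *v d))"
  if "a = (bC L i + bCbar L i) *v x" "d = bD L i *v (be i *v u)" "s = bsigma L i" for i a d s
  unfolding df_def that[symmetric]
  by (simp add: matrix_vector_right_distrib inner_add_left inner_add_right c[of d a] c[of a s] c[of d s])
 have g: "gm L x \<bullet> (P *v gm L x) = ((bGamma L + bGammabar L) *v x) \<bullet> (P *v ((bGamma L + bGammabar L) *v x))
  + 2 * (bgamma L \<bullet> (P *v ((bGamma L + bGammabar L) *v x))) + bgamma L \<bullet> (P *v bgamma L)"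
 proof -
  have "(a + s) \<bullet> (P *v (a + s)) = a \<bullet> (P *v a) + 2 * (s \<bullet> (P *v a)) + s \<bullet> (P *v s)" for a s
   by (simp add: matrix_vector_right_distrib inner_add_left inner_add_right c[of a s])
  then show ?thesis unfolding gm_def by simp
 qed
 have d: "(P *v x + p) \<bullet> dr L x u = x \<bullet> (P *v ((bA L + bAbar L) *v x)) + x \<bullet> (P *v (bB L *v u)) + x \<bullet> (P *v bb L)
  + p \<bullet> ((bA L + bAbar L) *v x) + p \<bullet> (bB L *v u) + p \<bullet> bb L"
 proof -
  have "(P *v x) \<bullet> y = x \<bullet> (P *v y)" for y using c[of y x] by (simp add: inner_commute)
  then show ?thesis
   unfolding dr_def inner_add_left inner_add_right by (simp add: matrix_vector_right_distrib inner_add_right)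
 qed
 define a where "a i = (bC L i + bCbar L i) *v x" for i
 define e where "e i = bD L i *v (be i *v u)" for i
 have S: "(\<Sum>i\<in>UNIV. df L i x u \<bullet> (P *v df L i x u)) = (\<Sum>i\<in>UNIV. a i \<bullet> (P *v a i)) + (\<Sum>i\<in>UNIV. e i \<bullet> (P *v e i))
   + (\<Sum>i\<in>UNIV. bsigma L i \<bullet> (P *v bsigma L i)) + 2 * (\<Sum>i\<in>UNIV. a i \<bullet> (P *v e i))
   + 2 * (\<Sum>i\<in>UNIV. bsigma L i \<bullet> (P *v a i)) + 2 * (\<Sum>i\<in>UNIV. bsigma L i \<bullet> (P *v e i))"
 proof -
  have "df L i x u \<bullet> (P *v df L i x u) = a i \<bullet> (P *v a i) + e i \<bullet> (P *v e i) + bsigma L i \<bullet> (P *v bsigma L i)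
   + 2 * (a i \<bullet> (P *v e i)) + 2 * (bsigma L i \<bullet> (P *v a i)) + 2 * (bsigma L i \<bullet> (P *v e i))" for i
   by (rule sq) (simp_all add: a_def e_def)
  then show ?thesis by (simp only: sum.distrib sum_distrib_left)
 qed
 have Wu: "u \<bullet> ww L P p x = x \<bullet> (P *v (bB L *v u)) + (\<Sum>i\<in>UNIV. a i \<bullet> (P *v e i)) + u \<bullet> (bS L *v x)
  + p \<bullet> (bB L *v u) + (\<Sum>i\<in>UNIV. bsigma L i \<bullet> (P *v e i)) + br L \<bullet> u"
  unfolding a_def e_def by (rule inner_ww)
 have Nu: "u \<bullet> (NN L P *v u) = u \<bullet> (bR L *v u) + (\<Sum>i\<in>UNIV. e i \<bullet> (P *v e i))"
  unfolding e_def by (rule inner_NN)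
 show ?thesis
  unfolding Ham_def d g S Wu Nu cst_def a_def[symmetric] by (simp only: distrib_left)
qed

text \<open>The three Riccati equations, tested with \<open>x\<close>, say that the control-free
  part of \<open>quad + Ham\<close> equals \<open>w . N^-1 w\<close> for
  \<open>w = ww L P p x\<close>. Adding \<open>2 u . w + u . N u\<close> gives the square around
  \<open>fb = - N^-1 w\<close>.\<close>

lemma complete_square:
 assumes P: "symmetric_mat P" and inv: "invertible (NN L P)" and sym: "transpose (NN L P) = NN L P"
  and e1: "P' - MM L P ** matrix_inv (NN L P) ** transpose (MM L P) + P ** (bA L + bAbar L)
       + transpose (bA L + bAbar L) ** P + 2 *\<^sub>R M4 L P + bQ L + bQbar L = 0"
  and e2: "p' - (MM L P ** matrix_inv (NN L P)) *v vv L P p + P *v bb L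
       + transpose (bA L + bAbar L) *v p + M5 L P + bq L = 0"
  and e3: "k' - vv L P p \<bullet> (matrix_inv (NN L P) *v vv L P p) + 2 * (p \<bullet> bb L) + 2 * M6 L P = 0"
 shows "quad P' p' k' x + Ham L P p x u = (u - fb L P p x) \<bullet> (NN L P *v (u - fb L P p x))"
proof -
 let ?NI = "matrix_inv (NN L P)" and ?w = "ww L P p x" and ?m = "transpose (MM L P) *v x" and ?v = "vv L P p"
 note c = psd_inner_commute[OF P]
 have NI: "NN L P *v (?NI *v y) = y" "?NI *v (NN L P *v y) = y" for y
  by (rule matrix_inv_cancel[OF inv])+
 have symN: "a \<bullet> (NN L P *v b) = b \<bullet> (NN L P *v a)" for a b
  by (rule psd_inner_commute) (simp add: symmetric_mat_def sym)
 have symI: "a \<bullet> (?NI *v b) = b \<bullet> (?NI *v a)" for a b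
  using symN[of "?NI *v a" "?NI *v b"] by (simp add: NI inner_commute)
 have q1: "x \<bullet> (P' *v x) = ?m \<bullet> (?NI *v ?m) - 2 * (x \<bullet> (P *v ((bA L + bAbar L) *v x)))
   - (\<Sum>i\<in>UNIV. ((bC L i + bCbar L i) *v x) \<bullet> (P *v ((bC L i + bCbar L i) *v x)))
   - ((bGamma L + bGammabar L) *v x) \<bullet> (P *v ((bGamma L + bGammabar L) *v x)) - x \<bullet> ((bQ L + bQbar L) *v x)"
 proof -
  have P': "P' = MM L P ** ?NI ** transpose (MM L P) - P ** (bA L + bAbar L) - transpose (bA L + bAbar L) ** P - 2 *\<^sub>R M4 L P - (bQ L + bQbar L)"
   using e1 by (simp add: algebra_simps)
  have a: "x \<bullet> ((MM L P ** ?NI ** transpose (MM L P)) *v x) = ?m \<bullet> (?NI *v ?m)"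
   using inner_transpose[of "?NI *v ?m" "MM L P" x]
   unfolding matrix_vector_mul_assoc[symmetric] by (simp only: inner_commute)
  have b: "x \<bullet> ((transpose (bA L + bAbar L) ** P) *v x) = x \<bullet> (P *v ((bA L + bAbar L) *v x))"
   unfolding matrix_vector_mul_assoc[symmetric] inner_transpose by (rule c)
  have d: "x \<bullet> ((2 *\<^sub>R M4 L P) *v x) = (\<Sum>i\<in>UNIV. ((bC L i + bCbar L i) *v x) \<bullet> (P *v ((bC L i + bCbar L i) *v x)))
   + ((bGamma L + bGammabar L) *v x) \<bullet> (P *v ((bGamma L + bGammabar L) *v x))"
   unfolding M4_def
   by (simp add: scaleR_matrix_vector_assoc[symmetric] matrix_vector_mult_add_rdistrib[of "_ *\<^sub>R _"] sum_matrix_vector inner_add_right inner_sum_right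
     matrix_vector_mul_assoc[symmetric] inner_vmul del: scaleR_add_right)
  show ?thesis unfolding P' matrix_vector_mult_diff_rdistrib inner_diff_right a b d
   by (simp add: matrix_vector_mul_assoc)
 qed
 have q2: "p' \<bullet> x = ?m \<bullet> (?NI *v ?v) - x \<bullet> (P *v bb L) - p \<bullet> ((bA L + bAbar L) *v x)
   - (\<Sum>i\<in>UNIV. bsigma L i \<bullet> (P *v ((bC L i + bCbar L i) *v x))) - bgamma L \<bullet> (P *v ((bGamma L + bGammabar L) *v x)) - bq L \<bullet> x"
 proof -
  have p': "p' = (MM L P ** ?NI) *v ?v - P *v bb L - transpose (bA L + bAbar L) *v p - M5 L P - bq L"
   using e2 by (simp add: algebra_simps)
  have a: "((MM L P ** ?NI) *v ?v) \<bullet> x = ?m \<bullet> (?NI *v ?v)"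
   using inner_transpose[of "?NI *v ?v" "MM L P" x]
   unfolding matrix_vector_mul_assoc[symmetric] by (simp only: inner_commute)
  have b: "(transpose (bA L + bAbar L) *v p) \<bullet> x = p \<bullet> ((bA L + bAbar L) *v x)"
   using inner_transpose[of x "bA L + bAbar L" p] by (simp only: inner_commute)
  have d: "M5 L P \<bullet> x = (\<Sum>i\<in>UNIV. bsigma L i \<bullet> (P *v ((bC L i + bCbar L i) *v x))) + bgamma L \<bullet> (P *v ((bGamma L + bGammabar L) *v x))"
   unfolding M5_def inner_add_left inner_sum_left dot_lmul_matrix matrix_vector_mul_assoc[symmetric] ..
  show ?thesis unfolding p' inner_diff_left a b d by (simp add: inner_commute[of _ x])
 qed
 have q3: "k' = ?v \<bullet> (?NI *v ?v) - 2 * (p \<bullet> bb L) - (\<Sum>i\<in>UNIV. bsigma L i \<bullet> (P *v bsigma L i)) - bgamma L \<bullet> (P *v bgamma L)"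
  using e3 by (simp add: M6_def)
 have w: "?w \<bullet> (?NI *v ?w) = ?m \<bullet> (?NI *v ?m) + 2 * (?m \<bullet> (?NI *v ?v)) + ?v \<bullet> (?NI *v ?v)"
  unfolding ww_def matrix_vector_right_distrib inner_add_left inner_add_right symI[of ?v ?m] by simp
 have "quad P' p' k' x + Ham L P p x u = ?w \<bullet> (?NI *v ?w) + 2 * (u \<bullet> ?w) + u \<bullet> (NN L P *v u)"
  unfolding quad_def Ham_expand[OF P] q1 q2 q3 w by (simp add: algebra_simps)
 also have "... = (u - fb L P p x) \<bullet> (NN L P *v (u - fb L P p x))"
 proof -
  have "(?NI *v ?w) \<bullet> (NN L P *v u) = u \<bullet> ?w" using symN[of "?NI *v ?w" u] by (simp add: NI)
  then show ?thesis
   unfolding fb_def by (simp add: matrix_vector_right_distrib inner_add_left inner_add_right NI inner_commute[of _ ?w])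
 qed
 finally show ?thesis .
qed

text \<open>Positivity on the unit sphere is uniform by compactness and extends by homogeneity. The
  constant serves all times at once, because \<open>NN\<close> adds only a nonnegative form to
  \<open>bR\<close>.\<close>

lemma bR_coercive:
 assumes R: "pd_mat (cR L)"
 obtains c where "0 < c" "\<And>u :: real^('N::finite \<times> 'm::finite). c * (norm u)\<^sup>2 \<le> u \<bullet> (bR (L :: ('n::finite, 'm) lq) *v u)"
proof -
 let ?f = "%u :: real^('N \<times> 'm). u \<bullet> (bR L *v u)"
 have bRu: "?f u = (1 / real CARD('N)) * (\<Sum>i\<in>UNIV. blk i u \<bullet> (cR L *v blk i u))" for u
  by (simp add: bR_def scaleR_matrix_vector_assoc[symmetric] inner_blk blk_scaleR kron_id_blk sum_divide_distrib)
 have pos: "0 < ?f u" if "u \<noteq> 0" for u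
 proof -
  obtain i where i: "blk i u \<noteq> 0" using \<open>u \<noteq> 0\<close> unfolding blk_eq_iff by (auto simp: blk_def vec_eq_iff)
  have "0 \<le> blk i u \<bullet> (cR L *v blk i u)" for i
   using R unfolding pd_mat_def by (cases "blk i u = 0") (auto intro: less_imp_le)
  then have "0 < (\<Sum>i\<in>UNIV. blk i u \<bullet> (cR L *v blk i u))"
   using R i unfolding pd_mat_def by (intro sum_pos2[of _ i]) auto
  then show ?thesis unfolding bRu by simp
 qed
 have cont: "continuous_on UNIV ?f"
  by (intro continuous_on_inner continuous_on_id matrix_vector_mult_linear_continuous_on)
 let ?S = "sphere (0::real^('N \<times> 'm)) 1"
 have "compact ?S" by simp
 moreover have "?S \<noteq> {}" using norm_axis_1[of "undefined :: 'N \<times> 'm"] by force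
 ultimately obtain u0 where u0: "u0 \<in> ?S" "\<And>u. u \<in> ?S ==> ?f u0 \<le> ?f u"
  using continuous_attains_inf[of ?S ?f] continuous_on_subset[OF cont] by blast
 show ?thesis
 proof (rule that[of "?f u0"])
  show "0 < ?f u0" by (rule pos) (use u0(1) in auto)
  fix u :: "real^('N \<times> 'm)"
  show "?f u0 * (norm u)\<^sup>2 \<le> ?f u"
  proof (cases "u = 0")
   case False
   have "?f u0 \<le> ?f ((1 / norm u) *\<^sub>R u)" by (rule u0(2)) (use False in simp)
   also have "... = ?f u / (norm u)\<^sup>2" by (simp add: matrix_vector_mult_scaleR power2_eq_square)
   finally show ?thesis using False by (simp add: field_simps)
  qed simp
 qed
qed

lemma NN_coercive:
 fixes u :: "real^('N::finite \<times> 'm::finite)" and P :: "real^('N \<times> 'n::finite)^('N \<times> 'n)"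
 assumes P: "psd_mat P" and c: "\<And>u :: real^('N \<times> 'm). c * (norm u)\<^sup>2 \<le> u \<bullet> (bR L *v u)"
 shows "c * (norm u)\<^sup>2 \<le> u \<bullet> (NN L P *v u)"
proof -
 have "0 \<le> (\<Sum>i\<in>UNIV. (bD L i *v (be i *v u)) \<bullet> (P *v (bD L i *v (be i *v u))))"
  using P by (intro sum_nonneg) (simp add: psd_mat_def)
 then show ?thesis using c[of u] unfolding inner_NN by linarith
qed

text \<open>The lower bound on the norm is kept as a conclusion: later it stands in for estimates of
  inverse matrices.\<close>

lemma coercive_invertible:
 fixes A :: "real^'k::finite^'k"
 assumes c: "0 < c" and A: "\<And>u. c * (norm u)\<^sup>2 \<le> u \<bullet> (A *v u)"
 shows "invertible A" and "c * norm u \<le> norm (A *v u)"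
proof -
 show lb: "c * norm u \<le> norm (A *v u)" for u
 proof (cases "u = 0")
  case False
  have "c * norm u * norm u \<le> norm u * norm (A *v u)"
   using A[of u] norm_cauchy_schwarz[of u "A *v u"] by (simp add: power2_eq_square mult.assoc)
  then have "norm u * (c * norm u) \<le> norm u * norm (A *v u)" by (simp add: mult_ac)
  then show ?thesis using False by simp
 qed simp
 have "inj ((*v) A)"
 proof (rule injI)
  fix x y assume "A *v x = A *v y"
  then have "norm (A *v (x - y)) = 0" by (simp add: matrix_vector_mult_diff_distrib)
  then have "c * norm (x - y) \<le> 0" using lb[of "x - y"] by simp
  then show "x = y" using c by (simp add: mult_le_0_iff)
 qed
 then show "invertible A"
  using matrix_left_invertible_injective invertible_left_inverse by blast
qed

lemma NN_sym:
 assumes R: "symmetric_mat (cR L)" and P: "symmetric_mat P"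
 shows "transpose (NN L P) = NN L P"
proof -
 have bR: "a \<bullet> (bR L *v b) = b \<bullet> (bR L *v a)" for a b
  using psd_inner_commute[OF R]
  by (simp add: bR_def scaleR_matrix_vector_assoc[symmetric] inner_blk blk_scaleR kron_id_blk sum_divide_distrib)
 have s: "a \<bullet> (NN L P *v b) = b \<bullet> (NN L P *v a)" for a b
  unfolding inner_NN bR[of a b] psd_inner_commute[OF P, of "bD L _ *v (be _ *v a)"] ..
 have "transpose (NN L P) *v x = NN L P *v x" for x
 proof (rule vector_eq_ldot[THEN iffD1], rule allI)
  fix y show "y \<bullet> (transpose (NN L P) *v x) = y \<bullet> (NN L P *v x)"
   using s[of y x] by (simp only: inner_transpose inner_commute)
 qed
 then show ?thesis by (simp add: matrix_eq)
qed

section \<open>Symmetry under exchange of agents\<close>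

lemma continuous_on_matrix_vector:
 fixes A :: "real => real^'k::finite^'l::finite"
 assumes "continuous_on S A" "continuous_on S x"
 shows "continuous_on S (%t. A t *v x t)"
 unfolding matrix_vector_mult_def by (intro continuous_on_vec_lambda continuous_intros assms)

text \<open>Weak continuity suffices in finite dimension; \<open>NN\<close> and \<open>ww\<close>
  have manageable formulas after pairing with a vector.\<close>

lemma continuous_on_componentwise_inner:
 fixes f :: "real => real^'k::finite"
 assumes "\<And>u. continuous_on S (%t. u \<bullet> f t)"
 shows "continuous_on S f"
proof -
 have "f t = (\<chi> i. axis i 1 \<bullet> f t)" for t by (simp add: vec_eq_iff inner_axis')
 then have "f = (%t. \<chi> i. axis i 1 \<bullet> f t)" by (rule ext)
 moreover have "continuous_on S (%t. \<chi> i. axis i 1 \<bullet> f t)" by (intro continuous_on_vec_lambda assms)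
 ultimately show ?thesis by (rule ssubst[where P = "continuous_on S"])
qed

lemma norm_matrix_vector_le:
 fixes A :: "real^'k::finite^'l::finite"
 shows "norm (A *v x) \<le> real CARD('l) * (norm A * norm x)"
proof -
 have "norm (A *v x) \<le> (\<Sum>i\<in>UNIV. \<bar>(A *v x) $ i\<bar>)" by (rule norm_le_l1_cart)
 also have "... \<le> (\<Sum>i\<in>(UNIV::'l set). norm A * norm x)"
 proof (rule sum_mono)
  fix i show "\<bar>(A *v x) $ i\<bar> \<le> norm A * norm x"
   unfolding matrix_vector_mul_component
   by (rule order_trans[OF Cauchy_Schwarz_ineq2]) (intro mult_right_mono Finite_Cartesian_Product.norm_nth_le norm_ge_zero)
 qed
 finally show ?thesis by simp
qed

text \<open>Backward Gronwall: \<open>exp (2 C t) |z t|^2\<close> does not decrease in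
  \<open>t\<close> and is zero at \<open>T\<close>.\<close>

lemma vanishing_of_linear_growth:
 fixes z :: "real => 'a::real_inner"
 assumes z: "\<And>t. t \<in> {0..T} ==> (z has_vector_derivative z' t) (at t within {0..T})"
  and b: "\<And>t. t \<in> {0..T} ==> norm (z' t) \<le> C * norm (z t)"
  and T: "z T = 0" and t: "t \<in> {0..T}"
 shows "z t = 0"
proof -
 define h where "h = (%t. exp (2 * C * t) * (z t \<bullet> z t))"
 have h: "(h has_real_derivative (exp (2 * C * t) * (2 * C * (z t \<bullet> z t) + 2 * (z t \<bullet> z' t)))) (at t within {0..T})"
  if "t \<in> {0..T}" for t
 proof -
  have "((%t. z t \<bullet> z t) has_real_derivative (z t \<bullet> z' t + z' t \<bullet> z t)) (at t within {0..T})"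
   using bounded_bilinear.has_vector_derivative[OF bounded_bilinear_inner z[OF that] z[OF that]]
   by (simp add: has_real_derivative_iff_has_vector_derivative)
  then show ?thesis unfolding h_def
   by (auto intro!: derivative_eq_intros simp: algebra_simps inner_commute)
 qed
 have nn: "0 \<le> exp (2 * C * t) * (2 * C * (z t \<bullet> z t) + 2 * (z t \<bullet> z' t))" if "t \<in> {0..T}" for t
 proof -
  have "\<bar>z t \<bullet> z' t\<bar> \<le> norm (z t) * norm (z' t)" by (rule Cauchy_Schwarz_ineq2)
  also have "... \<le> norm (z t) * (C * norm (z t))" by (intro mult_left_mono b that norm_ge_zero)
  also have "... = C * (z t \<bullet> z t)" by (simp add: dot_square_norm power2_eq_square)
  finally show ?thesis by (intro mult_nonneg_nonneg) auto
 qed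
 have "h t \<le> h T"
 proof (cases "t = T")
  case False
  then have "t < T" using t by simp
  have "(h has_derivative (*) (exp (2 * C * y) * (2 * C * (z y \<bullet> z y) + 2 * (z y \<bullet> z' y)))) (at y within {t..T})"
   if "t \<le> y" "y \<le> T" for y
   by (rule has_derivative_subset[OF h[unfolded has_field_derivative_def]]) (use that t in auto)
  from mvt_very_simple[OF less_imp_le[OF \<open>t < T\<close>] this]
  obtain y where y: "y \<in> {t..T}" "h T - h t = exp (2 * C * y) * (2 * C * (z y \<bullet> z y) + 2 * (z y \<bullet> z' y)) * (T - t)"
   by blast
  have "0 \<le> exp (2 * C * y) * (2 * C * (z y \<bullet> z y) + 2 * (z y \<bullet> z' y)) * (T - t)"
   by (rule mult_nonneg_nonneg[OF nn]) (use t y in auto)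
  then show ?thesis using y(2) by linarith
 qed simp
 then have "z t \<bullet> z t \<le> 0" using T by (simp add: h_def mult_le_0_iff)
 then show ?thesis using inner_gt_zero_iff[of "z t"] by fastforce
qed

text \<open>Permutes the blocks of a vector; \<open>Pm\<close> is, for involutions, the induced
  conjugation of a matrix, see \<open>Pm_mult\<close>.\<close>

definition pm :: "('N => 'N) => real^('N::finite \<times> 'k::finite) => real^('N \<times> 'k)" where
 "pm \<pi> x = (\<chi> q. x $ (\<pi> (fst q), snd q))"

definition Pm :: "('N => 'N) => real^('N::finite \<times> 'k::finite)^('N \<times> 'k) => real^('N \<times> 'k)^('N \<times> 'k)" where
 "Pm \<pi> P = (\<chi> q. pm \<pi> (P $ (\<pi> (fst q), snd q)))"

lemma blk_pm: "blk i (pm \<pi> x) = blk (\<pi> i) x"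
 by (simp add: blk_def pm_def vec_eq_iff)

lemma pm_add: "pm \<pi> (x + y) = pm \<pi> x + pm \<pi> y"
 and pm_diff: "pm \<pi> (x - y) = pm \<pi> x - pm \<pi> y"
 by (simp_all add: pm_def vec_eq_iff)

lemma bounded_linear_pm: "bounded_linear (pm \<pi>)"
 by (intro linear_conv_bounded_linear[THEN iffD1] linearI) (simp_all add: pm_def vec_eq_iff)

lemma bounded_linear_Pm: "bounded_linear (Pm \<pi>)"
 by (intro linear_conv_bounded_linear[THEN iffD1] linearI) (simp_all add: pm_def Pm_def vec_eq_iff)

context
 fixes \<pi> :: "'N::finite => 'N"
 assumes inv: "\<And>i. \<pi> (\<pi> i) = i"
begin

lemma bij_involution: "bij \<pi>"
 by (rule o_bij[of \<pi>]) (auto simp: inv)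

lemma pm_pm: "pm \<pi> (pm \<pi> x) = x"
 by (simp add: pm_def vec_eq_iff inv)

text \<open>For an involution \<open>pm\<close> is its own adjoint as well as its own inverse;
  exchanges of two agents are all that is needed.\<close>

lemma pm_inner: "pm \<pi> x \<bullet> y = x \<bullet> pm \<pi> y"
proof -
 have "(\<Sum>i\<in>UNIV. blk (\<pi> i) x \<bullet> blk i y) = (\<Sum>i\<in>UNIV. blk (\<pi> (\<pi> i)) x \<bullet> blk (\<pi> i) y)"
  by (rule sum.reindex_bij_betw[OF bij_involution, symmetric])
 then show ?thesis by (simp add: inner_blk[of "pm \<pi> x"] inner_blk[of x] blk_pm inv)
qed

lemma Pm_mult: "Pm \<pi> P *v x = pm \<pi> (P *v pm \<pi> x)"
 by (simp add: vec_eq_iff matrix_vector_mul_component Pm_def pm_inner) (simp add: pm_def matrix_vector_mul_component)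

lemma mean_pm: "mean (pm \<pi> x) = mean x"
 unfolding mean_def blk_pm using sum.reindex_bij_betw[OF bij_involution, of "%i. blk i x"] by simp

lemma dr_pm: "dr L (pm \<pi> x) (pm \<pi> u) = pm \<pi> (dr L x u)"
 by (simp add: blk_eq_iff dr_blk blk_pm mean_pm)

lemma gm_pm: "gm L (pm \<pi> x) = pm \<pi> (gm L x)"
 by (simp add: blk_eq_iff gm_blk blk_pm mean_pm)

lemma df_pm: "df L i (pm \<pi> x) (pm \<pi> u) = pm \<pi> (df L (\<pi> i) x u)"
proof -
 have "\<pi> l = \<pi> i \<longleftrightarrow> l = i" for l by (metis inv)
 then show ?thesis by (simp add: blk_eq_iff df_blk blk_pm mean_pm)
qed

lemma cst_pm: "cst L (pm \<pi> x) (pm \<pi> u) = cst L x u"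
 unfolding cst_running blk_pm mean_pm
 using sum.reindex_bij_betw[OF bij_involution, of "%i. running_cost L (blk i x) (mean x) (blk i u)"] by simp

text \<open>Exchanging agents in state and control amounts to exchanging them in the coefficients:
  all agents share the same data, and the sum over the agent noises is merely reindexed.\<close>

lemma Ham_pm: "Ham L P p (pm \<pi> x) (pm \<pi> u) = Ham L (Pm \<pi> P) (pm \<pi> p) x u"
proof -
 have "(\<Sum>i\<in>UNIV. df L i (pm \<pi> x) (pm \<pi> u) \<bullet> (P *v df L i (pm \<pi> x) (pm \<pi> u)))
   = (\<Sum>i\<in>UNIV. df L (\<pi> i) x u \<bullet> (Pm \<pi> P *v df L (\<pi> i) x u))"
  by (simp add: df_pm Pm_mult pm_inner)
 also have "... = (\<Sum>i\<in>UNIV. df L i x u \<bullet> (Pm \<pi> P *v df L i x u))"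
  by (rule sum.reindex_bij_betw[OF bij_involution])
 finally have d: "(\<Sum>i\<in>UNIV. df L i (pm \<pi> x) (pm \<pi> u) \<bullet> (P *v df L i (pm \<pi> x) (pm \<pi> u))) = ..." .
 have "(P *v pm \<pi> x + p) \<bullet> pm \<pi> (dr L x u) = (Pm \<pi> P *v x + pm \<pi> p) \<bullet> dr L x u"
  by (simp add: pm_inner[symmetric] pm_add Pm_mult)
 moreover have "pm \<pi> (gm L x) \<bullet> (P *v pm \<pi> (gm L x)) = gm L x \<bullet> (Pm \<pi> P *v gm L x)"
  by (simp add: pm_inner Pm_mult)
 ultimately show ?thesis unfolding Ham_def d by (simp add: dr_pm gm_pm cst_pm)
qed

lemma quad_pm: "quad P p k (pm \<pi> x) = quad (Pm \<pi> P) (pm \<pi> p) k x"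
 by (simp add: quad_def Pm_mult pm_inner)

end

section \<open>Quadratic functions and the size of their coefficients\<close>

lemma quad_diff: "quad (P - P2) (p - p2) (k - k2) x = quad P p k x - quad P2 p2 k2 x"
 by (simp add: quad_def matrix_vector_mult_diff_rdistrib inner_diff_right inner_diff_left)

lemma symmetric_mat_nth: "symmetric_mat A ==> A $ i $ j = A $ j $ i"
 unfolding symmetric_mat_def by (erule subst) (simp add: transpose_def)

lemma quad_polarize:
 fixes A :: "real^'k::finite^'k"
 assumes "symmetric_mat A"
 shows "A $ i $ j = (quad A a k (axis i 1 + axis j 1) - quad A a k (axis i 1) - quad A a k (axis j 1) + quad A a k 0) / 2"
  and "a $ i = (quad A a k (axis i 1) - quad A a k (- axis i 1)) / 4"
proof -
 have e: "axis i 1 \<bullet> (A *v axis j 1) = A $ i $ j" for i j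
  by (simp add: inner_axis' matrix_vector_mul_component inner_axis)
 have s: "A $ j $ i = A $ i $ j" for i j
  by (rule symmetric_mat_nth[OF assms])
 show "A $ i $ j = (quad A a k (axis i 1 + axis j 1) - quad A a k (axis i 1) - quad A a k (axis j 1) + quad A a k 0) / 2"
  by (simp add: quad_def matrix_vector_right_distrib inner_add_left inner_add_right e s[of j i])
 show "a $ i = (quad A a k (axis i 1) - quad A a k (- axis i 1)) / 4"
  by (simp add: quad_def matrix_vector_minus inner_axis)
qed

text \<open>The coefficients are combinations of finitely many values of the quadratic function.
  Hence a bound that is not uniform in \<open>x\<close>, given by an arbitrary \<open>K x\<close>,
  still controls them, with \<open>C\<close> depending on \<open>K\<close> alone.\<close>

lemma norm_le_quad:
 fixes K :: "real^'k::finite => real"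
 shows "\<exists>C. \<forall>A a r. symmetric_mat A \<longrightarrow> 0 \<le> r \<longrightarrow> (\<forall>x. \<bar>quad A a 0 x\<bar> \<le> K x * r) \<longrightarrow> norm (A, a) \<le> C * r"
proof -
 define e where "e i = (axis i 1 :: real^'k)" for i
 define C where "C = (\<Sum>i\<in>UNIV. \<Sum>j\<in>UNIV. \<bar>K (e i + e j)\<bar> + \<bar>K (e i)\<bar> + \<bar>K (e j)\<bar> + \<bar>K 0\<bar>) + (\<Sum>i\<in>UNIV. \<bar>K (e i)\<bar> + \<bar>K (- e i)\<bar>)"
 show ?thesis
 proof (rule exI[of _ C], intro allI impI)
  fix A a and r :: real assume A: "symmetric_mat A" and r: "0 \<le> r" and "\<forall>x. \<bar>quad A a 0 x\<bar> \<le> K x * r"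
  then have K: "\<bar>quad A a 0 x\<bar> \<le> K x * r" for x by simp
  have K': "\<bar>quad A a 0 x\<bar> \<le> \<bar>K x\<bar> * r" for x
   by (rule order_trans[OF K]) (intro mult_right_mono abs_ge_self r)
  have 1: "\<bar>A $ i $ j\<bar> \<le> (\<bar>K (e i + e j)\<bar> + \<bar>K (e i)\<bar> + \<bar>K (e j)\<bar> + \<bar>K 0\<bar>) * r" for i j
  proof -
   have "\<bar>(x - y - z + w) / 2\<bar> \<le> k + l + m + n" if "\<bar>x\<bar> \<le> k" "\<bar>y\<bar> \<le> l" "\<bar>z\<bar> \<le> m" "\<bar>w\<bar> \<le> n"
    for x y z w k l m n :: real
   proof -
    have "\<bar>x - y - z + w\<bar> \<le> \<bar>x\<bar> + \<bar>y\<bar> + \<bar>z\<bar> + \<bar>w\<bar>" by linarith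
    also have "... \<le> k + l + m + n" by (intro add_mono that)
    finally have *: "\<bar>x - y - z + w\<bar> \<le> k + l + m + n" .
    have "b / 2 \<le> c" if "0 \<le> b" "b \<le> c" for b c :: real using that by linarith
    from this[OF abs_ge_zero *] show ?thesis by simp
   qed
   from this[OF K' K' K' K'] show ?thesis unfolding quad_polarize(1)[OF A, of i j a 0] e_def[symmetric] distrib_right .
  qed
  have 2: "\<bar>a $ i\<bar> \<le> (\<bar>K (e i)\<bar> + \<bar>K (- e i)\<bar>) * r" for i
  proof -
   have "\<bar>(x - y) / 4\<bar> \<le> k + l" if "\<bar>x\<bar> \<le> k" "\<bar>y\<bar> \<le> l" for x y k l :: real
   proof -
    have "\<bar>x - y\<bar> \<le> \<bar>x\<bar> + \<bar>y\<bar>" by linarith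
    also have "... \<le> k + l" by (intro add_mono that)
    finally have *: "\<bar>x - y\<bar> \<le> k + l" .
    have "b / 4 \<le> c" if "0 \<le> b" "b \<le> c" for b c :: real using that by linarith
    from this[OF abs_ge_zero *] show ?thesis by simp
   qed
   from this[OF K' K'] show ?thesis unfolding quad_polarize(2)[OF A, of a i 0] e_def[symmetric] distrib_right .
  qed
  have "norm A \<le> (\<Sum>i\<in>UNIV. norm (A $ i))" by (simp add: norm_vec_def L2_set_le_sum)
  also have "... \<le> (\<Sum>i\<in>UNIV. \<Sum>j\<in>UNIV. \<bar>A $ i $ j\<bar>)" by (intro sum_mono norm_le_l1_cart)
  also have "... \<le> (\<Sum>i\<in>UNIV. \<Sum>j\<in>UNIV. (\<bar>K (e i + e j)\<bar> + \<bar>K (e i)\<bar> + \<bar>K (e j)\<bar> + \<bar>K 0\<bar>) * r)"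
   by (intro sum_mono 1)
  finally have n1: "norm A \<le> (\<Sum>i\<in>UNIV. \<Sum>j\<in>UNIV. \<bar>K (e i + e j)\<bar> + \<bar>K (e i)\<bar> + \<bar>K (e j)\<bar> + \<bar>K 0\<bar>) * r"
   by (simp only: sum_distrib_right)
  have "norm a \<le> (\<Sum>i\<in>UNIV. \<bar>a $ i\<bar>)" by (rule norm_le_l1_cart)
  also have "... \<le> (\<Sum>i\<in>UNIV. (\<bar>K (e i)\<bar> + \<bar>K (- e i)\<bar>) * r)" by (intro sum_mono 2)
  finally have "norm a \<le> (\<Sum>i\<in>UNIV. \<bar>K (e i)\<bar> + \<bar>K (- e i)\<bar>) * r" by (simp only: sum_distrib_right)
  then show "norm (A, a) \<le> C * r" using n1 norm_Pair_le[of A a] unfolding C_def distrib_right by linarith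
 qed
qed

lemma Ham_diff:
 "Ham L P p x u - Ham L P2 p2 x u = 2 * (((P - P2) *v x + (p - p2)) \<bullet> dr L x u)
  + (\<Sum>i\<in>UNIV. df L i x u \<bullet> ((P - P2) *v df L i x u)) + gm L x \<bullet> ((P - P2) *v gm L x)"
 by (simp add: Ham_def matrix_vector_mult_diff_rdistrib inner_add_left inner_diff_left inner_diff_right sum_subtractf algebra_simps)

definition hbound :: "('n::finite, 'm::finite) lq => real^('N::finite \<times> 'n) => real^('N \<times> 'm) => real" where
 "hbound L x u = (let c = real CARD('N \<times> 'n) in 2 * ((c * norm x + 1) * norm (dr L x u))
  + (\<Sum>i\<in>UNIV. c * (norm (df L i x u))\<^sup>2) + c * (norm (gm L x))\<^sup>2)"

lemma Ham_diff_bound: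
 fixes x :: "real^('N::finite \<times> 'n::finite)"
 shows "\<bar>Ham L P p x u - Ham L P2 p2 x u\<bar> \<le> hbound L x u * norm (P - P2, p - p2)"
proof -
 define A a where "A = P - P2" "a = p - p2"
 define r where "r = norm (A, a)"
 define c where "c = real CARD('N \<times> 'n)"
 have Ar: "norm A \<le> r" and ar: "norm a \<le> r" by (simp_all add: r_def norm_Pair real_le_rsqrt)
 have c: "norm (A *v y) \<le> c * r * norm y" for y
  unfolding mult.assoc c_def
  by (rule order_trans[OF norm_matrix_vector_le]) (intro mult_left_mono mult_right_mono Ar norm_ge_zero of_nat_0_le_iff)
 have q: "\<bar>y \<bullet> (A *v y)\<bar> \<le> c * (norm y)\<^sup>2 * r" for y
  using Cauchy_Schwarz_ineq2[of y "A *v y"] mult_left_mono[OF c[of y] norm_ge_zero[of y]]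
  by (simp add: power2_eq_square mult_ac)
 have "norm (A *v x + a) \<le> (c * norm x + 1) * r"
  using norm_triangle_ineq[of "A *v x" a] c[of x] ar by (simp add: algebra_simps)
 then have d: "\<bar>(A *v x + a) \<bullet> dr L x u\<bar> \<le> (c * norm x + 1) * norm (dr L x u) * r"
  using order_trans[OF Cauchy_Schwarz_ineq2[of "A *v x + a" "dr L x u"] mult_right_mono[OF _ norm_ge_zero[of "dr L x u"]], of "(c * norm x + 1) * r"]
  by (simp add: mult_ac)
 have "\<bar>\<Sum>i\<in>UNIV. df L i x u \<bullet> (A *v df L i x u)\<bar> \<le> (\<Sum>i\<in>UNIV. c * (norm (df L i x u))\<^sup>2 * r)"
  by (rule order_trans[OF sum_abs]) (intro sum_mono q)
 then have "\<bar>\<Sum>i\<in>UNIV. df L i x u \<bullet> (A *v df L i x u)\<bar> \<le> (\<Sum>i\<in>UNIV. c * (norm (df L i x u))\<^sup>2) * r"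
  by (simp only: sum_distrib_right)
 then show ?thesis
 proof -
  have "\<bar>2 * x + y + z\<bar> \<le> 2 * k + l + m" if "\<bar>x\<bar> \<le> k" "\<bar>y\<bar> \<le> l" "\<bar>z\<bar> \<le> m" for x y z k l m :: real using that by linarith
  from this[OF d _ q[of "gm L x"]] show ?thesis if "\<bar>\<Sum>i\<in>UNIV. df L i x u \<bullet> (A *v df L i x u)\<bar> \<le> (\<Sum>i\<in>UNIV. c * (norm (df L i x u))\<^sup>2) * r"
   using that unfolding Ham_diff A_a_def[symmetric] hbound_def Let_def r_def[symmetric] c_def[symmetric]
   by (simp only: distrib_right mult.assoc)
 qed
qed

text \<open>What the verification uses of the Riccati system: the derivatives as functions of time
  and the identity \<open>square\<close>, a Hamilton-Jacobi-Bellman equation with explicit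
  remainder. The matrix equations are consulted only to establish it.\<close>

locale riccati_data =
 fixes L :: "('n::finite, 'm::finite) lq" and T :: real
  and P :: "real => real^('N::finite \<times> 'n)^('N \<times> 'n)" and p :: "real => real^('N \<times> 'n)" and k :: "real => real"
  and P' :: "real => real^('N \<times> 'n)^('N \<times> 'n)" and p' :: "real => real^('N \<times> 'n)" and k' :: "real => real" and c :: real
 assumes T_pos: "0 < T"
  and terminal: "P T = 0" "p T = 0" "k T = 0"
  and deriv: "\<And>t. t \<in> {0..T} ==> (P has_vector_derivative P' t) (at t within {0..T})"
   "\<And>t. t \<in> {0..T} ==> (p has_vector_derivative p' t) (at t within {0..T})"
   "\<And>t. t \<in> {0..T} ==> (k has_real_derivative k' t) (at t within {0..T})"
  and sym: "\<And>t. t \<in> {0..T} ==> symmetric_mat (P t)"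
  and psd: "\<And>t. t \<in> {0..T} ==> psd_mat (P t)"
  and c_pos: "0 < c"
  and coercive: "\<And>t u. t \<in> {0..T} ==> c * (norm u)\<^sup>2 \<le> u \<bullet> (NN L (P t) *v u)"
  and square: "\<And>t x u. t \<in> {0..T} ==> quad (P' t) (p' t) (k' t) x + Ham L (P t) (p t) x u
   = (u - fb L (P t) (p t) x) \<bullet> (NN L (P t) *v (u - fb L (P t) (p t) x))"
  and R_pd: "pd_mat (cR L)"

lemma riccati_dataI:
 fixes L :: "('n::finite, 'm::finite) lq" and P :: "real => real^('N::finite \<times> 'n)^('N \<times> 'n)"
 assumes T: "0 < T" and R: "pd_mat (cR L)" and ric: "riccati_solution L T P p k"
 obtains P' p' k' c where "riccati_data L T P p k P' p' k' c"
proof -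
 obtain c where c: "0 < c" "\<And>u :: real^('N \<times> 'm). c * (norm u)\<^sup>2 \<le> u \<bullet> (bR L *v u)"
  using bR_coercive[OF R] by blast
 have psd: "psd_mat (P t)" if "t \<in> {0..T}" for t using ric that unfolding riccati_solution_def by blast
 then have sym: "symmetric_mat (P t)" if "t \<in> {0..T}" for t using that unfolding psd_mat_def by blast
 \<comment> \<open>One tuple \<open>D\<close> per time, so that a single choice selects all three
   derivatives together with the identity they satisfy.\<close>
 have "\<exists>D. (P has_vector_derivative fst D) (at t within {0..T}) \<and>
      (p has_vector_derivative fst (snd D)) (at t within {0..T}) \<and>
      (k has_real_derivative snd (snd D)) (at t within {0..T}) \<and>
   (\<forall>x u. quad (fst D) (fst (snd D)) (snd (snd D)) x + Ham L (P t) (p t) x u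
   = (u - fb L (P t) (p t) x) \<bullet> (NN L (P t) *v (u - fb L (P t) (p t) x)))" if t: "t \<in> {0..T}" for t
 proof -
  obtain P' p' k' where d: "(P has_vector_derivative P') (at t within {0..T})"
      "(p has_vector_derivative p') (at t within {0..T})" "(k has_real_derivative k') (at t within {0..T})"
   and e: "P' - MM L (P t) ** matrix_inv (NN L (P t)) ** transpose (MM L (P t)) + P t ** (bA L + bAbar L)
       + transpose (bA L + bAbar L) ** P t + 2 *\<^sub>R M4 L (P t) + bQ L + bQbar L = 0"
      "p' - (MM L (P t) ** matrix_inv (NN L (P t))) *v vv L (P t) (p t) + P t *v bb L
       + transpose (bA L + bAbar L) *v p t + M5 L (P t) + bq L = 0"
      "k' - vv L (P t) (p t) \<bullet> (matrix_inv (NN L (P t)) *v vv L (P t) (p t)) + 2 * (p t \<bullet> bb L) + 2 * M6 L (P t) = 0"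
   using ric t unfolding riccati_solution_def Let_def NN_def[symmetric] MM_def[symmetric] vv_def[symmetric] by blast
  have "invertible (NN L (P t))"
   by (rule coercive_invertible(1)[OF c(1)]) (rule NN_coercive[OF psd[OF t] c(2)])
  moreover have "transpose (NN L (P t)) = NN L (P t)"
   using R by (intro NN_sym sym t) (simp add: pd_mat_def)
  ultimately show ?thesis
   using d complete_square[OF sym[OF t] _ _ e] by (intro exI[of _ "(P', p', k')"]) simp
 qed
 then have "\<forall>t. \<exists>D. t \<in> {0..T} \<longrightarrow> (P has_vector_derivative fst D) (at t within {0..T}) \<and>
      (p has_vector_derivative fst (snd D)) (at t within {0..T}) \<and>
      (k has_real_derivative snd (snd D)) (at t within {0..T}) \<and>
   (\<forall>x u. quad (fst D) (fst (snd D)) (snd (snd D)) x + Ham L (P t) (p t) x u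
   = (u - fb L (P t) (p t) x) \<bullet> (NN L (P t) *v (u - fb L (P t) (p t) x)))" by blast
 from choice[OF this] obtain D where D: "\<And>t. t \<in> {0..T} ==> (P has_vector_derivative fst (D t)) (at t within {0..T}) \<and>
      (p has_vector_derivative fst (snd (D t))) (at t within {0..T}) \<and>
      (k has_real_derivative snd (snd (D t))) (at t within {0..T}) \<and>
   (\<forall>x u. quad (fst (D t)) (fst (snd (D t))) (snd (snd (D t))) x + Ham L (P t) (p t) x u
   = (u - fb L (P t) (p t) x) \<bullet> (NN L (P t) *v (u - fb L (P t) (p t) x)))" by blast
 show ?thesis
 proof (rule that[of "%t. fst (D t)" "%t. fst (snd (D t))" "%t. snd (snd (D t))" c], unfold_locales)
  show "c * (norm u)\<^sup>2 \<le> u \<bullet> (NN L (P t) *v u)" if "t \<in> {0..T}" for t u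
   by (rule NN_coercive[OF psd[OF that] c(2)])
  show "P T = 0" "p T = 0" "k T = 0" using ric by (simp_all add: riccati_solution_def)
 qed (use D T R psd sym c(1) in simp_all)
qed

context riccati_data
begin

abbreviation "\<phi> t x \<equiv> fb L (P t) (p t) x"

lemma cont_P: "continuous_on {0..T} P" and cont_p: "continuous_on {0..T} p" and cont_k: "continuous_on {0..T} k"
 using has_vector_derivative_continuous[OF deriv(1)] has_vector_derivative_continuous[OF deriv(2)]
  has_field_derivative_subset[OF deriv(3)] DERIV_continuous[OF deriv(3)]
 by (simp_all add: continuous_on_eq_continuous_within)

lemma NN_fb: "t \<in> {0..T} ==> NN L (P t) *v \<phi> t x = - ww L (P t) (p t) x"
proof -
 assume t: "t \<in> {0..T}"
 have "invertible (NN L (P t))" by (rule coercive_invertible(1)[OF c_pos coercive[OF t]])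
 then show ?thesis by (simp add: fb_def matrix_inv_cancel matrix_vector_minus)
qed

lemma cont_NN: "continuous_on {0..T} (%t. NN L (P t) *v y)"
 by (rule continuous_on_componentwise_inner)
  (unfold inner_NN, intro continuous_intros continuous_on_matrix_vector cont_P)

lemma cont_ww: "continuous_on {0..T} (%t. ww L (P t) (p t) x)"
 by (rule continuous_on_componentwise_inner)
  (unfold inner_ww, intro continuous_intros continuous_on_matrix_vector cont_P cont_p)

text \<open>Coercivity replaces continuity of the inverse:
  \<open>c |\<phi> s x - \<phi> t x|\<close> is at most the norm of \<open>NN (P s)\<close> applied
  to the difference. That vector is \<open>- ww\<close> at time \<open>s\<close> minus
  \<open>NN (P s)\<close> applied to \<open>\<phi> t x\<close>, which is continuous in
  \<open>s\<close> and vanishes at \<open>s = t\<close>.\<close>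

lemma cont_fb: "continuous_on {0..T} (%t. \<phi> t x)"
 unfolding continuous_on_def
proof
 fix t assume t: "t \<in> {0..T}"
 have "((%s. - ww L (P s) (p s) x - NN L (P s) *v \<phi> t x) \<longlongrightarrow> - ww L (P t) (p t) x - NN L (P t) *v \<phi> t x) (at t within {0..T})"
  using cont_NN[of "\<phi> t x"] cont_ww[of x] t unfolding continuous_on_def by (intro tendsto_intros) auto
 then have "((%s. (1 / c) *\<^sub>R (- ww L (P s) (p s) x - NN L (P s) *v \<phi> t x)) \<longlongrightarrow> (1 / c) *\<^sub>R 0) (at t within {0..T})"
  unfolding NN_fb[OF t] by (intro tendsto_scaleR tendsto_const) simp
 then have lim: "((%s. (1 / c) *\<^sub>R (- ww L (P s) (p s) x - NN L (P s) *v \<phi> t x)) \<longlongrightarrow> 0) (at t within {0..T})" by simp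
 have "((%s. \<phi> s x - \<phi> t x) \<longlongrightarrow> 0) (at t within {0..T})"
 proof (rule Lim_null_comparison[OF _ tendsto_norm_zero[OF lim]])
  show "\<forall>\<^sub>F s in at t within {0..T}. norm (\<phi> s x - \<phi> t x) \<le> norm ((1 / c) *\<^sub>R (- ww L (P s) (p s) x - NN L (P s) *v \<phi> t x))"
   unfolding eventually_at_filter
  proof (rule always_eventually, intro allI impI)
   fix s assume s: "s \<in> {0..T}"
   have "c * norm (\<phi> s x - \<phi> t x) \<le> norm (NN L (P s) *v (\<phi> s x - \<phi> t x))"
    by (rule coercive_invertible(2)[OF c_pos coercive[OF s]])
   also have "NN L (P s) *v (\<phi> s x - \<phi> t x) = - ww L (P s) (p s) x - NN L (P s) *v \<phi> t x"
    by (simp add: matrix_vector_mult_diff_distrib NN_fb[OF s])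
   finally show "norm (\<phi> s x - \<phi> t x) \<le> norm ((1 / c) *\<^sub>R (- ww L (P s) (p s) x - NN L (P s) *v \<phi> t x))"
    unfolding norm_scaleR using c_pos by (simp add: pos_le_divide_eq mult.commute)
  qed
 qed
 then show "((%s. \<phi> s x) \<longlongrightarrow> \<phi> t x) (at t within {0..T})" by (rule LIM_zero_cancel)
qed

lemma dr_cont: "continuous_on {0..T} u ==> continuous_on {0..T} (%t. dr L x (u t))"
 unfolding dr_def by (intro continuous_intros continuous_on_matrix_vector)

lemma df_cont: "continuous_on {0..T} u ==> continuous_on {0..T} (%t. df L i x (u t))"
 unfolding df_def by (intro continuous_intros continuous_on_matrix_vector)

lemma quad'_eq: "t \<in> {0..T} ==> quad (P' t) (p' t) (k' t) x = - Ham L (P t) (p t) x (\<phi> t x)"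
 using square[of t x "\<phi> t x"] by simp

lemma quad'_ge: "t \<in> {0..T} ==> - Ham L (P t) (p t) x u \<le> quad (P' t) (p' t) (k' t) x"
 using square[of t x u] coercive[of t "u - \<phi> t x"] c_pos by (smt (verit) mult_nonneg_nonneg zero_le_power2)

text \<open>The solution is given as differentiable, with nothing said about continuity of its
  derivative. At the minimiser the Hamilton-Jacobi-Bellman equation expresses the derivative through
  continuous functions; its entries follow by polarisation and enter the integration by parts in
  time.\<close>

lemma cont_quad': "continuous_on {0..T} (%t. quad (P' t) (p' t) (k' t) x)"
proof -
 have "continuous_on {0..T} (%t. - Ham L (P t) (p t) x (\<phi> t x))"
  unfolding Ham_def cst_def
  by (intro continuous_intros continuous_on_matrix_vector cont_P cont_p cont_fb dr_cont df_cont)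
 then show ?thesis by (rule continuous_on_cong[THEN iffD1, rotated -1]) (simp_all add: quad'_eq)
qed

text \<open>Uniqueness of the derivative, applied to two mirrored entries; one-sided derivatives at
  the end points are unique because \<open>T_pos\<close> excludes a degenerate interval.\<close>

lemma sym': "t \<in> {0..T} ==> symmetric_mat (P' t)"
proof -
 assume t: "t \<in> {0..T}"
 have s: "P s $ i $ j = P s $ j $ i" if "s \<in> {0..T}" for s i j
  by (rule symmetric_mat_nth[OF sym[OF that]])
 have d: "((%s. P s $ i $ j) has_vector_derivative P' t $ i $ j) (at t within {0..T})" for i j
  by (intro bounded_linear.has_vector_derivative[OF bounded_linear_vec_nth] deriv(1) t)
 have "P' t $ i $ j = P' t $ j $ i" for i j
 proof (rule vector_derivative_unique_within_closed_interval[of 0 T t "%s. P s $ i $ j"])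
  have "((%s. P s $ i $ j) has_vector_derivative P' t $ j $ i) (at t within {0..T})"
   by (rule has_vector_derivative_transform[OF t _ d[of j i]]) (rule s)
  then show "((%s. P s $ i $ j) has_vector_derivative P' t $ j $ i) (at t within cbox 0 T)" by simp
 qed (use t T_pos d in simp_all)
 then show ?thesis by (simp add: symmetric_mat_def transpose_def vec_eq_iff)
qed

lemma cont_P': "continuous_on {0..T} (%t. P' t $ i $ j)"
 and cont_p': "continuous_on {0..T} (%t. p' t $ i)"
 and cont_k': "continuous_on {0..T} k'"
proof -
 have "continuous_on {0..T} (%t. (quad (P' t) (p' t) (k' t) (axis i 1 + axis j 1) - quad (P' t) (p' t) (k' t) (axis i 1)
  - quad (P' t) (p' t) (k' t) (axis j 1) + quad (P' t) (p' t) (k' t) 0) / 2)"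
  by (intro continuous_intros cont_quad') simp_all
 then show "continuous_on {0..T} (%t. P' t $ i $ j)"
  by (rule continuous_on_cong[THEN iffD1, rotated -1]) (simp_all only: quad_polarize(1)[OF sym', symmetric])
 have "continuous_on {0..T} (%t. (quad (P' t) (p' t) (k' t) (axis i 1) - quad (P' t) (p' t) (k' t) (- axis i 1)) / 4)"
  by (intro continuous_intros cont_quad') simp_all
 then show "continuous_on {0..T} (%t. p' t $ i)"
  by (rule continuous_on_cong[THEN iffD1, rotated -1]) (simp_all only: quad_polarize(2)[OF sym', symmetric])
 show "continuous_on {0..T} k'" using cont_quad'[of 0] by (simp add: quad_def)
qed

lemma hbound_fb: "\<exists>K. \<forall>t\<in>{0..T}. hbound L x (\<phi> t x) \<le> K"
proof -
 have "continuous_on {0..T} (%t. hbound L x (\<phi> t x))"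
  unfolding hbound_def Let_def by (intro continuous_intros cont_fb dr_cont df_cont)
 from continuous_attains_sup[OF _ _ this] show ?thesis using T_pos by auto
qed

text \<open>A value function composed with a permutation solves the same Hamilton-Jacobi-Bellman equation,
 and the Hamiltonian difference is linear in the coefficients, so that the two agree by Gronwall.\<close>

lemma permutation_invariant:
 assumes inv: "\<And>i. \<pi> (\<pi> i) = i" and t: "t \<in> {0..T}"
 shows "Pm \<pi> (P t) = P t" and "pm \<pi> (p t) = p t"
proof -
 define z where "z t = (Pm \<pi> (P t) - P t, pm \<pi> (p t) - p t)" for t
 define z' where "z' t = (Pm \<pi> (P' t) - P' t, pm \<pi> (p' t) - p' t)" for t
 have "\<forall>x. \<exists>K. \<forall>t\<in>{0..T}. hbound L x (\<phi> t x) \<le> K" by (rule allI) (rule hbound_fb)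
 from choice[OF this] obtain K where "\<forall>x. \<forall>t\<in>{0..T}. hbound L x (\<phi> t x) \<le> K x" by (elim exE)
 then have K: "\<And>x t. t \<in> {0..T} ==> hbound L x (\<phi> t x) \<le> K x" by simp
 \<comment> \<open>Both \<open>x\<close> and its permuted point occur as base points in the two
   inequalities below.\<close>
 define K2 where "K2 x = max (K x) (K (pm \<pi> x))" for x
 from norm_le_quad[of K2] obtain C where "\<forall>A a r. symmetric_mat A \<longrightarrow> 0 \<le> r \<longrightarrow> (\<forall>x. \<bar>quad A a 0 x\<bar> \<le> K2 x * r) \<longrightarrow> norm (A, a) \<le> C * r"
  by (elim exE)
 then have C: "\<And>A a r. symmetric_mat A ==> 0 \<le> r ==> (\<And>x. \<bar>quad A a 0 x\<bar> \<le> K2 x * r) ==> norm (A, a) \<le> C * r"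
  by simp
 \<comment> \<open>The permuted feedback of \<open>y\<close> is a competitor at the point
   \<open>pm \<pi> y\<close>, which gives one inequality. The reverse one is the same statement at
   \<open>pm \<pi> y\<close>, as \<open>\<pi>\<close> is an involution.\<close>
 have lower: "- (K y * norm (z t)) \<le> quad (P' t) (p' t) (k' t) (pm \<pi> y) - quad (P' t) (p' t) (k' t) y"
  if t: "t \<in> {0..T}" for t y
 proof -
  have "- Ham L (P t) (p t) (pm \<pi> y) (pm \<pi> (\<phi> t y)) \<le> quad (P' t) (p' t) (k' t) (pm \<pi> y)"
   by (rule quad'_ge[OF t])
  then have "- (Ham L (Pm \<pi> (P t)) (pm \<pi> (p t)) y (\<phi> t y) - Ham L (P t) (p t) y (\<phi> t y))
   \<le> quad (P' t) (p' t) (k' t) (pm \<pi> y) - quad (P' t) (p' t) (k' t) y"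
   unfolding Ham_pm[OF inv] quad'_eq[OF t] by linarith
  moreover have "\<bar>Ham L (Pm \<pi> (P t)) (pm \<pi> (p t)) y (\<phi> t y) - Ham L (P t) (p t) y (\<phi> t y)\<bar> \<le> K y * norm (z t)"
   unfolding z_def by (rule order_trans[OF Ham_diff_bound]) (intro mult_right_mono K t norm_ge_zero)
  ultimately show ?thesis by linarith
 qed
 have bound: "norm (z' t) \<le> C * norm (z t)" if t: "t \<in> {0..T}" for t
  unfolding z'_def
 proof (rule C)
  have P't: "P' t $ i $ j = P' t $ j $ i" for i j
   by (rule symmetric_mat_nth[OF sym'[OF t]])
  show "symmetric_mat (Pm \<pi> (P' t) - P' t)"
   unfolding symmetric_mat_def vec_eq_iff
  proof (intro allI)
   fix i j :: "'N \<times> 'n"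
   show "transpose (Pm \<pi> (P' t) - P' t) $ i $ j = (Pm \<pi> (P' t) - P' t) $ i $ j"
    using P't[of i j] P't[of "(\<pi> (fst i), snd i)" "(\<pi> (fst j), snd j)"]
    by (simp add: transpose_def Pm_def pm_def)
  qed
  fix x
  have e: "quad (Pm \<pi> (P' t) - P' t) (pm \<pi> (p' t) - p' t) 0 x = quad (P' t) (p' t) (k' t) (pm \<pi> x) - quad (P' t) (p' t) (k' t) x"
   using quad_diff[of "Pm \<pi> (P' t)" "P' t" "pm \<pi> (p' t)" "p' t" "k' t" "k' t" x] by (simp add: quad_pm[OF inv])
  have "K x * norm (z t) \<le> K2 x * norm (z t)" "K (pm \<pi> x) * norm (z t) \<le> K2 x * norm (z t)"
   by (simp_all add: K2_def mult_right_mono)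
  then show "\<bar>quad (Pm \<pi> (P' t) - P' t) (pm \<pi> (p' t) - p' t) 0 x\<bar> \<le> K2 x * norm (z t)"
   using lower[OF t, of x] lower[OF t, of "pm \<pi> x"] unfolding e pm_pm[OF inv] by linarith
 qed simp
 have der: "(z has_vector_derivative z' t) (at t within {0..T})" if "t \<in> {0..T}" for t
  unfolding z_def z'_def
  by (intro has_vector_derivative_Pair has_vector_derivative_diff deriv that
    bounded_linear.has_vector_derivative[OF bounded_linear_Pm] bounded_linear.has_vector_derivative[OF bounded_linear_pm])
 have "z t = 0"
  by (rule vanishing_of_linear_growth[OF der bound _ t])
   (simp_all add: z_def terminal zero_prod_def linear_simps[OF bounded_linear_Pm] linear_simps[OF bounded_linear_pm])
 then show "Pm \<pi> (P t) = P t" and "pm \<pi> (p t) = p t" by (simp_all add: z_def zero_prod_def)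
qed

section \<open>Blocks of the Riccati solution and the feedback of one agent\<close>

definition swap_index :: "'a => 'a => 'a => 'a" where
 "swap_index i j l = (if l = i then j else if l = j then i else l)"

lemma block_swap:
 fixes l l2 :: 'N
 defines "\<pi> \<equiv> swap_index l l2"
 assumes t: "t \<in> {0..T}"
 shows "block (\<pi> i) (\<pi> j) (P t) = block i j (P t)" and "blk (\<pi> i) (p t) = blk i (p t)"
proof -
 have inv: "\<pi> (\<pi> i) = i" for i by (simp add: \<pi>_def swap_index_def)
 note P = permutation_invariant[of \<pi>, OF inv t]
 show "block (\<pi> i) (\<pi> j) (P t) = block i j (P t)"
  by (subst (2) P(1)[symmetric]) (simp add: block_def Pm_def pm_def)
 show "blk (\<pi> i) (p t) = blk i (p t)" by (subst (2) P(2)[symmetric]) (simp add: blk_pm)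
qed

lemma ex_other: "CARD('N) \<ge> 2 ==> \<exists>i j :: 'N. i \<noteq> j"
 using card_2_iff'[of "UNIV :: 'N set"] card_le_Suc0_iff_eq[of "UNIV :: 'N set"] by force

text \<open>Two exchanges carry any pair \<open>i \<noteq> j\<close> to a fixed pair: first
  \<open>i\<close> to \<open>i0\<close>, then the image \<open>j'\<close> of \<open>j\<close> to
  \<open>j0\<close>; the second leaves \<open>i0\<close> alone because \<open>j'\<close> and
  \<open>j0\<close> differ from it.\<close>

lemma blocks:
 assumes N: "CARD('N) \<ge> 2" and t: "t \<in> {0..T}"
 shows "block i i (P t) = diagonal_block (P t)" and "i \<noteq> j ==> block i j (P t) = offdiagonal_block (P t)"
  and "blk i (p t) = vector_block (p t)"
proof -
 obtain i0 j0 :: 'N where ij: "i0 \<noteq> j0" using ex_other[OF N] by blast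
 note s = block_swap[OF t]
 have 1: "block i i (P t) = block i0 i0 (P t)" for i
  using s(1)[of i i0 i i] by (simp add: swap_index_def)
 have 2: "block i j (P t) = block i0 j0 (P t)" if "i \<noteq> j" for i j
 proof -
  define j' where "j' = swap_index i i0 j"
  have j': "j' \<noteq> i0" using that by (auto simp: j'_def swap_index_def)
  have "block i j (P t) = block i0 j' (P t)" using s(1)[of i i0 i j] by (simp add: j'_def[symmetric]) (simp add: swap_index_def)
  also have "... = block i0 j0 (P t)" using s(1)[of j' j0 i0 j'] ij j' by (simp add: swap_index_def)
  finally show ?thesis .
 qed
 have 3: "blk i (p t) = blk i0 (p t)" for i using s(2)[of i i0 i] by (simp add: swap_index_def)
 have d: "diagonal_block (P t) = block i0 i0 (P t)" unfolding diagonal_block_def by (rule the_equality, rule allI, rule 1) simp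
 have ofd: "offdiagonal_block (P t) = block i0 j0 (P t)" unfolding offdiagonal_block_def
  by (rule the_equality, intro allI impI, erule 2) (use ij in simp)
 have v: "vector_block (p t) = blk i0 (p t)" unfolding vector_block_def blk_def[symmetric] by (rule the_equality, rule allI, rule 3) simp
 show "block i i (P t) = diagonal_block (P t)" "i \<noteq> j ==> block i j (P t) = offdiagonal_block (P t)" "blk i (p t) = vector_block (p t)"
  unfolding d ofd v by (rule 1, rule 2, assumption, rule 3)
qed

lemma blk_mult: "blk i (Z *v x) = (\<Sum>j\<in>UNIV. block i j Z *v blk j x)"
 by (simp add: blk_def block_def vec_eq_iff matrix_vector_mult_def sum_prod_UNIV)

lemma blk_P:
 assumes N: "CARD('N) \<ge> 2" and t: "t \<in> {0..T}"
 shows "blk i (P t *v x) = diagonal_block (P t) *v blk i x + (\<Sum>j\<in>UNIV - {i}. offdiagonal_block (P t) *v blk j x)"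
 unfolding blk_mult by (subst sum.remove[of _ i]) (auto simp: blocks[OF N t] intro!: sum.cong)

text \<open>Vectors supported in a single block show that the diagonal block is positive
  semidefinite, so \<open>calR\<close> inherits positivity from \<open>R\<close>.\<close>

lemma calR_invertible:
 assumes N: "CARD('N) \<ge> 2" and t: "t \<in> {0..T}"
 shows "invertible (calR L (real CARD('N) *\<^sub>R diagonal_block (P t)))"
proof -
 let ?A = "calR L (real CARD('N) *\<^sub>R diagonal_block (P t))"
 have D: "0 \<le> v \<bullet> (diagonal_block (P t) *v v)" for v
 proof -
  define i :: 'N where "i = undefined"
  define z where "z = stack (%l. if l = i then v else 0)"
  have z: "blk l z = (if l = i then v else 0)" for l by (simp add: z_def blk_stack)
  have "0 \<le> z \<bullet> (P t *v z)" using psd[OF t] by (simp add: psd_mat_def)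
  also have "... = (\<Sum>l\<in>UNIV. if l = i then v \<bullet> blk i (P t *v z) else 0)"
   unfolding inner_blk[of z] by (rule sum.cong) (simp_all add: z)
  also have "... = v \<bullet> (diagonal_block (P t) *v v)"
   by (simp add: blk_P[OF N t] z)
  finally show ?thesis .
 qed
 have pos: "0 < y \<bullet> (?A *v y)" if "y \<noteq> 0" for y
 proof -
  have "y \<bullet> (?A *v y) = y \<bullet> (cR L *v y) + real CARD('N) * ((cD L *v y) \<bullet> (diagonal_block (P t) *v (cD L *v y)))"
   by (simp add: calR_def matrix_vector_mult_add_rdistrib inner_add_right matrix_vector_mul_assoc[symmetric] inner_vmul
     scaleR_matrix_vector_assoc[symmetric])
  then show ?thesis using R_pd that D[of "cD L *v y"] unfolding pd_mat_def by (simp add: add_pos_nonneg)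
 qed
 have "inj ((*v) ?A)"
 proof (rule injI)
  fix x y assume "?A *v x = ?A *v y"
  then have "(x - y) \<bullet> (?A *v (x - y)) = 0" by (simp add: matrix_vector_mult_diff_distrib)
  then show "x = y" using pos[of "x - y"] by fastforce
 qed
 then show ?thesis using matrix_left_invertible_injective invertible_left_inverse by blast
qed

text \<open>The stacked \<open>NN\<close> is not inverted block by block. The claimed feedback
  \<open>U\<close> is shown to satisfy \<open>NN U = - ww\<close> by testing against every
  \<open>w\<close>, and coercivity makes the solution unique.\<close>

lemma fb_eq:
 assumes N: "CARD('N) \<ge> 2" and t: "t \<in> {0..T}"
 defines "PN \<equiv> real CARD('N) *\<^sub>R diagonal_block (P t)" and "PiN \<equiv> (real CARD('N))\<^sup>2 *\<^sub>R offdiagonal_block (P t)"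
  and "pN \<equiv> real CARD('N) *\<^sub>R vector_block (p t)"
 shows "blk i (\<phi> t x) = (Theta L PN + (1 / real CARD('N)) *\<^sub>R theta_bar L PN PiN) *v blk i x
  + (Theta_bar L PN PiN - Theta L PN) *v mean x + theta L PN pN"
proof -
 let ?N = "real CARD('N)"
 have N0: "?N \<noteq> 0" by simp
 define U where "U i = (Theta L PN + (1 / ?N) *\<^sub>R theta_bar L PN PiN) *v blk i x
  + (Theta_bar L PN PiN - Theta L PN) *v mean x + theta L PN pN" for i
 note inv = matrix_inv_cancel[OF calR_invertible[OF N t], folded PN_def]
 have cU: "calR L PN *v U i = - (transpose (cB L) *v (PN *v blk i x - (1 / ?N) *\<^sub>R (PiN *v blk i x) + PiN *v mean x)
  + transpose (cD L) *v (PN *v (cC L *v blk i x + cCbar L *v mean x + csigma L)) + cS L *v blk i x + transpose (cB L) *v pN + cr L)" for i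
  by (simp add: U_def Theta_def Theta_bar_def theta_def theta_bar_def matrix_vector_right_distrib matrix_vector_mult_add_rdistrib
   matrix_vector_mult_diff_rdistrib matrix_vector_mult_diff_distrib matrix_vector_minus scaleR_matrix_vector_assoc[symmetric] matrix_vector_mult_scaleR
   matrix_vector_mul_assoc[symmetric] inv matrix_add_ldistrib del: transpose_matrix_vector)
 \<comment> \<open>The off-diagonal sum omits the agent itself: it is \<open>N\<close> times the
   mean minus the own block. This is the source of the correction
   \<open>theta_bar / N\<close>.\<close>
 have bP: "blk i (P t *v x) = (1 / ?N) *\<^sub>R (PN *v blk i x - (1 / ?N) *\<^sub>R (PiN *v blk i x) + PiN *v mean x)" for i
 proof -
  have "(\<Sum>j\<in>UNIV - {i}. offdiagonal_block (P t) *v blk j x) = offdiagonal_block (P t) *v (?N *\<^sub>R mean x) - offdiagonal_block (P t) *v blk i x"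
   unfolding sum_blk_mean[symmetric] by (simp add: matrix_vector_right_distrib sum_diff1 vec.sum)
  then show ?thesis
   unfolding blk_P[OF N t] PN_def PiN_def
   by (simp add: scaleR_matrix_vector_assoc[symmetric] matrix_vector_mult_scaleR scaleR_diff_right scaleR_add_right power2_eq_square)
 qed
 \<comment> \<open>The vectors multiplying the noise of agent \<open>i\<close> are supported in
   block \<open>i\<close>, so they see only the diagonal block of \<open>P\<close>; therefore
   \<open>calR\<close> contains \<open>PN\<close> alone.\<close>
 have one: "z \<bullet> (P t *v z2) = (1 / ?N) * (a \<bullet> (PN *v b))"
  if "\<And>l. blk l z = (if l = i then a else 0)" "\<And>l. blk l z2 = (if l = i then b else 0)" for i z z2 a b
 proof -
  have "blk i (P t *v z2) = diagonal_block (P t) *v b" by (simp add: blk_P[OF N t] that)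
  then have "z \<bullet> (P t *v z2) = (\<Sum>l\<in>UNIV. if l = i then a \<bullet> (diagonal_block (P t) *v b) else 0)"
   unfolding inner_blk[of z] by (intro sum.cong) (simp_all add: that)
  then show ?thesis by (simp add: PN_def scaleR_matrix_vector_assoc[symmetric])
 qed
 have PN_sym: "a \<bullet> (PN *v b) = b \<bullet> (PN *v a)" for a b
 proof -
  define z where "z v = stack (%l. if l = (undefined :: 'N) then v else 0)" for v :: "real^'n"
  have z: "blk l (z v) = (if l = undefined then v else 0)" for l v by (simp add: z_def blk_stack)
  show ?thesis using psd_inner_commute[OF sym[OF t], of "z a" "z b"] by (simp add: one[OF z z])
 qed
 have "w \<bullet> (NN L (P t) *v stack U) + w \<bullet> ww L (P t) (p t) x = 0" for w
 proof -
  have bD: "blk l (bD L i *v v) = (if l = i then cD L *v v else 0)" for l i v by (simp add: bD_def kron_col_blk)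
  have bs: "blk l (bsigma L i) = (if l = i then csigma L else 0)" for l i
   by (simp add: bsigma_def kron_vec_def axis_def blk_def vec_eq_iff)
  have brw: "blk i (br L :: real^('N \<times> 'm)) = (1 / ?N) *\<^sub>R cr L" for i
   by (simp add: br_def kron_vec_def ones_vec_def blk_def vec_eq_iff)
  have 1: "w \<bullet> (NN L (P t) *v stack U) = (\<Sum>i\<in>UNIV. (1 / ?N) * (blk i w \<bullet> (calR L PN *v U i)))"
   unfolding inner_NN be_blk one[OF bD bD]
   by (simp add: calR_def matrix_vector_mult_add_rdistrib inner_add_right matrix_vector_mul_assoc[symmetric] inner_vmul blk_stack
     bR_def scaleR_matrix_vector_assoc[symmetric] inner_blk[of w] blk_scaleR kron_id_blk sum.distrib add_divide_distrib sum_divide_distrib)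
  have 2: "x \<bullet> (P t *v (bB L *v w)) = (\<Sum>i\<in>UNIV. (cB L *v blk i w) \<bullet> blk i (P t *v x))"
   by (subst psd_inner_commute[OF sym[OF t]]) (simp add: inner_blk[of "bB L *v w"] bB_blk)
  have 3: "w \<bullet> (bS L *v x) = (\<Sum>i\<in>UNIV. (1 / ?N) * (blk i w \<bullet> (cS L *v blk i x)))"
   by (simp add: bS_def scaleR_matrix_vector_assoc[symmetric] inner_blk[of w] blk_scaleR kron_id_blk sum_divide_distrib)
  have 4: "p t \<bullet> (bB L *v w) = (\<Sum>i\<in>UNIV. (1 / ?N) * ((cB L *v blk i w) \<bullet> pN))"
   by (simp add: inner_blk[of "p t"] bB_blk blocks(3)[OF N t] pN_def inner_commute)
  have 5: "br L \<bullet> w = (\<Sum>i\<in>UNIV. (1 / ?N) * (blk i w \<bullet> cr L))"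
   by (simp add: inner_blk[of _ w] brw inner_commute[of "cr L"])
  have z: "(1 / ?N) * (v \<bullet> (calR L PN *v U i)) + (cB L *v v) \<bullet> blk i (P t *v x)
   + (1 / ?N) * ((cC L *v blk i x + cCbar L *v mean x) \<bullet> (PN *v (cD L *v v))) + (1 / ?N) * (v \<bullet> (cS L *v blk i x))
   + (1 / ?N) * ((cB L *v v) \<bullet> pN) + (1 / ?N) * (csigma L \<bullet> (PN *v (cD L *v v))) + (1 / ?N) * (v \<bullet> cr L) = 0" for i v
   unfolding cU bP PN_sym[of _ "cD L *v v"]
   by (simp only: inner_minus_right inner_add_right inner_scaleR_right inner_transpose matrix_vector_right_distrib inner_diff_right)
    (simp add: algebra_simps)
  show ?thesis
   unfolding inner_ww be_blk one[OF bC_blk bD] one[OF bs bD] 1 2 3 4 5 sum.distrib[symmetric]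
   by (rule sum.neutral) (use z in \<open>simp add: algebra_simps\<close>)
 qed
 then have "w \<bullet> (NN L (P t) *v stack U - NN L (P t) *v \<phi> t x) = 0" for w
  unfolding NN_fb[OF t] by (simp add: inner_add_right)
 from this[of "NN L (P t) *v stack U - NN L (P t) *v \<phi> t x"] have "NN L (P t) *v (stack U - \<phi> t x) = 0"
  by (simp add: matrix_vector_mult_diff_distrib)
 then have "c * norm (stack U - \<phi> t x) \<le> 0"
  using coercive_invertible(2)[OF c_pos coercive[OF t], of "stack U - \<phi> t x"] by simp
 then have "\<phi> t x = stack U" using c_pos by (simp add: mult_le_0_iff)
 then show ?thesis by (simp add: blk_stack U_def)
qed

lemma quad_blocks:
 fixes x :: "'N => real^'n"
 assumes N: "CARD('N) \<ge> 2" and t: "t \<in> {0..T}"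
 shows "stack x \<bullet> (P t *v stack x) + 2 * (stack x \<bullet> p t) + k t =
     (1 / real CARD('N)) * (\<Sum>j\<in>UNIV. x j \<bullet> ((real CARD('N) *\<^sub>R diagonal_block (P t)) *v x j))
     + (1 / (real CARD('N))\<^sup>2) * (\<Sum>l\<in>UNIV. \<Sum>j\<in>UNIV - {l}. x j \<bullet> (((real CARD('N))\<^sup>2 *\<^sub>R offdiagonal_block (P t)) *v x l))
     + 2 * (((1 / real CARD('N)) *\<^sub>R (\<Sum>j\<in>UNIV. x j)) \<bullet> (real CARD('N) *\<^sub>R vector_block (p t))) + k t"
proof -
 let ?N = "real CARD('N)"
 have 1: "stack x \<bullet> (P t *v stack x) = (\<Sum>j\<in>UNIV. x j \<bullet> (diagonal_block (P t) *v x j))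
  + (\<Sum>j\<in>UNIV. \<Sum>l\<in>UNIV - {j}. x j \<bullet> (offdiagonal_block (P t) *v x l))"
  by (simp add: inner_blk[of "stack x"] blk_stack blk_P[OF N t] inner_add_right inner_sum_right sum.distrib)
 have 2: "(\<Sum>j\<in>UNIV. \<Sum>l\<in>UNIV - {j}. f j l) = (\<Sum>l\<in>UNIV. \<Sum>j\<in>UNIV - {l}. f j l)" for f :: "'N => 'N => real"
 proof -
  have "(\<Sum>j\<in>UNIV. \<Sum>l\<in>UNIV - {j}. f j l) = (\<Sum>j\<in>UNIV. \<Sum>l\<in>UNIV. if j \<noteq> l then f j l else 0)"
   by (intro sum.cong refl sum.mono_neutral_cong_left) auto
  also have "... = (\<Sum>l\<in>UNIV. \<Sum>j\<in>UNIV. if j \<noteq> l then f j l else 0)" by (rule sum.swap)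
  also have "... = (\<Sum>l\<in>UNIV. \<Sum>j\<in>UNIV - {l}. f j l)"
   by (intro sum.cong refl sum.mono_neutral_cong_right) auto
  finally show ?thesis .
 qed
 have 3: "stack x \<bullet> p t = (\<Sum>j\<in>UNIV. x j) \<bullet> vector_block (p t)"
  by (simp add: inner_blk[of "stack x"] blk_stack blocks(3)[OF N t] inner_sum_left)
 show ?thesis unfolding 1 2[of "%j l. x j \<bullet> (offdiagonal_block (P t) *v x l)"] 3
  by (simp add: scaleR_matrix_vector_assoc[symmetric] sum_distrib_left[symmetric] sum_divide_distrib[symmetric])
qed

end

section \<open>Affine coefficients and moments weighted in time\<close>

context brownian_filtration
begin

lemma cut_inner: "cut T (%s w. f s w \<bullet> g s w) = (%x. cut T f x \<bullet> cut T g x)"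
 by (auto simp: cut_def fun_eq_iff split: split_indicator)

lemma cut_inner_integrable:
 assumes "L2 Lam (cut T f)" "L2 Lam (cut T g)"
 shows "integrable Lam (cut T (%s w. f s w \<bullet> g s w))"
 unfolding cut_inner by (rule L2_inner_integrable[OF assms])

lemma progressive_compose_linear:
 fixes A :: "'a::euclidean_space => 'c::euclidean_space"
 assumes A: "bounded_linear A" and H: "progressive F T H"
 shows "progressive F T (%s w. A (H s w))"
proof -
 have "A \<in> bm borel"
  by (rule borel_measurable_continuous_onI[OF linear_continuous_on[OF A]])
 then show ?thesis using H unfolding progressive_def by (auto simp: split_beta' intro!: measurable_compose[OF _ \<open>A \<in> _\<close>])
qed

lemma progressive_affine:
 fixes X :: "real => 'w => real^'k::finite" and A :: "real => real^'k^'l::finite"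
 assumes A: "continuous_on {0..T} A" and X: "progressive F T X"
 shows "progressive F T (%s w. A s *v X s w)"
 unfolding progressive_def
proof
 fix t assume t: "t \<in> {0..T}"
 have "A \<in> bm (restrict_space borel {0..t})"
  by (rule borel_measurable_continuous_on_restrict) (rule continuous_on_subset[OF A], use t in auto)
 then have "(%x. A (fst x)) \<in> bm (restrict_space borel {0..t} \<Otimes>\<^sub>M F t)" by measurable
 moreover have "(%x. X (fst x) (snd x)) \<in> bm (restrict_space borel {0..t} \<Otimes>\<^sub>M F t)"
  using X t unfolding progressive_def by (simp add: split_beta')
 ultimately have "(%x. A (fst x) *v X (fst x) (snd x)) \<in> bm (restrict_space borel {0..t} \<Otimes>\<^sub>M F t)"
  by (rule borel_measurable_continuous_Pair)
   (unfold matrix_vector_mult_def, intro continuous_on_vec_lambda continuous_intros)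
 then show "(%(s, w). A s *v X s w) \<in> bm (restrict_space borel {0..t} \<Otimes>\<^sub>M F t)"
  by (simp add: split_beta')
qed

lemma continuous_norm_bound:
 fixes A :: "real => 'a::real_normed_vector"
 assumes "continuous_on {0..T} A" obtains K where "0 \<le> K" "\<And>s. s \<in> {0..T} ==> norm (A s) \<le> K"
proof -
 have "bounded (A ` {0..T})" by (intro compact_imp_bounded compact_continuous_image assms compact_Icc)
 then obtain K where K: "\<forall>y\<in>A ` {0..T}. norm y \<le> K" unfolding bounded_iff by blast
 show ?thesis by (rule that[of "max 0 K"]) (use K in \<open>auto simp: le_max_iff_disj\<close>)
qed

lemma affine_L2:
 fixes X :: "real => 'w => real^'k::finite" and A :: "real => real^'k^'l::finite"
 assumes T: "0 \<le> T" and A: "continuous_on {0..T} A" and X: "progressive F T X" "L2 Lam (cut T X)"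
 shows "L2 Lam (cut T (%s w. A s *v X s w))"
proof -
 obtain K where K: "0 \<le> K" "\<And>s. s \<in> {0..T} ==> norm (A s) \<le> K" using continuous_norm_bound[OF A] by blast
 show ?thesis
 proof (rule L2_bound[OF X(2) cut_measurable[OF progressive_affine[OF A X(1)] T order_refl]], rule AE_I2)
  fix x show "norm (cut T (%s w. A s *v X s w) x) \<le> (real CARD('l) * K) * norm (cut T X x)"
  proof (cases "fst x \<in> {0..T}")
   case True
   have "norm (A (fst x) *v X (fst x) (snd x)) \<le> real CARD('l) * (norm (A (fst x)) * norm (X (fst x) (snd x)))"
    by (rule norm_matrix_vector_le)
   also have "... \<le> real CARD('l) * (K * norm (X (fst x) (snd x)))"
    by (intro mult_left_mono mult_right_mono K True) auto
   finally show ?thesis using True by (simp add: cut_def split_beta' mult.assoc)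
  qed (simp add: cut_def split_beta' mult_nonneg_nonneg)
 qed
qed

lemma lipschitz_affine:
 fixes A :: "real => real^'k^'k::finite"
 assumes A: "continuous_on {0..T} A" and a: "progressive F T a" "L2 Lam (cut T a)"
  and K: "0 \<le> K" "\<And>s. s \<in> {0..T} ==> real CARD('k) * norm (A s) \<le> K"
 shows "lipschitz_coeff T K (%s w x. A s *v x + a s w)"
 unfolding lipschitz_coeff_def
proof (intro conjI ballI allI impI)
 fix s w x y assume s: "s \<in> {0..T}"
 have "norm (A s *v x + a s w - (A s *v y + a s w)) = norm (A s *v (x - y))"
  by (simp add: matrix_vector_mult_diff_distrib)
 also have "... \<le> real CARD('k) * norm (A s) * norm (x - y)"
  using norm_matrix_vector_le[of "A s" "x - y"] by (simp add: mult.assoc)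
 also have "... \<le> K * norm (x - y)" by (intro mult_right_mono K(2) s norm_ge_zero)
 finally show "norm (A s *v x + a s w - (A s *v y + a s w)) \<le> K * norm (x - y)" .
qed (use a K(1) in \<open>auto intro!: progressive_add progressive_affine A\<close>)

text \<open>Integration by parts in time, applied to \<open>q\<close> and the moment function \<open>t \<mapsto> E \<langle>X\<^sub>t, Y\<^sub>t\<rangle>\<close>, avoids Ito's formula
 for time-dependent integrands.\<close>

lemma time_moment:
 fixes X Y :: "real => 'w => 'a::euclidean_space" and q q' :: "real => real"
 assumes T: "0 \<le> T" and X: "ito_process T x0 b \<sigma> X" and Y: "ito_process T y0 g \<rho> Y"
  and q: "\<And>t. t \<in> {0..T} ==> (q has_real_derivative q' t) (at t within {0..T})" and q': "continuous_on {0..T} q'"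
  and qT: "q T = 0"
 shows "has_bochner_integral Lam (cut T (%s \<omega>. q' s * (X s \<omega> \<bullet> Y s \<omega>)
   + q s * (b s \<omega> \<bullet> Y s \<omega> + X s \<omega> \<bullet> g s \<omega> + (\<Sum>j\<in>UNIV. \<sigma> j s \<omega> \<bullet> \<rho> j s \<omega>)))) (- (q 0 * (\<integral>\<omega>. x0 \<omega> \<bullet> y0 \<omega> \<partial>M)))"
proof -
 let ?I = "%s. indicator {0..T} s :: real"
 define R where "R x = cut T b x \<bullet> cut T Y x + cut T X x \<bullet> cut T g x + (\<Sum>j\<in>UNIV. cut T (\<sigma> j) x \<bullet> cut T (\<rho> j) x)" for x
 define S where "S x = cut T X x \<bullet> cut T Y x" for x
 define m where "m t = (\<integral>\<omega>. X t \<omega> \<bullet> Y t \<omega> \<partial>M)" for t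
 define m0 where "m0 = (\<integral>\<omega>. x0 \<omega> \<bullet> y0 \<omega> \<partial>M)"
 define r where "r s = (\<integral>\<omega>. R (s, \<omega>) \<partial>M)" for s
 define f where "f s = ?I s * q' s" for s
 have Tm: "T \<in> {0..T}" using T by simp
 have Ri: "integrable Lam R" unfolding R_def by (rule ito_moment(1)[OF X Y Tm])
 have Si: "integrable Lam S" unfolding S_def by (intro L2_inner_integrable ito_processD(6)[OF X] ito_processD(6)[OF Y])
 have qc: "continuous_on {0..T} q" by (simp add: continuous_on_eq_continuous_within DERIV_continuous[OF q])
 have f: "integrable lborel f"
  using borel_integrable_atLeastAtMost'[OF q'] by (simp add: f_def[abs_def] set_integrable_def)
 have r: "integrable lborel r"
  unfolding r_def using PS.integrable_fst[of "%s \<omega>. R (s, \<omega>)"] Ri by (simp add: split_beta')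
 have Rcut: "R x = (if fst x \<in> {0..T} then R x else 0)" for x
  by (auto simp: R_def cut_def split_beta')
 \<comment> \<open>The primitives of \<open>f\<close> and \<open>r\<close> are the increments of
   \<open>q\<close> and of the moment function \<open>m\<close>; the second is
   \<open>ito_moment\<close> at time \<open>t\<close>.\<close>
 have IF: "(LI lborel (%s. indicator {..t} s *\<^sub>R f s)) = q t - q 0" if t: "t \<in> {0..T}" for t
 proof -
  have "(LI lborel (%s. indicator {0..t} s *\<^sub>R q' s)) = q t - q 0"
  proof (rule integral_FTC_Icc)
   show "0 \<le> t" using t by simp
   show "(q has_vector_derivative q' x) (at x within {0..t})" if "0 \<le> x" "x \<le> t" for x
    using has_field_derivative_subset[OF q[of x], of "{0..t}"] that t
    by (simp add: has_real_derivative_iff_has_vector_derivative)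
   show "continuous_on {0..t} q'" by (rule continuous_on_subset[OF q']) (use t in auto)
  qed
  moreover have "(LI lborel (%s. indicator {..t} s *\<^sub>R f s)) = (LI lborel (%s. indicator {0..t} s *\<^sub>R q' s))"
   by (rule LI_integral_cong) (use t in \<open>auto simp: f_def split: split_indicator\<close>)
  ultimately show ?thesis by simp
 qed
 have IR: "(LI lborel (%s. indicator {..t} s *\<^sub>R r s)) = m t - m0" if t: "t \<in> {0..T}" for t
 proof -
  have "(LI lborel (%s. indicator {..t} s *\<^sub>R r s)) = (LI lborel (%s. (\<integral>\<omega>. indicator {..t} s * R (s, \<omega>) \<partial>M)))"
   by (simp add: r_def)
  also have "... = (LI Lam (%x. indicator {..t} (fst x) * R x))"
  proof -
   have "integrable Lam (%x. indicator {..t} (fst x) * R x)"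
    by (rule LI_integrable_bound[OF Ri]) (use Ri in \<open>auto split: split_indicator\<close>)
   then show ?thesis using PS.integral_fst[of "%s \<omega>. indicator {..t} s * R (s, \<omega>)"] by (simp add: split_beta')
  qed
  also have "... = (LI Lam (%x. cut t b x \<bullet> cut t Y x + cut t X x \<bullet> cut t g x + (\<Sum>j\<in>UNIV. cut t (\<sigma> j) x \<bullet> cut t (\<rho> j) x)))"
   by (rule LI_integral_cong) (use t in \<open>auto simp: R_def cut_def split: split_indicator\<close>)
  also have "... = m t - m0" using ito_moment(2)[OF X Y t] by (simp add: m_def m0_def)
  finally show ?thesis .
 qed
 note P = integral_product[OF f r]
 define h where "h x = cut T (%s \<omega>. q' s * (X s \<omega> \<bullet> Y s \<omega>)) x" for x
 define h2 where "h2 x = cut T (%s \<omega>. q s * (b s \<omega> \<bullet> Y s \<omega> + X s \<omega> \<bullet> g s \<omega> + (\<Sum>j\<in>UNIV. \<sigma> j s \<omega> \<bullet> \<rho> j s \<omega>))) x" for x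
 have w: "integrable Lam (%x. ?I (fst x) * w (fst x) * G x)" if w: "continuous_on {0..T} w" and G: "integrable Lam G" for w G
 proof -
  obtain K where K: "0 \<le> K" "\<And>s. s \<in> {0..T} ==> norm (w s) \<le> K" using continuous_norm_bound[OF w] by blast
  have [measurable]: "(%s. ?I s * w s) \<in> bm borel"
   using borel_measurable_continuous_on_indicator[OF _ w] by simp
  show ?thesis
  proof (rule LI_integrable_bound[of Lam "%x. K * G x"])
   show "integrable Lam (%x. K * G x)" using G by simp
   show "(%x. ?I (fst x) * w (fst x) * G x) \<in> bm Lam" using G by measurable
   show "AE x in Lam. norm (?I (fst x) * w (fst x) * G x) \<le> norm (K * G x)"
    using K by (intro AE_I2) (auto simp: abs_mult intro!: mult_right_mono split: split_indicator)
  qed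
 qed
 have hS: "h x = ?I (fst x) * q' (fst x) * S x" for x
  by (auto simp: h_def S_def cut_def split_beta' split: split_indicator)
 have hR: "h2 x = ?I (fst x) * q (fst x) * R x" for x
  by (auto simp: h2_def R_def cut_def split_beta' split: split_indicator)
 have hi: "integrable Lam h" "integrable Lam h2" unfolding hS hR by (rule w[OF q' Si], rule w[OF qc Ri])
 have "(LI Lam (%x. h x)) = (LI lborel (%s. (\<integral>\<omega>. h (s, \<omega>) \<partial>M)))"
  using PS.integral_fst[of "%s \<omega>. h (s, \<omega>)"] hi(1) by (simp add: split_beta')
 also have "... = (LI lborel (%s. f s * m s))"
 proof (rule LI_integral_cong[OF refl])
  fix s :: real show "(\<integral>\<omega>. h (s, \<omega>) \<partial>M) = f s * m s"
   by (cases "s \<in> {0..T}") (simp_all add: h_def cut_def f_def m_def)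
 qed
 finally have 1: "(LI Lam (%x. h x)) = (LI lborel (%s. f s * m s))" .
 have "(LI Lam (%x. h2 x)) = (LI lborel (%s. (\<integral>\<omega>. h2 (s, \<omega>) \<partial>M)))"
  using PS.integral_fst[of "%s \<omega>. h2 (s, \<omega>)"] hi(2) by (simp add: split_beta')
 also have "... = (LI lborel (%s. ?I s * q s * r s))"
  unfolding hR r_def by simp
 finally have 2: "(LI Lam (%x. h2 x)) = (LI lborel (%s. ?I s * q s * r s))" .
 have r0: "r s = 0" if "s \<notin> {0..T}" for s unfolding r_def using that by (subst Rcut) auto
 have c1: "f s \<bullet> (LI lborel (%u. indicator {..s} u *\<^sub>R r u)) = f s * m s - m0 * f s" for s
 proof (cases "s \<in> {0..T}")
  case True show ?thesis unfolding IR[OF True] by (simp add: algebra_simps)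
 qed (auto simp: f_def)
 have c2: "(LI lborel (%u. indicator {..s} u *\<^sub>R f u)) \<bullet> r s = ?I s * q s * r s - q 0 * r s" for s
 proof (cases "s \<in> {0..T}")
  case True show ?thesis unfolding IF[OF True] using True by (simp add: algebra_simps)
 qed (use r0 in auto)
 have fm: "integrable lborel (%s. f s * m s)"
  using LI_integrable_add[OF P(1)[unfolded c1] integrable_mult_right[OF f, of m0]] by simp
 have qr: "integrable lborel (%s. ?I s * q s * r s)"
  using LI_integrable_add[OF P(2)[unfolded c2] integrable_mult_right[OF r, of "q 0"]] by simp
 have fT: "(LI lborel (%s. f s)) = q T - q 0"
  unfolding IF[OF Tm, symmetric] by (rule LI_integral_cong) (auto simp: f_def split: split_indicator)
 have rT: "(LI lborel (%s. r s)) = m T - m0"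
  unfolding IR[OF Tm, symmetric] by (rule LI_integral_cong) (use r0 in \<open>auto split: split_indicator\<close>)
 \<comment> \<open>Integration by parts for the increments; since \<open>q T = 0\<close>, everything
   except \<open>- (q 0 * m0)\<close> cancels.\<close>
 have "(q T - q 0) * (m T - m0) = ((LI lborel (%s. f s * m s)) - m0 * (q T - q 0)) + ((LI lborel (%s. ?I s * q s * r s)) - q 0 * (m T - m0))"
  using P(3) unfolding c1 c2 fT rT using fm qr f r fT rT by (simp add: LI_integral_diff)
 then have "(LI Lam (%x. h x)) + (LI Lam (%x. h2 x)) = - (q 0 * m0)"
  unfolding 1 2 using qT by (simp add: algebra_simps)
 then have "has_bochner_integral Lam (%x. h x + h2 x) (- (q 0 * m0))"
  using hi by (simp add: has_bochner_integral_iff LI_integral_add)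
 moreover have "cut T (%s \<omega>. q' s * (X s \<omega> \<bullet> Y s \<omega>)
   + q s * (b s \<omega> \<bullet> Y s \<omega> + X s \<omega> \<bullet> g s \<omega> + (\<Sum>j\<in>UNIV. \<sigma> j s \<omega> \<bullet> \<rho> j s \<omega>))) = (%x. h x + h2 x)"
  by (auto simp: fun_eq_iff h_def h2_def cut_def algebra_simps)
 ultimately show ?thesis by (simp add: m0_def)
qed

end

section \<open>The social optimization problem\<close>

definition emb :: "'N::finite => real^'k::finite => real^('N \<times> 'k)" where
 "emb i v = (\<chi> q. if fst q = i then v $ snd q else 0)"

lemma blk_emb: "blk l (emb i v) = (if l = i then v else 0)"
 by (simp add: blk_def emb_def vec_eq_iff)

lemma bounded_linear_emb: "bounded_linear (emb i)"
 by (intro linear_conv_bounded_linear[THEN iffD1] linearI) (auto simp: emb_def vec_eq_iff)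

lemma bounded_linear_blk: "bounded_linear (blk i :: real^('N::finite \<times> 'k::finite) => _)"
 by (intro linear_conv_bounded_linear[THEN iffD1] linearI) (simp_all add: blk_add blk_scaleR)

lemma blk_sum: "blk i (\<Sum>l\<in>I. x l) = (\<Sum>l\<in>I. blk i (x l))"
 by (simp add: blk_def vec_eq_iff)

text \<open>Reduces measurability and integrability of stacked processes to those of linear images
  of single blocks.\<close>

lemma stack_eq_sum: "stack x = (\<Sum>i\<in>UNIV. emb i (x i))"
 by (simp add: blk_eq_iff blk_stack blk_sum blk_emb)

lemma mean_stack: "mean (stack x) = (1 / real CARD('N::finite)) *\<^sub>R (\<Sum>i\<in>UNIV. x (i::'N))"
 by (simp add: mean_def blk_stack)

lemma stack_blk: "stack (%i. blk i x) = x"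
 by (simp add: blk_eq_iff blk_stack)

definition sg :: "('n::finite, 'm::finite) lq => 'N::finite option => real^('N \<times> 'n) => real^('N \<times> 'm) => real^('N \<times> 'n)" where
 "sg L j x u = (case j of None => gm L x | Some i => df L i x u)"

lemma sum_UNIV_option: "(\<Sum>j\<in>UNIV. f j) = f None + (\<Sum>i\<in>UNIV. f (Some (i::'a::finite)))"
 by (simp add: UNIV_option_conv sum.reindex)

lemma inner_matrix_sum: "x \<bullet> (Q *v y) = (\<Sum>p\<in>UNIV. \<Sum>q\<in>UNIV. Q $ p $ q * (x $ p * y $ q))"
 by (simp add: inner_vec_def matrix_vector_mult_def sum_distrib_left mult_ac)

locale social = riccati_data L T P p k P' p' k' c
 for L :: "('n::finite, 'm::finite) lq" and T :: real
  and P :: "real => real^('N::finite \<times> 'n)^('N \<times> 'n)" and p k P' p' k' c +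
 fixes M F0 :: "'w measure" and W :: "'N option => real => 'w => real"
 assumes basis: "stochastic_basis M F0 W"
begin

abbreviation "F \<equiv> augmented_filtration M F0 W"

sublocale brownian_filtration M F W
 by (rule basis_brownian_filtration[OF basis])

lemma T0: "0 \<le> T" and T_in: "T \<in> {0..T}" using T_pos by auto

lemma stack_progressive: "(\<And>i. progressive F T (u i)) ==> progressive F T (%s w. stack (%i. u i s w))"
 unfolding stack_eq_sum by (intro progressive_sum progressive_compose_linear[OF bounded_linear_emb])

lemma stack_L2: "(\<And>i. L2 N (f i)) ==> L2 N (%x. stack (%i. f i x))"
 unfolding stack_eq_sum by (intro L2_sum L2_linear[OF bounded_linear_emb])

lemma cut_stack: "cut T (%s w. stack (%i. u i s w)) = (%x. stack (%i. cut T (u i) x))"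
 by (auto simp: fun_eq_iff cut_def blk_eq_iff blk_stack blk_scaleR)

lemma deterministic_process:
 fixes f :: "real => 'a::euclidean_space"
 assumes f: "continuous_on {0..T} f"
 shows "progressive F T (%s _. f s)" "L2 Lam (cut T (%s _. f s))"
proof -
 show pr: "progressive F T (%s _. f s)"
  unfolding progressive_def
 proof
  fix t assume t: "t \<in> {0..T}"
  have "f \<in> bm (restrict_space borel {0..t})"
   by (rule borel_measurable_continuous_on_restrict) (rule continuous_on_subset[OF f], use t in auto)
  then show "(%(s, _). f s) \<in> bm (restrict_space borel {0..t} \<Otimes>\<^sub>M F t)" by measurable
 qed
 obtain K where K: "0 \<le> K" "\<And>s. s \<in> {0..T} ==> norm (f s) \<le> K" using continuous_norm_bound[OF f] by blast
 have "L2 M (%_. 1 :: real)" by (rule L2_bdd[of _ 1]) auto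
 from cut_const_L2[OF this] show "L2 Lam (cut T (%s _. f s))"
  by (rule L2_bound[OF _ cut_measurable[OF pr T0 order_refl], where K = K])
   (use K in \<open>auto simp: cut_def split: split_indicator\<close>)
qed

definition "KF s = - (matrix_inv (NN L (P s)) ** transpose (MM L (P s)))"

lemma fb_affine: "\<phi> s x = KF s *v x + \<phi> s 0"
 by (simp add: fb_def ww_def KF_def matrix_vector_minus matrix_vector_right_distrib matrix_vector_mul_assoc[symmetric]
   del: transpose_matrix_vector)

lemma continuous_matrixI:
 fixes A :: "real => real^'a::finite^'b::finite"
 assumes "\<And>y. continuous_on S (%t. A t *v y)" shows "continuous_on S A"
proof -
 have "(A t *v axis j 1) $ i = A t $ i $ j" for t i j by (simp add: matrix_vector_mul_component inner_axis)
 then have "A = (%t. \<chi> i j. (A t *v axis j 1) $ i)" by (simp add: fun_eq_iff vec_eq_iff)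
 moreover have "continuous_on S (%t. \<chi> i j. (A t *v axis j 1) $ i)"
  by (intro continuous_on_vec_lambda continuous_on_component assms)
 ultimately show ?thesis by (rule ssubst[where P = "continuous_on S"])
qed

lemma cont_KF: "continuous_on {0..T} KF"
proof (rule continuous_matrixI)
 fix y
 have "continuous_on {0..T} (%t. \<phi> t y - \<phi> t 0)" by (intro continuous_intros cont_fb)
 then show "continuous_on {0..T} (%t. KF t *v y)" by (simp add: fb_affine[of _ y])
qed

lemma feedback_process:
 assumes X: "progressive F T X" "L2 Lam (cut T X)"
 shows "progressive F T (%s w. \<phi> s (X s w))" "L2 Lam (cut T (%s w. \<phi> s (X s w)))"
 unfolding fb_affine[of _ "X _ _"] cut_add
 by (intro progressive_add progressive_affine cont_KF X deterministic_process cont_fb)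
  (intro L2_add affine_L2 T0 cont_KF X deterministic_process cont_fb)

text \<open>One estimate for both kinds of control: \<open>G = 0\<close> with \<open>w\<close> the
  control gives the open loop equation, \<open>G = KF\<close> with \<open>w = \<phi> s 0\<close> the
  closed loop.\<close>

lemma affine_feedback_lipschitz:
 fixes G :: "real => real^('N \<times> 'n)^('N \<times> 'm)"
 assumes G: "continuous_on {0..T} G" and w: "progressive F T w" "L2 Lam (cut T w)"
 shows "\<exists>K. lipschitz_coeff T K (%s \<omega> x. dr L x (G s *v x + w s \<omega>)) \<and>
  (\<forall>j. lipschitz_coeff T K (%s \<omega> x. sg L j x (G s *v x + w s \<omega>)))"
proof -
 define A0 where "A0 s = bA L + bAbar L + bB L ** G s" for s
 define a0 where "a0 s \<omega> = bB L *v w s \<omega> + bb L" for s \<omega>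
 define A where "A j s = (case j of None => bGamma L + bGammabar L | Some i => bC L i + bCbar L i + bD L i ** be i ** G s)" for j s
 define a where "a j s \<omega> = (case j of None => bgamma L | Some i => bD L i *v (be i *v w s \<omega>) + bsigma L i)" for j s \<omega>
 have e0: "dr L x (G s *v x + w s \<omega>) = A0 s *v x + a0 s \<omega>" for x s \<omega>
  by (simp add: dr_def A0_def a0_def matrix_vector_mult_add_rdistrib matrix_vector_right_distrib matrix_vector_mul_assoc add_ac)
 have e: "sg L j x (G s *v x + w s \<omega>) = A j s *v x + a j s \<omega>" for j x s \<omega>
  by (cases j) (simp_all add: sg_def gm_def df_def A_def a_def matrix_vector_mult_add_rdistrib matrix_vector_right_distrib
    matrix_vector_mul_assoc matrix_mul_assoc add_ac)
 have GB: "continuous_on {0..T} (%s. B ** G s)" for B :: "real^('N \<times> 'm)^'c::finite"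
  by (rule continuous_matrixI)
   (simp add: matrix_vector_mul_assoc[symmetric] continuous_on_matrix_vector G continuous_on_const)
 have c0: "continuous_on {0..T} A0" unfolding A0_def by (intro continuous_intros GB)
 have cA: "continuous_on {0..T} (A j)" for j
  unfolding A_def by (cases j) (auto intro!: continuous_intros GB)
 note det = deterministic_process[OF continuous_on_const]
 have lin: "progressive F T (%s \<omega>. B *v w s \<omega> + d) \<and> L2 Lam (cut T (%s \<omega>. B *v w s \<omega> + d))" for B :: "real^('N \<times> 'm)^'c::finite" and d
  unfolding cut_add by (intro conjI progressive_add L2_add progressive_affine affine_L2 w det T0 continuous_on_const)
 have pa0: "progressive F T a0 \<and> L2 Lam (cut T a0)" unfolding a0_def[abs_def] by (rule lin)
 have pa: "progressive F T (a j) \<and> L2 Lam (cut T (a j))" for j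
 proof (cases j)
  case None then show ?thesis unfolding a_def[abs_def] using det[of "bgamma L"] by simp
 next
  case (Some i) then show ?thesis unfolding a_def[abs_def] using lin[of "bD L i ** be i" "bsigma L i"]
   by (simp add: matrix_vector_mul_assoc)
 qed
 obtain K0 where K0: "0 \<le> K0" "\<And>s. s \<in> {0..T} ==> norm (A0 s) \<le> K0" using continuous_norm_bound[OF c0] by blast
 have "\<forall>j. \<exists>K. 0 \<le> K \<and> (\<forall>s\<in>{0..T}. norm (A j s) \<le> K)"
 proof
  fix j show "\<exists>K. 0 \<le> K \<and> (\<forall>s\<in>{0..T}. norm (A j s) \<le> K)" by (rule continuous_norm_bound[OF cA[of j]]) blast
 qed
 from choice[OF this] obtain K1 where K1: "\<forall>j. 0 \<le> K1 j \<and> (\<forall>s\<in>{0..T}. norm (A j s) \<le> K1 j)" by (elim exE)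
 define K where "K = K0 + (\<Sum>j\<in>UNIV. K1 j)"
 have s0: "0 \<le> (\<Sum>j\<in>UNIV. K1 j)" using K1 by (simp add: sum_nonneg)
 have K1K: "K1 j \<le> K" for j
  using member_le_sum[of j UNIV K1] K1 K0(1) by (simp add: K_def)
 have Kp: "0 \<le> real CARD('N \<times> 'n) * K" using K0(1) s0 by (simp add: K_def)
 have "lipschitz_coeff T (real CARD('N \<times> 'n) * K) (%s \<omega> x. A0 s *v x + a0 s \<omega>)"
  by (rule lipschitz_affine[OF c0 _ _ Kp]) (use pa0 K0(2) s0 in \<open>auto simp: K_def intro!: mult_left_mono add_increasing2\<close>)
 moreover have "lipschitz_coeff T (real CARD('N \<times> 'n) * K) (%s \<omega> x. A j s *v x + a j s \<omega>)" for j
 proof (rule lipschitz_affine[OF cA _ _ Kp])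
  fix s assume "s \<in> {0..T}"
  then have "norm (A j s) \<le> K" using K1 K1K[of j] by (blast intro: order_trans)
  then show "real CARD('N \<times> 'n) * norm (A j s) \<le> real CARD('N \<times> 'n) * K" by (intro mult_left_mono) auto
 qed (use pa in auto)
 ultimately show ?thesis unfolding e0 e by blast
qed

lemma open_loop_lipschitz:
 fixes U :: "real => 'w => real^('N \<times> 'm)"
 assumes "progressive F T U" "L2 Lam (cut T U)"
 shows "\<exists>K. lipschitz_coeff T K (%s w x. dr L x (U s w)) \<and> (\<forall>j. lipschitz_coeff T K (%s w x. sg L j x (U s w)))"
 using affine_feedback_lipschitz[where G = "%_. 0", OF continuous_on_const assms] by simp

lemma closed_loop_lipschitz:
 "\<exists>K. lipschitz_coeff T K (%s w x. dr L x (\<phi> s x)) \<and> (\<forall>j. lipschitz_coeff T K (%s w x. sg L j x (\<phi> s x)))"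
 using affine_feedback_lipschitz[OF cont_KF deterministic_process[OF cont_fb[of 0]]] by (simp add: fb_affine[symmetric])

lemma square_integrable_of_L2:
 assumes "L2 Lam (cut T H)" shows "square_integrable_process M T H"
 using assms unfolding square_integrable_process_def L2_iff_nn by (simp add: cut_nn_integral)

abbreviation "state_ito x0 U X \<equiv>
 ito_process T x0 (%s w. dr L (X s w) (U s w)) (%j s w. sg L j (X s w) (U s w)) X"

text \<open>In the stacked equation agent \<open>i\<close> carries an integral against the noise of
  every agent. For \<open>l \<noteq> i\<close> the \<open>i\<close>-th block of the integrand is
  zero, and so is the integral almost surely.\<close>

lemma state_of_ito:
 assumes X: "state_ito (%w. stack (%i. \<xi> i w)) U X" and c: "AE w in M. continuous_on {0..T} (%t. X t w)"
 shows "state_solution L M F0 W T \<xi> (%i s w. blk i (U s w)) (%i s w. blk i (X s w))"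
proof -
 have av: "average (%i s w. blk i (X s w)) s w = mean (X s w)" for s w
  by (simp add: average_def mean_def)
 note D = ito_processD[OF X]
 show ?thesis
  unfolding state_solution_def
 proof (intro conjI allI ballI)
  fix i
  show "progressive F T (%s w. blk i (X s w))" by (rule progressive_compose_linear[OF bounded_linear_blk D(5)])
  show "square_integrable_process M T (%s w. blk i (X s w))"
   by (rule square_integrable_of_L2) (unfold cut_linear[OF bounded_linear_blk], rule L2_linear[OF bounded_linear_blk D(6)])
  show "AE w in M. continuous_on {0..T} (%t. blk i (X t w))"
   using c by eventually_elim (rule bounded_linear.continuous_on[OF bounded_linear_blk])
  fix t assume t: "t \<in> {0..T}"
  then have t0: "0 \<le> t" by simp
  obtain J where J: "\<And>j. has_ito_integral M F (W j) t (%s w. blk i (sg L j (X s w) (U s w))) (J j)"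
   and e: "AE w in M. blk i (X t w) = blk i (stack (%i. \<xi> i w)) + drift (%s w. blk i (dr L (X s w) (U s w))) t w + (\<Sum>j\<in>UNIV. J j w)"
   using ito_process_linear[OF bounded_linear_blk X, of i] t unfolding ito_process_def by blast
  have z: "AE w in M. J (Some l) w = 0" if "l \<noteq> i" for l
  proof (rule L2_norm_sq_eq_0[OF ito_L2[OF J t0]])
   have "has_ito_integral M F (W (Some l)) t (%_ _. 0) (J (Some l))"
    using J[of "Some l"] that by (simp add: sg_def df_blk)
   from ito_diff_norm[OF this ito_zero[OF t0] t0 t0] show "rsq M (J (Some l)) = 0"
    by simp
  qed
  have "AE w in M. \<forall>l\<in>UNIV - {i}. J (Some l) w = 0" by (rule AE_finite_allI) (use z in auto)
  with e have "AE w in M. blk i (X t w) = \<xi> i w + drift (%s w. blk i (dr L (X s w) (U s w))) t w + J (Some i) w + J None w"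
  proof eventually_elim
   case (elim w)
   have "(\<Sum>l\<in>UNIV. J (Some l) w) = J (Some i) w" using elim(2) by (subst sum.remove[of _ i]) auto
   then show ?case using elim(1) by (simp add: blk_stack sum_UNIV_option)
  qed
  then show "\<exists>J J0.
    has_ito_integral M F (W (Some i)) t
     (%s w. cC L *v blk i (X s w) + cCbar L *v average (%i s w. blk i (X s w)) s w + cD L *v blk i (U s w) + csigma L) J \<and>
    has_ito_integral M F (W None) t
     (%s w. cGamma L *v blk i (X s w) + cGammabar L *v average (%i s w. blk i (X s w)) s w + cgamma L) J0 \<and>
    (AE w in M. blk i (X t w) = \<xi> i w
     + (\<integral>s\<in>{0..t}. (cA L *v blk i (X s w) + cAbar L *v average (%i s w. blk i (X s w)) s w + cB L *v blk i (U s w) + cb L) \<partial>lborel)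
     + J w + J0 w)"
   using J[of "Some i"] J[of None] unfolding av
   by (intro exI[of _ "J (Some i)"] exI[of _ "J None"]) (simp add: sg_def df_blk gm_blk dr_blk drift_def)
 qed
qed

lemma initial_measurable:
 fixes \<xi> :: "'N => 'w => real^'n"
 assumes \<xi>: "\<And>i. \<xi> i \<in> bm F0"
 shows "(%w. stack (%i. \<xi> i w)) \<in> bm (F 0)"
proof -
 have \<xi>0: "\<xi> i \<in> bm (F 0)" for i
  by (rule measurable_from_subalg[OF _ \<xi>])
   (use F0_augmented[OF basis order_refl] F0_space[OF basis] aug_space[OF basis] in \<open>simp add: subalgebra_def\<close>)
 have "(emb i :: real^'n => real^('N \<times> 'n)) \<in> bm borel" for i
  by (rule borel_measurable_continuous_onI[OF linear_continuous_on[OF bounded_linear_emb]])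
 then show ?thesis
  unfolding stack_eq_sum by (intro borel_measurable_sum measurable_compose[OF \<xi>0])
qed

text \<open>The solution concept provides integrals separately for every agent. Those against agent
  noises are embedded in their own blocks; for the common noise a fresh integral of the stacked
  integrand is taken, whose blocks agree with the given integrals by the isometry.\<close>

lemma ito_of_state:
 assumes S: "state_solution L M F0 W T \<xi> u X" and u: "u \<in> social_controls M F0 W T"
  and \<xi>: "\<And>i. \<xi> i \<in> bm F0" "\<And>i. L2 M (\<xi> i)"
 defines "Xs \<equiv> %s w. stack (%i. X i s w)" and "U \<equiv> %s w. stack (%i. u i s w)"
 shows "state_ito (%w. stack (%i. \<xi> i w)) U Xs" and "progressive F T U" "L2 Lam (cut T U)"
proof -
 have X: "progressive F T (X i)" "L2 Lam (cut T (X i))" for i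
  using S cut_L2[OF _ T0 order_refl] unfolding state_solution_def by blast+
 have u': "progressive F T (u i)" "L2 Lam (cut T (u i))" for i
  using u cut_L2[OF _ T0 order_refl] unfolding social_controls_def by blast+
 show U: "progressive F T U" "L2 Lam (cut T U)"
  unfolding U_def cut_stack by (intro stack_progressive u', intro stack_L2 u')
 have Xs: "progressive F T Xs" "L2 Lam (cut T Xs)"
  unfolding Xs_def cut_stack by (intro stack_progressive X, intro stack_L2 X)
 have av: "average X s w = mean (Xs s w)" for s w by (simp add: average_def Xs_def mean_stack)
 have b: "blk i (Xs s w) = X i s w" "blk i (U s w) = u i s w" for i s w by (simp_all add: Xs_def U_def blk_stack)
 obtain K where K: "lipschitz_coeff T K (%s w x. dr L x (U s w))" "\<And>j. lipschitz_coeff T K (%s w x. sg L j x (U s w))"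
  using open_loop_lipschitz[OF U] by blast
 note bp = coeff_L2[OF K(1) T0 Xs]
 show "state_ito (%w. stack (%i. \<xi> i w)) U Xs"
  unfolding ito_process_def
 proof (intro conjI ballI)
  show "(%w. stack (%i. \<xi> i w)) \<in> bm (F 0)" by (rule initial_measurable[OF \<xi>(1)])
  show "L2 M (%w. stack (%i. \<xi> i w))" by (intro stack_L2 \<xi>)
  fix t assume t: "t \<in> {0..T}"
  then have t': "0 \<le> t" "t \<le> T" by auto
  have "\<forall>i. \<exists>J J0. has_ito_integral M F (W (Some i)) t (%s w. blk i (df L i (Xs s w) (U s w))) J \<and>
    has_ito_integral M F (W None) t (%s w. blk i (gm L (Xs s w))) J0 \<and>
    (AE w in M. X i t w = \<xi> i w + drift (%s w. blk i (dr L (Xs s w) (U s w))) t w + J w + J0 w)"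
   using S t unfolding state_solution_def av by (simp add: df_blk gm_blk dr_blk b drift_def)
  from choice[OF this] obtain J where "\<forall>i. \<exists>J0. has_ito_integral M F (W (Some i)) t (%s w. blk i (df L i (Xs s w) (U s w))) (J i) \<and>
    has_ito_integral M F (W None) t (%s w. blk i (gm L (Xs s w))) J0 \<and>
    (AE w in M. X i t w = \<xi> i w + drift (%s w. blk i (dr L (Xs s w) (U s w))) t w + J i w + J0 w)"
   by (elim exE)
  from choice[OF this] obtain J0 where J: "\<forall>i. has_ito_integral M F (W (Some i)) t (%s w. blk i (df L i (Xs s w) (U s w))) (J i) \<and>
    has_ito_integral M F (W None) t (%s w. blk i (gm L (Xs s w))) (J0 i) \<and>
    (AE w in M. X i t w = \<xi> i w + drift (%s w. blk i (dr L (Xs s w) (U s w))) t w + J i w + J0 i w)"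
   by (elim exE)
  obtain I where I: "\<And>t. t \<in> {0..T} ==> has_ito_integral M F (W None) t (%s w. sg L None (Xs s w) (U s w)) (I t)"
   by (rule ito_exists[OF T_pos coeff_L2[OF K(2) T0 Xs], of None None]) (rule that)
  have I0: "AE w in M. blk i (I t w) = J0 i w" for i
  proof -
   have a: "has_ito_integral M F (W None) t (%s w. blk i (gm L (Xs s w))) (%w. blk i (I t w))"
    using ito_linear[OF bounded_linear_blk I[OF t] t'(1), of i] by (simp add: sg_def)
   have a2: "has_ito_integral M F (W None) t (%s w. blk i (gm L (Xs s w))) (J0 i)" using J by blast
   have "AE w in M. blk i (I t w) - J0 i w = 0"
    by (rule L2_norm_sq_eq_0[OF L2_diff[OF ito_L2[OF a t'(1)] ito_L2[OF a2 t'(1)]]])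
     (use ito_diff_norm[OF a a2 t'(1) t'(1)] in simp)
   then show ?thesis by eventually_elim simp
  qed
  have em: "emb i (blk i (df L i x v)) = df L i x v" for i x v by (simp add: blk_eq_iff blk_emb df_blk)
  show "\<exists>J. (\<forall>j. has_ito_integral M F (W j) t (%s w. sg L j (Xs s w) (U s w)) (J j)) \<and>
    (AE w in M. Xs t w = stack (%i. \<xi> i w) + drift (%s w. dr L (Xs s w) (U s w)) t w + (\<Sum>j\<in>UNIV. J j w))"
  proof (intro exI[of _ "case_option (I t) (%i w. emb i (J i w))"] conjI allI)
   fix j show "has_ito_integral M F (W j) t (%s w. sg L j (Xs s w) (U s w)) (case_option (I t) (%i w. emb i (J i w)) j)"
   proof (cases j)
    case (Some i)
    have "has_ito_integral M F (W (Some i)) t (%s w. blk i (df L i (Xs s w) (U s w))) (J i)" using J by blast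
    from ito_linear[OF bounded_linear_emb this t'(1), of i] show ?thesis by (simp add: Some sg_def em)
   qed (use I[OF t] in simp)
   have "AE w in M. X i t w = \<xi> i w + drift (%s w. blk i (dr L (Xs s w) (U s w))) t w + J i w + J0 i w" for i using J by blast
   then have "AE w in M. \<forall>i\<in>UNIV. X i t w = \<xi> i w + drift (%s w. blk i (dr L (Xs s w) (U s w))) t w + J i w + J0 i w"
    by (intro AE_finite_allI) auto
   moreover have "AE w in M. \<forall>i\<in>UNIV. blk i (I t w) = J0 i w" by (intro AE_finite_allI I0) auto
   ultimately show "AE w in M. Xs t w = stack (%i. \<xi> i w) + drift (%s w. dr L (Xs s w) (U s w)) t w
    + (\<Sum>j\<in>UNIV. (case_option (I t) (%i w. emb i (J i w)) j) w)"
    using L2_path[OF cut_L2_mono[OF bp(2,1) t']]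
   proof eventually_elim
    case (elim w)
    have "drift (%s w. blk i (dr L (Xs s w) (U s w))) t w = blk i (drift (%s w. dr L (Xs s w) (U s w)) t w)" for i
     using integral_bounded_linear[OF bounded_linear_blk[of i] path_integrable[OF elim(3)]]
     by (simp add: drift_def set_lebesgue_integral_def cut_def blk_scaleR)
    then show ?case
     using elim(1,2) by (simp add: blk_eq_iff b blk_add blk_stack blk_sum sum_UNIV_option blk_emb)
   qed
  qed
 qed (use bp Xs in auto)
qed

end

section \<open>The cost identity\<close>

context social
begin

definition sq :: "(real => 'w => real^('N \<times> 'm)) => (real => 'w => real^('N \<times> 'n)) => real => 'w => real" where
 "sq U X s w = (U s w - \<phi> s (X s w)) \<bullet> (NN L (P s) *v (U s w - \<phi> s (X s w)))"

lemma sq_integrable: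
 assumes X: "progressive F T X" "L2 Lam (cut T X)" and U: "progressive F T U" "L2 Lam (cut T U)"
 shows "integrable Lam (cut T (sq U X))" and "L2 Lam (cut T (%s w. U s w - \<phi> s (X s w)))"
proof -
 have p: "progressive F T (%s w. U s w - \<phi> s (X s w))"
  using progressive_add[OF U(1) progressive_compose_linear[OF bounded_linear_minus[OF bounded_linear_ident] feedback_process(1)[OF X]]] by simp
 show l: "L2 Lam (cut T (%s w. U s w - \<phi> s (X s w)))"
  unfolding cut_diff by (intro L2_diff U feedback_process X)
 show "integrable Lam (cut T (sq U X))"
  unfolding sq_def[abs_def] by (intro cut_inner_integrable l affine_L2 p T0 continuous_matrixI cont_NN)
qed

text \<open>Pairing with the constant process turns linear and constant terms into instances of
  \<open>time_moment\<close>.\<close>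

lemma one_process: "ito_process T (%_. 1 :: real) (%_ _. 0) (%_ _ _. 0) (%_ _. 1)"
proof -
 have 1: "L2 M (%_. 1 :: real)" by (rule L2_bdd[of _ 1]) auto
 have 0: "L2 M (%_. 0 :: real)" by (rule L2_zero)
 show ?thesis
  unfolding ito_process_def
 proof (intro conjI ballI)
  fix t assume t: "t \<in> {0..T}"
  show "\<exists>J. (\<forall>j. has_ito_integral M F (W j) t (%_ _. 0 :: real) (J j)) \<and>
    (AE w in M. 1 = 1 + drift (%_ _. 0) t w + (\<Sum>j\<in>UNIV. J j w))"
   by (intro exI[of _ "%_ _. 0"]) (use t in \<open>auto simp: drift_def intro!: ito_zero\<close>)
 qed (use 1 0 in \<open>auto intro!: progressive_const cut_const_L2\<close>)
qed

text \<open>\<open>time_moment\<close> is applied to each pair of coordinates with weight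
  \<open>P_ij\<close>, to each coordinate and the constant 1 with weight \<open>p_i\<close>, and to
  the pair of constants with weight \<open>k\<close>. The zero terminal values are its hypothesis
  \<open>q T = 0\<close>, and \<open>Ham - cst\<close> is the generator part.\<close>

lemma quad_moment:
 assumes X: "state_ito x0 U X"
 shows "has_bochner_integral Lam (cut T (%s w. quad (P' s) (p' s) (k' s) (X s w) + (Ham L (P s) (p s) (X s w) (U s w) - cst L (X s w) (U s w))))
  (- ((LI M (%w. x0 w \<bullet> (P 0 *v x0 w))) + 2 * (LI M (%w. p 0 \<bullet> x0 w)) + k 0))"
proof -
 define b where "b s w = dr L (X s w) (U s w)" for s w
 define \<sigma> where "\<sigma> j s w = sg L j (X s w) (U s w)" for j s w
 have X': "ito_process T x0 b \<sigma> X" using X unfolding b_def[abs_def] \<sigma>_def[abs_def] .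
 note C = ito_process_linear[OF bounded_linear_vec_nth X']
 note x0 = ito_processD(2)[OF X']
 have x0i: "L2 M (%w. x0 w $ i)" for i by (rule L2_linear[OF bounded_linear_vec_nth x0])
 have dP: "((%t. P t $ i $ j) has_real_derivative P' t $ i $ j) (at t within {0..T})" if "t \<in> {0..T}" for t i j
  unfolding has_real_derivative_iff_has_vector_derivative
  by (intro bounded_linear.has_vector_derivative[OF bounded_linear_vec_nth] deriv(1) that)
 have dp: "((%t. p t $ i) has_real_derivative p' t $ i) (at t within {0..T})" if "t \<in> {0..T}" for t i
  unfolding has_real_derivative_iff_has_vector_derivative
  by (intro bounded_linear.has_vector_derivative[OF bounded_linear_vec_nth] deriv(2) that)
 have 1: "has_bochner_integral Lam (%x. \<Sum>i\<in>UNIV. \<Sum>j\<in>UNIV. cut T (%s w. P' s $ i $ j * (X s w $ i \<bullet> X s w $ j)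
   + P s $ i $ j * (b s w $ i \<bullet> X s w $ j + X s w $ i \<bullet> b s w $ j + (\<Sum>l\<in>UNIV. \<sigma> l s w $ i \<bullet> \<sigma> l s w $ j))) x)
   (\<Sum>i\<in>UNIV. \<Sum>j\<in>UNIV. - (P 0 $ i $ j * (LI M (%w. x0 w $ i \<bullet> x0 w $ j))))"
  by (intro has_bochner_integral_sum time_moment[OF T0 C C] dP cont_P') (simp_all add: terminal)
 have 2: "has_bochner_integral Lam (%x. \<Sum>i\<in>UNIV. cut T (%s w. p' s $ i * (X s w $ i \<bullet> 1)
   + p s $ i * (b s w $ i \<bullet> 1 + X s w $ i \<bullet> 0 + (\<Sum>l\<in>UNIV. \<sigma> l s w $ i \<bullet> 0))) x)
   (\<Sum>i\<in>UNIV. - (p 0 $ i * (LI M (%w. x0 w $ i \<bullet> 1))))"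
  by (intro has_bochner_integral_sum time_moment[OF T0 C one_process] dp cont_p') (simp_all add: terminal)
 have 3: "has_bochner_integral Lam (cut T (%s w. k' s * ((1::real) \<bullet> 1) + k s * ((0::real) \<bullet> 1 + (1::real) \<bullet> 0 + (\<Sum>l\<in>(UNIV :: 'N option set). (0::real) \<bullet> 0))))
   (- (k 0 * (LI M (%w. (1::real) \<bullet> 1))))"
  by (intro time_moment[OF T0 one_process one_process] deriv(3) cont_k') (simp_all add: terminal)
 have i2: "integrable M (%w. x0 w $ i * x0 w $ j)" for i j
  using L2_inner_integrable[OF x0i x0i, of i j] by simp
 have i1: "integrable M (%w. x0 w $ i)" for i
  using L2_inner_integrable[OF x0i ito_processD(2)[OF one_process], of i] by simp
 have v1: "(LI M (%w. x0 w \<bullet> (P 0 *v x0 w))) = (\<Sum>i\<in>UNIV. \<Sum>j\<in>UNIV. P 0 $ i $ j * (LI M (%w. x0 w $ i \<bullet> x0 w $ j)))"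
  unfolding inner_matrix_sum using i2 by (simp add: LI_integral_sum)
 have v2: "(LI M (%w. p 0 \<bullet> x0 w)) = (\<Sum>i\<in>UNIV. p 0 $ i * (LI M (%w. x0 w $ i \<bullet> 1)))"
  unfolding inner_vec_def using i1 by (simp add: LI_integral_sum)
 have S: "(\<Sum>l\<in>UNIV. \<sigma> l s w \<bullet> (P s *v \<sigma> l s w)) = (\<Sum>i\<in>UNIV. \<Sum>j\<in>UNIV. P s $ i $ j * (\<Sum>l\<in>UNIV. \<sigma> l s w $ i * \<sigma> l s w $ j))" for s w
 proof -
  have "(\<Sum>l\<in>UNIV. \<sigma> l s w \<bullet> (P s *v \<sigma> l s w)) = (\<Sum>i\<in>UNIV. \<Sum>l\<in>UNIV. \<Sum>j\<in>UNIV. P s $ i $ j * (\<sigma> l s w $ i * \<sigma> l s w $ j))"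
   unfolding inner_matrix_sum by (rule sum.swap)
  also have "... = (\<Sum>i\<in>UNIV. \<Sum>j\<in>UNIV. \<Sum>l\<in>UNIV. P s $ i $ j * (\<sigma> l s w $ i * \<sigma> l s w $ j))"
   by (intro sum.cong[OF refl] sum.swap)
  finally show ?thesis by (simp add: sum_distrib_left)
 qed
 have e: "quad (P' s) (p' s) (k' s) (X s w) + (Ham L (P s) (p s) (X s w) (U s w) - cst L (X s w) (U s w))
  = (\<Sum>i\<in>UNIV. \<Sum>j\<in>UNIV. P' s $ i $ j * (X s w $ i * X s w $ j)
   + P s $ i $ j * (b s w $ i * X s w $ j + X s w $ i * b s w $ j + (\<Sum>l\<in>UNIV. \<sigma> l s w $ i * \<sigma> l s w $ j)))
   + 2 * (\<Sum>i\<in>UNIV. p' s $ i * X s w $ i + p s $ i * b s w $ i) + k' s" if s: "s \<in> {0..T}" for s w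
 proof -
  have "(\<Sum>l\<in>UNIV. \<sigma> l s w \<bullet> (P s *v \<sigma> l s w)) = gm L (X s w) \<bullet> (P s *v gm L (X s w))
   + (\<Sum>i\<in>UNIV. df L i (X s w) (U s w) \<bullet> (P s *v df L i (X s w) (U s w)))"
   by (simp add: sum_UNIV_option \<sigma>_def sg_def)
  moreover have "(P s *v X s w + p s) \<bullet> dr L (X s w) (U s w) = b s w \<bullet> (P s *v X s w) + p s \<bullet> b s w"
   by (simp only: b_def inner_add_left inner_commute[of "dr L _ _"])
  moreover have "X s w \<bullet> (P s *v b s w) = b s w \<bullet> (P s *v X s w)" by (rule psd_inner_commute[OF sym[OF s]])
  ultimately have "quad (P' s) (p' s) (k' s) (X s w) + (Ham L (P s) (p s) (X s w) (U s w) - cst L (X s w) (U s w))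
   = X s w \<bullet> (P' s *v X s w) + (b s w \<bullet> (P s *v X s w) + X s w \<bullet> (P s *v b s w) + (\<Sum>l\<in>UNIV. \<sigma> l s w \<bullet> (P s *v \<sigma> l s w)))
    + 2 * (p' s \<bullet> X s w + p s \<bullet> b s w) + k' s"
   unfolding quad_def Ham_def by simp
  also have "... = (\<Sum>i\<in>UNIV. \<Sum>j\<in>UNIV. P' s $ i $ j * (X s w $ i * X s w $ j)
   + P s $ i $ j * (b s w $ i * X s w $ j + X s w $ i * b s w $ j + (\<Sum>l\<in>UNIV. \<sigma> l s w $ i * \<sigma> l s w $ j)))
   + 2 * (\<Sum>i\<in>UNIV. p' s $ i * X s w $ i + p s $ i * b s w $ i) + k' s"
   unfolding S unfolding inner_matrix_sum by (simp add: inner_vec_def distrib_left sum.distrib)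
  finally show ?thesis .
 qed
 have "has_bochner_integral Lam (%x. (\<Sum>i\<in>UNIV. \<Sum>j\<in>UNIV. cut T (%s w. P' s $ i $ j * (X s w $ i \<bullet> X s w $ j)
   + P s $ i $ j * (b s w $ i \<bullet> X s w $ j + X s w $ i \<bullet> b s w $ j + (\<Sum>l\<in>UNIV. \<sigma> l s w $ i \<bullet> \<sigma> l s w $ j))) x)
   + 2 * (\<Sum>i\<in>UNIV. cut T (%s w. p' s $ i * (X s w $ i \<bullet> 1)
   + p s $ i * (b s w $ i \<bullet> 1 + X s w $ i \<bullet> 0 + (\<Sum>l\<in>UNIV. \<sigma> l s w $ i \<bullet> 0))) x)
   + cut T (%s w. k' s * ((1::real) \<bullet> 1) + k s * ((0::real) \<bullet> 1 + (1::real) \<bullet> 0 + (\<Sum>l\<in>(UNIV :: 'N option set). (0::real) \<bullet> 0))) x)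
   ((\<Sum>i\<in>UNIV. \<Sum>j\<in>UNIV. - (P 0 $ i $ j * (LI M (%w. x0 w $ i \<bullet> x0 w $ j))))
   + 2 * (\<Sum>i\<in>UNIV. - (p 0 $ i * (LI M (%w. x0 w $ i \<bullet> 1)))) + - (k 0 * (LI M (%w. (1::real) \<bullet> 1))))" (is "has_bochner_integral _ ?f ?v")
  by (intro has_bochner_integral_add has_bochner_integral_mult_right 1 2 3)
 moreover have "?f = cut T (%s w. quad (P' s) (p' s) (k' s) (X s w) + (Ham L (P s) (p s) (X s w) (U s w) - cst L (X s w) (U s w)))"
 proof (rule ext)
  fix x :: "real \<times> 'w"
  show "?f x = cut T (%s w. quad (P' s) (p' s) (k' s) (X s w) + (Ham L (P s) (p s) (X s w) (U s w) - cst L (X s w) (U s w))) x"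
  proof (cases "fst x \<in> {0..T}")
   case True then show ?thesis by (simp add: cut_def split_beta' e)
  qed (simp add: cut_def split_beta')
 qed
 moreover have "?v = - ((LI M (%w. x0 w \<bullet> (P 0 *v x0 w))) + 2 * (LI M (%w. p 0 \<bullet> x0 w)) + k 0)"
  unfolding v1 v2 by (simp add: sum_negf prob_space)
 ultimately show ?thesis by simp
qed

text \<open>The expected value function at time 0; for a deterministic initial state it is the
  quadratic expression of the theorem, see \<open>V0_const\<close>.\<close>

definition "V0 x0 = (LI M (%w. x0 w \<bullet> (P 0 *v x0 w))) + 2 * (LI M (%w. p 0 \<bullet> x0 w)) + k 0"

text \<open>The square identity writes the running cost as \<open>sq\<close> minus the integrand of
  \<open>quad_moment\<close>, whose integral is \<open>- V0\<close>.\<close>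

lemma cost_identity:
 assumes X: "state_ito x0 U X" and U: "progressive F T U" "L2 Lam (cut T U)"
 shows "(LI Lam (%x. cut T (%s w. cst L (X s w) (U s w)) x)) = V0 x0 + (LI Lam (%x. cut T (sq U X) x))"
proof -
 note i = sq_integrable(1)[OF ito_processD(5,6)[OF X] U]
 have e: "cut T (%s w. cst L (X s w) (U s w)) = (%x. cut T (sq U X) x - cut T (%s w. quad (P' s) (p' s) (k' s) (X s w)
   + (Ham L (P s) (p s) (X s w) (U s w) - cst L (X s w) (U s w))) x)"
 proof (rule ext)
  fix x :: "real \<times> 'w"
  show "cut T (%s w. cst L (X s w) (U s w)) x = cut T (sq U X) x - cut T (%s w. quad (P' s) (p' s) (k' s) (X s w)
   + (Ham L (P s) (p s) (X s w) (U s w) - cst L (X s w) (U s w))) x"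
   using square[of "fst x" "X (fst x) (snd x)" "U (fst x) (snd x)"]
   by (auto simp: cut_def split_beta' sq_def split: split_indicator)
 qed
 from has_bochner_integral_diff[OF has_bochner_integral_integrable[OF i] quad_moment[OF X]]
 show ?thesis unfolding e[symmetric] by (simp add: has_bochner_integral_iff V0_def)
qed

lemma state_exists:
 assumes \<xi>: "\<And>i. \<xi> i \<in> bm F0" "\<And>i. L2 M (\<xi> i)"
  and b: "lipschitz_coeff T K (%s w x. dr L x (G s w x))" "\<And>j. lipschitz_coeff T K (%s w x. sg L j x (G s w x))"
 obtains X where "state_ito (%w. stack (%i. \<xi> i w)) (%s w. G s w (X s w)) X"
  "state_solution L M F0 W T \<xi> (%i s w. blk i (G s w (X s w))) (%i s w. blk i (X s w))"
proof -
 have "(%w. stack (%i. \<xi> i w)) \<in> bm (F 0)" by (rule initial_measurable[OF \<xi>(1)])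
 moreover have "L2 M (%w. stack (%i. \<xi> i w))" by (intro stack_L2 \<xi>)
 note x0 = calculation this
 from sde_exists[where \<sigma> = "%j s w x. sg L j x (G s w x)", OF T_pos b x0] obtain X where X: "state_ito (%w. stack (%i. \<xi> i w)) (%s w. G s w (X s w)) X"
  "AE w in M. continuous_on {0..T} (%t. X t w)"
  by (elim exE conjE)
 from that[OF X(1) state_of_ito[OF X]] show ?thesis .
qed

text \<open>\<open>state_of\<close> is a choice among solutions and is meaningful because
  \<open>state_exists\<close> provides one. Whatever version is chosen, its stack is an Ito process
  driven by \<open>u\<close>, and the cost identity applies to it.\<close>

lemma social_cost_eq:
 assumes \<xi>: "\<And>i. \<xi> i \<in> bm F0" "\<And>i. L2 M (\<xi> i)" and u: "u \<in> social_controls M F0 W T"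
 defines "U \<equiv> %s w. stack (%i. u i s w)"
 obtains X where "state_ito (%w. stack (%i. \<xi> i w)) U X"
  "social_cost L M F0 W T \<xi> u = V0 (%w. stack (%i. \<xi> i w)) + (LI Lam (%x. cut T (sq U X) x))"
proof -
 define Y where "Y = state_of L M F0 W T \<xi> u"
 have u': "progressive F T (u i)" "L2 Lam (cut T (u i))" for i
  using u cut_L2[OF _ T0 order_refl] unfolding social_controls_def by blast+
 have U: "progressive F T U" "L2 Lam (cut T U)"
  unfolding U_def cut_stack by (intro stack_progressive u', intro stack_L2 u')
 obtain K where K: "lipschitz_coeff T K (%s w x. dr L x (U s w))" "\<And>j. lipschitz_coeff T K (%s w x. sg L j x (U s w))"
  using open_loop_lipschitz[OF U] by blast
 obtain X where "state_solution L M F0 W T \<xi> (%i s w. blk i (U s w)) (%i s w. blk i (X s w))"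
  by (rule state_exists[OF \<xi> K]) (rule that)
 then have "state_solution L M F0 W T \<xi> u (%i s w. blk i (X s w))" by (simp add: U_def blk_stack)
 then have Y: "state_solution L M F0 W T \<xi> u Y" unfolding Y_def state_of_def by (rule someI[where P = "state_solution L M F0 W T \<xi> u"])
 define X where "X s w = stack (%i. Y i s w)" for s w
 have X: "state_ito (%w. stack (%i. \<xi> i w)) U X"
  using ito_of_state(1)[OF Y u \<xi>] unfolding X_def[abs_def] U_def .
 have Yp: "progressive F T (Y i)" "L2 Lam (cut T (Y i))" for i
  using Y cut_L2[OF _ T0 order_refl] unfolding state_solution_def by blast+
 have av: "average Y s w = mean (X s w)" for s w by (simp add: average_def X_def mean_stack)
 have av2: "mean (stack (%i. Y i s w)) = average Y s w" for s w by (simp add: average_def mean_stack)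
 have bl: "bounded_linear (mean :: real^('N \<times> 'n) => _)"
  by (intro linear_conv_bounded_linear[THEN iffD1] linearI)
   (simp_all add: mean_def blk_add blk_scaleR sum.distrib scaleR_add_right scaleR_sum_right)
 have mp: "progressive F T (average Y)" "L2 Lam (cut T (average Y))"
  using progressive_compose_linear[OF bl ito_processD(5)[OF X]] L2_linear[OF bl ito_processD(6)[OF X]]
  unfolding cut_linear[OF bl, symmetric] av[symmetric] by simp_all
 have cq: "L2 Lam (cut T (%_ _. v :: 'c::euclidean_space))" for v
  by (rule deterministic_process[OF continuous_on_const])
 have ri: "integrable Lam (cut T (%s w. running_cost L (Y i s w) (average Y s w) (u i s w)))" for i
 proof -
  have "cut T (%s w. running_cost L (Y i s w) (average Y s w) (u i s w)) = (%x. cut T (%s w. (cQ L *v Y i s w) \<bullet> Y i s w) x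
   + 2 * cut T (%s w. (cS L *v Y i s w) \<bullet> u i s w) x + cut T (%s w. (cR L *v u i s w) \<bullet> u i s w) x
   + 2 * cut T (%s w. cq L \<bullet> Y i s w) x + 2 * cut T (%s w. cr L \<bullet> u i s w) x + cut T (%s w. (cQbar L *v average Y s w) \<bullet> average Y s w) x)"
   by (auto simp: fun_eq_iff running_cost_def cut_def split: split_indicator)
  then show ?thesis
   by (simp only:) (intro LI_integrable_add integrable_mult_right cut_inner_integrable affine_L2 T0 continuous_on_const
    deterministic_process Yp u' mp)
 qed
 have "agent_cost L M F0 W T \<xi> u i = (LI Lam (%x. cut T (%s w. running_cost L (Y i s w) (average Y s w) (u i s w)) x))" for i
  unfolding agent_cost_def Let_def Y_def[symmetric]
  using PS.integral_snd[of "%s w. cut T (%s w. running_cost L (Y i s w) (average Y s w) (u i s w)) (s, w)"] ri[of i]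
  by (simp add: split_beta' set_lebesgue_integral_def cut_def)
 then have "social_cost L M F0 W T \<xi> u = (1 / real CARD('N)) * (LI Lam (%x. (\<Sum>i\<in>UNIV. cut T (%s w. running_cost L (Y i s w) (average Y s w) (u i s w)) x)))"
  unfolding social_cost_def using ri by (simp add: LI_integral_sum)
 also have "... = (LI Lam (%x. cut T (%s w. cst L (X s w) (U s w)) x))"
  unfolding integral_mult_right_zero[symmetric]
  by (intro LI_integral_cong refl)
   (auto simp: cut_def cst_running av2 X_def U_def blk_stack sum_distrib_left split: split_indicator)
 finally show ?thesis using that[OF X] cost_identity[OF X U] by simp
qed

lemma sq_nonneg: "0 \<le> cut T (sq U X) x"
 using coercive[of "fst x" "U (fst x) (snd x) - \<phi> (fst x) (X (fst x) (snd x))"] c_pos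
 by (auto simp: cut_def split_beta' sq_def split: split_indicator intro: order_trans[rotated])

lemma sq_zero:
 assumes X: "progressive F T X" "L2 Lam (cut T X)" and U: "progressive F T U" "L2 Lam (cut T U)"
  and z: "(LI Lam (%x. cut T (sq U X) x)) = 0"
 shows "AE x in Lam. cut T U x = cut T (%s w. \<phi> s (X s w)) x"
proof -
 have "AE x in Lam. cut T (sq U X) x = 0"
  using z integral_nonneg_eq_0_iff_AE[OF sq_integrable(1)[OF X U]] sq_nonneg by simp
 then show ?thesis
 proof eventually_elim
  case (elim x)
  show ?case
  proof (cases "fst x \<in> {0..T}")
   case True
   let ?d = "U (fst x) (snd x) - \<phi> (fst x) (X (fst x) (snd x))"
   have "c * (norm ?d)\<^sup>2 \<le> 0" using coercive[OF True, of ?d] elim True by (simp add: cut_def split_beta' sq_def)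
   then have "?d = 0" using c_pos by (simp add: mult_le_0_iff)
   then show ?thesis using True by (simp add: cut_def split_beta')
  qed (simp add: cut_def split_beta')
 qed
qed

text \<open>Where control and feedback agree almost everywhere, one may be exchanged for the other
  in the coefficients, so the state solves the closed loop equation.\<close>

lemma closed_loop_of_zero:
 assumes X: "state_ito x0 U X" and U: "progressive F T U" "L2 Lam (cut T U)"
  and z: "AE x in Lam. cut T U x = cut T (%s w. \<phi> s (X s w)) x"
 shows "state_ito x0 (%s w. \<phi> s (X s w)) X"
proof -
 obtain K where K: "lipschitz_coeff T K (%s w x. dr L x (\<phi> s x))" "\<And>j. lipschitz_coeff T K (%s w x. sg L j x (\<phi> s x))"
  using closed_loop_lipschitz by blast
 note D = ito_processD(5,6)[OF X]
 have "cut T (%s w. f (X s w) (U s w)) x = cut T (%s w. f (X s w) (\<phi> s (X s w))) x"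
  if "cut T U x = cut T (%s w. \<phi> s (X s w)) x" for f :: "real^('N \<times> 'n) => real^('N \<times> 'm) => real^('N \<times> 'n)" and x
  using that by (auto simp: cut_def split_beta' split: split_indicator_asm split_indicator)
 with z have "AE x in Lam. cut T (%s w. f (X s w) (U s w)) x = cut T (%s w. f (X s w) (\<phi> s (X s w))) x"
  for f :: "real^('N \<times> 'n) => real^('N \<times> 'm) => real^('N \<times> 'n)"
  by (auto elim!: eventually_mono)
 then show ?thesis
  by (intro ito_process_cong[OF X coeff_L2(1)[OF K(1) T0 D] _ coeff_L2(1)[OF K(2) T0 D] _ T0])
qed

end

text \<open>\<open>same_control\<close> is formulated on the product with restricted time, a
  different space; null sets are transferred through their time sections.\<close>

lemma AE_restrict_pair:
 fixes M :: "'w measure" and T :: real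
 assumes M: "sigma_finite_measure M" and Q: "AE x in lborel \<Otimes>\<^sub>M M. fst x \<in> {0..T} \<longrightarrow> Q x"
 shows "AE x in restrict_space lborel {0..T} \<Otimes>\<^sub>M M. Q x"
proof -
 interpret M: sigma_finite_measure M by fact
 interpret R: sigma_finite_measure "restrict_space lborel {0..T}"
  by (rule sigma_finite_measure_restrict_space) (simp_all add: lborel.sigma_finite_measure_axioms)
 interpret PL: pair_sigma_finite "lborel :: real measure" M ..
 interpret PR: pair_sigma_finite "restrict_space lborel {0..T}" M ..
 obtain E where E: "{x \<in> space (lborel \<Otimes>\<^sub>M M). \<not> (fst x \<in> {0..T} \<longrightarrow> Q x)} \<subseteq> E" "emeasure (lborel \<Otimes>\<^sub>M M) E = 0" "E \<in> sets (lborel \<Otimes>\<^sub>M M)"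
  using Q by (rule AE_E)
 have id: "(%x. x) \<in> restrict_space lborel {0..T} \<Otimes>\<^sub>M M \<rightarrow>\<^sub>M lborel \<Otimes>\<^sub>M M"
  by (rule measurable_pair) (auto simp: comp_def intro: measurable_compose[OF measurable_fst measurable_restrict_space1])
 have "AE x in lborel \<Otimes>\<^sub>M M. x \<notin> E" using E(2,3) by (intro AE_not_in) auto
 then have "AE s in lborel. AE w in M. (s, w) \<notin> E" by (rule PL.AE_pair)
 then have "AE s in restrict_space lborel {0..T}. AE w in M. (s, w) \<notin> E"
  by (subst AE_restrict_space_iff) (auto elim: eventually_mono)
 moreover have "{x \<in> space (restrict_space lborel {0..T} \<Otimes>\<^sub>M M). x \<notin> E} \<in> sets (restrict_space lborel {0..T} \<Otimes>\<^sub>M M)"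
  using id E(3) by measurable
 ultimately have "AE x in restrict_space lborel {0..T} \<Otimes>\<^sub>M M. x \<notin> E"
  by (intro PR.AE_pair_measure) auto
 then show ?thesis
  by (rule AE_mp) (use E(1) in \<open>fastforce intro!: AE_I2 simp: space_pair_measure space_restrict_space\<close>)
qed

section \<open>Existence and uniqueness of the optimal control\<close>

context social
begin

text \<open>The control is read off a solution of the closed loop equation. Any control of cost
  \<open>V0\<close> has zero loss, so its state solves the same equation, and uniqueness of that
  solution determines the control.\<close>

lemma optimal_control_exists:
 assumes N: "CARD('N) \<ge> 2" and \<xi>: "\<And>i. \<xi> i \<in> bm F0" "\<And>i. L2 M (\<xi> i)"
 defines "PN \<equiv> %t. real CARD('N) *\<^sub>R diagonal_block (P t)" and "PiN \<equiv> %t. (real CARD('N))\<^sup>2 *\<^sub>R offdiagonal_block (P t)"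
  and "pN \<equiv> %t. real CARD('N) *\<^sub>R vector_block (p t)"
 shows "\<exists>u. social_optimal L M F0 W T \<xi> u \<and> social_cost L M F0 W T \<xi> u = V0 (%w. stack (%i. \<xi> i w)) \<and>
  (\<forall>v. social_optimal L M F0 W T \<xi> v \<longrightarrow> same_control M T u v) \<and>
  (\<exists>X. state_solution L M F0 W T \<xi> u X \<and> (\<forall>i. \<forall>t\<in>{0..T}. \<forall>w\<in>space M.
   u i t w = (Theta L (PN t) + (1 / real CARD('N)) *\<^sub>R theta_bar L (PN t) (PiN t)) *v X i t w
        + (Theta_bar L (PN t) (PiN t) - Theta L (PN t)) *v average X t w + theta L (PN t) (pN t)))"
proof -
 let ?x0 = "%w. stack (%i. \<xi> i w)"
 obtain K where K: "lipschitz_coeff T K (%s w x. dr L x (\<phi> s x))" "\<And>j. lipschitz_coeff T K (%s w x. sg L j x (\<phi> s x))"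
  using closed_loop_lipschitz by blast
 obtain X where X: "state_ito ?x0 (%s w. \<phi> s (X s w)) X"
  and S: "state_solution L M F0 W T \<xi> (%i s w. blk i (\<phi> s (X s w))) (%i s w. blk i (X s w))"
  by (rule state_exists[OF \<xi> K]) (rule that)
 define u where "u i s w = blk i (\<phi> s (X s w))" for i s w
 define U where "U s w = \<phi> s (X s w)" for s w
 have stu: "stack (%i. u i s w) = U s w" for s w by (simp add: u_def U_def stack_blk)
 have U: "progressive F T U" "L2 Lam (cut T U)"
  unfolding U_def[abs_def] by (rule feedback_process[OF ito_processD(5,6)[OF X]])+
 have u: "u \<in> social_controls M F0 W T"
  unfolding social_controls_def
 proof (intro CollectI allI conjI)
  fix i
  have e: "u i = (%s w. blk i (U s w))" by (simp add: u_def U_def fun_eq_iff)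
  show "progressive F T (u i)" unfolding e by (rule progressive_compose_linear[OF bounded_linear_blk U(1)])
  show "square_integrable_process M T (u i)"
   unfolding e by (rule square_integrable_of_L2) (unfold cut_linear[OF bounded_linear_blk], rule L2_linear[OF bounded_linear_blk U(2)])
 qed
 have ge: "V0 ?x0 \<le> social_cost L M F0 W T \<xi> v" if "v \<in> social_controls M F0 W T" for v
 proof (rule social_cost_eq[OF \<xi> that])
  fix Y assume "social_cost L M F0 W T \<xi> v = V0 ?x0 + (LI Lam (%x. cut T (sq (%s w. stack (%i. v i s w)) Y) x))"
  moreover have "0 \<le> (LI Lam (%x. cut T (sq (%s w. stack (%i. v i s w)) Y) x))" by (intro integral_nonneg_AE AE_I2 sq_nonneg)
  ultimately show ?thesis by simp
 qed
 have uX: "AE x in Lam. cut T V x = cut T U x"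
  if V: "state_ito ?x0 V Y" "progressive F T V" "L2 Lam (cut T V)" "(LI Lam (%x. cut T (sq V Y) x)) = 0" for V Y
 proof -
  note z = sq_zero[OF ito_processD(5,6)[OF V(1)] V(2,3,4)]
  have "AE x in Lam. cut T Y x = cut T X x"
   by (rule sde_unique[where b = "%s w x. dr L x (\<phi> s x)" and \<sigma> = "%j s w x. sg L j x (\<phi> s x)",
     OF T0 K closed_loop_of_zero[OF V(1-3) z] X])
  with z show ?thesis
  proof eventually_elim
   case (elim x)
   then show ?case unfolding U_def[abs_def] by (cases "fst x \<in> {0..T}") (auto simp: cut_def split_beta')
  qed
 qed
 \<comment> \<open>The cost of \<open>u\<close> is computed with the state chosen by
   \<open>state_of\<close>, not with \<open>X\<close>. Both solve the open loop equation of
   \<open>U\<close>, hence agree almost everywhere, and along \<open>X\<close> the loss of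
   \<open>U\<close> is zero by construction.\<close>
 have cu: "social_cost L M F0 W T \<xi> u = V0 ?x0"
 proof (rule social_cost_eq[OF \<xi> u], unfold stu)
  fix Y assume Y: "state_ito ?x0 U Y" and s: "social_cost L M F0 W T \<xi> u = V0 ?x0 + (LI Lam (%x. cut T (sq U Y) x))"
  obtain K where K: "lipschitz_coeff T K (%s w x. dr L x (U s w))" "\<And>j. lipschitz_coeff T K (%s w x. sg L j x (U s w))"
   using open_loop_lipschitz[OF U] by blast
  have "AE x in Lam. cut T Y x = cut T X x"
   by (rule sde_unique[where b = "%s w x. dr L x (U s w)" and \<sigma> = "%j s w x. sg L j x (U s w)", OF T0 K Y])
    (use X in \<open>simp add: U_def\<close>)
  then have "AE x in Lam. cut T (sq U Y) x = 0"
  proof eventually_elim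
   case (elim x)
   then show ?case by (cases "fst x \<in> {0..T}") (auto simp: cut_def split_beta' sq_def U_def)
  qed
  then show ?thesis using s by (simp add: integral_eq_zero_AE)
 qed
 have opt: "social_optimal L M F0 W T \<xi> u" using u ge cu by (simp add: social_optimal_def)
 have uniq: "same_control M T u v" if v: "social_optimal L M F0 W T \<xi> v" for v
 proof -
  have vc: "v \<in> social_controls M F0 W T" and le: "social_cost L M F0 W T \<xi> v \<le> V0 ?x0"
   using v u cu unfolding social_optimal_def by auto
  let ?V = "%s w. stack (%i. v i s w)"
  have v': "progressive F T (v i)" "L2 Lam (cut T (v i))" for i
   using vc cut_L2[OF _ T0 order_refl] unfolding social_controls_def by blast+
  have V: "progressive F T ?V" "L2 Lam (cut T ?V)"
   unfolding cut_stack by (intro stack_progressive v', intro stack_L2 v')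
  have "AE x in Lam. cut T ?V x = cut T U x"
  proof (rule social_cost_eq[OF \<xi> vc])
   fix Y assume Y: "state_ito ?x0 ?V Y" and s: "social_cost L M F0 W T \<xi> v = V0 ?x0 + (LI Lam (%x. cut T (sq ?V Y) x))"
   have "0 \<le> (LI Lam (%x. cut T (sq ?V Y) x))" by (intro integral_nonneg_AE AE_I2 sq_nonneg)
   then show ?thesis by (intro uX[OF Y V]) (use s le in linarith)
  qed
  then have "AE x in Lam. fst x \<in> {0..T} \<longrightarrow> (case x of (t, w) => u i t w = v i t w)" for i
  proof eventually_elim
   case (elim x)
   then show ?case
    by (auto simp: cut_def split_beta' u_def U_def[symmetric] blk_stack[of i "%i. v i (fst x) (snd x)", symmetric])
  qed
  then show ?thesis unfolding same_control_def by (intro allI AE_restrict_pair sigma_finite_measure_axioms)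
 qed
 have S': "state_solution L M F0 W T \<xi> u (%i s w. blk i (X s w))" using S unfolding u_def[abs_def] .
 have av: "average (%i s w. blk i (X s w)) t w = mean (X t w)" for t w by (simp add: average_def mean_def)
 show ?thesis
 proof (intro exI[of _ u] conjI opt cu allI impI uniq exI[of _ "%i s w. blk i (X s w)"] S' ballI)
  fix i t w assume t: "t \<in> {0..T}"
  show "u i t w = (Theta L (PN t) + (1 / real CARD('N)) *\<^sub>R theta_bar L (PN t) (PiN t)) *v blk i (X t w)
        + (Theta_bar L (PN t) (PiN t) - Theta L (PN t)) *v average (%i s w. blk i (X s w)) t w + theta L (PN t) (pN t)"
   unfolding u_def av PN_def PiN_def pN_def by (rule fb_eq[OF N t])
 qed
qed

lemma V0_const: "V0 (%_. x) = x \<bullet> (P 0 *v x) + 2 * (x \<bullet> p 0) + k 0"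
 by (simp add: V0_def prob_space inner_commute)

end

theorem proposition3p6:
  fixes L :: "('n::finite, 'm::finite) lq"
    and M F0 :: "'w measure"
    and W :: "'N::finite option \<Rightarrow> real \<Rightarrow> 'w \<Rightarrow> real"
    and T :: real
    and P :: "real \<Rightarrow> real^('N \<times> 'n)^('N \<times> 'n)"
    and p :: "real \<Rightarrow> real^('N \<times> 'n)"
    and k :: "real \<Rightarrow> real"
    and PN PiN :: "real \<Rightarrow> real^'n^'n"
    and pN :: "real \<Rightarrow> real^'n"
    and kN :: "real \<Rightarrow> real"
  assumes N: "CARD('N) \<ge> 2"
    and T: "T > 0"
    and basis: "stochastic_basis M F0 W"
    and Q_sym: "symmetric_mat (cQ L)"
    and Qbar_sym: "symmetric_mat (cQbar L)"
    and R_pd: "pd_mat (cR L)"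
    and Q_pd: "pd_mat (cQ L - transpose (cS L) ** matrix_inv (cR L) ** cS L)"
    and QQbar_pd: "pd_mat (cQ L + cQbar L - transpose (cS L) ** matrix_inv (cR L) ** cS L)"
    and riccati: "riccati_solution L T P p k"
    and PN: "PN = (\<lambda>t. real CARD('N) *\<^sub>R diagonal_block (P t))"
    and PiN: "PiN = (\<lambda>t. (real CARD('N))\<^sup>2 *\<^sub>R offdiagonal_block (P t))"
    and pN: "pN = (\<lambda>t. real CARD('N) *\<^sub>R vector_block (p t))"
    and kN: "kN = k"
  shows
    "(\<forall>\<xi> \<in> initial_states M F0 W.
        \<exists>u. social_optimal L M F0 W T \<xi> u \<and>
            (\<forall>v. social_optimal L M F0 W T \<xi> v \<longrightarrow> same_control M T u v) \<and>
            (\<exists>X. state_solution L M F0 W T \<xi> u X \<and>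
                 (\<forall>i. \<forall>t\<in>{0..T}. \<forall>w\<in>space M.
                    u i t w =
                      (Theta L (PN t) + (1 / real CARD('N)) *\<^sub>R theta_bar L (PN t) (PiN t)) *v X i t w
                      + (Theta_bar L (PN t) (PiN t) - Theta L (PN t)) *v average X t w
                      + theta L (PN t) (pN t)))) \<and>
     (\<forall>x :: 'N \<Rightarrow> real^'n.
        social_value L M F0 W T x =
          ereal (stack x \<bullet> (P 0 *v stack x) + 2 * (stack x \<bullet> p 0) + k 0) \<and>
        stack x \<bullet> (P 0 *v stack x) + 2 * (stack x \<bullet> p 0) + k 0 =
          (1 / real CARD('N)) * (\<Sum>j\<in>UNIV. x j \<bullet> (PN 0 *v x j))
          + (1 / (real CARD('N))\<^sup>2) * (\<Sum>l\<in>UNIV. \<Sum>j\<in>UNIV - {l}. x j \<bullet> (PiN 0 *v x l))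
          + 2 * (((1 / real CARD('N)) *\<^sub>R (\<Sum>j\<in>UNIV. x j)) \<bullet> pN 0) + kN 0)"
proof -
 obtain P' p' k' c where "riccati_data L T P p k P' p' k' c" using riccati_dataI[OF T R_pd riccati] .
 then interpret riccati_data L T P p k P' p' k' c .
 interpret social L T P p k P' p' k' c M F0 W by unfold_locales (rule basis)
 show ?thesis
 proof (intro conjI ballI allI)
  fix \<xi> :: "'N => 'w => real^'n" assume \<xi>: "\<xi> \<in> initial_states M F0 W"
  have m: "\<xi> i \<in> bm F0" for i using \<xi> by (simp add: initial_states_def)
  \<comment> \<open>Fourth moments control second ones through
    \<open>r^2 \<le> 1 + r^4\<close>.\<close>
  have "L2 M (\<xi> i)" for i
  proof -
   have mM: "\<xi> i \<in> bm M"
    by (rule measurable_from_subalg[OF _ m]) (use basis in \<open>simp add: stochastic_basis_def\<close>)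
   have "(norm v)\<^sup>2 \<le> 1 + norm v ^ 4" for v :: "real^'n"
   proof -
    have "0 \<le> ((norm v)\<^sup>2 - 1)\<^sup>2" by simp
    then have "2 * (norm v)\<^sup>2 \<le> 1 + norm v ^ 4" by (simp add: power2_diff flip: power_mult)
    then show ?thesis using zero_le_power2[of "norm v"] by linarith
   qed
   then have "nsq M (\<xi> i) \<le> (NI M (%w. 1 + ennreal (norm (\<xi> i w) ^ 4)))"
    by (intro nn_integral_mono) (simp flip: ennreal_1 ennreal_plus)
   also have "... = 1 + (NI M (%w. ennreal (norm (\<xi> i w) ^ 4)))"
    using mM by (subst nn_integral_add) (auto simp: emeasure_space_1)
   also have "... < \<infinity>" using \<xi> by (simp add: initial_states_def ennreal_add_less_top)
   finally show ?thesis using mM by (simp add: L2_iff_nn)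
  qed
  from optimal_control_exists[where \<xi> = \<xi>, OF N m this]
  show "\<exists>u. social_optimal L M F0 W T \<xi> u \<and>
      (\<forall>v. social_optimal L M F0 W T \<xi> v \<longrightarrow> same_control M T u v) \<and>
      (\<exists>X. state_solution L M F0 W T \<xi> u X \<and>
        (\<forall>i. \<forall>t\<in>{0..T}. \<forall>w\<in>space M.
          u i t w =
           (Theta L (PN t) + (1 / real CARD('N)) *\<^sub>R theta_bar L (PN t) (PiN t)) *v X i t w
           + (Theta_bar L (PN t) (PiN t) - Theta L (PN t)) *v average X t w
           + theta L (PN t) (pN t)))"
   unfolding PN PiN pN by (elim exE conjE) (intro exI conjI)
 next
  fix x :: "'N => real^'n"
  \<comment> \<open>Constants are measurable for every sigma algebra, so deterministic states are
    covered by the same existence result, and its optimal control attains the infimum.\<close>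
  have m: "(%_. x i) \<in> bm F0" for i by simp
  have l: "L2 M (%_. x i)" for i by (rule L2_bdd[of _ "norm (x i)"]) auto
  obtain u where "social_optimal L M F0 W T (%i _. x i) u" "social_cost L M F0 W T (%i _. x i) u = V0 (%_. stack x)"
   using optimal_control_exists[where \<xi> = "%i _. x i", OF N m l] by (elim exE conjE)
  then show "social_value L M F0 W T x = ereal (stack x \<bullet> (P 0 *v stack x) + 2 * (stack x \<bullet> p 0) + k 0)"
   unfolding social_value_def V0_const social_optimal_def
   by (intro antisym INF_lower2[of u] INF_greatest) auto
  show "stack x \<bullet> (P 0 *v stack x) + 2 * (stack x \<bullet> p 0) + k 0 =
     (1 / real CARD('N)) * (\<Sum>j\<in>UNIV. x j \<bullet> (PN 0 *v x j))
     + (1 / (real CARD('N))\<^sup>2) * (\<Sum>l\<in>UNIV. \<Sum>j\<in>UNIV - {l}. x j \<bullet> (PiN 0 *v x l))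
     + 2 * (((1 / real CARD('N)) *\<^sub>R (\<Sum>j\<in>UNIV. x j)) \<bullet> pN 0) + kN 0"
   unfolding PN PiN pN kN by (rule quad_blocks[OF N]) (use T in simp)
 qed
qed

end
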